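(* Let $\Omega\subset\mathbb{R}^3$ be a bounded sliceable domain with Lipschitz boundary $\Gamma$, and let $\Gamma_t\subset\Gamma$ be relatively open and separated from $\Gamma_n:=\Gamma\setminus\overline{\Gamma_t}$ by a Lipschitz curve ($\Gamma_t=\emptyset$ and $\Gamma_t=\Gamma$ are allowed). Let $c_m>0$ be the Maxwell constant and $c_k>0$ the irrotational Korn constant for $(\Omega,\Gamma_t)$ (both defined in the context), and set $$\hat c:=\max\{\sqrt2\,c_k,\;c_m\sqrt{1+2c_k^2}\},\qquad \tilde c:=\sqrt2\,\max\{c_k,\;c_m(1+c_k)\}\ \geq\ \hat c.$$ For $T\in H(\mathrm{Curl};\Omega)$ let $|||T|||^2:=\|\mathrm{sym}\,T\|_{L^2(\Omega)}^2+\|\mathrm{Curl}\,T\|_{L^2(\Omega)}^2$. (i) If $\Gamma_t\neq\emptyset$, then for all tensor fields $T\in\mathring H(\mathrm{Curl};\Gamma_t,\Omega)$ $$\|T\|_{L^2(\Omega)}\leq\hat c\,|||T|||.$$ (ii) If $\Gamma_t=\emptyset$, then for all tensor fields $T\in H(\mathrm{Curl};\Omega)$ there exists a piece-wise constant skew-symmetric tensor field $A$ such that $$\|T-A\|_{L^2(\Omega)}\leq\tilde c\,|||T|||,\qquad \|T\|_{L^2(\Omega)}\leq\sqrt2\max\{\tilde c,1\}\big(|||T|||^2+\|A\|_{L^2(\Omega)}^2\big)^{1/2}.$$ Note that, in general, $A\notin H(\mathrm{Curl};\Omega)$. (ii') If $\Gamma_t=\emptyset$ and $\Omega$ is additionally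 simply connected, then for all tensor fields $T\in H(\mathrm{Curl};\Omega)$ there exists a uniquely determined constant skew-symmetric tensor field $A=A_T\in\mathfrak{so}(3)$ such that $$\|T-A_T\|_{L^2(\Omega)}\leq\hat c\,|||T|||,$$ $$\|T\|_{L^2(\Omega)}\leq\sqrt2\max\{\hat c,1\}\big(|||T|||^2+\|A_T\|_{L^2(\Omega)}^2\big)^{1/2},$$ $$\|T-A_T\|_{H(\mathrm{Curl};\Omega)}\leq(1+\hat c^2)^{1/2}\,|||T|||,$$ $$\|T\|_{H(\mathrm{Curl};\Omega)}\leq\sqrt2(1+\hat c^2)^{1/2}\big(|||T|||^2+\|A_T\|_{L^2(\Omega)}^2\big)^{1/2},$$ and $A_T=\pi_{\mathfrak{so}(3)}T$ is given by $A_T=\mathrm{skew}\big(\lambda(\Omega)^{-1}\int_\Omega T\,d\lambda\big)$. Moreover, $T-A_T\in H(\mathrm{Curl};\Omega)\cap\mathfrak{so}(3)^{\bot}$, and $A_T=0$ if and only if $T\bot\,\mathfrak{so}(3)$. Thus $\|T\|_{L^2(\Omega)}\leq\hat c\,|||T|||$ holds for all $T\in H(\mathrm{Curl};\Omega)\cap\mathfrak{so}(3)^\bot$. Furthermore, $A_T$ can be represented by $$A_T=A_R:=\pi_{\mathfrak{so}(3)}R=\mathrm{skew}\Big(\lambda(\Omega)^{-1}\int_\Omega R\,d\lambda\Big)\in\mathfrak{so}(3),$$ where $R$ denotes the Helmholtz projection of $T$ onto $H(\mathrm{Curl}_0;\Omega)$, i.e. the $L^2(\Omega)$-orthogonal 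projection.
   Context: A domain is a nonempty connected open set. $L^2(\Omega)$ denotes square-integrable functions, vector fields or $3\times3$ tensor fields (with the Frobenius inner product), $\lambda$ is Lebesgue measure, $\bot$ is orthogonality (orthogonal complement) in $L^2(\Omega)$. $\mathrm{sym}\,T=\frac12(T+T^\top)$, $\mathrm{skew}\,T=\frac12(T-T^\top)$; $\mathfrak{so}(3)$ is the space of skew-symmetric $3\times3$ matrices, identified with constant tensor fields; $\pi_{\mathfrak{so}(3)}$ is the $L^2(\Omega)$-orthogonal projection onto it. "$\Gamma_t$ and $\Gamma_n$ are separated by a Lipschitz curve" means that the common relative boundary of $\Gamma_t$ and $\Gamma_n$ in $\Gamma$ is empty or is, locally in bi-Lipschitz charts of $\Gamma$, a Lipschitz curve with $\Gamma_t$ on one side and $\Gamma_n$ on the other. Vector spaces: $H(\mathrm{curl};\Omega)=\{v\in L^2:\mathrm{curl}\,v\in L^2\}$, $H(\mathrm{div};\Omega)=\{v\in L^2:\mathrm{div}\,v\in L^2\}$ (weak derivatives), with graph norms. For $\gamma\subset\Gamma$, $\mathring C^\infty(\gamma,\Omega):=\{u\in C^\infty(\overline\Omega):\mathrm{dist}(\mathrm{supp}\,u,\gamma)>0\}$ (all of $C^\infty(\overline\Omega)$ if $\gamma=\emptyset$). $\mathring H(\mathrm{curl};\Gamma_t,\Omega)$ and $\mathring H(\mathrm{div};\Gamma_n,\Omega)$ are the closures of $\mathring C^\infty(\Gamma_t,\Omega)$ resp. $\mathring C^\infty(\Gamma_n,\Omega)$ vector fields in the respective graph norms (generalizing $\nu\times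 v|_{\Gamma_t}=0$ resp. $\nu\cdot v|_{\Gamma_n}=0$, $\nu$ the outward unit normal). A lower index $0$ (as in $\mathrm{curl}_0$, $\mathrm{div}_0$) means additionally $\mathrm{curl}\,v=0$ resp. $\mathrm{div}\,v=0$. Harmonic Dirichlet–Neumann fields: $\mathcal H(\Omega):=\mathring H(\mathrm{curl}_0;\Gamma_t,\Omega)\cap\mathring H(\mathrm{div}_0;\Gamma_n,\Omega)$. Tensor spaces: $\mathrm{Curl}\,T$ is the row-wise $\mathrm{curl}$ of a $3\times3$ tensor field. $H(\mathrm{Curl};\Omega)$, $\mathring H(\mathrm{Curl};\Gamma_t,\Omega)$, $H(\mathrm{Curl}_0;\Omega)$, $\mathring H(\mathrm{Curl}_0;\Gamma_t,\Omega)$ are the spaces of tensor fields all of whose rows lie in the corresponding $\mathrm{curl}$ space; $\|T\|_{H(\mathrm{Curl};\Omega)}^2=\|T\|_{L^2}^2+\|\mathrm{Curl}\,T\|_{L^2}^2$. Sliceable: $\Omega$ is sliceable (with respect to $\Gamma_t$) if there exist $J\in\mathbb N$ and $\Omega_j\subset\Omega$, $j=1,\dots,J$, such that $\Omega\setminus(\Omega_1\cup\dots\cup\Omega_J)$ is a null set and, for each $j$: the $\Omega_j$ are open, disjoint, simply connected Lipschitz subdomains of $\Omega$; and, if $\Gamma_t\neq\emptyset$, $\Gamma_{t,j}:=\mathrm{int}_{\mathrm{rel}}(\overline{\Omega_j}\cap\Gamma_t)\neq\emptyset$ (interior relative to $\Gamma$). Fix such a decomposition; "piece-wise constant" means (a.e.)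 constant on each $\Omega_j$. Maxwell constant $c_m>0$: $\|v\|_{L^2}\leq c_m(\|\mathrm{curl}\,v\|_{L^2}^2+\|\mathrm{div}\,v\|_{L^2}^2)^{1/2}$ for all $v\in\mathring H(\mathrm{curl};\Gamma_t,\Omega)\cap\mathring H(\mathrm{div};\Gamma_n,\Omega)\cap\mathcal H(\Omega)^\bot$. Irrotational Korn constant $c_k>0$: if $\Gamma_t\neq\emptyset$, $\|T\|_{L^2}\leq c_k\|\mathrm{sym}\,T\|_{L^2}$ for all $T\in\mathring H(\mathrm{Curl}_0;\Gamma_t,\Omega)$; if $\Gamma_t=\emptyset$, for every $T\in H(\mathrm{Curl}_0;\Omega)$ there is a piece-wise constant skew-symmetric $A$ with $\|T-A\|_{L^2}\leq c_k\|\mathrm{sym}\,T\|_{L^2}$ and $\|T\|_{L^2}\leq c_k(\|\mathrm{sym}\,T\|_{L^2}^2+\|A\|_{L^2}^2)^{1/2}$, where for simply connected $\Omega$ these hold with $A=A_T:=\mathrm{skew}\,\lambda(\Omega)^{-1}\int_\Omega T\,d\lambda$. Such constants $c_m,c_k$ exist under the stated assumptions.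
   Formalization: In (ii') the four estimates alone do not determine A (for T = Id any small skew A satisfies them); uniqueness of A_T is stated as uniqueness of the L²-orthogonal projection of T onto so(3). *)

theory Defs
  imports "HOL-Analysis.Analysis"
begin

section \<open>Domains and their boundaries\<close>

definition domain :: "(real^3) set \<Rightarrow> bool" where
  "domain \<Omega> \<longleftrightarrow> open \<Omega> \<and> connected \<Omega> \<and> \<Omega> \<noteq> {}"

text \<open>Near each boundary point, and after a rotation or reflection \<open>Q\<close>, the set is the part of a
  neighbourhood lying strictly below the graph of a Lipschitz function. Translations are absorbed
  in \<open>g\<close>. Since \<open>g\<close> is continuous, the boundary is then locally the graph itself.\<close>

definition lipschitz_boundary :: "(real^3) set \<Rightarrow> bool" where
  "lipschitz_boundary \<Omega> \<longleftrightarrow>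
     (\<forall>x \<in> frontier \<Omega>. \<exists>U (Q :: real^3 \<Rightarrow> real^3) (g :: real \<times> real \<Rightarrow> real) L.
        open U \<and> x \<in> U \<and> orthogonal_transformation Q \<and> L-lipschitz_on UNIV g \<and>
        \<Omega> \<inter> U = {y \<in> U. Q y $ 3 < g (Q y $ 1, Q y $ 2)})"

definition bilipschitz_on :: "'a::metric_space set \<Rightarrow> ('a \<Rightarrow> 'b::metric_space) \<Rightarrow> bool" where
  "bilipschitz_on U \<phi> \<longleftrightarrow>
     (\<exists>L>0. \<forall>y\<in>U. \<forall>z\<in>U. dist (\<phi> y) (\<phi> z) \<le> L * dist y z \<and> dist y z \<le> L * dist (\<phi> y) (\<phi> z))"

definition Gamma_n :: "(real^3) set \<Rightarrow> (real^3) set \<Rightarrow> (real^3) set" where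
  "Gamma_n \<Omega> \<Gamma>t = frontier \<Omega> - closure \<Gamma>t"

text \<open>The common relative boundary of \<open>\<Gamma>t\<close> and \<open>\<Gamma>n\<close> in \<open>\<Gamma>\<close>.\<close>

definition interface :: "(real^3) set \<Rightarrow> (real^3) set \<Rightarrow> (real^3) set" where
  "interface \<Omega> \<Gamma>t =
     (top_of_set (frontier \<Omega>) frontier_of \<Gamma>t) \<inter> (top_of_set (frontier \<Omega>) frontier_of Gamma_n \<Omega> \<Gamma>t)"

definition lipschitz_separated :: "(real^3) set \<Rightarrow> (real^3) set \<Rightarrow> bool" where
  "lipschitz_separated \<Omega> \<Gamma>t \<longleftrightarrow>
     (\<forall>x \<in> interface \<Omega> \<Gamma>t. \<exists>U (\<phi> :: real^3 \<Rightarrow> real \<times> real) (g :: real \<Rightarrow> real) L.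
        openin (top_of_set (frontier \<Omega>)) U \<and> x \<in> U \<and> bilipschitz_on U \<phi> \<and> open (\<phi> ` U) \<and>
        L-lipschitz_on UNIV g \<and>
        U \<inter> interface \<Omega> \<Gamma>t = {y \<in> U. snd (\<phi> y) = g (fst (\<phi> y))} \<and>
        U \<inter> \<Gamma>t = {y \<in> U. snd (\<phi> y) < g (fst (\<phi> y))} \<and>
        U \<inter> Gamma_n \<Omega> \<Gamma>t = {y \<in> U. snd (\<phi> y) > g (fst (\<phi> y))})"

text \<open>The pieces \<open>D 1, \<dots>, D J\<close> witness that \<open>\<Omega>\<close> is sliceable with respect to \<open>\<Gamma>t\<close>.\<close>

definition slicing :: "(real^3) set \<Rightarrow> (real^3) set \<Rightarrow> nat \<Rightarrow> (nat \<Rightarrow> (real^3) set) \<Rightarrow> bool" where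
  "slicing \<Omega> \<Gamma>t J D \<longleftrightarrow>
     negligible (\<Omega> - (\<Union>j\<in>{1..J}. D j)) \<and>
     disjoint_family_on D {1..J} \<and>
     (\<forall>j\<in>{1..J}. D j \<subseteq> \<Omega> \<and> domain (D j) \<and> lipschitz_boundary (D j) \<and> simply_connected (D j) \<and>
        (\<Gamma>t \<noteq> {} \<longrightarrow> top_of_set (frontier \<Omega>) interior_of (closure (D j) \<inter> \<Gamma>t) \<noteq> {}))"


section \<open>Square-integrable fields\<close>

text \<open>Fields are represented by total functions on \<open>real^3\<close>, of which only the values almost
  everywhere on \<open>\<Omega>\<close> matter. On \<open>real^3^3\<close>, \<open>\<bullet>\<close> and \<open>norm\<close> are the Frobenius inner product and norm.\<close>

definition L2 :: "(real^3) set \<Rightarrow> (real^3 \<Rightarrow> 'b::euclidean_space) set" where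
  "L2 \<Omega> = {f. f \<in> borel_measurable (lebesgue_on \<Omega>) \<and> integrable (lebesgue_on \<Omega>) (\<lambda>x. (norm (f x))\<^sup>2)}"

definition L2_inner ::
  "(real^3) set \<Rightarrow> (real^3 \<Rightarrow> 'b::euclidean_space) \<Rightarrow> (real^3 \<Rightarrow> 'b) \<Rightarrow> real" where
  "L2_inner \<Omega> f g = (\<integral>x. f x \<bullet> g x \<partial>lebesgue_on \<Omega>)"

definition L2_norm :: "(real^3) set \<Rightarrow> (real^3 \<Rightarrow> 'b::euclidean_space) \<Rightarrow> real" where
  "L2_norm \<Omega> f = sqrt (\<integral>x. (norm (f x))\<^sup>2 \<partial>lebesgue_on \<Omega>)"

definition L2_perp ::
  "(real^3) set \<Rightarrow> (real^3 \<Rightarrow> 'b::euclidean_space) set \<Rightarrow> (real^3 \<Rightarrow> 'b) set" where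
  "L2_perp \<Omega> S = {f \<in> L2 \<Omega>. \<forall>g\<in>S. L2_inner \<Omega> f g = 0}"

text \<open>\<open>p\<close> is (a representative of) the orthogonal projection of \<open>f\<close> onto the subspace \<open>S\<close>.\<close>

definition L2_proj ::
  "(real^3) set \<Rightarrow> (real^3 \<Rightarrow> 'b::euclidean_space) set \<Rightarrow> (real^3 \<Rightarrow> 'b) \<Rightarrow> (real^3 \<Rightarrow> 'b) \<Rightarrow> bool" where
  "L2_proj \<Omega> S f p \<longleftrightarrow> p \<in> S \<and> (\<lambda>x. f x - p x) \<in> L2_perp \<Omega> S"


section \<open>Smooth functions and classical derivatives\<close>

primrec C_k :: "nat \<Rightarrow> ('a::real_normed_vector \<Rightarrow> 'b::real_normed_vector) \<Rightarrow> bool" where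
  "C_k 0 f \<longleftrightarrow> continuous_on UNIV f"
| "C_k (Suc k) f \<longleftrightarrow>
     (\<forall>x. f differentiable (at x)) \<and> (\<forall>v. C_k k (\<lambda>x. frechet_derivative f (at x) v))"

definition smooth :: "('a::real_normed_vector \<Rightarrow> 'b::real_normed_vector) \<Rightarrow> bool" where
  "smooth f \<longleftrightarrow> (\<forall>k. C_k k f)"

definition test_functions :: "(real^3) set \<Rightarrow> (real^3 \<Rightarrow> 'b::euclidean_space) set" where
  "test_functions \<Omega> =
     {u. smooth u \<and> compact (closure {x. u x \<noteq> 0}) \<and> closure {x. u x \<noteq> 0} \<subseteq> \<Omega>}"

text \<open>Smooth fields on the closure of \<open>\<Omega>\<close> (restrictions of smooth fields on the whole space) whose
  support has positive distance from \<open>\<gamma>\<close>. The distance is spelled out because \<open>setdist\<close> to the empty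
  set is \<open>0\<close>, whereas here \<open>\<gamma> = {}\<close> must impose no condition.\<close>

definition C_inf_vanishing :: "(real^3) set \<Rightarrow> (real^3) set \<Rightarrow> (real^3 \<Rightarrow> 'b::euclidean_space) set" where
  "C_inf_vanishing \<gamma> \<Omega> =
     {u. smooth u \<and> (\<exists>d>0. \<forall>x \<in> closure {x \<in> \<Omega>. u x \<noteq> 0}. \<forall>y\<in>\<gamma>. d \<le> dist x y)}"

definition classical_grad :: "(real^3 \<Rightarrow> real) \<Rightarrow> real^3 \<Rightarrow> real^3" where
  "classical_grad u x = (\<chi> i. frechet_derivative u (at x) (axis i 1))"

definition classical_curl :: "(real^3 \<Rightarrow> real^3) \<Rightarrow> real^3 \<Rightarrow> real^3" where
  "classical_curl u x =
     (let d = (\<lambda>i j. frechet_derivative u (at x) (axis i 1) $ j)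
      in vector [d 2 3 - d 3 2, d 3 1 - d 1 3, d 1 2 - d 2 1])"


section \<open>Weak derivatives of vector fields\<close>

definition has_weak_curl :: "(real^3) set \<Rightarrow> (real^3 \<Rightarrow> real^3) \<Rightarrow> (real^3 \<Rightarrow> real^3) \<Rightarrow> bool" where
  "has_weak_curl \<Omega> v w \<longleftrightarrow>
     (\<forall>u \<in> test_functions \<Omega>. L2_inner \<Omega> v (classical_curl u) = L2_inner \<Omega> w u)"

definition has_weak_div :: "(real^3) set \<Rightarrow> (real^3 \<Rightarrow> real^3) \<Rightarrow> (real^3 \<Rightarrow> real) \<Rightarrow> bool" where
  "has_weak_div \<Omega> v w \<longleftrightarrow>
     (\<forall>u \<in> test_functions \<Omega>. L2_inner \<Omega> v (classical_grad u) = - L2_inner \<Omega> w u)"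

definition H_curl :: "(real^3) set \<Rightarrow> (real^3 \<Rightarrow> real^3) set" where
  "H_curl \<Omega> = {v \<in> L2 \<Omega>. \<exists>w \<in> L2 \<Omega>. has_weak_curl \<Omega> v w}"

definition H_div :: "(real^3) set \<Rightarrow> (real^3 \<Rightarrow> real^3) set" where
  "H_div \<Omega> = {v \<in> L2 \<Omega>. \<exists>w \<in> L2 \<Omega>. has_weak_div \<Omega> v w}"

text \<open>On \<open>H_curl\<close> and \<open>H_div\<close> the chosen representatives are unique up to null sets.\<close>

definition weak_curl :: "(real^3) set \<Rightarrow> (real^3 \<Rightarrow> real^3) \<Rightarrow> real^3 \<Rightarrow> real^3" where
  "weak_curl \<Omega> v = (SOME w. w \<in> L2 \<Omega> \<and> has_weak_curl \<Omega> v w)"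

definition weak_div :: "(real^3) set \<Rightarrow> (real^3 \<Rightarrow> real^3) \<Rightarrow> real^3 \<Rightarrow> real" where
  "weak_div \<Omega> v = (SOME w. w \<in> L2 \<Omega> \<and> has_weak_div \<Omega> v w)"

definition H_curl_norm :: "(real^3) set \<Rightarrow> (real^3 \<Rightarrow> real^3) \<Rightarrow> real" where
  "H_curl_norm \<Omega> v = sqrt ((L2_norm \<Omega> v)\<^sup>2 + (L2_norm \<Omega> (weak_curl \<Omega> v))\<^sup>2)"

definition H_div_norm :: "(real^3) set \<Rightarrow> (real^3 \<Rightarrow> real^3) \<Rightarrow> real" where
  "H_div_norm \<Omega> v = sqrt ((L2_norm \<Omega> v)\<^sup>2 + (L2_norm \<Omega> (weak_div \<Omega> v))\<^sup>2)"

text \<open>The suffix \<open>bc\<close> marks the closures that encode vanishing tangential, respectively normal,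
  traces on \<open>\<gamma>\<close>; the suffix \<open>0\<close> marks the kernels of the differential operators.\<close>

definition H_curl_bc :: "(real^3) set \<Rightarrow> (real^3) set \<Rightarrow> (real^3 \<Rightarrow> real^3) set" where
  "H_curl_bc \<gamma> \<Omega> =
     {v \<in> H_curl \<Omega>. \<forall>e>0. \<exists>u \<in> C_inf_vanishing \<gamma> \<Omega>. H_curl_norm \<Omega> (\<lambda>x. v x - u x) < e}"

definition H_div_bc :: "(real^3) set \<Rightarrow> (real^3) set \<Rightarrow> (real^3 \<Rightarrow> real^3) set" where
  "H_div_bc \<gamma> \<Omega> =
     {v \<in> H_div \<Omega>. \<forall>e>0. \<exists>u \<in> C_inf_vanishing \<gamma> \<Omega>. H_div_norm \<Omega> (\<lambda>x. v x - u x) < e}"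

definition H_curl0 :: "(real^3) set \<Rightarrow> (real^3 \<Rightarrow> real^3) set" where
  "H_curl0 \<Omega> = {v \<in> H_curl \<Omega>. AE x in lebesgue_on \<Omega>. weak_curl \<Omega> v x = 0}"

definition H_curl0_bc :: "(real^3) set \<Rightarrow> (real^3) set \<Rightarrow> (real^3 \<Rightarrow> real^3) set" where
  "H_curl0_bc \<gamma> \<Omega> = {v \<in> H_curl_bc \<gamma> \<Omega>. AE x in lebesgue_on \<Omega>. weak_curl \<Omega> v x = 0}"

definition H_div0_bc :: "(real^3) set \<Rightarrow> (real^3) set \<Rightarrow> (real^3 \<Rightarrow> real^3) set" where
  "H_div0_bc \<gamma> \<Omega> = {v \<in> H_div_bc \<gamma> \<Omega>. AE x in lebesgue_on \<Omega>. weak_div \<Omega> v x = 0}"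

definition harmonic_fields :: "(real^3) set \<Rightarrow> (real^3) set \<Rightarrow> (real^3 \<Rightarrow> real^3) set" where
  "harmonic_fields \<Omega> \<Gamma>t = H_curl0_bc \<Gamma>t \<Omega> \<inter> H_div0_bc (Gamma_n \<Omega> \<Gamma>t) \<Omega>"


section \<open>Tensor fields\<close>

definition mat_sym :: "real^3^3 \<Rightarrow> real^3^3" where
  "mat_sym M = (1/2) *\<^sub>R (M + transpose M)"

definition mat_skew :: "real^3^3 \<Rightarrow> real^3^3" where
  "mat_skew M = (1/2) *\<^sub>R (M - transpose M)"

definition so3 :: "(real^3^3) set" where
  "so3 = {A. transpose A = - A}"

definition so3_fields :: "(real^3 \<Rightarrow> real^3^3) set" where
  "so3_fields = {(\<lambda>_. A) | A. A \<in> so3}"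

definition skew_mean :: "(real^3) set \<Rightarrow> (real^3 \<Rightarrow> real^3^3) \<Rightarrow> real^3^3" where
  "skew_mean \<Omega> T = mat_skew ((1 / measure lebesgue \<Omega>) *\<^sub>R (\<integral>x. T x \<partial>lebesgue_on \<Omega>))"

definition row_field :: "(real^3 \<Rightarrow> real^3^3) \<Rightarrow> 3 \<Rightarrow> real^3 \<Rightarrow> real^3" where
  "row_field T i = (\<lambda>x. T x $ i)"

definition weak_Curl :: "(real^3) set \<Rightarrow> (real^3 \<Rightarrow> real^3^3) \<Rightarrow> real^3 \<Rightarrow> real^3^3" where
  "weak_Curl \<Omega> T = (\<lambda>x. \<chi> i. weak_curl \<Omega> (row_field T i) x)"

definition H_Curl :: "(real^3) set \<Rightarrow> (real^3 \<Rightarrow> real^3^3) set" where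
  "H_Curl \<Omega> = {T. \<forall>i. row_field T i \<in> H_curl \<Omega>}"

definition H_Curl_bc :: "(real^3) set \<Rightarrow> (real^3) set \<Rightarrow> (real^3 \<Rightarrow> real^3^3) set" where
  "H_Curl_bc \<gamma> \<Omega> = {T. \<forall>i. row_field T i \<in> H_curl_bc \<gamma> \<Omega>}"

definition H_Curl0 :: "(real^3) set \<Rightarrow> (real^3 \<Rightarrow> real^3^3) set" where
  "H_Curl0 \<Omega> = {T. \<forall>i. row_field T i \<in> H_curl0 \<Omega>}"

definition H_Curl0_bc :: "(real^3) set \<Rightarrow> (real^3) set \<Rightarrow> (real^3 \<Rightarrow> real^3^3) set" where
  "H_Curl0_bc \<gamma> \<Omega> = {T. \<forall>i. row_field T i \<in> H_curl0_bc \<gamma> \<Omega>}"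

definition H_Curl_norm :: "(real^3) set \<Rightarrow> (real^3 \<Rightarrow> real^3^3) \<Rightarrow> real" where
  "H_Curl_norm \<Omega> T = sqrt ((L2_norm \<Omega> T)\<^sup>2 + (L2_norm \<Omega> (weak_Curl \<Omega> T))\<^sup>2)"

text \<open>The norm written with triple bars.\<close>

definition sym_Curl_norm :: "(real^3) set \<Rightarrow> (real^3 \<Rightarrow> real^3^3) \<Rightarrow> real" where
  "sym_Curl_norm \<Omega> T =
     sqrt ((L2_norm \<Omega> (\<lambda>x. mat_sym (T x)))\<^sup>2 + (L2_norm \<Omega> (weak_Curl \<Omega> T))\<^sup>2)"

definition piecewise_const_skew ::
  "nat \<Rightarrow> (nat \<Rightarrow> (real^3) set) \<Rightarrow> (real^3 \<Rightarrow> real^3^3) \<Rightarrow> bool" where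
  "piecewise_const_skew J D A \<longleftrightarrow>
     (\<forall>j\<in>{1..J}. \<exists>B\<in>so3. AE x in lebesgue_on (D j). A x = B)"


section \<open>The Maxwell and the irrotational Korn constants\<close>

definition maxwell_constant :: "(real^3) set \<Rightarrow> (real^3) set \<Rightarrow> real \<Rightarrow> bool" where
  "maxwell_constant \<Omega> \<Gamma>t c \<longleftrightarrow> c > 0 \<and>
     (\<forall>v \<in> H_curl_bc \<Gamma>t \<Omega> \<inter> H_div_bc (Gamma_n \<Omega> \<Gamma>t) \<Omega> \<inter> L2_perp \<Omega> (harmonic_fields \<Omega> \<Gamma>t).
        L2_norm \<Omega> v \<le> c * sqrt ((L2_norm \<Omega> (weak_curl \<Omega> v))\<^sup>2 + (L2_norm \<Omega> (weak_div \<Omega> v))\<^sup>2))"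

definition korn_estimates ::
  "(real^3) set \<Rightarrow> real \<Rightarrow> (real^3 \<Rightarrow> real^3^3) \<Rightarrow> (real^3 \<Rightarrow> real^3^3) \<Rightarrow> bool" where
  "korn_estimates \<Omega> c T A \<longleftrightarrow>
     L2_norm \<Omega> (\<lambda>x. T x - A x) \<le> c * L2_norm \<Omega> (\<lambda>x. mat_sym (T x)) \<and>
     L2_norm \<Omega> T \<le> c * sqrt ((L2_norm \<Omega> (\<lambda>x. mat_sym (T x)))\<^sup>2 + (L2_norm \<Omega> A)\<^sup>2)"

definition korn_constant ::
  "(real^3) set \<Rightarrow> (real^3) set \<Rightarrow> nat \<Rightarrow> (nat \<Rightarrow> (real^3) set) \<Rightarrow> real \<Rightarrow> bool" where
  "korn_constant \<Omega> \<Gamma>t J D c \<longleftrightarrow> c > 0 \<and>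
     (\<Gamma>t \<noteq> {} \<longrightarrow>
        (\<forall>T \<in> H_Curl0_bc \<Gamma>t \<Omega>. L2_norm \<Omega> T \<le> c * L2_norm \<Omega> (\<lambda>x. mat_sym (T x)))) \<and>
     (\<Gamma>t = {} \<longrightarrow>
        (\<forall>T \<in> H_Curl0 \<Omega>. \<exists>A. piecewise_const_skew J D A \<and> korn_estimates \<Omega> c T A)) \<and>
     (\<Gamma>t = {} \<and> simply_connected \<Omega> \<longrightarrow>
        (\<forall>T \<in> H_Curl0 \<Omega>. korn_estimates \<Omega> c T (\<lambda>_. skew_mean \<Omega> T)))"

definition c_hat :: "real \<Rightarrow> real \<Rightarrow> real" where
  "c_hat cm ck = max (sqrt 2 * ck) (cm * sqrt (1 + 2 * ck\<^sup>2))"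

definition c_tilde :: "real \<Rightarrow> real \<Rightarrow> real" where
  "c_tilde cm ck = sqrt 2 * max ck (cm * (1 + ck))"

end

theory Submission
  imports Defs
begin

text \<open>Row by row, \<open>T = R + S\<close> with \<open>R\<close> the orthogonal projection onto the curl-free fields with
  vanishing tangential trace on \<open>\<Gamma>t\<close>. The remainder \<open>S\<close> is orthogonal to the gradients of smooth
  functions vanishing near \<open>\<Gamma>t\<close>, hence divergence-free; that it lies in the closure of the smooth
  fields vanishing near \<open>\<Gamma>n\<close> uses that the Lipschitz interface has zero capacity, so that weakly
  differentiable functions with zero trace on \<open>\<Gamma>t\<close> can be cut off near it. The Maxwell estimate then
  gives \<open>\<parallel>S\<parallel> \<le> cm * \<parallel>Curl T\<parallel>\<close>, Korn's inequality controls \<open>R\<close> by \<open>sym R = sym T - sym S\<close>, and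
  \<open>R\<close> and \<open>S\<close> are orthogonal. A piecewise constant field outside the Curl space is a skew matrix
  on one piece and zero on the others: its weak Curl would vanish on every piece, making the
  indicator of a piece locally constant in the connected set \<open>\<Omega>\<close>.\<close>

section \<open>The space of square-integrable fields\<close>

text \<open>The step that resists is the boundary condition of \<open>S\<close> on \<Gamma>n:
  orthogonality to gradients gives only a weak form of it, whereas the Maxwell estimate asks for a
  limit of smooth fields in the graph norm. Duality in a product of two \<open>L2\<close> spaces
  closes the gap: the residual of \<open>(S, 0)\<close> against the pairs \<open>(u, div u)\<close>,
  with \<open>u\<close> smooth and vanishing near \<Gamma>n, is a pair \<open>(grad q, q)\<close> in
  which \<open>q\<close> has zero trace on \<Gamma>t, and it vanishes once \<open>S\<close> is
  orthogonal to \<open>grad q\<close>. So \<open>grad q\<close> has to be approximated by gradients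
  of smooth functions vanishing near \<Gamma>t. Mollifiers shifted inward do this at \<Gamma>t and
  outward ones at \<Gamma>n; where the two parts meet the directions conflict, hence the cutoff
  there. Its product-rule term \<open>q * grad \<theta>\<close> is controlled only for bounded
  \<open>q\<close>, hence a truncation before it. In the constants, \<open>2 * ck\<^sup>2\<close>
  comes from squaring \<open>ck * (\<sigma> + s)\<close>; \<open>c_tilde\<close> is what the
  triangle inequality leaves when \<open>A\<close> is not curl-free and Pythagoras fails.\<close>

lemma L2_I:
  assumes "f \<in> borel_measurable (lebesgue_on \<Omega>)" "integrable (lebesgue_on \<Omega>) (\<lambda>x. (norm (f x))\<^sup>2)"
  shows "f \<in> L2 \<Omega>"
  using assms by (simp add: L2_def)

lemma L2_measurable: "f \<in> L2 \<Omega> \<Longrightarrow> f \<in> borel_measurable (lebesgue_on \<Omega>)"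
  by (simp add: L2_def)

lemma L2_integrable_sq: "f \<in> L2 \<Omega> \<Longrightarrow> integrable (lebesgue_on \<Omega>) (\<lambda>x. (norm (f x))\<^sup>2)"
  by (simp add: L2_def)

lemma L2_bound:
  fixes f :: "real^3 \<Rightarrow> 'b::euclidean_space"
  assumes "f \<in> borel_measurable (lebesgue_on \<Omega>)" "integrable (lebesgue_on \<Omega>) g"
    and "AE x in lebesgue_on \<Omega>. (norm (f x))\<^sup>2 \<le> g x"
  shows "f \<in> L2 \<Omega>"
proof (rule L2_I[OF assms(1)], rule Bochner_Integration.integrable_bound[OF assms(2)])
  show "(\<lambda>x. (norm (f x))\<^sup>2) \<in> borel_measurable (lebesgue_on \<Omega>)"
    using assms(1) by measurable
  show "AE x in lebesgue_on \<Omega>. norm ((norm (f x))\<^sup>2) \<le> norm (g x)"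
    using assms(3) by eventually_elim auto
qed

lemma L2_dominated:
  fixes f :: "real^3 \<Rightarrow> 'b::euclidean_space" and g :: "real^3 \<Rightarrow> 'c::euclidean_space"
  assumes "f \<in> borel_measurable (lebesgue_on \<Omega>)" "g \<in> L2 \<Omega>"
    and "AE x in lebesgue_on \<Omega>. norm (f x) \<le> C * norm (g x)"
  shows "f \<in> L2 \<Omega>"
proof (rule L2_bound[OF assms(1)])
  show "integrable (lebesgue_on \<Omega>) (\<lambda>x. C\<^sup>2 * (norm (g x))\<^sup>2)"
    using L2_integrable_sq[OF assms(2)] by simp
  show "AE x in lebesgue_on \<Omega>. (norm (f x))\<^sup>2 \<le> C\<^sup>2 * (norm (g x))\<^sup>2"
    using assms(3)
  proof eventually_elim
    case (elim x)
    then have "(norm (f x))\<^sup>2 \<le> (C * norm (g x))\<^sup>2" by (intro power_mono) auto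
    then show ?case by (simp add: power_mult_distrib)
  qed
qed

lemma L2_cong_AE:
  assumes "f \<in> L2 \<Omega>" "g \<in> borel_measurable (lebesgue_on \<Omega>)"
    and "AE x in lebesgue_on \<Omega>. g x = f x"
  shows "g \<in> L2 \<Omega>"
  by (rule L2_dominated[OF assms(2,1), of 1]) (use assms(3) in eventually_elim, simp)

lemma L2_zero: "(\<lambda>x. 0) \<in> L2 \<Omega>"
  by (simp add: L2_def)

lemma L2_scaleR: "f \<in> L2 \<Omega> \<Longrightarrow> (\<lambda>x. c *\<^sub>R f x) \<in> L2 \<Omega>"
  by (rule L2_dominated[of _ _ f "\<bar>c\<bar>"]) (auto intro!: borel_measurable_scaleR dest: L2_measurable)

lemma L2_add:
  assumes "f \<in> L2 \<Omega>" "g \<in> L2 \<Omega>"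
  shows "(\<lambda>x. f x + g x) \<in> L2 \<Omega>"
proof (rule L2_bound)
  show "(\<lambda>x. f x + g x) \<in> borel_measurable (lebesgue_on \<Omega>)"
    using L2_measurable[OF assms(1)] L2_measurable[OF assms(2)] by measurable
  show "integrable (lebesgue_on \<Omega>) (\<lambda>x. 2 * (norm (f x))\<^sup>2 + 2 * (norm (g x))\<^sup>2)"
    using L2_integrable_sq[OF assms(1)] L2_integrable_sq[OF assms(2)] by simp
  have "(norm (f x + g x))\<^sup>2 \<le> 2 * (norm (f x))\<^sup>2 + 2 * (norm (g x))\<^sup>2" for x
  proof -
    have "(norm (f x + g x))\<^sup>2 \<le> (norm (f x) + norm (g x))\<^sup>2"
      by (intro power_mono norm_triangle_ineq) auto
    also have "\<dots> \<le> 2 * (norm (f x))\<^sup>2 + 2 * (norm (g x))\<^sup>2"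
      using sum_squares_bound[of "norm (f x)" "norm (g x)"] by (simp add: power2_sum)
    finally show ?thesis .
  qed
  then show "AE x in lebesgue_on \<Omega>. (norm (f x + g x))\<^sup>2 \<le> 2 * (norm (f x))\<^sup>2 + 2 * (norm (g x))\<^sup>2"
    by simp
qed

lemma L2_uminus: "f \<in> L2 \<Omega> \<Longrightarrow> (\<lambda>x. - f x) \<in> L2 \<Omega>"
  using L2_scaleR[of f \<Omega> "-1"] by simp

lemma L2_diff: "f \<in> L2 \<Omega> \<Longrightarrow> g \<in> L2 \<Omega> \<Longrightarrow> (\<lambda>x. f x - g x) \<in> L2 \<Omega>"
  using L2_add[of f \<Omega> "\<lambda>x. - g x"] L2_uminus[of g \<Omega>] by simp

lemma L2_sum: "(\<And>i. i \<in> I \<Longrightarrow> f i \<in> L2 \<Omega>) \<Longrightarrow> (\<lambda>x. \<Sum>i\<in>I. f i x) \<in> L2 \<Omega>"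
  by (induction I rule: infinite_finite_induct) (auto intro: L2_zero L2_add)

lemma L2_bounded_linear:
  assumes "f \<in> L2 \<Omega>" "bounded_linear L"
  shows "(\<lambda>x. L (f x)) \<in> L2 \<Omega>"
proof -
  obtain K where K: "\<And>x. norm (L x) \<le> norm x * K"
    using bounded_linear.bounded[OF assms(2)] by blast
  have "L \<in> borel_measurable borel"
    using assms(2) by (intro borel_measurable_continuous_onI linear_continuous_on)
  then show ?thesis
    using K by (intro L2_dominated[OF _ assms(1), of _ K] measurable_compose[OF L2_measurable[OF assms(1)]])
      (auto simp: mult.commute)
qed

lemma L2_inner_integrable:
  assumes "f \<in> L2 \<Omega>" "g \<in> L2 \<Omega>"
  shows "integrable (lebesgue_on \<Omega>) (\<lambda>x. f x \<bullet> g x)"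
proof (rule Bochner_Integration.integrable_bound)
  show "integrable (lebesgue_on \<Omega>) (\<lambda>x. (norm (f x))\<^sup>2 + (norm (g x))\<^sup>2)"
    using assms by (auto dest: L2_integrable_sq)
  show "(\<lambda>x. f x \<bullet> g x) \<in> borel_measurable (lebesgue_on \<Omega>)"
    using assms by (auto dest: L2_measurable intro!: borel_measurable_inner)
  have "\<bar>f x \<bullet> g x\<bar> \<le> (norm (f x))\<^sup>2 + (norm (g x))\<^sup>2" for x
  proof -
    have "\<bar>f x \<bullet> g x\<bar> \<le> norm (f x) * norm (g x)" by (rule Cauchy_Schwarz_ineq2)
    also have "\<dots> \<le> 2 * (norm (f x) * norm (g x))" by simp
    also have "\<dots> \<le> (norm (f x))\<^sup>2 + (norm (g x))\<^sup>2"
      using sum_squares_bound[of "norm (f x)" "norm (g x)"] by (simp add: mult.assoc)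
    finally show ?thesis .
  qed
  then show "AE x in lebesgue_on \<Omega>. norm (f x \<bullet> g x) \<le> norm ((norm (f x))\<^sup>2 + (norm (g x))\<^sup>2)"
    by simp
qed

lemma L2_inner_commute: "L2_inner \<Omega> f g = L2_inner \<Omega> g f"
  by (simp add: L2_inner_def inner_commute)

lemma L2_inner_add_left:
  "f \<in> L2 \<Omega> \<Longrightarrow> g \<in> L2 \<Omega> \<Longrightarrow> h \<in> L2 \<Omega> \<Longrightarrow>
    L2_inner \<Omega> (\<lambda>x. f x + g x) h = L2_inner \<Omega> f h + L2_inner \<Omega> g h"
  by (simp add: L2_inner_def inner_add_left L2_inner_integrable)

lemma L2_inner_diff_left:
  "f \<in> L2 \<Omega> \<Longrightarrow> g \<in> L2 \<Omega> \<Longrightarrow> h \<in> L2 \<Omega> \<Longrightarrow>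
    L2_inner \<Omega> (\<lambda>x. f x - g x) h = L2_inner \<Omega> f h - L2_inner \<Omega> g h"
  by (simp add: L2_inner_def inner_diff_left L2_inner_integrable)

lemma L2_inner_scaleR_left: "L2_inner \<Omega> (\<lambda>x. c *\<^sub>R f x) h = c * L2_inner \<Omega> f h"
  by (simp add: L2_inner_def)

lemma L2_inner_diff_right:
  "f \<in> L2 \<Omega> \<Longrightarrow> g \<in> L2 \<Omega> \<Longrightarrow> h \<in> L2 \<Omega> \<Longrightarrow>
    L2_inner \<Omega> h (\<lambda>x. f x - g x) = L2_inner \<Omega> h f - L2_inner \<Omega> h g"
  by (simp add: L2_inner_def inner_diff_right L2_inner_integrable)

lemma L2_inner_scaleR_right: "L2_inner \<Omega> h (\<lambda>x. c *\<^sub>R f x) = c * L2_inner \<Omega> h f"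
  by (simp add: L2_inner_def)

lemma L2_inner_zero [simp]: "L2_inner \<Omega> (\<lambda>x. 0) f = 0" "L2_inner \<Omega> f (\<lambda>x. 0) = 0"
  by (simp_all add: L2_inner_def)

lemma L2_inner_cong_AE:
  assumes "f \<in> L2 \<Omega>" "g \<in> L2 \<Omega>" "f' \<in> L2 \<Omega>" "g' \<in> L2 \<Omega>"
    and "AE x in lebesgue_on \<Omega>. f' x = f x" "AE x in lebesgue_on \<Omega>. g' x = g x"
  shows "L2_inner \<Omega> f' g' = L2_inner \<Omega> f g"
  unfolding L2_inner_def
proof (rule integral_cong_AE)
  show "AE x in lebesgue_on \<Omega>. f' x \<bullet> g' x = f x \<bullet> g x"
    using assms(5,6) by eventually_elim simp
qed (use assms in \<open>auto dest: L2_measurable intro!: borel_measurable_inner\<close>)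

lemma L2_norm_nonneg [simp]: "0 \<le> L2_norm \<Omega> f"
  by (simp add: L2_norm_def)

lemma L2_norm_sq: "(L2_norm \<Omega> f)\<^sup>2 = (\<integral>x. (norm (f x))\<^sup>2 \<partial>lebesgue_on \<Omega>)"
  by (simp add: L2_norm_def)

lemma L2_norm_sq_inner: "(L2_norm \<Omega> f)\<^sup>2 = L2_inner \<Omega> f f"
  by (simp add: L2_norm_sq L2_inner_def power2_norm_eq_inner)

lemma L2_norm_zero [simp]: "L2_norm \<Omega> (\<lambda>x. 0) = 0"
  by (simp add: L2_norm_def)

lemma L2_norm_scaleR: "L2_norm \<Omega> (\<lambda>x. c *\<^sub>R f x) = \<bar>c\<bar> * L2_norm \<Omega> f"
  by (simp add: L2_norm_def power_mult_distrib real_sqrt_mult)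

lemma L2_norm_minus: "L2_norm \<Omega> (\<lambda>x. - f x) = L2_norm \<Omega> f"
  by (simp add: L2_norm_def)

lemma L2_norm_minus_commute: "L2_norm \<Omega> (\<lambda>x. f x - g x) = L2_norm \<Omega> (\<lambda>x. g x - f x)"
  by (simp add: L2_norm_def norm_minus_commute)

lemma L2_norm_cong_AE:
  assumes "f \<in> borel_measurable (lebesgue_on \<Omega>)" "g \<in> borel_measurable (lebesgue_on \<Omega>)"
    and "AE x in lebesgue_on \<Omega>. f x = g x"
  shows "L2_norm \<Omega> f = L2_norm \<Omega> g"
  unfolding L2_norm_def
proof (rule arg_cong[of _ _ sqrt], rule integral_cong_AE)
  show "AE x in lebesgue_on \<Omega>. (norm (f x))\<^sup>2 = (norm (g x))\<^sup>2"
    using assms(3) by eventually_elim simp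
qed (use assms in measurable)

lemma L2_norm_mono_AE:
  assumes "f \<in> L2 \<Omega>" "g \<in> L2 \<Omega>" "AE x in lebesgue_on \<Omega>. norm (f x) \<le> norm (g x)"
  shows "L2_norm \<Omega> f \<le> L2_norm \<Omega> g"
  unfolding L2_norm_def
proof (rule real_sqrt_le_mono, rule integral_mono_AE)
  show "AE x in lebesgue_on \<Omega>. (norm (f x))\<^sup>2 \<le> (norm (g x))\<^sup>2"
    using assms(3) by eventually_elim (intro power_mono, auto)
qed (use assms in \<open>auto dest: L2_integrable_sq\<close>)

lemma L2_norm_sq_diff_scaleR:
  assumes "f \<in> L2 \<Omega>" "g \<in> L2 \<Omega>"
  shows "(L2_norm \<Omega> (\<lambda>x. f x - t *\<^sub>R g x))\<^sup>2
    = (L2_norm \<Omega> f)\<^sup>2 - 2 * t * L2_inner \<Omega> f g + t\<^sup>2 * (L2_norm \<Omega> g)\<^sup>2"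
proof -
  note [simp] = assms L2_scaleR L2_diff
  have "(L2_norm \<Omega> (\<lambda>x. f x - t *\<^sub>R g x))\<^sup>2 =
      L2_inner \<Omega> f f - t * L2_inner \<Omega> f g - t * (L2_inner \<Omega> g f - t * L2_inner \<Omega> g g)"
    unfolding L2_norm_sq_inner
    by (simp add: L2_inner_diff_left L2_inner_diff_right L2_inner_scaleR_left L2_inner_scaleR_right
        algebra_simps)
  then show ?thesis
    unfolding L2_norm_sq_inner[of \<Omega> f] L2_norm_sq_inner[of \<Omega> g]
    by (simp add: L2_inner_commute[of \<Omega> g f] algebra_simps power2_eq_square[of t])
qed

lemma L2_norm_sq_add:
  assumes "f \<in> L2 \<Omega>" "g \<in> L2 \<Omega>"
  shows "(L2_norm \<Omega> (\<lambda>x. f x + g x))\<^sup>2 = (L2_norm \<Omega> f)\<^sup>2 + 2 * L2_inner \<Omega> f g + (L2_norm \<Omega> g)\<^sup>2"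
  using L2_norm_sq_diff_scaleR[OF assms, of "-1"] by simp

text \<open>The linear term dominates near \<open>t = 0\<close>. In the projection theorem this is
  the vanishing of the first variation at a minimiser.\<close>

lemma quadratic_nonneg_imp_coefficient_zero:
  fixes b c :: real
  assumes "\<And>t. 0 \<le> t\<^sup>2 * b - 2 * t * c"
  shows "c = 0"
proof (rule ccontr)
  assume c: "c \<noteq> 0"
  \<comment> \<open>At \<open>t = c / s\<close> the quadratic equals
    \<open>(c\<^sup>2 / s) * (b / s - 2)\<close>, which is negative because
    \<open>s = \<bar>b\<bar> + 1\<close> exceeds \<open>b / 2\<close>.\<close>
  define s where "s = \<bar>b\<bar> + 1"
  define t where "t = c / s"
  have pos: "s > 0" and bs: "b < 2 * s" by (simp_all add: s_def)
  have eq: "t\<^sup>2 * b - 2 * t * c = (c\<^sup>2 / s) * (b / s - 2)"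
    using pos by (simp add: t_def power2_eq_square field_simps)
  have "c\<^sup>2 / s > 0" using c pos by simp
  moreover have "b / s - 2 < 0" using pos bs by (simp add: field_simps)
  ultimately have "t\<^sup>2 * b - 2 * t * c < 0" unfolding eq by (rule mult_pos_neg)
  then show False using assms[of t] by linarith
qed

lemma L2_Cauchy_Schwarz:
  assumes "f \<in> L2 \<Omega>" "g \<in> L2 \<Omega>"
  shows "\<bar>L2_inner \<Omega> f g\<bar> \<le> L2_norm \<Omega> f * L2_norm \<Omega> g"
proof -
  define a b c where "a = (L2_norm \<Omega> f)\<^sup>2" and "b = (L2_norm \<Omega> g)\<^sup>2" and "c = L2_inner \<Omega> f g"
  have q: "0 \<le> a - 2 * t * c + t\<^sup>2 * b" for t
    using L2_norm_sq_diff_scaleR[OF assms, of t] unfolding a_def b_def c_def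
    by (metis zero_le_power2)
  have "c\<^sup>2 \<le> a * b"
  proof (cases "b = 0")
    case True
    \<comment> \<open>Here the quadratic is affine in \<open>t\<close>; a nonzero slope would make
      it \<open>-1\<close> at \<open>(a + 1) / (2 * c)\<close>.\<close>
    have "c = 0"
    proof (rule ccontr)
      assume "c \<noteq> 0"
      then have "a - 2 * ((a + 1) / (2 * c)) * c = -1" by (simp add: field_simps)
      then show False using q[of "(a + 1) / (2 * c)"] True by simp
    qed
    then show ?thesis using True by simp
  next
    case False
    then have "b > 0" by (simp add: b_def)
    \<comment> \<open>\<open>t = c / b\<close> is the minimiser of the quadratic.\<close>
    moreover have "a - 2 * (c / b) * c + (c / b)\<^sup>2 * b = a - c\<^sup>2 / b"
      using False by (simp add: power2_eq_square field_simps)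
    ultimately have "c\<^sup>2 / b \<le> a" using q[of "c / b"] by simp
    then show ?thesis using \<open>b > 0\<close> by (simp add: pos_divide_le_eq)
  qed
  then have "sqrt (c\<^sup>2) \<le> sqrt (a * b)" by (rule real_sqrt_le_mono)
  then show ?thesis by (simp add: a_def b_def c_def real_sqrt_mult)
qed

lemma L2_norm_triangle:
  assumes "f \<in> L2 \<Omega>" "g \<in> L2 \<Omega>"
  shows "L2_norm \<Omega> (\<lambda>x. f x + g x) \<le> L2_norm \<Omega> f + L2_norm \<Omega> g"
proof (rule power2_le_imp_le)
  have "L2_inner \<Omega> f g \<le> L2_norm \<Omega> f * L2_norm \<Omega> g"
    using L2_Cauchy_Schwarz[OF assms] by linarith
  then show "(L2_norm \<Omega> (\<lambda>x. f x + g x))\<^sup>2 \<le> (L2_norm \<Omega> f + L2_norm \<Omega> g)\<^sup>2"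
    unfolding L2_norm_sq_add[OF assms] by (simp add: power2_sum)
qed simp

lemma L2_norm_triangle_diff:
  assumes "f \<in> L2 \<Omega>" "g \<in> L2 \<Omega>" "h \<in> L2 \<Omega>"
  shows "L2_norm \<Omega> (\<lambda>x. f x - h x) \<le> L2_norm \<Omega> (\<lambda>x. f x - g x) + L2_norm \<Omega> (\<lambda>x. g x - h x)"
  using L2_norm_triangle[OF L2_diff[OF assms(1,2)] L2_diff[OF assms(2,3)]] by simp

section \<open>Completeness and orthogonal projection\<close>

lemma nn_integral_L2:
  assumes "f \<in> L2 \<Omega>"
  shows "(\<integral>\<^sup>+x. ennreal ((norm (f x))\<^sup>2) \<partial>lebesgue_on \<Omega>) = ennreal ((L2_norm \<Omega> f)\<^sup>2)"
  unfolding L2_norm_sq using L2_integrable_sq[OF assms] by (intro nn_integral_eq_integral) auto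

lemma L2_nn_integralI:
  fixes f :: "real^3 \<Rightarrow> 'b::euclidean_space"
  assumes "f \<in> borel_measurable (lebesgue_on \<Omega>)" "0 \<le> e"
    and "(\<integral>\<^sup>+x. ennreal ((norm (f x))\<^sup>2) \<partial>lebesgue_on \<Omega>) \<le> ennreal (e\<^sup>2)"
  shows "f \<in> L2 \<Omega>" "L2_norm \<Omega> f \<le> e"
proof -
  show *: "f \<in> L2 \<Omega>"
  proof (rule L2_I[OF assms(1)], rule integrableI_bounded)
    show "(\<lambda>x. (norm (f x))\<^sup>2) \<in> borel_measurable (lebesgue_on \<Omega>)" using assms(1) by measurable
    have "(\<integral>\<^sup>+x. ennreal (norm ((norm (f x))\<^sup>2)) \<partial>lebesgue_on \<Omega>) \<le> ennreal (e\<^sup>2)"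
      using assms(3) by simp
    also have "\<dots> < \<infinity>" by simp
    finally show "(\<integral>\<^sup>+x. ennreal (norm ((norm (f x))\<^sup>2)) \<partial>lebesgue_on \<Omega>) < \<infinity>" .
  qed
  have "(L2_norm \<Omega> f)\<^sup>2 \<le> e\<^sup>2"
    using assms(3) unfolding nn_integral_L2[OF *] by (simp add: ennreal_le_iff)
  then show "L2_norm \<Omega> f \<le> e" using assms(2) by (rule power2_le_imp_le)
qed

lemma L2_norm_eq_0_AE:
  assumes "f \<in> L2 \<Omega>" "L2_norm \<Omega> f = 0"
  shows "AE x in lebesgue_on \<Omega>. f x = 0"
proof -
  have "(\<integral>x. (norm (f x))\<^sup>2 \<partial>lebesgue_on \<Omega>) = 0" using assms(2) L2_norm_sq[of \<Omega> f] by simp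
  then have "AE x in lebesgue_on \<Omega>. (norm (f x))\<^sup>2 = 0"
    using integral_nonneg_eq_0_iff_AE[OF L2_integrable_sq[OF assms(1)]] by simp
  then show ?thesis by simp
qed

text \<open>Fatou's lemma for squared norms. It turns a norm bound along a pointwise convergent
  sequence into the same bound for the limit, and the finite nonnegative integral gives membership
  in \<open>L2\<close> as well. Completeness and the fundamental lemma rest on it.\<close>

lemma L2_Fatou:
  fixes f :: "nat \<Rightarrow> real^3 \<Rightarrow> 'b::euclidean_space"
  assumes f: "\<And>n. f n \<in> L2 \<Omega>" and g: "g \<in> borel_measurable (lebesgue_on \<Omega>)"
    and lim: "AE x in lebesgue_on \<Omega>. (\<lambda>n. f n x) \<longlonglongrightarrow> g x"
    and bd: "eventually (\<lambda>n. L2_norm \<Omega> (f n) \<le> e) sequentially" and e: "0 \<le> e"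
  shows "g \<in> L2 \<Omega>" "L2_norm \<Omega> g \<le> e"
proof -
  have [measurable]: "f n \<in> borel_measurable (lebesgue_on \<Omega>)" for n using L2_measurable[OF f] .
  have "(\<integral>\<^sup>+x. ennreal ((norm (g x))\<^sup>2) \<partial>lebesgue_on \<Omega>)
      = (\<integral>\<^sup>+x. liminf (\<lambda>n. ennreal ((norm (f n x))\<^sup>2)) \<partial>lebesgue_on \<Omega>)"
  proof (rule nn_integral_cong_AE)
    show "AE x in lebesgue_on \<Omega>. ennreal ((norm (g x))\<^sup>2) = liminf (\<lambda>n. ennreal ((norm (f n x))\<^sup>2))"
      using lim
    proof eventually_elim
      case (elim x)
      have "(\<lambda>n. ennreal ((norm (f n x))\<^sup>2)) \<longlonglongrightarrow> ennreal ((norm (g x))\<^sup>2)"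
        using elim by (intro tendsto_intros)
      then show ?case using lim_imp_Liminf[OF trivial_limit_sequentially] by metis
    qed
  qed
  also have "\<dots> \<le> liminf (\<lambda>n. \<integral>\<^sup>+x. ennreal ((norm (f n x))\<^sup>2) \<partial>lebesgue_on \<Omega>)"
    by (rule nn_integral_liminf) measurable
  also have "\<dots> = liminf (\<lambda>n. ennreal ((L2_norm \<Omega> (f n))\<^sup>2))"
    by (simp add: nn_integral_L2[OF f])
  also have "\<dots> \<le> liminf (\<lambda>n. ennreal (e\<^sup>2))"
    by (rule Liminf_mono) (use bd in eventually_elim, auto intro!: ennreal_leI power_mono)
  also have "\<dots> = ennreal (e\<^sup>2)" by (simp add: Liminf_const)
  finally show "g \<in> L2 \<Omega>" "L2_norm \<Omega> g \<le> e" using L2_nn_integralI[OF g e] by auto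
qed

text \<open>Along a subsequence with increments \<open>d k\<close> of norm at most \<open>4^-k\<close>, the bound
  \<open>d k \<le> 2^k * (d k)^2 + 2^-k\<close> reduces pointwise summability to the integrability of
  \<open>\<Sum>k. 2^k * (d k)^2\<close>.\<close>

lemma L2_rapidly_Cauchy_AE_convergent:
  fixes f :: "nat \<Rightarrow> real^3 \<Rightarrow> 'b::euclidean_space"
  assumes f: "\<And>n. f n \<in> L2 \<Omega>"
    and d: "\<And>k. L2_norm \<Omega> (\<lambda>x. f (Suc k) x - f k x) \<le> (1/2)^k"
  shows "AE x in lebesgue_on \<Omega>. convergent (\<lambda>n. f n x)"
proof -
  have [measurable]: "f n \<in> borel_measurable (lebesgue_on \<Omega>)" for n using L2_measurable[OF f] .
  define D where "D k x = (norm (f (Suc k) x - f k x))\<^sup>2" for k x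
  have [measurable]: "D k \<in> borel_measurable (lebesgue_on \<Omega>)" for k unfolding D_def by measurable
  have "(\<integral>\<^sup>+x. (\<Sum>k. ennreal (2^k * D k x)) \<partial>lebesgue_on \<Omega>)
      = (\<Sum>k. \<integral>\<^sup>+x. ennreal (2^k * D k x) \<partial>lebesgue_on \<Omega>)"
    by (rule nn_integral_suminf) measurable
  also have "\<dots> \<le> (\<Sum>k. ennreal ((1/2)^k))"
  proof (rule suminf_le)
    fix k
    have "(\<integral>\<^sup>+x. ennreal (2^k * D k x) \<partial>lebesgue_on \<Omega>)
        = ennreal (2^k) * (\<integral>\<^sup>+x. ennreal (D k x) \<partial>lebesgue_on \<Omega>)"
      by (subst nn_integral_cmult[symmetric]) (auto simp: ennreal_mult' D_def)
    also have "\<dots> = ennreal (2^k * (L2_norm \<Omega> (\<lambda>x. f (Suc k) x - f k x))\<^sup>2)"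
      unfolding D_def nn_integral_L2[OF L2_diff[OF f f]] by (simp add: ennreal_mult')
    \<comment> \<open>The square of the norm is at most \<open>4^-k\<close>, so the weight
      \<open>2^k\<close> still leaves the summable \<open>2^-k\<close>.\<close>
    also have "\<dots> \<le> ennreal (2^k * ((1/2)^k)\<^sup>2)"
      by (intro ennreal_leI mult_left_mono power_mono d) auto
    also have "2^k * ((1/2)^k)\<^sup>2 = (1/2::real)^k"
      by (simp add: power2_eq_square power_one_over)
    finally show "(\<integral>\<^sup>+x. ennreal (2^k * D k x) \<partial>lebesgue_on \<Omega>) \<le> ennreal ((1/2)^k)" .
  qed auto
  also have "\<dots> = ennreal (\<Sum>k. (1/2)^k)" by (rule suminf_ennreal2) (auto intro: summable_geometric)
  also have "\<dots> < \<infinity>" by simp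
  finally have "AE x in lebesgue_on \<Omega>. (\<Sum>k. ennreal (2^k * D k x)) \<noteq> \<infinity>"
    by (intro nn_integral_noteq_infinite) auto
  then show ?thesis
  proof eventually_elim
    case (elim x)
    have "summable (\<lambda>k. 2^k * D k x)"
      using elim by (intro summable_suminf_not_top) (auto simp: D_def)
    then have "summable (\<lambda>k. 2^k * D k x + (1/2)^k)"
      by (intro summable_add summable_geometric) auto
    then have "summable (\<lambda>k. norm (f (Suc k) x - f k x))"
    proof (rule summable_comparison_test')
      fix k :: nat
      define a where "a = norm (f (Suc k) x - f k x)"
      have "0 \<le> (2^k * a - 1)\<^sup>2 + 2^k * a" by (simp add: a_def)
      then have "2^k * a \<le> 2^k * (2^k * a\<^sup>2 + (1/2)^k)"
        by (simp add: power2_eq_square algebra_simps power_one_over)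
      then have "a \<le> 2^k * a\<^sup>2 + (1/2)^k" by simp
      then show "norm (norm (f (Suc k) x - f k x)) \<le> 2^k * D k x + (1/2)^k"
        by (simp add: a_def D_def)
    qed
    then have "summable (\<lambda>k. f (Suc k) x - f k x)" by (rule summable_norm_cancel)
    then have "convergent (\<lambda>n. \<Sum>k<n. f (Suc k) x - f k x)" by (simp add: summable_iff_convergent)
    then have "convergent (\<lambda>n. f n x - f 0 x)" by (simp add: sum_lessThan_telescope[of "\<lambda>k. f k x"])
    then have "convergent (\<lambda>n. (f n x - f 0 x) + f 0 x)" by (intro convergent_add convergent_const)
    then show ?case by simp
  qed
qed

theorem L2_complete:
  fixes f :: "nat \<Rightarrow> real^3 \<Rightarrow> 'b::euclidean_space"
  assumes f: "\<And>n. f n \<in> L2 \<Omega>"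
    and Cauchy: "\<And>e. e > 0 \<Longrightarrow> \<exists>N. \<forall>m\<ge>N. \<forall>n\<ge>N. L2_norm \<Omega> (\<lambda>x. f m x - f n x) < e"
  obtains g where "g \<in> L2 \<Omega>" "(\<lambda>n. L2_norm \<Omega> (\<lambda>x. f n x - g x)) \<longlonglongrightarrow> 0"
proof -
  have [measurable]: "f n \<in> borel_measurable (lebesgue_on \<Omega>)" for n using L2_measurable[OF f] .
  have "\<forall>k. \<exists>N. \<forall>m\<ge>N. \<forall>n\<ge>N. L2_norm \<Omega> (\<lambda>x. f m x - f n x) < (1/2)^k"
    using Cauchy by simp
  then obtain N where N: "\<And>k m n. m \<ge> N k \<Longrightarrow> n \<ge> N k \<Longrightarrow> L2_norm \<Omega> (\<lambda>x. f m x - f n x) < (1/2)^k"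
    by metis
  \<comment> \<open>Partial sums make \<open>r\<close> increasing and at least \<open>N k\<close>;
    the summand \<open>k\<close> makes it at least \<open>k\<close>, so that it passes every
    threshold \<open>M\<close> below.\<close>
  define r where "r k = (\<Sum>j\<le>k. N j) + k" for k
  have rN: "r k \<ge> N k" for k
    unfolding r_def by (metis atMost_iff finite_atMost le_add1 le_trans member_le_sum order_refl zero_le)
  have rk: "r k \<ge> k" for k by (simp add: r_def)
  have rS: "r (Suc k) \<ge> r k" for k by (simp add: r_def)
  have "AE x in lebesgue_on \<Omega>. convergent (\<lambda>n. f (r n) x)"
    by (rule L2_rapidly_Cauchy_AE_convergent)
      (auto intro!: f less_imp_le[OF N] rN order_trans[OF rN rS])
  then have lim: "AE x in lebesgue_on \<Omega>. (\<lambda>n. f (r n) x) \<longlonglongrightarrow> lim (\<lambda>n. f (r n) x)"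
    by eventually_elim (simp add: convergent_LIMSEQ_iff)
  define g where "g x = lim (\<lambda>n. f (r n) x)" for x
  have [measurable]: "g \<in> borel_measurable (lebesgue_on \<Omega>)" unfolding g_def by measurable
  \<comment> \<open>Fatou is applied in the second index along the subsequence, with
    \<open>n\<close> fixed: the Cauchy bound for the whole sequence passes to the difference with
    \<open>g\<close>.\<close>
  have est: "(\<lambda>x. f n x - g x) \<in> L2 \<Omega> \<and> L2_norm \<Omega> (\<lambda>x. f n x - g x) \<le> e"
    if e: "e > 0" and n: "n \<ge> M" and M: "\<forall>m\<ge>M. \<forall>n\<ge>M. L2_norm \<Omega> (\<lambda>x. f m x - f n x) < e" for e n M
  proof -
    have a: "AE x in lebesgue_on \<Omega>. (\<lambda>k. f n x - f (r k) x) \<longlonglongrightarrow> f n x - g x"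
      using lim unfolding g_def[symmetric] by eventually_elim (intro tendsto_intros)
    have b: "eventually (\<lambda>k. L2_norm \<Omega> (\<lambda>x. f n x - f (r k) x) \<le> e) sequentially"
      using eventually_ge_at_top[of M]
      proof eventually_elim
        case (elim k)
        then have "r k \<ge> M" using rk[of k] by linarith
        then show ?case using M n by (intro less_imp_le) blast
      qed
    show ?thesis using L2_Fatou[OF L2_diff[OF f f] _ a b] e by auto
  qed
  obtain M1 where M1: "\<forall>m\<ge>M1. \<forall>n\<ge>M1. L2_norm \<Omega> (\<lambda>x. f m x - f n x) < 1" using Cauchy[of 1] by auto
  have "(\<lambda>x. f M1 x - (f M1 x - g x)) \<in> L2 \<Omega>"
    by (rule L2_diff[OF f]) (use est[of 1 M1 M1] M1 in simp)
  then have gL: "g \<in> L2 \<Omega>" by simp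
  have "(\<lambda>n. L2_norm \<Omega> (\<lambda>x. f n x - g x)) \<longlonglongrightarrow> 0"
  proof (rule LIMSEQ_I)
    fix e :: real assume e: "e > 0"
    then obtain M where M: "\<forall>m\<ge>M. \<forall>n\<ge>M. L2_norm \<Omega> (\<lambda>x. f m x - f n x) < e/2" using Cauchy[of "e/2"] by auto
    have "norm (L2_norm \<Omega> (\<lambda>x. f n x - g x) - 0) < e" if "n \<ge> M" for n
      using est[OF _ that M] e by simp
    then show "\<exists>no. \<forall>n\<ge>no. norm (L2_norm \<Omega> (\<lambda>x. f n x - g x) - 0) < e" by blast
  qed
  with gL that show thesis by blast
qed

definition L2_subspace :: "(real^3) set \<Rightarrow> (real^3 \<Rightarrow> 'b::euclidean_space) set \<Rightarrow> bool" where
  "L2_subspace \<Omega> V \<longleftrightarrow> V \<subseteq> L2 \<Omega> \<and> (\<lambda>x. 0) \<in> V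
     \<and> (\<forall>u\<in>V. \<forall>v\<in>V. (\<lambda>x. u x + v x) \<in> V) \<and> (\<forall>u\<in>V. \<forall>c. (\<lambda>x. c *\<^sub>R u x) \<in> V)"

text \<open>A minimising sequence for the distance to \<open>V\<close> is Cauchy by the
  parallelogram law. \<open>V\<close> is not assumed closed, so \<open>p\<close> is only
  approximable from \<open>V\<close>. This fits the pairs of a smooth field and its divergence,
  whose closure is the object of interest; for curl-free fields closedness is supplied
  separately.\<close>

theorem L2_projection_onto_closure:
  fixes f :: "real^3 \<Rightarrow> 'b::euclidean_space"
  assumes V: "L2_subspace \<Omega> V" and f: "f \<in> L2 \<Omega>"
  obtains p where "p \<in> L2 \<Omega>" "\<And>e. e > 0 \<Longrightarrow> \<exists>u\<in>V. L2_norm \<Omega> (\<lambda>x. p x - u x) < e"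
    "\<And>u. u \<in> V \<Longrightarrow> L2_inner \<Omega> (\<lambda>x. f x - p x) u = 0"
proof -
  have VL: "u \<in> V \<Longrightarrow> u \<in> L2 \<Omega>" and V0: "(\<lambda>x. 0) \<in> V"
    and Vadd: "u \<in> V \<Longrightarrow> v \<in> V \<Longrightarrow> (\<lambda>x. u x + v x) \<in> V"
    and Vsc: "u \<in> V \<Longrightarrow> (\<lambda>x. c *\<^sub>R u x) \<in> V" for u v c
    using V by (auto simp: L2_subspace_def)
  define S where "S = (\<lambda>u. (L2_norm \<Omega> (\<lambda>x. f x - u x))\<^sup>2) ` V"
  define d where "d = Inf S"
  have S: "S \<noteq> {}" "bdd_below S" using V0 by (auto simp: S_def intro!: bdd_belowI[of _ 0])
  have dle: "d \<le> (L2_norm \<Omega> (\<lambda>x. f x - u x))\<^sup>2" if "u \<in> V" for u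
    unfolding d_def using that S by (intro cInf_lower) (auto simp: S_def)
  have "\<exists>u\<in>V. (L2_norm \<Omega> (\<lambda>x. f x - u x))\<^sup>2 < d + 1 / Suc n" for n
    using cInf_lessD[OF S(1), of "d + 1 / Suc n"] unfolding d_def[symmetric] by (auto simp: S_def)
  then obtain u where uV: "\<And>n. u n \<in> V"
    and ud: "\<And>n. (L2_norm \<Omega> (\<lambda>x. f x - u n x))\<^sup>2 < d + 1 / Suc n" by metis
  have uL: "u n \<in> L2 \<Omega>" for n using VL uV by blast
  \<comment> \<open>The parallelogram law, with the midpoint of \<open>u m\<close> and
    \<open>u n\<close> as a competitor in \<open>V\<close>: its squared distance from
    \<open>f\<close> is at least \<open>d\<close>, which leaves only the two excesses over
    \<open>d\<close> for the difference.\<close>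
  have par: "(L2_norm \<Omega> (\<lambda>x. u m x - u n x))\<^sup>2 \<le> 2 / Suc m + 2 / Suc n" for m n
  proof -
    let ?a = "\<lambda>x. f x - u m x" and ?b = "\<lambda>x. f x - u n x"
    have ab: "?a \<in> L2 \<Omega>" "?b \<in> L2 \<Omega>" using f uL by (auto intro: L2_diff)
    have 1: "(L2_norm \<Omega> (\<lambda>x. u m x - u n x))\<^sup>2 = (L2_norm \<Omega> ?a)\<^sup>2 - 2 * L2_inner \<Omega> ?a ?b + (L2_norm \<Omega> ?b)\<^sup>2"
      using L2_norm_sq_diff_scaleR[OF ab, of 1] L2_norm_minus_commute[of \<Omega> "u m" "u n"] by simp
    have 2: "(L2_norm \<Omega> (\<lambda>x. ?a x + ?b x))\<^sup>2 = (L2_norm \<Omega> ?a)\<^sup>2 + 2 * L2_inner \<Omega> ?a ?b + (L2_norm \<Omega> ?b)\<^sup>2"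
      by (rule L2_norm_sq_add[OF ab])
    have "(\<lambda>x. ?a x + ?b x) = (\<lambda>x. 2 *\<^sub>R (f x - (1/2) *\<^sub>R (u m x + u n x)))"
      by (auto simp: algebra_simps scaleR_2 fun_eq_iff simp flip: scaleR_add_left)
    then have "(L2_norm \<Omega> (\<lambda>x. ?a x + ?b x))\<^sup>2 = 4 * (L2_norm \<Omega> (\<lambda>x. f x - (1/2) *\<^sub>R (u m x + u n x)))\<^sup>2"
      by (simp add: L2_norm_scaleR power_mult_distrib)
    moreover have "d \<le> (L2_norm \<Omega> (\<lambda>x. f x - (1/2) *\<^sub>R (u m x + u n x)))\<^sup>2"
      by (intro dle Vsc Vadd uV)
    ultimately show ?thesis using 1 2 ud[of m] ud[of n] by linarith
  qed
  have Cauchy: "\<exists>N. \<forall>m\<ge>N. \<forall>n\<ge>N. L2_norm \<Omega> (\<lambda>x. u m x - u n x) < e" if e: "e > 0" for e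
  proof -
    obtain N where N: "4 / real (Suc N) < e\<^sup>2"
      using reals_Archimedean[of "e\<^sup>2 / 4"] e by (auto simp: field_simps)
    have "L2_norm \<Omega> (\<lambda>x. u m x - u n x) < e" if "m \<ge> N" "n \<ge> N" for m n
    proof -
      have "2 / real (Suc m) \<le> 2 / Suc N" "2 / real (Suc n) \<le> 2 / Suc N"
        using that by (auto intro!: divide_left_mono)
      then have "(L2_norm \<Omega> (\<lambda>x. u m x - u n x))\<^sup>2 < e\<^sup>2" using par[of m n] N by simp
      then show ?thesis using e by (intro power2_less_imp_less[of _ e]) auto
    qed
    then show ?thesis by blast
  qed
  obtain p where p: "p \<in> L2 \<Omega>" and lim: "(\<lambda>n. L2_norm \<Omega> (\<lambda>x. u n x - p x)) \<longlonglongrightarrow> 0"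
    using L2_complete[OF uL Cauchy] .
  show thesis
  proof (rule that[OF p])
    fix e :: real assume "e > 0"
    then have "eventually (\<lambda>n. L2_norm \<Omega> (\<lambda>x. u n x - p x) < e) sequentially"
      using order_tendstoD(2)[OF lim] by auto
    then obtain n where "L2_norm \<Omega> (\<lambda>x. u n x - p x) < e"
      by (auto simp: eventually_sequentially)
    then show "\<exists>u\<in>V. L2_norm \<Omega> (\<lambda>x. p x - u x) < e"
      using uV by (intro bexI[of _ "u n"]) (simp_all add: L2_norm_minus_commute[of \<Omega> p])
  next
    fix v assume v: "v \<in> V"
    have vL: "v \<in> L2 \<Omega>" using v VL by blast
    define c where "c n = L2_inner \<Omega> (\<lambda>x. f x - u n x) v" for n
    have z: "(\<lambda>n. L2_norm \<Omega> (\<lambda>x. u n x - p x) * L2_norm \<Omega> v) \<longlonglongrightarrow> 0"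
      by (rule tendsto_mult_left_zero[OF lim])
    have bd: "norm (c n - L2_inner \<Omega> (\<lambda>x. f x - p x) v) \<le> L2_norm \<Omega> (\<lambda>x. u n x - p x) * L2_norm \<Omega> v" for n
    proof -
      have "c n - L2_inner \<Omega> (\<lambda>x. f x - p x) v = - L2_inner \<Omega> (\<lambda>x. u n x - p x) v"
        using f p vL uL by (simp add: c_def L2_inner_diff_left)
      then show ?thesis using L2_Cauchy_Schwarz[OF L2_diff[OF uL p] vL, of n] by simp
    qed
    have "(\<lambda>n. c n - L2_inner \<Omega> (\<lambda>x. f x - p x) v) \<longlonglongrightarrow> 0"
      by (rule Lim_null_comparison[OF _ z]) (simp add: bd del: real_norm_def)
    then have clim: "c \<longlonglongrightarrow> L2_inner \<Omega> (\<lambda>x. f x - p x) v" by (simp add: LIM_zero_iff)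
    \<comment> \<open>\<open>p\<close> itself need not lie in \<open>V\<close>, so the
      near-minimiser \<open>u n\<close> is perturbed by \<open>t *\<^sub>R v\<close> instead; the
      excess \<open>1 / Suc n\<close> over the infimum disappears in the limit.\<close>
    show "L2_inner \<Omega> (\<lambda>x. f x - p x) v = 0"
    proof (rule quadratic_nonneg_imp_coefficient_zero)
      fix t :: real
      have "- (1 / Suc n) \<le> t\<^sup>2 * (L2_norm \<Omega> v)\<^sup>2 - 2 * t * c n" for n
      proof -
        have "d \<le> (L2_norm \<Omega> (\<lambda>x. f x - (u n x + t *\<^sub>R v x)))\<^sup>2" by (intro dle Vadd Vsc uV v)
        also have "\<dots> = (L2_norm \<Omega> (\<lambda>x. (f x - u n x) - t *\<^sub>R v x))\<^sup>2" by (simp add: algebra_simps)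
        also have "\<dots> = (L2_norm \<Omega> (\<lambda>x. f x - u n x))\<^sup>2 - 2 * t * c n + t\<^sup>2 * (L2_norm \<Omega> v)\<^sup>2"
          unfolding c_def by (intro L2_norm_sq_diff_scaleR L2_diff f uL vL)
        finally show ?thesis using ud[of n] by linarith
      qed
      moreover have "(\<lambda>n. - (1 / real (Suc n))) \<longlonglongrightarrow> - 0"
        by (intro tendsto_minus LIMSEQ_Suc[OF lim_1_over_n])
      moreover have "(\<lambda>n. t\<^sup>2 * (L2_norm \<Omega> v)\<^sup>2 - 2 * t * c n) \<longlonglongrightarrow> t\<^sup>2 * (L2_norm \<Omega> v)\<^sup>2 - 2 * t * L2_inner \<Omega> (\<lambda>x. f x - p x) v"
        by (intro tendsto_intros clim)
      ultimately show "0 \<le> t\<^sup>2 * (L2_norm \<Omega> v)\<^sup>2 - 2 * t * L2_inner \<Omega> (\<lambda>x. f x - p x) v"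
        using LIMSEQ_le[of "\<lambda>n. - (1 / real (Suc n))" "-0"] by fastforce
    qed
  qed
qed

section \<open>Smooth functions\<close>

lemma C_k_SucI:
  assumes "\<And>x. (f has_derivative f' x) (at x)" "\<And>v. C_k k (\<lambda>x. f' x v)"
  shows "C_k (Suc k) f"
proof -
  have "frechet_derivative f (at x) = f' x" for x
    using frechet_derivative_at[OF assms(1)] by simp
  then show ?thesis using assms by (auto simp: differentiable_def)
qed

lemma C_k_has_derivative:
  "C_k (Suc k) f \<Longrightarrow> (f has_derivative frechet_derivative f (at x)) (at x)"
  by (simp add: frechet_derivative_works[symmetric])

lemma C_k_continuous: "C_k k f \<Longrightarrow> continuous_on UNIV f"
  by (cases k) (auto simp: continuous_on_eq_continuous_within intro: differentiable_imp_continuous_within)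

lemma C_k_Suc_imp: "C_k (Suc k) f \<Longrightarrow> C_k k f"
proof (induction k arbitrary: f)
  case 0
  then show ?case using C_k_continuous by fastforce
next
  case (Suc k)
  then show ?case by (metis C_k.simps(2))
qed

lemma C_k_const: "C_k k (\<lambda>x. c)"
proof (induction k arbitrary: c)
  case (Suc k)
  show ?case by (rule C_k_SucI[OF has_derivative_const]) (rule Suc)
qed simp

lemma C_k_linear: "bounded_linear L \<Longrightarrow> C_k k L"
  by (cases k) (simp_all only: C_k.simps(1) linear_continuous_on
      C_k_SucI[of L "\<lambda>x. L", OF bounded_linear_imp_has_derivative C_k_const])

lemma C_k_add: "C_k k f \<Longrightarrow> C_k k g \<Longrightarrow> C_k k (\<lambda>x. f x + g x)"
proof (induction k arbitrary: f g)
  case 0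
  then show ?case by (auto intro: continuous_on_add)
next
  case (Suc k)
  show ?case
    by (rule C_k_SucI[OF has_derivative_add[OF C_k_has_derivative[OF Suc.prems(1)] C_k_has_derivative[OF Suc.prems(2)]]])
      (use Suc in auto)
qed

text \<open>The product rule yields two products of the same shape, each with one factor
  differentiated, so the induction has to vary both functions.\<close>

lemma C_k_bounded_bilinear:
  assumes "bounded_bilinear B"
  shows "C_k k f \<Longrightarrow> C_k k g \<Longrightarrow> C_k k (\<lambda>x. B (f x) (g x))"
proof (induction k arbitrary: f g)
  case 0
  then show ?case using bounded_bilinear.continuous_on[OF assms] by auto
next
  case (Suc k)
  have fg: "C_k k f" "C_k k g" using Suc.prems C_k_Suc_imp by blast+
  show ?case
    by (rule C_k_SucI[OF bounded_bilinear.FDERIV[OF assms C_k_has_derivative[OF Suc.prems(1)] C_k_has_derivative[OF Suc.prems(2)]]])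
      (use Suc fg in \<open>auto intro!: C_k_add\<close>)
qed

lemmas C_k_scaleR = C_k_bounded_bilinear[OF bounded_bilinear_scaleR]
lemmas C_k_mult = C_k_bounded_bilinear[OF bounded_bilinear_mult]
lemmas C_k_inner = C_k_bounded_bilinear[OF bounded_bilinear_inner]

lemma C_k_bounded_linear_comp: "C_k k f \<Longrightarrow> bounded_linear L \<Longrightarrow> C_k k (\<lambda>x. L (f x))"
proof (induction k arbitrary: f)
  case 0
  then show ?case using bounded_linear.continuous_on by fastforce
next
  case (Suc k)
  show ?case
    by (rule C_k_SucI[OF bounded_linear.has_derivative[OF Suc.prems(2) C_k_has_derivative[OF Suc.prems(1)]]])
      (use Suc in auto)
qed

lemma C_k_affine: "C_k k f \<Longrightarrow> C_k k (\<lambda>x. f (a + c *\<^sub>R x))"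
proof (induction k arbitrary: f)
  case 0
  then show ?case by (auto intro!: continuous_on_compose2[of UNIV f] continuous_intros)
next
  case (Suc k)
  have lin: "((\<lambda>x. a + c *\<^sub>R x) has_derivative (\<lambda>v. c *\<^sub>R v)) (at x)" for x
    by (auto intro!: derivative_eq_intros)
  have "((\<lambda>x. f (a + c *\<^sub>R x)) has_derivative (\<lambda>v. frechet_derivative f (at (a + c *\<^sub>R x)) (c *\<^sub>R v))) (at x)" for x
    by (rule has_derivative_compose[OF lin C_k_has_derivative[OF Suc.prems]])
  then show ?case by (rule C_k_SucI) (use Suc in auto)
qed

lemma smoothD: "smooth f \<Longrightarrow> C_k k f"
  by (simp add: smooth_def)

lemma smooth_const: "smooth (\<lambda>x. c)"
  by (simp add: smooth_def C_k_const)

lemma smooth_add: "smooth f \<Longrightarrow> smooth g \<Longrightarrow> smooth (\<lambda>x. f x + g x)"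
  by (simp add: smooth_def C_k_add)

lemma smooth_scaleR: "smooth f \<Longrightarrow> smooth g \<Longrightarrow> smooth (\<lambda>x. f x *\<^sub>R g x)"
  by (simp add: smooth_def C_k_scaleR)

lemma smooth_bounded_linear_comp: "smooth f \<Longrightarrow> bounded_linear L \<Longrightarrow> smooth (\<lambda>x. L (f x))"
  by (simp add: smooth_def C_k_bounded_linear_comp)

lemma smooth_affine: "smooth f \<Longrightarrow> smooth (\<lambda>x. f (a + c *\<^sub>R x))"
  by (simp add: smooth_def C_k_affine)

lemma smooth_uminus: "smooth f \<Longrightarrow> smooth (\<lambda>x. - f x)"
  using smooth_bounded_linear_comp[of f uminus] by (simp add: bounded_linear_minus bounded_linear_ident)

lemma smooth_diff: "smooth f \<Longrightarrow> smooth g \<Longrightarrow> smooth (\<lambda>x. f x - g x)"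
  using smooth_add[of f "\<lambda>x. - g x"] smooth_uminus[of g] by simp

lemma smooth_sum: "(\<And>i. i \<in> I \<Longrightarrow> smooth (f i)) \<Longrightarrow> smooth (\<lambda>x. \<Sum>i\<in>I. f i x)"
  by (induction I rule: infinite_finite_induct) (auto intro: smooth_const smooth_add)

lemma smooth_continuous: "smooth f \<Longrightarrow> continuous_on UNIV f"
  using C_k_continuous[of 0] smoothD by blast

lemma smooth_has_derivative: "smooth f \<Longrightarrow> (f has_derivative frechet_derivative f (at x)) (at x)"
  using C_k_has_derivative[of 0] smoothD by blast

lemma smooth_frechet_derivative: "smooth f \<Longrightarrow> smooth (\<lambda>x. frechet_derivative f (at x) v)"
  unfolding smooth_def by (metis C_k.simps(2))

definition pd :: "3 \<Rightarrow> (real^3 \<Rightarrow> 'b::real_normed_vector) \<Rightarrow> real^3 \<Rightarrow> 'b" where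
  "pd i u x = frechet_derivative u (at x) (axis i 1)"

lemma pd_eq: "(u has_derivative D) (at x) \<Longrightarrow> pd i u x = D (axis i 1)"
  unfolding pd_def using frechet_derivative_at by metis

lemma smooth_pd: "smooth f \<Longrightarrow> smooth (pd i f)"
  using smooth_frechet_derivative[of f "axis i 1"] by (simp add: pd_def[abs_def])

lemma pd_const [simp]: "pd i (\<lambda>x. c) x = 0"
  by (rule pd_eq[OF has_derivative_const])

lemma pd_add: "smooth f \<Longrightarrow> smooth g \<Longrightarrow> pd i (\<lambda>x. f x + g x) x = pd i f x + pd i g x"
  by (subst pd_eq[OF has_derivative_add[OF smooth_has_derivative smooth_has_derivative]]) (auto simp: pd_def)

lemma pd_diff: "smooth f \<Longrightarrow> smooth g \<Longrightarrow> pd i (\<lambda>x. f x - g x) x = pd i f x - pd i g x"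
  by (subst pd_eq[OF has_derivative_diff[OF smooth_has_derivative smooth_has_derivative]]) (auto simp: pd_def)

lemma pd_bounded_linear:
  "smooth f \<Longrightarrow> bounded_linear L \<Longrightarrow> pd i (\<lambda>x. L (f x)) x = L (pd i f x)"
  by (subst pd_eq[OF bounded_linear.has_derivative[OF _ smooth_has_derivative]]) (auto simp: pd_def)

lemma pd_scaleR:
  "smooth f \<Longrightarrow> smooth g \<Longrightarrow> pd i (\<lambda>x. f x *\<^sub>R g x) x = f x *\<^sub>R pd i g x + pd i f x *\<^sub>R g x"
  by (subst pd_eq[OF bounded_bilinear.FDERIV[OF bounded_bilinear_scaleR smooth_has_derivative smooth_has_derivative]])
    (auto simp: pd_def)

lemma frechet_derivative_linear: "C_k (Suc 0) f \<Longrightarrow> linear (frechet_derivative f (at x))"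
  using C_k_has_derivative has_derivative_linear by blast

lemma frechet_derivative_outside_support:
  assumes "x \<notin> closure {y. u y \<noteq> 0}"
  shows "frechet_derivative u (at x) v = 0"
proof -
  have "(u has_derivative (\<lambda>v. 0)) (at x)"
  proof (rule has_derivative_transform_within_open)
    show "((\<lambda>x. 0) has_derivative (\<lambda>v. 0)) (at x)" by (rule has_derivative_const)
    show "open (- closure {y. u y \<noteq> 0})" by auto
    show "x \<in> - closure {y. u y \<noteq> 0}" using assms by auto
    fix y assume "y \<in> - closure {y. u y \<noteq> 0}"
    then show "0 = u y" using closure_subset[of "{y. u y \<noteq> 0}"] by auto
  qed
  then show ?thesis using frechet_derivative_at by metis
qed

subsection \<open>A smooth kernel\<close>

text \<open>Up to integer coefficients these are the terms that arise on differentiating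
  \<open>exp (-1/t)\<close>. With \<open>m\<close> as a parameter the family generates its own
  derivatives, which is all that smoothness needs.\<close>

definition flat :: "nat \<Rightarrow> real \<Rightarrow> real" where
  "flat m t = (if t \<le> 0 then 0 else exp (-1/t) / t^m)"

text \<open>With \<open>s = 1 / t\<close>, the term of order \<open>m + 2\<close> of the exponential
  series is at most \<open>exp s\<close>. The quadratic decay makes the derivative at the origin
  vanish.\<close>

lemma flat_bound: "\<bar>flat m t\<bar> \<le> fact (m+2) * t\<^sup>2"
proof (cases "t \<le> 0")
  case False
  define s where "s = 1 / t"
  have s: "s > 0" using False by (simp add: s_def)
  define F :: real where "F = fact (m+2)"
  have F: "F > 0" by (simp add: F_def)
  have "s^(m+2) /\<^sub>R F = (\<Sum>n\<in>{m+2}. s^n /\<^sub>R fact n)" by (simp add: F_def)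
  also have "\<dots> \<le> (\<Sum>n. s^n /\<^sub>R fact n)"
    using s by (intro sum_le_suminf summable_exp_generic) auto
  finally have "s^(m+2) / F \<le> exp s"
    by (simp add: exp_def divide_inverse mult.commute)
  then have "s^m * s\<^sup>2 * exp (-s) \<le> F" using F by (simp add: exp_minus field_simps power_add power2_eq_square)
  moreover have "s^m * s\<^sup>2 * exp (-s) = flat m t / t\<^sup>2"
    using False by (simp add: flat_def s_def field_simps)
  ultimately have "flat m t / t\<^sup>2 \<le> F" by simp
  then have "flat m t \<le> F * t\<^sup>2" using False by (simp add: pos_divide_le_eq)
  moreover have "flat m t \<ge> 0" using False by (simp add: flat_def)
  ultimately show ?thesis unfolding F_def by linarith
qed (simp add: flat_def)

text \<open>Away from the origin this is the quotient rule; at the origin the difference quotient is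
  squeezed by the quadratic bound.\<close>

lemma flat_has_derivative:
  "(flat m has_real_derivative (flat (m+2) t - m * flat (m+1) t)) (at t)"
proof -
  consider "t > 0" | "t < 0" | "t = 0" by linarith
  then show ?thesis
  proof cases
    case 1
    have "((\<lambda>t. exp (-1/t) / t^m) has_real_derivative (flat (m+2) t - m * flat (m+1) t)) (at t)"
    proof (rule DERIV_cong[OF DERIV_divide[OF _ DERIV_pow]])
      show "((\<lambda>t. exp (-1/t)) has_real_derivative exp (-1/t) / t\<^sup>2) (at t)"
        using 1 by (auto intro!: derivative_eq_intros simp: power2_eq_square)
      show "(exp (-1/t) / t\<^sup>2 * t^m - exp (-1/t) * (real m * t^(m - Suc 0))) / (t^m * t^m)
          = flat (m+2) t - m * flat (m+1) t"
        using 1 by (cases m) (auto simp: flat_def field_simps power2_eq_square)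
    qed (use 1 in simp)
    then show ?thesis
      by (rule has_field_derivative_transform_within_open[of _ _ _ "{0<..}"]) (use 1 in \<open>auto simp: flat_def\<close>)
  next
    case 2
    have "((\<lambda>t. 0) has_real_derivative (flat (m+2) t - m * flat (m+1) t)) (at t)"
      using 2 by (simp add: flat_def)
    then show ?thesis
      by (rule has_field_derivative_transform_within_open[of _ _ _ "{..<0}"]) (use 2 in \<open>auto simp: flat_def\<close>)
  next
    case 3
    have "(\<lambda>y. (flat m y - flat m 0) / (y - 0)) \<midarrow>0\<rightarrow> 0"
    proof (rule Lim_null_comparison)
      show "\<forall>\<^sub>F y in at 0. norm ((flat m y - flat m 0) / (y - 0)) \<le> fact (m+2) * \<bar>y\<bar>"
      proof (rule always_eventually, rule allI)
        fix y :: real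
        show "norm ((flat m y - flat m 0) / (y - 0)) \<le> fact (m+2) * \<bar>y\<bar>"
          using flat_bound[of m y]
          by (cases "y = 0") (auto simp: flat_def[of m 0] divide_le_eq power2_eq_square abs_mult_self mult.assoc)
      qed
      have "((\<lambda>y::real. fact (m+2) * \<bar>y\<bar>) \<longlongrightarrow> fact (m+2) * \<bar>0\<bar>) (at 0)" by (intro tendsto_intros)
      then show "((\<lambda>y::real. fact (m+2) * \<bar>y\<bar>) \<longlongrightarrow> 0) (at 0)" by simp
    qed
    then show ?thesis using 3 by (simp add: has_field_derivative_iff flat_def)
  qed
qed

text \<open>The chain rule replaces \<open>flat m\<close> by \<open>flat (m+2)\<close> and
  \<open>flat (m+1)\<close>, so the induction on \<open>k\<close> has to run over all
  \<open>m\<close> at once.\<close>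

lemma C_k_flat_comp:
  assumes "\<And>k. C_k k p"
  shows "C_k k (\<lambda>x. flat m (p x))"
proof (induction k arbitrary: m)
  case 0
  have "continuous_on UNIV (flat m)"
    using flat_has_derivative by (auto intro!: continuous_at_imp_continuous_on DERIV_isCont)
  then show ?case using C_k_continuous[OF assms] by (auto intro: continuous_on_compose2)
next
  case (Suc k)
  have "((\<lambda>x. flat m (p x)) has_derivative
      (\<lambda>v. (flat (m+2) (p x) - m * flat (m+1) (p x)) * frechet_derivative p (at x) v)) (at x)" for x
    using has_derivative_compose[OF C_k_has_derivative[OF assms[of "Suc 0"]]
        flat_has_derivative[unfolded has_field_derivative_def]] by simp
  then show ?case
  proof (rule C_k_SucI)
    fix v
    have "C_k k (\<lambda>x. flat (m+2) (p x) + (- real m) * flat (m+1) (p x))"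
      by (intro C_k_add C_k_mult C_k_const Suc)
    moreover have "C_k k (\<lambda>x. frechet_derivative p (at x) v)" using assms[of "Suc k"] by simp
    ultimately show "C_k k (\<lambda>x. (flat (m+2) (p x) - m * flat (m+1) (p x)) * frechet_derivative p (at x) v)"
      using C_k_mult[of k "\<lambda>x. flat (m+2) (p x) + (- real m) * flat (m+1) (p x)"] by simp
  qed
qed

text \<open>The squared norm is a polynomial, so the argument of \<open>flat\<close> is smooth also
  at the origin; it is positive exactly on the open unit ball.\<close>

definition bump :: "real^3 \<Rightarrow> real" where
  "bump x = flat 0 (1 - x \<bullet> x)"

lemma smooth_bump: "smooth bump"
proof -
  have "C_k k (\<lambda>x::real^3. 1 - x \<bullet> x)" for k
  proof -
    have "C_k k (\<lambda>x::real^3. 1 + (-1) * (x \<bullet> x))"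
      by (intro C_k_add C_k_mult C_k_const C_k_inner C_k_linear bounded_linear_ident)
    then show ?thesis by simp
  qed
  then show ?thesis unfolding smooth_def bump_def[abs_def] by (auto intro: C_k_flat_comp)
qed

lemma bump_nonneg: "0 \<le> bump x"
  by (simp add: bump_def flat_def)

lemma bump_neq_0_iff: "bump x \<noteq> 0 \<longleftrightarrow> norm x < 1"
  using abs_square_less_1[of "norm x"] by (auto simp: bump_def flat_def not_le power2_norm_eq_inner[symmetric])

section \<open>Integrals of compactly supported functions and affine substitutions\<close>

lemma integrable_continuous_bounded_support:
  fixes f :: "'a::euclidean_space \<Rightarrow> 'b::euclidean_space"
  assumes "continuous_on UNIV f" "bounded {x. f x \<noteq> 0}"
  shows "integrable lborel f"
proof -
  have "integrable lborel (\<lambda>x. indicator (closure {x. f x \<noteq> 0}) x *\<^sub>R f x)"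
    using assms by (intro borel_integrable_compact) (auto intro: continuous_on_subset)
  moreover have "(\<lambda>x. indicator (closure {x. f x \<noteq> 0}) x *\<^sub>R f x) = f"
    using closure_subset[of "{x. f x \<noteq> 0}"] by (auto simp: fun_eq_iff indicator_def)
  ultimately show ?thesis by simp
qed

lemma bounded_image_bounded_support:
  fixes f :: "'a::euclidean_space \<Rightarrow> 'b::euclidean_space"
  assumes "continuous_on UNIV f" "bounded {x. f x \<noteq> 0}"
  obtains B where "B > 0" "\<And>x. norm (f x) \<le> B"
proof -
  have "compact (f ` closure {x. f x \<noteq> 0})"
    using assms by (intro compact_continuous_image) (auto intro: continuous_on_subset)
  then obtain B where B: "B > 0" "\<And>x. x \<in> closure {x. f x \<noteq> 0} \<Longrightarrow> norm (f x) \<le> B"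
    using compact_imp_bounded bounded_pos by (metis imageI)
  have "norm (f x) \<le> B" for x
    using B closure_subset[of "{x. f x \<noteq> 0}"] by (cases "f x = 0") auto
  then show thesis using that B by blast
qed

lemma lborel_integral_translate:
  fixes f :: "'a::euclidean_space \<Rightarrow> 'b::{banach,second_countable_topology}"
  assumes "f \<in> borel_measurable borel"
  shows "(\<integral>x. f (a + x) \<partial>lborel) = (\<integral>x. f x \<partial>lborel)"
proof -
  have "(\<integral>x. f x \<partial>lborel) = (\<integral>x. f x \<partial>distr lborel borel ((+) a))" by (simp add: lborel_distr_plus)
  also have "\<dots> = (\<integral>x. f (a + x) \<partial>lborel)" using assms by (intro integral_distr) auto
  finally show ?thesis by simp
qed

lemma lborel_integrable_translate:
  fixes f :: "'a::euclidean_space \<Rightarrow> 'b::{banach,second_countable_topology}"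
  assumes "integrable lborel f"
  shows "integrable lborel (\<lambda>x. f (a + x))"
  by (rule integrable_distr[of "(+) a" lborel borel]) (simp_all add: lborel_distr_plus assms)

lemma lborel_integral_affine:
  fixes f :: "'a::euclidean_space \<Rightarrow> 'b::{banach,second_countable_topology}"
  assumes "f \<in> borel_measurable borel" "c \<noteq> 0"
  shows "(\<integral>x. f x \<partial>lborel) = \<bar>c\<bar> ^ DIM('a) *\<^sub>R (\<integral>x. f (a + c *\<^sub>R x) \<partial>lborel)"
proof -
  have "(\<integral>x. f x \<partial>lborel) = (\<integral>x. f x \<partial>density (distr lborel borel (\<lambda>x. a + c *\<^sub>R x)) (\<lambda>_. \<bar>c\<bar>^DIM('a)))"
    using lborel_affine[OF assms(2), of a] by simp
  also have "\<dots> = (\<integral>x. \<bar>c\<bar>^DIM('a) *\<^sub>R f x \<partial>distr lborel borel (\<lambda>x. a + c *\<^sub>R x))"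
    using assms by (subst integral_density) auto
  also have "\<dots> = (\<integral>x. \<bar>c\<bar>^DIM('a) *\<^sub>R f (a + c *\<^sub>R x) \<partial>lborel)"
    using assms by (intro integral_distr) auto
  finally show ?thesis by simp
qed

lemma bump_integral_pos: "0 < (\<integral>x. bump x \<partial>lborel)"
proof -
  have i: "integrable lborel bump"
    by (rule integrable_continuous_bounded_support[OF smooth_continuous[OF smooth_bump]])
      (simp add: bump_neq_0_iff, auto intro: bounded_subset[OF bounded_ball[of 0 1]])
  have "(\<integral>x. bump x \<partial>lborel) \<noteq> 0"
  proof
    assume "(\<integral>x. bump x \<partial>lborel) = 0"
    then have "AE x in lborel. bump x = 0"
      using integral_nonneg_eq_0_iff_AE[OF i] bump_nonneg by simp
    then have "AE x in lborel. x \<notin> ball (0::real^3) 1"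
      by eventually_elim (use bump_neq_0_iff in fastforce)
    then have "emeasure lborel (ball (0::real^3) 1) = 0"
      by (subst (asm) AE_iff_measurable[of "ball 0 1"]) auto
    then have "negligible (ball (0::real^3) 1)"
      by (auto simp: negligible_iff_null_sets null_sets_def)
    then show False using open_not_negligible[of "ball (0::real^3) 1"] by simp
  qed
  moreover have "0 \<le> (\<integral>x. bump x \<partial>lborel)" using bump_nonneg by simp
  ultimately show ?thesis by linarith
qed

text \<open>A mollifier whose centre \<open>a\<close> is free. Convolution with it averages over
  \<open>ball (x - a) r\<close>, hence translates by about \<open>a\<close>; this is how supports
  are moved away from, or across, the boundary.\<close>

definition kernel :: "(real^3 \<Rightarrow> real) \<Rightarrow> real^3 \<Rightarrow> real \<Rightarrow> bool" where
  "kernel \<rho> a r \<longleftrightarrow> smooth \<rho> \<and> (\<forall>x. 0 \<le> \<rho> x) \<and> (\<forall>x. \<rho> x \<noteq> 0 \<longrightarrow> x \<in> ball a r)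
     \<and> (\<integral>x. \<rho> x \<partial>lborel) = 1"

lemma bounded_support_frechet_derivative:
  assumes "bounded {x. u x \<noteq> 0}"
  shows "bounded {x. frechet_derivative u (at x) v \<noteq> 0}"
  using assms frechet_derivative_outside_support[of _ u v]
  by (intro bounded_subset[OF bounded_closure[OF assms]]) auto

lemma frechet_derivative_bound_bounded_support:
  fixes u :: "'a::euclidean_space \<Rightarrow> 'b::euclidean_space"
  assumes "smooth u" "bounded {x. u x \<noteq> 0}"
  obtains C where "C > 0" "\<And>x v. norm (frechet_derivative u (at x) v) \<le> C * norm v"
proof -
  have "\<exists>C>0. \<forall>x. norm (frechet_derivative u (at x) b) \<le> C" for b
    by (metis bounded_image_bounded_support smooth_continuous[OF smooth_frechet_derivative[OF assms(1)]]
        bounded_support_frechet_derivative[OF assms(2)])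
  then obtain C where C: "\<And>b. C b > 0" "\<And>b x. norm (frechet_derivative u (at x) b) \<le> C b" by metis
  have "norm (frechet_derivative u (at x) v) \<le> (\<Sum>b\<in>Basis. C b) * norm v" for x v
  proof -
    interpret linear "frechet_derivative u (at x)" by (rule frechet_derivative_linear[OF smoothD[OF assms(1)]])
    have "frechet_derivative u (at x) v = frechet_derivative u (at x) (\<Sum>b\<in>Basis. (v \<bullet> b) *\<^sub>R b)"
      by (simp add: euclidean_representation)
    also have "\<dots> = (\<Sum>b\<in>Basis. (v \<bullet> b) *\<^sub>R frechet_derivative u (at x) b)" by (simp add: sum scale)
    also have "norm \<dots> \<le> (\<Sum>b\<in>Basis. norm v * C b)"
      using C by (intro sum_norm_le) (auto intro!: mult_mono Basis_le_norm)
    also have "\<dots> = (\<Sum>b\<in>Basis. C b) * norm v" by (subst sum_distrib_right) (simp add: mult.commute)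
    finally show ?thesis .
  qed
  moreover have "(\<Sum>b\<in>Basis. C b) > 0" using C by (intro sum_pos) auto
  ultimately show thesis using that by blast
qed

text \<open>The kernel is \<open>bump\<close> rescaled to radius \<open>r\<close> and divided by
  \<open>r^3\<close> times its integral; differentiation costs one more factor \<open>r\<close>,
  whence \<open>r^4\<close>. The constant is the same for all centres and radii, on which the
  gradient bound for cutoffs relies.\<close>

lemma kernel_exists_bounded_derivative:
  obtains C where "C > 0"
    "\<And>a r. r > 0 \<Longrightarrow> \<exists>\<rho>. kernel \<rho> a r \<and> (\<forall>x v. norm (frechet_derivative \<rho> (at x) v) \<le> C / r^4 * norm v)"
proof -
  have "bounded {x. bump x \<noteq> 0}"
    unfolding bump_neq_0_iff by (auto intro: bounded_subset[OF bounded_ball[of 0 1]])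
  then obtain C where C: "C > 0" "\<And>x v. norm (frechet_derivative bump (at x) v) \<le> C * norm v"
    using frechet_derivative_bound_bounded_support[OF smooth_bump] by blast
  define I where "I = (\<integral>x. bump x \<partial>lborel)"
  have I: "I > 0" unfolding I_def by (rule bump_integral_pos)
  show thesis
  proof (rule that[of "C / I"])
    show "C / I > 0" using C I by simp
    fix a :: "real^3" and r :: real assume r: "r > 0"
    define \<rho> where "\<rho> x = (1 / (r^3 * I)) *\<^sub>R bump (- (1/r) *\<^sub>R a + (1/r) *\<^sub>R x)" for x
    have sm: "smooth \<rho>" unfolding \<rho>_def by (intro smooth_scaleR smooth_const smooth_affine smooth_bump)
    have meas: "bump \<in> borel_measurable borel"
      by (intro borel_measurable_continuous_onI smooth_continuous smooth_bump)
    have "I = (1/r)^3 * (\<integral>x. bump (- (1/r) *\<^sub>R a + (1/r) *\<^sub>R x) \<partial>lborel)"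
      unfolding I_def using lborel_integral_affine[OF meas, of "1/r" "- (1/r) *\<^sub>R a"] r by simp
    then have J: "(\<integral>x. bump (- (1/r) *\<^sub>R a + (1/r) *\<^sub>R x) \<partial>lborel) = r^3 * I"
      using r by (simp add: power_one_over divide_simps mult.commute)
    have int: "(\<integral>x. \<rho> x \<partial>lborel) = 1"
      unfolding \<rho>_def real_scaleR_def integral_mult_right_zero J using r I by simp
    have supp: "x \<in> ball a r" if "\<rho> x \<noteq> 0" for x
    proof -
      have "norm (- (1/r) *\<^sub>R a + (1/r) *\<^sub>R x) < 1" using that bump_neq_0_iff by (auto simp: \<rho>_def)
      moreover have eq: "- (1/r) *\<^sub>R a + (1/r) *\<^sub>R x = (1/r) *\<^sub>R (x - a)" by (simp add: algebra_simps)
      ultimately have "norm (x - a) / r < 1" unfolding eq using r by simp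
      then show ?thesis using r by (simp add: dist_norm norm_minus_commute)
    qed
    have gen: "norm (k *\<^sub>R frechet_derivative bump (at y) w) \<le> k * (C * norm w)" if "k \<ge> 0" for k y w
      using that C(2)[of y w] by (simp add: abs_mult mult_left_mono)
    have der: "norm (frechet_derivative \<rho> (at x) v) \<le> C / I / r^4 * norm v" for x v
    proof -
      have "(\<rho> has_derivative (\<lambda>v. (1 / (r^3 * I)) *\<^sub>R frechet_derivative bump (at (- (1/r) *\<^sub>R a + (1/r) *\<^sub>R x)) ((1/r) *\<^sub>R v))) (at x)"
        unfolding \<rho>_def
        by (intro has_derivative_scaleR_right has_derivative_compose[OF _ smooth_has_derivative[OF smooth_bump]])
          (auto intro!: derivative_eq_intros)
      then have "frechet_derivative \<rho> (at x) v = (1 / (r^3 * I)) *\<^sub>R frechet_derivative bump (at (- (1/r) *\<^sub>R a + (1/r) *\<^sub>R x)) ((1/r) *\<^sub>R v)"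
        using frechet_derivative_at by metis
      also have "norm \<dots> \<le> (1 / (r^3 * I)) * (C * norm ((1/r) *\<^sub>R v))"
        by (rule gen) (use r I in simp)
      also have "\<dots> = C / I / r^4 * norm v" using r I by (simp add: field_simps eval_nat_numeral)
      finally show ?thesis .
    qed
    show "\<exists>\<rho>. kernel \<rho> a r \<and> (\<forall>x v. norm (frechet_derivative \<rho> (at x) v) \<le> C / I / r^4 * norm v)"
      using sm int supp der r I bump_nonneg by (intro exI[of _ \<rho>]) (auto simp: kernel_def \<rho>_def)
  qed
qed

lemma kernel_exists:
  assumes "r > 0"
  obtains \<rho> where "kernel \<rho> a r"
  using kernel_exists_bounded_derivative assms by metis

subsection \<open>Uniform differentiability and integration by parts\<close>

text \<open>Each directional derivative is continuous with bounded support, hence uniformly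
  continuous, and the mean value inequality turns this into a remainder estimate uniform in
  \<open>x\<close>. The uniformity is what allows first-order expansions to be compared under an
  integral.\<close>

lemma C1_uniformly_differentiable:
  fixes u :: "'a::euclidean_space \<Rightarrow> 'b::euclidean_space"
  assumes u: "C_k (Suc 0) u" "bounded {x. u x \<noteq> 0}" and e: "e > 0"
  obtains d where "d > 0"
    "\<And>x h. norm h < d \<Longrightarrow> norm (u (x + h) - u x - frechet_derivative u (at x) h) \<le> e * norm h"
proof -
  \<comment> \<open>The operator norm is estimated by a sum over the basis, which costs a factor
    \<open>DIM('a)\<close>.\<close>
  define e' where "e' = e / real DIM('a)"
  have e': "e' > 0" using e by (simp add: e'_def)
  have "\<exists>d>0. \<forall>x y. dist y x < d \<longrightarrow> dist (frechet_derivative u (at y) b) (frechet_derivative u (at x) b) < e'" for b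
  proof -
    let ?f = "\<lambda>x. frechet_derivative u (at x) b"
    have c: "continuous_on UNIV ?f" using u(1) by simp
    have bs: "bounded {x. ?f x \<noteq> 0}" by (intro bounded_support_frechet_derivative u)
    then obtain R where R: "\<And>x. ?f x \<noteq> 0 \<Longrightarrow> norm x \<le> R" unfolding bounded_iff by auto
    \<comment> \<open>The extra unit keeps both points in the compact ball when they are closer than
      1 and the derivative is nonzero at one of them.\<close>
    have "uniformly_continuous_on (cball 0 (R+1)) ?f"
      by (intro compact_uniformly_continuous continuous_on_subset[OF c]) auto
    then obtain d where d: "d > 0" "\<And>x y. x \<in> cball 0 (R+1) \<Longrightarrow> y \<in> cball 0 (R+1) \<Longrightarrow> dist y x < d \<Longrightarrow> dist (?f y) (?f x) < e'"
      unfolding uniformly_continuous_on_def using e' by blast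
    have "dist (?f y) (?f x) < e'" if "dist y x < min d 1" for x y
    proof (cases "?f x = 0 \<and> ?f y = 0")
      case True
      then show ?thesis using e' by simp
    next
      case False
      then have "norm x \<le> R + 1" "norm y \<le> R + 1"
        using R[of x] R[of y] that norm_triangle_ineq2[of x y] norm_triangle_ineq2[of y x]
        by (auto simp: dist_norm norm_minus_commute)
      then show ?thesis using d that by (auto simp: dist_norm)
    qed
    then show ?thesis using d by (intro exI[of _ "min d 1"]) auto
  qed
  then obtain d where d: "\<And>b. d b > 0"
    "\<And>b x y. dist y x < d b \<Longrightarrow> dist (frechet_derivative u (at y) b) (frechet_derivative u (at x) b) < e'" by metis
  define \<delta> where "\<delta> = Min (d ` Basis)"
  have \<delta>: "\<delta> > 0" "\<And>b. b \<in> Basis \<Longrightarrow> \<delta> \<le> d b" unfolding \<delta>_def using d(1) by auto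
  show thesis
  proof (rule that[OF \<delta>(1)])
    fix x h :: 'a assume h: "norm h < \<delta>"
    have "norm (u (x + h) - u x - frechet_derivative u (at x) (x + h - x)) \<le> norm (x + h - x) * e"
    proof (rule differentiable_bound_linearization[of x "x + h" "ball x \<delta>" u "\<lambda>y. frechet_derivative u (at y)" x e])
      fix t :: real assume "t \<in> {0..1}"
      then have "norm (t *\<^sub>R h) \<le> norm h" by (auto intro: mult_left_le_one_le)
      then show "x + t *\<^sub>R (x + h - x) \<in> ball x \<delta>" using h by (simp add: dist_norm)
    next
      fix y
      show "(u has_derivative frechet_derivative u (at y)) (at y within ball x \<delta>)"
        using C_k_has_derivative[OF u(1)] has_derivative_at_withinI by blast
    next
      fix y assume y: "y \<in> ball x \<delta>"
      show "onorm (frechet_derivative u (at y) - frechet_derivative u (at x)) \<le> e"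
      proof (rule onorm_le)
        fix v
        let ?D = "\<lambda>v. frechet_derivative u (at y) v - frechet_derivative u (at x) v"
        interpret linear ?D by (intro linear_compose_sub frechet_derivative_linear u)
        have "?D v = ?D (\<Sum>b\<in>Basis. (v \<bullet> b) *\<^sub>R b)" by (simp add: euclidean_representation)
        also have "\<dots> = (\<Sum>b\<in>Basis. (v \<bullet> b) *\<^sub>R ?D b)" by (simp only: sum scale)
        also have "norm \<dots> \<le> (\<Sum>b\<in>(Basis::'a set). norm v * e')"
        proof (rule sum_norm_le)
          fix b :: 'a assume b: "b \<in> Basis"
          have "dist y x < d b" using y \<delta>(2)[OF b] by (simp add: dist_commute)
          then have "norm (?D b) \<le> e'" using d(2)[of y x b] by (simp add: dist_norm)
          then show "norm ((v \<bullet> b) *\<^sub>R ?D b) \<le> norm v * e'"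
            using b by (auto intro!: mult_mono Basis_le_norm)
        qed
        also have "\<dots> = e * norm v" by (simp add: e'_def)
        finally show "norm ((frechet_derivative u (at y) - frechet_derivative u (at x)) v) \<le> e * norm v"
          by (simp add: fun_diff_def)
      qed
    qed (use \<delta> in auto)
    then show "norm (u (x + h) - u x - frechet_derivative u (at x) h) \<le> e * norm h"
      by (simp add: mult.commute)
  qed
qed

text \<open>By translation invariance \<open>u (x + t v) - u x\<close> has integral zero, so up to
  sign \<open>t\<close> times the integral of the derivative is the integral of a first-order
  remainder. That remainder is \<open>o(t)\<close> uniformly and lives in a fixed ball. This gives
  integration by parts without iterated integrals.\<close>

lemma integral_frechet_derivative_eq_0:
  fixes u :: "'a::euclidean_space \<Rightarrow> 'b::euclidean_space"
  assumes u: "C_k (Suc 0) u" "bounded {x. u x \<noteq> 0}"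
  shows "(\<integral>x. frechet_derivative u (at x) v \<partial>lborel) = 0"
proof -
  define K where "K = (\<integral>x. frechet_derivative u (at x) v \<partial>lborel)"
  obtain R where R: "\<And>x. u x \<noteq> 0 \<Longrightarrow> norm x \<le> R" using u(2) unfolding bounded_iff by auto
  \<comment> \<open>For steps of length at most \<open>norm v\<close> this ball contains the
    supports of \<open>u\<close>, of its translates and of its derivative.\<close>
  define S where "S = cball (0::'a) (R + norm v)"
  have Dsupp: "x \<in> S" if "frechet_derivative u (at x) w \<noteq> 0" for x w
  proof -
    have "x \<in> closure {y. u y \<noteq> 0}" using that frechet_derivative_outside_support[of x u w] by blast
    also have "\<dots> \<subseteq> cball 0 R" by (rule closure_minimal) (auto dest: R)
    finally show ?thesis by (simp add: S_def add_increasing2)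
  qed
  have iu: "integrable lborel u" by (rule integrable_continuous_bounded_support[OF C_k_continuous[OF u(1)] u(2)])
  have mu: "u \<in> borel_measurable borel" using iu by auto
  have iD: "integrable lborel (\<lambda>x. frechet_derivative u (at x) v)"
    using u by (intro integrable_continuous_bounded_support bounded_support_frechet_derivative) auto
  have est: "norm K \<le> e * (norm v * measure lborel S)" if e: "e > 0" for e
  proof -
    obtain d where d: "d > 0"
      "\<And>x h. norm h < d \<Longrightarrow> norm (u (x + h) - u x - frechet_derivative u (at x) h) \<le> e * norm h"
      using C1_uniformly_differentiable[OF u e] by blast
    \<comment> \<open>Small enough for \<open>norm (t *\<^sub>R v) < d\<close>; the summand 1 in the
      denominator covers \<open>v = 0\<close>.\<close>
    define t where "t = min 1 (d / (2 * (norm v + 1)))"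
    have nv: "norm v + 1 > 0" by (simp add: add_nonneg_pos)
    then have t: "0 < t" "t \<le> 1" using d(1) by (auto simp: t_def)
    have "t * norm v \<le> d / (2 * (norm v + 1)) * norm v" by (intro mult_right_mono) (auto simp: t_def)
    also have "\<dots> = (d / 2) * (norm v / (norm v + 1))" by (simp add: field_simps)
    also have "\<dots> \<le> d / 2 * 1" using d(1) nv by (intro mult_left_mono) (auto simp: divide_le_eq_1)
    also have "\<dots> < d" using d(1) by simp
    finally have td: "norm (t *\<^sub>R v) < d" using t by simp
    define g where "g x = u (t *\<^sub>R v + x) - u x - frechet_derivative u (at x) (t *\<^sub>R v)" for x
    have gb: "norm (g x) \<le> e * (t * norm v)" for x
      using d(2)[OF td, of x] t by (simp add: g_def add.commute)
    have g0: "g x = 0" if "x \<notin> S" for x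
    proof -
      have "norm x > R + norm v" using that by (simp add: S_def)
      moreover have "norm (t *\<^sub>R v) \<le> norm v" using t by (auto intro: mult_left_le_one_le)
      moreover have "norm (t *\<^sub>R v + x) \<ge> norm x - norm (t *\<^sub>R v)"
        by (metis add.commute norm_diff_ineq)
      ultimately have "\<not> norm x \<le> R" "\<not> norm (t *\<^sub>R v + x) \<le> R" by (auto, smt (verit) norm_ge_zero)
      then have "u x = 0" "u (t *\<^sub>R v + x) = 0" using R by blast+
      moreover have "frechet_derivative u (at x) (t *\<^sub>R v) = 0" using Dsupp that by blast
      ultimately show ?thesis by (simp add: g_def)
    qed
    have lin: "frechet_derivative u (at x) (t *\<^sub>R v) = t *\<^sub>R frechet_derivative u (at x) v" for x
      using linear_scale[OF frechet_derivative_linear[OF u(1)]] by blast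
    have it: "integrable lborel (\<lambda>x. u (t *\<^sub>R v + x))"
      by (rule lborel_integrable_translate[OF iu])
    have "(\<integral>x. g x \<partial>lborel) = - (t *\<^sub>R K)"
      unfolding g_def lin K_def using it iu iD lborel_integral_translate[OF mu, of "t *\<^sub>R v"] by simp
    then have "t * norm K = norm (\<integral>x. g x \<partial>lborel)" using t by simp
    also have "\<dots> \<le> (\<integral>x. norm (g x) \<partial>lborel)" by simp
    also have "\<dots> \<le> (\<integral>x. e * (t * norm v) * indicator S x \<partial>lborel)"
    proof (rule integral_mono)
      show "integrable lborel (\<lambda>x. norm (g x))" unfolding g_def lin using it iu iD by auto
      show "integrable lborel (\<lambda>x. e * (t * norm v) * indicator S x)"
        unfolding S_def by (intro integrable_mult_right integrable_real_indicator) (simp_all add: emeasure_lborel_cball_finite[unfolded infinity_ennreal_def])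
      show "norm (g x) \<le> e * (t * norm v) * indicator S x" for x
        using gb[of x] g0[of x] by (cases "x \<in> S") auto
    qed
    also have "\<dots> = t * (e * (norm v * measure lborel S))" by simp
    finally show ?thesis using t by (simp add: mult_le_cancel_left)
  qed
  have "norm K \<le> 0 + e" if "e > 0" for e
  proof -
    define m where "m = norm v * measure lborel S"
    have m: "m \<ge> 0" by (simp add: m_def)
    have "norm K \<le> e / (m + 1) * m" unfolding m_def by (rule est) (use that m in \<open>simp add: m_def[symmetric]\<close>)
    also have "\<dots> \<le> e" using that m by (simp add: field_simps)
    finally show ?thesis by simp
  qed
  then have "norm K \<le> 0" by (rule field_le_epsilon)
  then show ?thesis by (simp add: K_def)
qed

section \<open>Mollification\<close>

definition conv :: "(real^3 \<Rightarrow> real) \<Rightarrow> (real^3 \<Rightarrow> 'b::euclidean_space) \<Rightarrow> real^3 \<Rightarrow> 'b" where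
  "conv \<rho> f x = (\<integral>y. \<rho> (x - y) *\<^sub>R f y \<partial>lborel)"

lemma conv_integrable:
  fixes f :: "real^3 \<Rightarrow> 'b::euclidean_space"
  assumes "continuous_on UNIV \<rho>" "bounded {x. \<rho> x \<noteq> 0}" "integrable lborel f"
  shows "integrable lborel (\<lambda>y. \<rho> (x - y) *\<^sub>R f y)"
proof -
  obtain B where B: "B > 0" "\<And>x. norm (\<rho> x) \<le> B"
    using bounded_image_bounded_support[OF assms(1,2)] by blast
  have [measurable]: "\<rho> \<in> borel_measurable borel" by (rule borel_measurable_continuous_onI[OF assms(1)])
  have [measurable]: "f \<in> borel_measurable borel" using assms(3) by auto
  show ?thesis
  proof (rule Bochner_Integration.integrable_bound)
    show "integrable lborel (\<lambda>y. B *\<^sub>R f y)" using assms(3) by simp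
    show "(\<lambda>y. \<rho> (x - y) *\<^sub>R f y) \<in> borel_measurable lborel" by measurable
    show "AE y in lborel. norm (\<rho> (x - y) *\<^sub>R f y) \<le> norm (B *\<^sub>R f y)"
      using B by (auto intro!: mult_right_mono)
  qed
qed

text \<open>The increment falls on the kernel, whose remainder is uniformly small; multiplied by
  \<open>norm (f z)\<close> and integrated it stays small, so integrability of \<open>f\<close>
  suffices.\<close>

lemma conv_has_derivative:
  fixes f :: "real^3 \<Rightarrow> 'b::euclidean_space"
  assumes \<rho>: "smooth \<rho>" "bounded {x. \<rho> x \<noteq> 0}" and f: "integrable lborel f"
  shows "(conv \<rho> f has_derivative (\<lambda>v. conv (\<lambda>z. frechet_derivative \<rho> (at z) v) f x)) (at x)"
proof -
  let ?D = "\<lambda>v. conv (\<lambda>z. frechet_derivative \<rho> (at z) v) f x"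
  have C1: "C_k (Suc 0) \<rho>" by (rule smoothD[OF \<rho>(1)])
  have i1: "integrable lborel (\<lambda>y. \<rho> (x - y) *\<^sub>R f y)" for x
    by (rule conv_integrable[OF smooth_continuous[OF \<rho>(1)] \<rho>(2) f])
  have i2: "integrable lborel (\<lambda>y. frechet_derivative \<rho> (at (x - y)) v *\<^sub>R f y)" for x v
    by (rule conv_integrable[where \<rho>="\<lambda>z. frechet_derivative \<rho> (at z) v"])
      (auto intro!: smooth_continuous smooth_frechet_derivative bounded_support_frechet_derivative \<rho> f)
  note lin = frechet_derivative_linear[OF C1]
  have "linear ?D"
    using i2 by (intro linearI)
      (simp_all add: conv_def linear_add[OF lin] linear_scale[OF lin] scaleR_add_left flip: scaleR_scaleR)
  then have bl: "bounded_linear ?D" by (simp add: linear_conv_bounded_linear)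
  have "\<exists>d>0. \<forall>y. norm (y - x) < d \<longrightarrow> norm (conv \<rho> f y - conv \<rho> f x - ?D (y - x)) \<le> e * norm (y - x)"
    if e: "e > 0" for e
  proof -
    define F where "F = (\<integral>y. norm (f y) \<partial>lborel)"
    have F: "F \<ge> 0" by (simp add: F_def)
    define e' where "e' = e / (F + 1)"
    have e': "e' > 0" using e F by (simp add: e'_def)
    obtain d where d: "d > 0"
      "\<And>x h. norm h < d \<Longrightarrow> norm (\<rho> (x + h) - \<rho> x - frechet_derivative \<rho> (at x) h) \<le> e' * norm h"
      using C1_uniformly_differentiable[OF C1 \<rho>(2) e'] by blast
    have "norm (conv \<rho> f y - conv \<rho> f x - ?D (y - x)) \<le> e * norm (y - x)" if y: "norm (y - x) < d" for y
    proof -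
      have "conv \<rho> f y - conv \<rho> f x - ?D (y - x)
        = (\<integral>z. (\<rho> (y - z) - \<rho> (x - z) - frechet_derivative \<rho> (at (x - z)) (y - x)) *\<^sub>R f z \<partial>lborel)"
        unfolding conv_def using i1 i2 by (simp add: scaleR_diff_left)
      also have "norm \<dots> \<le> (\<integral>z. norm ((\<rho> (y - z) - \<rho> (x - z) - frechet_derivative \<rho> (at (x - z)) (y - x)) *\<^sub>R f z) \<partial>lborel)"
        by (rule integral_norm_bound)
      also have "\<dots> \<le> (\<integral>z. e' * norm (y - x) * norm (f z) \<partial>lborel)"
      proof (rule integral_mono)
        show "integrable lborel (\<lambda>z. norm ((\<rho> (y - z) - \<rho> (x - z) - frechet_derivative \<rho> (at (x - z)) (y - x)) *\<^sub>R f z))"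
          unfolding scaleR_diff_left using i1 i2 by (intro integrable_norm Bochner_Integration.integrable_diff)
        show "integrable lborel (\<lambda>z. e' * norm (y - x) * norm (f z))" using f by simp
        fix z
        have "norm (\<rho> (y - z) - \<rho> (x - z) - frechet_derivative \<rho> (at (x - z)) (y - x)) \<le> e' * norm (y - x)"
          using d(2)[OF y, of "x - z"] by (simp add: algebra_simps)
        then show "norm ((\<rho> (y - z) - \<rho> (x - z) - frechet_derivative \<rho> (at (x - z)) (y - x)) *\<^sub>R f z) \<le> e' * norm (y - x) * norm (f z)"
          unfolding norm_scaleR by (intro mult_right_mono) auto
      qed
      also have "\<dots> = e' * F * norm (y - x)" by (simp add: F_def)
      also have "\<dots> \<le> e * norm (y - x)"
      proof (rule mult_right_mono)
        have "e' * F = e * (F / (F + 1))" by (simp add: e'_def)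
        also have "\<dots> \<le> e * 1" using e F by (intro mult_left_mono) auto
        finally show "e' * F \<le> e" by simp
      qed simp
      finally show ?thesis .
    qed
    then show ?thesis using d(1) by blast
  qed
  then show ?thesis unfolding has_derivative_at_alt using bl by blast
qed

lemma smooth_conv:
  fixes f :: "real^3 \<Rightarrow> 'b::euclidean_space"
  assumes "smooth \<rho>" "bounded {x. \<rho> x \<noteq> 0}" "integrable lborel f"
  shows "smooth (conv \<rho> f)"
proof -
  \<comment> \<open>Generalised over all smooth weights of bounded support, since a derivative of a
    mollifier has lost its sign and its normalisation.\<close>
  have "C_k k (conv \<rho> f)" if "smooth \<rho>" "bounded {x. \<rho> x \<noteq> 0}" for k \<rho>
    using that
  proof (induction k arbitrary: \<rho>)
    case 0
    then show ?case using conv_has_derivative[OF 0 assms(3)]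
      by (auto simp: continuous_on_eq_continuous_within intro: has_derivative_continuous)
  next
    case (Suc k)
    show ?case
      by (rule C_k_SucI[OF conv_has_derivative[OF Suc.prems assms(3)]])
        (intro Suc.IH smooth_frechet_derivative bounded_support_frechet_derivative Suc.prems)
  qed
  then show ?thesis using assms by (simp add: smooth_def)
qed

lemma pd_conv:
  fixes f :: "real^3 \<Rightarrow> 'b::euclidean_space"
  assumes "smooth \<rho>" "bounded {x. \<rho> x \<noteq> 0}" "integrable lborel f"
  shows "pd i (conv \<rho> f) x = conv (pd i \<rho>) f x"
  using pd_eq[OF conv_has_derivative[OF assms], of i x] by (simp add: pd_def[abs_def])

lemma kernelD:
  assumes "kernel \<rho> a r"
  shows "smooth \<rho>" "\<And>x. 0 \<le> \<rho> x" "\<And>x. \<rho> x \<noteq> 0 \<Longrightarrow> x \<in> ball a r" "(\<integral>x. \<rho> x \<partial>lborel) = 1"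
    "bounded {x. \<rho> x \<noteq> 0}" "continuous_on UNIV \<rho>" "integrable lborel \<rho>" "\<rho> \<in> borel_measurable borel"
proof -
  show *: "smooth \<rho>" "\<And>x. 0 \<le> \<rho> x" "\<And>x. \<rho> x \<noteq> 0 \<Longrightarrow> x \<in> ball a r" "(\<integral>x. \<rho> x \<partial>lborel) = 1"
    using assms by (auto simp: kernel_def)
  show b: "bounded {x. \<rho> x \<noteq> 0}" using *(3) by (intro bounded_subset[OF bounded_ball[of a r]]) auto
  show c: "continuous_on UNIV \<rho>" by (rule smooth_continuous[OF *(1)])
  show "integrable lborel \<rho>" by (rule integrable_continuous_bounded_support[OF c b])
  then show "\<rho> \<in> borel_measurable borel" by auto
qed

lemma lborel_integral_reflect:
  fixes f :: "'a::euclidean_space \<Rightarrow> 'b::{banach,second_countable_topology}"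
  assumes "f \<in> borel_measurable borel"
  shows "(\<integral>s. f (x - s) \<partial>lborel) = (\<integral>y. f y \<partial>lborel)"
  using lborel_integral_affine[OF assms, of "-1" x] by simp

lemma conv_reflect:
  fixes f :: "real^3 \<Rightarrow> 'b::euclidean_space"
  assumes [measurable]: "\<rho> \<in> borel_measurable borel" "f \<in> borel_measurable borel"
  shows "conv \<rho> f x = (\<integral>s. \<rho> s *\<^sub>R f (x - s) \<partial>lborel)"
proof -
  have "(\<integral>s. (\<lambda>y. \<rho> (x - y) *\<^sub>R f y) (x - s) \<partial>lborel) = conv \<rho> f x"
    unfolding conv_def by (rule lborel_integral_reflect) measurable
  then show ?thesis by simp
qed

lemma conv_support:
  assumes "kernel \<rho> a r" "conv \<rho> f x \<noteq> 0"
  obtains y s where "f y \<noteq> 0" "s \<in> ball a r" "x = y + s"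
proof -
  have "\<exists>y. \<rho> (x - y) *\<^sub>R f y \<noteq> 0"
  proof (rule ccontr)
    assume "\<nexists>y. \<rho> (x - y) *\<^sub>R f y \<noteq> 0"
    then have "(\<lambda>y. \<rho> (x - y) *\<^sub>R f y) = (\<lambda>y. 0)" by auto
    then show False using assms(2) by (simp add: conv_def)
  qed
  then obtain y where "\<rho> (x - y) \<noteq> 0" "f y \<noteq> 0" by auto
  then show thesis using that[of y "x - y"] kernelD(3)[OF assms(1)] by simp
qed

text \<open>\<open>conv \<rho> f x - f x\<close> is the mean of \<open>f (x - s) - f x\<close> with
  respect to the probability density \<open>\<rho>\<close>. Cauchy-Schwarz bounds its square by the
  mean of the squares, and exchanging the integrals leaves a mean of quantities at most
  \<open>e\<close>.\<close>

lemma conv_diff_nn_integral: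
  fixes f :: "real^3 \<Rightarrow> 'b::euclidean_space"
  assumes \<rho>: "kernel \<rho> a r" and f: "integrable lborel f"
    and e: "\<And>s. s \<in> ball a r \<Longrightarrow> (\<integral>\<^sup>+x. ennreal ((norm (f (x - s) - f x))\<^sup>2) \<partial>lborel) \<le> e"
  shows "(\<integral>\<^sup>+x. ennreal ((norm (conv \<rho> f x - f x))\<^sup>2) \<partial>lborel) \<le> e"
proof -
  note k = kernelD[OF \<rho>]
  have [measurable]: "f \<in> borel_measurable borel" "\<rho> \<in> borel_measurable borel" using f k by auto
  have i: "integrable lborel (\<lambda>s. \<rho> s *\<^sub>R f (x - s))" for x
  proof -
    have "integrable lborel (\<lambda>s. (\<lambda>y. \<rho> (x - y) *\<^sub>R f y) (x + (-1) *\<^sub>R s))"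
    proof (rule integrable_distr[of "\<lambda>s. x + (-1) *\<^sub>R s" lborel borel "\<lambda>y. \<rho> (x - y) *\<^sub>R f y"])
      have "distr lborel borel (\<lambda>s. x + (-1) *\<^sub>R s) = lborel"
        using lborel_affine[of "-1" x] by (simp add: density_1)
      then show "integrable (distr lborel borel (\<lambda>s. x + (-1) *\<^sub>R s)) (\<lambda>y. \<rho> (x - y) *\<^sub>R f y)"
        using conv_integrable[OF k(6,5) f] by simp
    qed measurable
    then show ?thesis by simp
  qed
  have pt: "ennreal ((norm (conv \<rho> f x - f x))\<^sup>2) \<le> (\<integral>\<^sup>+s. ennreal (\<rho> s) * ennreal ((norm (f (x - s) - f x))\<^sup>2) \<partial>lborel)" for x
  proof -
    have i2: "integrable lborel (\<lambda>s. \<rho> s *\<^sub>R (f (x - s) - f x))"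
      unfolding scaleR_diff_right using i k(7) by (intro Bochner_Integration.integrable_diff) auto
    have "conv \<rho> f x - f x = (\<integral>s. \<rho> s *\<^sub>R f (x - s) \<partial>lborel) - (\<integral>s. \<rho> s *\<^sub>R f x \<partial>lborel)"
      using k by (simp add: conv_reflect)
    also have "\<dots> = (\<integral>s. \<rho> s *\<^sub>R (f (x - s) - f x) \<partial>lborel)"
      using i[of x] k(7) by (simp add: scaleR_diff_right)
    finally have eq: "conv \<rho> f x - f x = (\<integral>s. \<rho> s *\<^sub>R (f (x - s) - f x) \<partial>lborel)" .
    have "ennreal ((norm (conv \<rho> f x - f x))\<^sup>2) = (ennreal (norm (conv \<rho> f x - f x)))\<^sup>2"
      by (simp add: ennreal_power)
    also have "\<dots> \<le> (\<integral>\<^sup>+s. ennreal (norm (\<rho> s *\<^sub>R (f (x - s) - f x))) \<partial>lborel)\<^sup>2"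
      unfolding eq by (intro power_mono integral_norm_bound_ennreal i2) auto
    \<comment> \<open>One root of the density goes to each factor, so that the square of the first
      has integral one.\<close>
    also have "\<dots> = (\<integral>\<^sup>+s. ennreal (sqrt (\<rho> s)) * ennreal (sqrt (\<rho> s) * norm (f (x - s) - f x)) \<partial>lborel)\<^sup>2"
      using k(2) by (intro arg_cong[of _ _ "\<lambda>z. z\<^sup>2"] nn_integral_cong) (simp add: ennreal_mult'[symmetric] mult.assoc[symmetric])
    also have "\<dots> \<le> (\<integral>\<^sup>+s. ennreal (sqrt (\<rho> s)) ^ 2 \<partial>lborel) * (\<integral>\<^sup>+s. ennreal (sqrt (\<rho> s) * norm (f (x - s) - f x)) ^ 2 \<partial>lborel)"
      by (rule Cauchy_Schwarz_nn_integral) measurable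
    also have "(\<integral>\<^sup>+s. ennreal (sqrt (\<rho> s)) ^ 2 \<partial>lborel) = (\<integral>\<^sup>+s. ennreal (\<rho> s) \<partial>lborel)"
      using k(2) by (intro nn_integral_cong) (simp add: ennreal_power)
    also have "\<dots> = 1" using nn_integral_eq_integral[OF k(7)] k(2,4) by simp
    also have "(\<integral>\<^sup>+s. ennreal (sqrt (\<rho> s) * norm (f (x - s) - f x)) ^ 2 \<partial>lborel)
        = (\<integral>\<^sup>+s. ennreal (\<rho> s) * ennreal ((norm (f (x - s) - f x))\<^sup>2) \<partial>lborel)"
      using k(2) by (intro nn_integral_cong) (simp add: ennreal_power power_mult_distrib ennreal_mult')
    finally show ?thesis by simp
  qed
  have "(\<integral>\<^sup>+x. ennreal ((norm (conv \<rho> f x - f x))\<^sup>2) \<partial>lborel)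
      \<le> (\<integral>\<^sup>+x. (\<integral>\<^sup>+s. ennreal (\<rho> s) * ennreal ((norm (f (x - s) - f x))\<^sup>2) \<partial>lborel) \<partial>lborel)"
    by (intro nn_integral_mono pt)
  also have "\<dots> = (\<integral>\<^sup>+s. (\<integral>\<^sup>+x. ennreal (\<rho> s) * ennreal ((norm (f (x - s) - f x))\<^sup>2) \<partial>lborel) \<partial>lborel)"
    by (rule lborel_pair.Fubini') measurable
  also have "\<dots> = (\<integral>\<^sup>+s. ennreal (\<rho> s) * (\<integral>\<^sup>+x. ennreal ((norm (f (x - s) - f x))\<^sup>2) \<partial>lborel) \<partial>lborel)"
    by (intro nn_integral_cong nn_integral_cmult) measurable
  also have "\<dots> \<le> (\<integral>\<^sup>+s. ennreal (\<rho> s) * e \<partial>lborel)"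
  proof (intro nn_integral_mono)
    fix s
    show "ennreal (\<rho> s) * (\<integral>\<^sup>+x. ennreal ((norm (f (x - s) - f x))\<^sup>2) \<partial>lborel) \<le> ennreal (\<rho> s) * e"
      using e[of s] k(3)[of s] by (cases "\<rho> s = 0") (auto intro!: mult_left_mono)
  qed
  also have "\<dots> = (\<integral>\<^sup>+s. ennreal (\<rho> s) \<partial>lborel) * e" by (rule nn_integral_multc) measurable
  also have "(\<integral>\<^sup>+s. ennreal (\<rho> s) \<partial>lborel) = 1" using nn_integral_eq_integral[OF k(7)] k(2,4) by simp
  finally show ?thesis by simp
qed

section \<open>Continuity of translations in the mean square\<close>

definition translation_continuous :: "(real^3 \<Rightarrow> 'b::euclidean_space) \<Rightarrow> bool" where
  "translation_continuous f \<longleftrightarrow> (\<forall>e>0. \<exists>d>0. \<forall>s. norm s < d \<longrightarrow>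
     (\<integral>\<^sup>+x. ennreal ((norm (f (x - s) - f x))\<^sup>2) \<partial>lborel) \<le> ennreal e)"

lemma nn_integral_lborel_translate:
  fixes f :: "'a::euclidean_space \<Rightarrow> ennreal"
  assumes [measurable]: "f \<in> borel_measurable borel"
  shows "(\<integral>\<^sup>+x. f (x - s) \<partial>lborel) = (\<integral>\<^sup>+x. f x \<partial>lborel)"
proof -
  have "(\<integral>\<^sup>+x. f x \<partial>lborel) = (\<integral>\<^sup>+x. f x \<partial>distr lborel borel ((+) (-s)))"
    by (simp add: lborel_distr_plus)
  also have "\<dots> = (\<integral>\<^sup>+x. f (-s + x) \<partial>lborel)" by (intro nn_integral_distr) auto
  finally show ?thesis by simp
qed

text \<open>Replacing \<open>f\<close> by \<open>g\<close> costs the same at \<open>x\<close> and at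
  \<open>x - s\<close>, because translation preserves the integral. The share \<open>e/9\<close>
  allows for three terms and for the factor 3 in bounding the square of their sum.\<close>

lemma translation_continuous_limit:
  fixes f :: "real^3 \<Rightarrow> 'b::euclidean_space"
  assumes [measurable]: "f \<in> borel_measurable borel"
    and appr: "\<And>e. e > 0 \<Longrightarrow> \<exists>g \<in> borel_measurable borel. translation_continuous g
        \<and> (\<integral>\<^sup>+x. ennreal ((norm (f x - g x))\<^sup>2) \<partial>lborel) \<le> ennreal e"
  shows "translation_continuous f"
  unfolding translation_continuous_def
proof (intro allI impI)
  fix e :: real assume e: "e > 0"
  obtain g where g[measurable]: "g \<in> borel_measurable borel" and tc: "translation_continuous g"
    and fg: "(\<integral>\<^sup>+x. ennreal ((norm (f x - g x))\<^sup>2) \<partial>lborel) \<le> ennreal (e/9)"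
    using appr[of "e/9"] e by auto
  obtain d where d: "d > 0" "\<And>s. norm s < d \<Longrightarrow> (\<integral>\<^sup>+x. ennreal ((norm (g (x - s) - g x))\<^sup>2) \<partial>lborel) \<le> ennreal (e/9)"
    using tc[unfolded translation_continuous_def, rule_format, of "e/9"] e by auto
  have "(\<integral>\<^sup>+x. ennreal ((norm (f (x - s) - f x))\<^sup>2) \<partial>lborel) \<le> ennreal e" if s: "norm s < d" for s
  proof -
    define h where "h x = ennreal ((norm (f x - g x))\<^sup>2)" for x
    have [measurable]: "h \<in> borel_measurable borel" unfolding h_def by measurable
    define k where "k x = ennreal ((norm (g (x - s) - g x))\<^sup>2)" for x
    have [measurable]: "k \<in> borel_measurable borel" unfolding k_def by measurable
    have pt: "ennreal ((norm (f (x - s) - f x))\<^sup>2) \<le> 3 * (h (x - s) + k x + h x)" for x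
    proof -
      define a b c where "a = norm (f (x - s) - g (x - s))" and "b = norm (g (x - s) - g x)" and "c = norm (f x - g x)"
      have "f (x - s) - f x = (f (x - s) - g (x - s)) + (g (x - s) - g x) + (g x - f x)" by simp
      then have "norm (f (x - s) - f x) \<le> a + b + c"
        unfolding a_def b_def c_def by (metis norm_add_rule_thm norm_minus_commute norm_triangle_mono order_refl)
      then have "(norm (f (x - s) - f x))\<^sup>2 \<le> (a + b + c)\<^sup>2" by (intro power_mono) auto
      also have "\<dots> \<le> 3 * (a\<^sup>2 + b\<^sup>2 + c\<^sup>2)"
        using sum_squares_bound[of a b] sum_squares_bound[of b c] sum_squares_bound[of a c]
        by (simp add: power2_eq_square algebra_simps)
      finally have "ennreal ((norm (f (x - s) - f x))\<^sup>2) \<le> ennreal (3 * (a\<^sup>2 + b\<^sup>2 + c\<^sup>2))" by (rule ennreal_leI)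
      also have "\<dots> = 3 * (h (x - s) + k x + h x)"
        by (simp add: h_def k_def a_def b_def c_def ennreal_mult'' ennreal_plus)
      finally show ?thesis .
    qed
    have "(\<integral>\<^sup>+x. ennreal ((norm (f (x - s) - f x))\<^sup>2) \<partial>lborel) \<le> (\<integral>\<^sup>+x. 3 * (h (x - s) + k x + h x) \<partial>lborel)"
      by (intro nn_integral_mono pt)
    also have "\<dots> = 3 * ((\<integral>\<^sup>+x. h (x - s) \<partial>lborel) + (\<integral>\<^sup>+x. k x \<partial>lborel) + (\<integral>\<^sup>+x. h x \<partial>lborel))"
      by (simp add: nn_integral_cmult nn_integral_add)
    also have "(\<integral>\<^sup>+x. h (x - s) \<partial>lborel) = (\<integral>\<^sup>+x. h x \<partial>lborel)" by (rule nn_integral_lborel_translate) measurable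
    also have "3 * ((\<integral>\<^sup>+x. h x \<partial>lborel) + (\<integral>\<^sup>+x. k x \<partial>lborel) + (\<integral>\<^sup>+x. h x \<partial>lborel))
        \<le> 3 * (ennreal (e/9) + ennreal (e/9) + ennreal (e/9))"
      using fg d(2)[OF s] unfolding h_def k_def by (intro mult_left_mono add_mono) auto
    also have "\<dots> = ennreal 3 * ennreal (e/3)" using e by (simp add: ennreal_plus[symmetric] del: ennreal_plus)
    also have "\<dots> = ennreal e" by (subst ennreal_mult'[symmetric]) auto
    finally show ?thesis .
  qed
  then show "\<exists>d>0. \<forall>s. norm s < d \<longrightarrow> (\<integral>\<^sup>+x. ennreal ((norm (f (x - s) - f x))\<^sup>2) \<partial>lborel) \<le> ennreal e"
    using d(1) by blast
qed

lemma translation_continuous_continuous: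
  fixes f :: "real^3 \<Rightarrow> 'b::euclidean_space"
  assumes f: "continuous_on UNIV f" and R: "\<And>x. f x \<noteq> 0 \<Longrightarrow> norm x \<le> R"
  shows "translation_continuous f"
  unfolding translation_continuous_def
proof (intro allI impI)
  fix e :: real assume e: "e > 0"
  define S where "S = cball (0::real^3) (R+1)"
  define m where "m = measure lborel S"
  have m: "m \<ge> 0" by (simp add: m_def)
  define e' where "e' = sqrt (e / (m + 1))"
  have e': "e' > 0" using e m by (simp add: e'_def)
  have "uniformly_continuous_on (cball 0 (R+2)) f"
    by (intro compact_uniformly_continuous continuous_on_subset[OF f]) auto
  then obtain d where d: "d > 0" "\<And>x y. x \<in> cball 0 (R+2) \<Longrightarrow> y \<in> cball 0 (R+2) \<Longrightarrow> dist y x < d \<Longrightarrow> dist (f y) (f x) < e'"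
    unfolding uniformly_continuous_on_def using e' by blast
  have "(\<integral>\<^sup>+x. ennreal ((norm (f (x - s) - f x))\<^sup>2) \<partial>lborel) \<le> ennreal e" if s: "norm s < min d 1" for s
  proof -
    have pt: "(norm (f (x - s) - f x))\<^sup>2 \<le> e'\<^sup>2 * indicator S x" for x
    proof (cases "x \<in> S")
      case True
      then have "norm x \<le> R + 1" by (simp add: S_def)
      moreover have "norm (x - s) \<le> norm x + norm s" by (rule norm_triangle_ineq4)
      ultimately have "x \<in> cball 0 (R+2)" "x - s \<in> cball 0 (R+2)" using s by auto
      then have "norm (f (x - s) - f x) < e'" using d(2)[of x "x - s"] s by (simp add: dist_norm)
      then show ?thesis using True by (simp add: power_mono)
    next
      case False
      then have "norm x > R + 1" by (simp add: S_def)
      moreover have "norm x - norm s \<le> norm (x - s)" by (rule norm_triangle_ineq2)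
      ultimately have "\<not> norm x \<le> R" "\<not> norm (x - s) \<le> R" using s by auto
      then have "f x = 0" "f (x - s) = 0" using R by blast+
      then show ?thesis by simp
    qed
    have "(\<integral>\<^sup>+x. ennreal ((norm (f (x - s) - f x))\<^sup>2) \<partial>lborel) \<le> (\<integral>\<^sup>+x. ennreal (e'\<^sup>2) * indicator S x \<partial>lborel)"
      using pt by (intro nn_integral_mono) (simp add: ennreal_indicator[symmetric] ennreal_mult''[symmetric] ennreal_leI)
    also have "\<dots> = ennreal (e'\<^sup>2) * emeasure lborel S"
      by (subst nn_integral_cmult_indicator) (auto simp: S_def)
    also have "emeasure lborel S = ennreal m"
      unfolding m_def S_def using emeasure_lborel_cball_finite by (intro emeasure_eq_ennreal_measure) (auto simp: less_top)
    also have "ennreal (e'\<^sup>2) * ennreal m = ennreal (e / (m + 1) * m)"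
      using e m by (simp add: e'_def ennreal_mult[symmetric])
    also have "\<dots> \<le> ennreal e" using e m by (intro ennreal_leI) (simp add: field_simps)
    finally show ?thesis .
  qed
  then show "\<exists>d>0. \<forall>s. norm s < d \<longrightarrow> (\<integral>\<^sup>+x. ennreal ((norm (f (x - s) - f x))\<^sup>2) \<partial>lborel) \<le> ennreal e"
    using d(1) by (intro exI[of _ "min d 1"]) auto
qed

text \<open>A measurable function is almost everywhere a limit of continuous functions. Composing
  them with the nearest-point map of the ball of radius \<open>M\<close> and multiplying by a
  continuous cutoff leaves the limit unchanged and gives a uniform bound and a common bounded
  support, as dominated convergence requires.\<close>

lemma translation_continuous_bounded:
  fixes f :: "real^3 \<Rightarrow> 'b::euclidean_space"
  assumes [measurable]: "f \<in> borel_measurable borel" and M: "\<And>x. norm (f x) \<le> M"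
    and R: "\<And>x. f x \<noteq> 0 \<Longrightarrow> norm x \<le> R"
  shows "translation_continuous f"
proof (rule translation_continuous_limit)
  have M0: "M \<ge> 0" using M[of 0] norm_ge_zero order_trans by blast
  fix e :: real assume e: "e > 0"
  have "f measurable_on UNIV"
    by (intro lebesgue_measurable_imp_measurable_on measurable_completion) auto
  then obtain N g where N: "negligible N" and g: "\<And>n. continuous_on UNIV (g n)"
    and lim: "\<And>x. x \<notin> N \<Longrightarrow> (\<lambda>n. g n x) \<longlonglongrightarrow> f x"
    unfolding measurable_on_def by auto
  define cl where "cl = closest_point (cball (0::'b) M)"
  have ne: "cball (0::'b) M \<noteq> {}" using M0 by auto
  have cont_cl: "continuous_on UNIV cl"
    unfolding cl_def by (intro continuous_on_closest_point convex_cball closed_cball ne)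
  have clM: "norm (cl y) \<le> M" for y
    using closest_point_in_set[OF closed_cball ne, of y] by (simp add: cl_def)
  have clf: "cl (f x) = f x" for x
    unfolding cl_def using M by (intro closest_point_self) auto
  define \<theta> where "\<theta> x = max 0 (min 1 (R + 1 - norm x))" for x :: "real^3"
  have cont_\<theta>: "continuous_on UNIV \<theta>" unfolding \<theta>_def by (intro continuous_intros)
  have \<theta>01: "0 \<le> \<theta> x" "\<theta> x \<le> 1" for x by (auto simp: \<theta>_def)
  have \<theta>f: "\<theta> x *\<^sub>R f x = f x" for x using R[of x] by (cases "f x = 0") (auto simp: \<theta>_def)
  define h where "h n x = \<theta> x *\<^sub>R cl (g n x)" for n x
  have cont_h: "continuous_on UNIV (h n)" for n
    unfolding h_def
    by (intro continuous_on_scaleR cont_\<theta> continuous_on_compose2[OF cont_cl g]) auto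
  have [measurable]: "h n \<in> borel_measurable borel" for n
    by (rule borel_measurable_continuous_onI[OF cont_h])
  have hR: "norm x \<le> R + 1" if "h n x \<noteq> 0" for n x
    using that by (auto simp: h_def \<theta>_def max_def min_def split: if_splits)
  have hM: "norm (h n x) \<le> M" for n x
    unfolding h_def norm_scaleR using \<theta>01[of x] clM[of "g n x"] M0
    by (smt (verit) mult_left_le_one_le norm_ge_zero)
  have hlim: "(\<lambda>n. h n x) \<longlonglongrightarrow> f x" if "x \<notin> N" for x
  proof -
    have "isCont cl (f x)" using cont_cl by (simp add: continuous_on_eq_continuous_at)
    then have "(\<lambda>n. cl (g n x)) \<longlonglongrightarrow> cl (f x)" by (rule isCont_tendsto_compose[OF _ lim[OF that]])
    then have "(\<lambda>n. \<theta> x *\<^sub>R cl (g n x)) \<longlonglongrightarrow> \<theta> x *\<^sub>R cl (f x)" by (intro tendsto_intros)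
    then show ?thesis by (simp add: h_def clf \<theta>f)
  qed
  have AE: "AE x in lborel. x \<notin> N"
    using N by (subst AE_completion_iff[symmetric]) (simp add: negligible_iff_null_sets AE_not_in)
  define S where "S = cball (0::real^3) (R+1)"
  have [measurable]: "S \<in> sets borel" by (simp add: S_def)
  have "(\<lambda>n. \<integral>\<^sup>+x. ennreal ((norm (f x - h n x))\<^sup>2) \<partial>lborel) \<longlonglongrightarrow> nn_integral (lborel :: (real^3) measure) (\<lambda>x. 0)"
  proof (rule nn_integral_dominated_convergence[where w="\<lambda>x. ennreal ((2*M)\<^sup>2) * indicator S x"])
    fix n
    have "ennreal ((norm (f x - h n x))\<^sup>2) \<le> ennreal ((2*M)\<^sup>2) * indicator S x" for x
    proof (cases "x \<in> S")
      case True
      have "norm (f x - h n x) \<le> 2 * M" using norm_triangle_ineq4[of "f x" "h n x"] M[of x] hM[of n x] by linarith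
      then have "(norm (f x - h n x))\<^sup>2 \<le> (2 * M)\<^sup>2" by (intro power_mono) auto
      then show ?thesis using True by (simp add: ennreal_leI)
    next
      case False
      then have "\<not> norm x \<le> R + 1" by (simp add: S_def)
      then have "f x = 0" "h n x = 0" using R[of x] hR[of n x] by force+
      then show ?thesis by simp
    qed
    then show "AE x in lborel. ennreal ((norm (f x - h n x))\<^sup>2) \<le> ennreal ((2*M)\<^sup>2) * indicator S x" by simp
    show "AE x in lborel. (\<lambda>i. ennreal ((norm (f x - h i x))\<^sup>2)) \<longlonglongrightarrow> 0"
      using AE
    proof eventually_elim
      case (elim x)
      have "(\<lambda>i. ennreal ((norm (f x - h i x))\<^sup>2)) \<longlonglongrightarrow> ennreal ((norm (f x - f x))\<^sup>2)"
        by (intro tendsto_intros hlim elim)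
      then show ?case by simp
    qed
    have "(\<integral>\<^sup>+x. ennreal ((2*M)\<^sup>2) * indicator S x \<partial>lborel) = ennreal ((2*M)\<^sup>2) * emeasure lborel S"
      by (subst nn_integral_cmult_indicator) (auto simp: S_def)
    also have "emeasure lborel S = ennreal (measure lborel S)"
      unfolding S_def using emeasure_lborel_cball_finite by (intro emeasure_eq_ennreal_measure) (auto simp: less_top)
    also have "ennreal ((2*M)\<^sup>2) * ennreal (measure lborel S) < \<infinity>"
      by (simp add: ennreal_mult'[symmetric])
    finally show "(\<integral>\<^sup>+x. ennreal ((2*M)\<^sup>2) * indicator S x \<partial>lborel) < \<infinity>" .
  qed measurable
  then have "(\<lambda>n. \<integral>\<^sup>+x. ennreal ((norm (f x - h n x))\<^sup>2) \<partial>lborel) \<longlonglongrightarrow> 0" by simp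
  then have "eventually (\<lambda>n. (\<integral>\<^sup>+x. ennreal ((norm (f x - h n x))\<^sup>2) \<partial>lborel) < ennreal e) sequentially"
    using e by (intro order_tendstoD(2)) auto
  then obtain n where "(\<integral>\<^sup>+x. ennreal ((norm (f x - h n x))\<^sup>2) \<partial>lborel) < ennreal e"
    by (auto simp: eventually_sequentially)
  moreover have "translation_continuous (h n)" by (rule translation_continuous_continuous[OF cont_h hR])
  ultimately show "\<exists>g \<in> borel_measurable borel. translation_continuous g \<and> (\<integral>\<^sup>+x. ennreal ((norm (f x - g x))\<^sup>2) \<partial>lborel) \<le> ennreal e"
    by (intro bexI[of _ "h n"]) auto
qed auto

text \<open>Discarding the values of norm above \<open>n\<close> reduces to bounded functions; the
  squared error is dominated by that of \<open>f\<close> and is eventually zero at each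
  point.\<close>

lemma translation_continuous_L2:
  fixes f :: "real^3 \<Rightarrow> 'b::euclidean_space"
  assumes [measurable]: "f \<in> borel_measurable borel" and R: "\<And>x. f x \<noteq> 0 \<Longrightarrow> norm x \<le> R"
    and fin: "integrable lborel (\<lambda>x. (norm (f x))\<^sup>2)"
  shows "translation_continuous f"
proof (rule translation_continuous_limit)
  fix e :: real assume e: "e > 0"
  define g where "g n x = (if norm (f x) \<le> real n then f x else 0)" for n x
  have [measurable]: "g n \<in> borel_measurable borel" for n unfolding g_def by measurable
  have tc: "translation_continuous (g n)" for n
    by (rule translation_continuous_bounded[of _ "real n" R]) (use R in \<open>auto simp: g_def split: if_splits\<close>)
  have "(\<lambda>n. \<integral>\<^sup>+x. ennreal ((norm (f x - g n x))\<^sup>2) \<partial>lborel) \<longlonglongrightarrow> nn_integral (lborel :: (real^3) measure) (\<lambda>x. 0)"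
  proof (rule nn_integral_dominated_convergence[where w="\<lambda>x. ennreal ((norm (f x))\<^sup>2)"])
    show "AE x in lborel. ennreal ((norm (f x - g n x))\<^sup>2) \<le> ennreal ((norm (f x))\<^sup>2)" for n
      by (auto simp: g_def)
    show "AE x in lborel. (\<lambda>i. ennreal ((norm (f x - g i x))\<^sup>2)) \<longlonglongrightarrow> 0"
    proof (rule AE_I2)
      fix x
      have "eventually (\<lambda>n. norm (f x) \<le> real n) sequentially"
        using eventually_ge_at_top[of "nat \<lceil>norm (f x)\<rceil>"]
        by eventually_elim linarith
      then have "eventually (\<lambda>i. ennreal ((norm (f x - g i x))\<^sup>2) = 0) sequentially"
        by eventually_elim (simp add: g_def)
      then show "(\<lambda>i. ennreal ((norm (f x - g i x))\<^sup>2)) \<longlonglongrightarrow> 0" by (rule tendsto_eventually)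
    qed
    show "(\<integral>\<^sup>+x. ennreal ((norm (f x))\<^sup>2) \<partial>lborel) < \<infinity>"
      using nn_integral_eq_integral[OF fin] by simp
  qed auto
  then have "(\<lambda>n. \<integral>\<^sup>+x. ennreal ((norm (f x - g n x))\<^sup>2) \<partial>lborel) \<longlonglongrightarrow> 0" by simp
  then have "eventually (\<lambda>n. (\<integral>\<^sup>+x. ennreal ((norm (f x - g n x))\<^sup>2) \<partial>lborel) < ennreal e) sequentially"
    using e by (intro order_tendstoD(2)) auto
  then obtain n where "(\<integral>\<^sup>+x. ennreal ((norm (f x - g n x))\<^sup>2) \<partial>lborel) < ennreal e"
    by (auto simp: eventually_sequentially)
  then show "\<exists>g \<in> borel_measurable borel. translation_continuous g \<and> (\<integral>\<^sup>+x. ennreal ((norm (f x - g x))\<^sup>2) \<partial>lborel) \<le> ennreal e"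
    using tc by (intro bexI[of _ "g n"]) auto
qed auto

section \<open>Passing between an open set and the whole space\<close>

lemma integral_lebesgue_on_eq_lborel:
  fixes h :: "real^3 \<Rightarrow> 'b::euclidean_space"
  assumes "open \<Omega>" "h \<in> borel_measurable borel" "\<And>x. x \<notin> \<Omega> \<Longrightarrow> h x = 0"
  shows "(\<integral>x. h x \<partial>lebesgue_on \<Omega>) = (\<integral>x. h x \<partial>lborel)"
proof -
  have "(\<integral>x. h x \<partial>lebesgue_on \<Omega>) = (\<integral>x. indicator \<Omega> x *\<^sub>R h x \<partial>lebesgue)"
    using assms(1) by (subst integral_restrict_space) auto
  also have "(\<lambda>x. indicator \<Omega> x *\<^sub>R h x) = h" using assms(3) by (auto simp: indicator_def fun_eq_iff)
  also have "(\<integral>x. h x \<partial>lebesgue) = (\<integral>x. h x \<partial>lborel)" using assms(2) by (intro integral_completion) auto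
  finally show ?thesis .
qed

lemma AE_lebesgue_on_iff: "open \<Omega> \<Longrightarrow> (AE x in lebesgue_on \<Omega>. P x) \<longleftrightarrow> (AE x in lborel. x \<in> \<Omega> \<longrightarrow> P x)"
  by (subst AE_restrict_space_iff) (auto simp: AE_completion_iff)

lemma borel_imp_lebesgue_on:
  fixes h :: "real^3 \<Rightarrow> 'b::euclidean_space"
  shows "h \<in> borel_measurable borel \<Longrightarrow> h \<in> borel_measurable (lebesgue_on \<Omega>)"
  by (intro measurable_restrict_space1 measurable_completion) auto

lemma L2_UNIV_iff:
  fixes h :: "real^3 \<Rightarrow> 'b::euclidean_space"
  assumes [measurable]: "h \<in> borel_measurable borel"
  shows "h \<in> L2 UNIV \<longleftrightarrow> integrable lborel (\<lambda>x. (norm (h x))\<^sup>2)"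
proof -
  have "integrable (lebesgue_on UNIV) (\<lambda>x. (norm (h x))\<^sup>2) \<longleftrightarrow> integrable lborel (\<lambda>x. (norm (h x))\<^sup>2)"
    unfolding lebesgue_on_UNIV_eq by (intro integrable_completion) measurable
  then show ?thesis using borel_imp_lebesgue_on[OF assms] by (simp add: L2_def)
qed

lemma L2_restrict:
  assumes "f \<in> L2 UNIV" "open \<Omega>"
  shows "f \<in> L2 \<Omega>" "L2_norm \<Omega> f \<le> L2_norm UNIV f"
proof -
  have i: "integrable lebesgue (\<lambda>x. (norm (f x))\<^sup>2)" and m: "f \<in> borel_measurable lebesgue"
    using assms(1) by (auto simp: L2_def lebesgue_on_UNIV_eq)
  have i2: "integrable lebesgue (\<lambda>x. indicator \<Omega> x *\<^sub>R (norm (f x))\<^sup>2)"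
    using i assms(2) by (intro integrable_mult_indicator) auto
  show "f \<in> L2 \<Omega>"
    using i2 m assms(2) by (auto simp: L2_def integrable_restrict_space intro: measurable_restrict_space1)
  have "(\<integral>x. (norm (f x))\<^sup>2 \<partial>lebesgue_on \<Omega>) = (\<integral>x. indicator \<Omega> x *\<^sub>R (norm (f x))\<^sup>2 \<partial>lebesgue)"
    using assms(2) by (subst integral_restrict_space) auto
  also have "\<dots> \<le> (\<integral>x. (norm (f x))\<^sup>2 \<partial>lebesgue)"
    using i i2 by (intro integral_mono) (auto simp: indicator_def)
  finally show "L2_norm \<Omega> f \<le> L2_norm UNIV f" by (simp add: L2_norm_def lebesgue_on_UNIV_eq)
qed

lemma emeasure_bounded_lborel_finite: "bounded B \<Longrightarrow> emeasure lborel (B :: (real^3) set) < \<infinity>"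
  by (rule emeasure_bounded_finite)

text \<open>Convolution integrates Borel functions over the whole space, whereas elements of
  \<open>L2\<close> are only Lebesgue measurable and arbitrary outside \<Omega>. The representative
  vanishes everywhere off \<open>B\<close>, not just almost everywhere, so that supports of
  convolutions can be located pointwise.\<close>

lemma L2_borel_representative:
  fixes f :: "real^3 \<Rightarrow> 'b::euclidean_space"
  assumes \<Omega>: "open \<Omega>" "bounded \<Omega>" and f: "f \<in> L2 \<Omega>"
    and B: "B \<in> sets borel" "B \<subseteq> \<Omega>" "\<And>x. x \<in> \<Omega> - B \<Longrightarrow> f x = 0"
  obtains f' where "f' \<in> borel_measurable borel" "\<And>x. x \<notin> B \<Longrightarrow> f' x = 0"
    "AE x in lebesgue_on \<Omega>. f' x = f x" "integrable lborel (\<lambda>x. (norm (f' x))\<^sup>2)" "integrable lborel f'"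
proof -
  define g where "g x = (if x \<in> \<Omega> then f x else 0)" for x
  have gm: "g \<in> borel_measurable lebesgue"
    unfolding g_def using L2_measurable[OF f] \<Omega> by (subst borel_measurable_if) auto
  have "\<exists>h\<in>borel_measurable lborel. AE x in lborel. g x \<bullet> b = h x" for b
    using gm by (intro completion_ex_borel_measurable_real) auto
  then obtain h where h: "\<And>b. h b \<in> borel_measurable lborel" "\<And>b. AE x in lborel. g x \<bullet> b = h b x"
    by metis
  define f' where "f' x = (\<Sum>b\<in>Basis. (indicator B x * h b x) *\<^sub>R b)" for x
  have [measurable]: "h b \<in> borel_measurable borel" for b using h(1)[of b] by simp
  have [measurable]: "B \<in> sets borel" by fact
  have m[measurable]: "f' \<in> borel_measurable borel" unfolding f'_def by measurable
  have "AE x in lborel. \<forall>b\<in>Basis. g x \<bullet> b = h b x"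
    using h(2) by (intro AE_finite_allI) auto
  then have ae: "AE x in lborel. f' x = g x"
  proof eventually_elim
    case (elim x)
    have "f' x = (\<Sum>b\<in>Basis. (indicator B x * (g x \<bullet> b)) *\<^sub>R b)"
      unfolding f'_def using elim by (intro sum.cong) auto
    also have "\<dots> = indicator B x *\<^sub>R (\<Sum>b\<in>Basis. (g x \<bullet> b) *\<^sub>R b)" by (simp add: scaleR_sum_right)
    also have "\<dots> = g x" using B by (auto simp: euclidean_representation g_def indicator_def)
    finally show ?case .
  qed
  have "integrable lebesgue (\<lambda>x. indicator \<Omega> x *\<^sub>R (norm (f x))\<^sup>2)"
    using L2_integrable_sq[OF f] \<Omega> by (subst (asm) integrable_restrict_space) auto
  also have "(\<lambda>x. indicator \<Omega> x *\<^sub>R (norm (f x))\<^sup>2) = (\<lambda>x. (norm (g x))\<^sup>2)"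
    by (auto simp: g_def indicator_def fun_eq_iff)
  finally have "integrable lebesgue (\<lambda>x. (norm (g x))\<^sup>2)" .
  moreover have "AE x in lebesgue. (norm (g x))\<^sup>2 = (norm (f' x))\<^sup>2"
    using AE_completion[OF ae] by eventually_elim simp
  moreover have "(\<lambda>x. (norm (f' x))\<^sup>2) \<in> borel_measurable lebesgue"
    by (intro measurable_completion) measurable
  moreover have "(\<lambda>x. (norm (g x))\<^sup>2) \<in> borel_measurable lebesgue" using gm by measurable
  ultimately have "integrable lebesgue (\<lambda>x. (norm (f' x))\<^sup>2)"
    by (subst integrable_cong_AE[symmetric]) auto
  then have i: "integrable lborel (\<lambda>x. (norm (f' x))\<^sup>2)"
    by (subst (asm) integrable_completion) auto
  have i2: "integrable lborel f'"
  proof (rule Bochner_Integration.integrable_bound)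
    have "emeasure lborel B < \<infinity>"
      using bounded_subset[OF \<Omega>(2) B(2)] by (rule emeasure_bounded_lborel_finite)
    then show "integrable lborel (\<lambda>x. indicator B x + (norm (f' x))\<^sup>2)"
      using i B(1) by (intro Bochner_Integration.integrable_add integrable_real_indicator) auto
    \<comment> \<open>On a bounded set square integrability implies integrability, through
      \<open>a \<le> 1 + a\<^sup>2\<close>.\<close>
    have "norm (f' x) \<le> indicator B x + (norm (f' x))\<^sup>2" for x
    proof (cases "x \<in> B")
      case True
      have "0 \<le> (norm (f' x) - 1)\<^sup>2 + norm (f' x)" by simp
      then have "norm (f' x) \<le> 1 + (norm (f' x))\<^sup>2" unfolding power2_diff by simp
      then show ?thesis using True by simp
    qed (simp add: f'_def)
    then show "AE x in lborel. norm (f' x) \<le> norm (indicator B x + (norm (f' x))\<^sup>2)"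
      by (auto intro!: AE_I2 order_trans[OF _ abs_ge_self])
  qed simp
  have "AE x in lebesgue_on \<Omega>. f' x = f x"
    unfolding AE_lebesgue_on_iff[OF \<Omega>(1)] using ae by eventually_elim (simp add: g_def)
  then show thesis using that[OF m _ _ i i2] by (simp add: f'_def)
qed

text \<open>The estimate is uniform over all kernels supported near the origin, whatever their
  centre: only the size of the translations in the support enters.\<close>

lemma mollify_L2:
  fixes f :: "real^3 \<Rightarrow> 'b::euclidean_space"
  assumes [measurable]: "f \<in> borel_measurable borel" and supp: "bounded {x. f x \<noteq> 0}"
    and sq: "integrable lborel (\<lambda>x. (norm (f x))\<^sup>2)" and int: "integrable lborel f" and e: "e > 0"
  obtains d where "d > 0"
    "\<And>\<rho> a r. kernel \<rho> a r \<Longrightarrow> ball a r \<subseteq> ball 0 d \<Longrightarrow>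
      (\<lambda>x. conv \<rho> f x - f x) \<in> L2 UNIV \<and> L2_norm UNIV (\<lambda>x. conv \<rho> f x - f x) \<le> e"
proof -
  obtain R where R: "\<And>x. f x \<noteq> 0 \<Longrightarrow> norm x \<le> R" using supp unfolding bounded_iff by auto
  have "translation_continuous f" by (rule translation_continuous_L2[OF _ R sq]) auto
  then obtain d where d: "d > 0"
    "\<And>s. norm s < d \<Longrightarrow> (\<integral>\<^sup>+x. ennreal ((norm (f (x - s) - f x))\<^sup>2) \<partial>lborel) \<le> ennreal (e\<^sup>2)"
    unfolding translation_continuous_def using e by (elim allE[of _ "e\<^sup>2"]) auto
  show thesis
  proof (rule that[OF d(1)])
    fix \<rho> a r assume \<rho>: "kernel \<rho> a r" and sub: "ball a r \<subseteq> ball 0 d"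
    have "smooth (conv \<rho> f)" by (rule smooth_conv[OF kernelD(1,5)[OF \<rho>] int])
    then have [measurable]: "conv \<rho> f \<in> borel_measurable borel"
      by (intro borel_measurable_continuous_onI smooth_continuous)
    have m: "(\<lambda>x. conv \<rho> f x - f x) \<in> borel_measurable (lebesgue_on UNIV)"
      by (rule borel_imp_lebesgue_on) measurable
    have "(\<integral>\<^sup>+x. ennreal ((norm (conv \<rho> f x - f x))\<^sup>2) \<partial>lebesgue_on UNIV)
      = (\<integral>\<^sup>+x. ennreal ((norm (conv \<rho> f x - f x))\<^sup>2) \<partial>lborel)"
      by (simp add: lebesgue_on_UNIV_eq nn_integral_completion)
    also have "\<dots> \<le> ennreal (e\<^sup>2)"
      by (rule conv_diff_nn_integral[OF \<rho> int]) (use d(2) sub in force)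
    finally show "(\<lambda>x. conv \<rho> f x - f x) \<in> L2 UNIV \<and> L2_norm UNIV (\<lambda>x. conv \<rho> f x - f x) \<le> e"
      using L2_nn_integralI[OF m, of e] e by simp
  qed
qed

lemma continuous_L2:
  fixes f :: "real^3 \<Rightarrow> 'b::euclidean_space"
  assumes "open \<Omega>" "bounded \<Omega>" "continuous_on UNIV f"
  shows "f \<in> L2 \<Omega>"
proof -
  have m: "f \<in> borel_measurable (lebesgue_on \<Omega>)"
    by (intro borel_imp_lebesgue_on borel_measurable_continuous_onI assms)
  have "compact (f ` closure \<Omega>)"
    using assms by (intro compact_continuous_image continuous_on_subset[OF assms(3)]) (auto simp: compact_closure)
  then obtain B where B: "\<And>x. x \<in> closure \<Omega> \<Longrightarrow> norm (f x) \<le> B"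
    using compact_imp_bounded bounded_pos by (metis imageI)
  interpret finite_measure "lebesgue_on \<Omega>"
    using assms by (intro finite_measure_lebesgue_on) (simp add: bounded_set_imp_lmeasurable lmeasurable_open)
  show ?thesis
  proof (rule L2_bound[OF m])
    show "integrable (lebesgue_on \<Omega>) (\<lambda>x. B\<^sup>2)" by simp
    show "AE x in lebesgue_on \<Omega>. (norm (f x))\<^sup>2 \<le> B\<^sup>2"
      using B closure_subset[of \<Omega>] by (intro AE_I2 power_mono) auto
  qed
qed

lemma bounded_continuous_mult_L2:
  fixes f :: "real^3 \<Rightarrow> 'b::euclidean_space" and \<eta> :: "real^3 \<Rightarrow> real"
  assumes "open \<Omega>" "bounded \<Omega>" "continuous_on UNIV \<eta>" "f \<in> L2 \<Omega>"
  shows "(\<lambda>x. \<eta> x *\<^sub>R f x) \<in> L2 \<Omega>"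
proof -
  have "compact (\<eta> ` closure \<Omega>)"
    using assms by (intro compact_continuous_image continuous_on_subset[OF assms(3)]) (auto simp: compact_closure)
  then obtain B where B: "\<And>x. x \<in> closure \<Omega> \<Longrightarrow> norm (\<eta> x) \<le> B"
    using compact_imp_bounded bounded_pos by (metis imageI)
  show ?thesis
  proof (rule L2_dominated[OF _ assms(4), of _ B])
    show "(\<lambda>x. \<eta> x *\<^sub>R f x) \<in> borel_measurable (lebesgue_on \<Omega>)"
      using L2_measurable[OF assms(4)] borel_imp_lebesgue_on[OF borel_measurable_continuous_onI[OF assms(3)]]
      by measurable
    show "AE x in lebesgue_on \<Omega>. norm (\<eta> x *\<^sub>R f x) \<le> B * norm (f x)"
      using B closure_subset[of \<Omega>] by (intro AE_I2) (auto intro!: mult_right_mono)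
  qed
qed

section \<open>First-order operators with constant coefficients\<close>

definition diff_op :: "(3 \<Rightarrow> 'b \<Rightarrow> 'c) \<Rightarrow> (real^3 \<Rightarrow> 'b::euclidean_space) \<Rightarrow> real^3 \<Rightarrow> 'c::euclidean_space" where
  "diff_op A u x = (\<Sum>i\<in>UNIV. A i (pd i u x))"

text \<open>\<open>F\<close> is the weak image of \<open>f\<close> under the operator; test fields are supported in \<open>W\<close>, which
  may reach across the part of the boundary of \<open>\<Omega>\<close> on which \<open>f\<close> has zero trace.\<close>

definition weak_op :: "(3 \<Rightarrow> 'b \<Rightarrow> 'c) \<Rightarrow> (real^3) set \<Rightarrow> (real^3) set \<Rightarrow> (real^3 \<Rightarrow> 'b::euclidean_space)
    \<Rightarrow> (real^3 \<Rightarrow> 'c::euclidean_space) \<Rightarrow> bool" where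
  "weak_op A W \<Omega> f F \<longleftrightarrow> f \<in> L2 \<Omega> \<and> F \<in> L2 \<Omega> \<and> (\<forall>u\<in>test_functions W.
     (\<integral>x. (\<Sum>i\<in>UNIV. A i (f x) \<bullet> pd i u x) \<partial>lebesgue_on \<Omega>) = - L2_inner \<Omega> F u)"

text \<open>The pair \<open>(f, F)\<close> lies in the closure of the graph of the operator over
  smooth fields vanishing near \<gamma>. Carrying \<open>F\<close> as an argument avoids the choice
  hidden in \<open>weak_curl\<close> and \<open>weak_div\<close>.\<close>

definition smoothly_approximable :: "(real^3) set \<Rightarrow> (3 \<Rightarrow> 'b \<Rightarrow> 'c) \<Rightarrow> (real^3) set \<Rightarrow>
    (real^3 \<Rightarrow> 'b::euclidean_space) \<Rightarrow> (real^3 \<Rightarrow> 'c::euclidean_space) \<Rightarrow> bool" where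
  "smoothly_approximable \<gamma> A \<Omega> f F \<longleftrightarrow> (\<forall>e>0. \<exists>\<phi> \<in> C_inf_vanishing \<gamma> \<Omega>.
     L2_norm \<Omega> (\<lambda>x. f x - \<phi> x) < e \<and> L2_norm \<Omega> (\<lambda>x. F x - diff_op A \<phi> x) < e)"

lemma test_functionsD:
  assumes "u \<in> test_functions W"
  shows "smooth u" "bounded {x. u x \<noteq> 0}" "\<And>x. x \<notin> W \<Longrightarrow> u x = 0" "\<And>x i. x \<notin> W \<Longrightarrow> pd i u x = 0"
    "bounded {x. pd i u x \<noteq> 0}"
proof -
  show "smooth u" using assms by (simp add: test_functions_def)
  show b: "bounded {x. u x \<noteq> 0}"
    using assms bounded_subset[OF compact_imp_bounded closure_subset] by (auto simp: test_functions_def)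
  show "u x = 0" if "x \<notin> W" for x
    using assms that closure_subset[of "{x. u x \<noteq> 0}"] by (auto simp: test_functions_def)
  show "pd i u x = 0" if "x \<notin> W" for x i
    unfolding pd_def by (rule frechet_derivative_outside_support) (use assms that in \<open>auto simp: test_functions_def\<close>)
  show "bounded {x. pd i u x \<noteq> 0}"
    unfolding pd_def by (rule bounded_support_frechet_derivative[OF b])
qed

lemma smooth_diff_op:
  assumes "\<And>i. linear (A i)" "smooth u"
  shows "smooth (diff_op A u)"
  unfolding diff_op_def
  by (intro smooth_sum smooth_bounded_linear_comp[of "pd i u" "A i" for i] smooth_pd assms(2))
    (use assms(1) in \<open>simp add: linear_conv_bounded_linear\<close>)

lemma smooth_L2: "open \<Omega> \<Longrightarrow> bounded \<Omega> \<Longrightarrow> smooth f \<Longrightarrow> f \<in> L2 \<Omega>" for f :: "real^3 \<Rightarrow> 'b::euclidean_space"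
  by (rule continuous_L2[OF _ _ smooth_continuous])

lemma test_function_L2: "open \<Omega> \<Longrightarrow> bounded \<Omega> \<Longrightarrow> u \<in> test_functions W \<Longrightarrow> u \<in> L2 \<Omega>"
  for u :: "real^3 \<Rightarrow> 'b::euclidean_space"
  by (rule smooth_L2[OF _ _ test_functionsD(1)])

lemma smooth_inner: "smooth f \<Longrightarrow> smooth g \<Longrightarrow> smooth (\<lambda>x. f x \<bullet> g x)"
  by (simp add: smooth_def C_k_inner)

lemma pd_inner:
  "smooth f \<Longrightarrow> smooth g \<Longrightarrow> pd i (\<lambda>x. f x \<bullet> g x) x = f x \<bullet> pd i g x + pd i f x \<bullet> g x"
  by (subst pd_eq[OF bounded_bilinear.FDERIV[OF bounded_bilinear_inner smooth_has_derivative smooth_has_derivative]])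
    (auto simp: pd_def)

text \<open>The product \<open>A i (\<phi> x) \<bullet> u x\<close> inherits the compact support of
  the test field, so its derivatives integrate to zero over the whole space and the boundary of
  \<Omega> contributes nothing.\<close>

lemma smooth_weak_op:
  fixes A :: "3 \<Rightarrow> 'b::euclidean_space \<Rightarrow> 'c::euclidean_space"
  assumes \<Omega>: "open \<Omega>" "bounded \<Omega>" and A: "\<And>i. linear (A i)" and \<phi>: "smooth \<phi>"
  shows "weak_op A \<Omega> \<Omega> \<phi> (diff_op A \<phi>)"
  unfolding weak_op_def
proof (intro conjI ballI)
  show "\<phi> \<in> L2 \<Omega>" "diff_op A \<phi> \<in> L2 \<Omega>" using smooth_L2[OF \<Omega> \<phi>] smooth_L2[OF \<Omega> smooth_diff_op[of A, OF A \<phi>]] by auto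
  fix u :: "real^3 \<Rightarrow> 'c" assume u: "u \<in> test_functions \<Omega>"
  note U = test_functionsD[OF u]
  have bl: "bounded_linear (A i)" for i using A by (simp add: linear_conv_bounded_linear)
  have sA: "smooth (\<lambda>x. A i (\<phi> x))" for i by (rule smooth_bounded_linear_comp[OF \<phi> bl])
  have pA: "pd i (\<lambda>x. A i (\<phi> x)) x = A i (pd i \<phi> x)" for i x by (rule pd_bounded_linear[OF \<phi> bl])
  have sAp: "smooth (\<lambda>x. A i (pd i \<phi> x))" for i by (rule smooth_bounded_linear_comp[OF smooth_pd[OF \<phi>] bl])
  have i1: "integrable lborel (\<lambda>x. A i (\<phi> x) \<bullet> pd i u x)" for i
    by (intro integrable_continuous_bounded_support smooth_continuous smooth_inner sA smooth_pd U(1))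
      (auto intro: bounded_subset[OF U(5)[of i]])
  have i2: "integrable lborel (\<lambda>x. A i (pd i \<phi> x) \<bullet> u x)" for i
    by (intro integrable_continuous_bounded_support smooth_continuous smooth_inner sAp U(1))
      (auto intro: bounded_subset[OF U(2)])
  have parts: "(\<integral>x. A i (\<phi> x) \<bullet> pd i u x \<partial>lborel) = - (\<integral>x. A i (pd i \<phi> x) \<bullet> u x \<partial>lborel)" for i
  proof -
    have s: "smooth (\<lambda>x. A i (\<phi> x) \<bullet> u x)" by (intro smooth_inner sA U(1))
    have "(\<integral>x. pd i (\<lambda>x. A i (\<phi> x) \<bullet> u x) x \<partial>lborel) = 0"
      unfolding pd_def
      by (rule integral_frechet_derivative_eq_0[OF smoothD[OF s]]) (auto intro: bounded_subset[OF U(2)])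
    moreover have "pd i (\<lambda>x. A i (\<phi> x) \<bullet> u x) x = A i (\<phi> x) \<bullet> pd i u x + A i (pd i \<phi> x) \<bullet> u x" for x
      using pd_inner[OF sA U(1), of i i x] by (simp add: pA)
    ultimately show ?thesis using i1 i2 by simp
  qed
  have "(\<integral>x. (\<Sum>i\<in>UNIV. A i (\<phi> x) \<bullet> pd i u x) \<partial>lebesgue_on \<Omega>) = (\<integral>x. (\<Sum>i\<in>UNIV. A i (\<phi> x) \<bullet> pd i u x) \<partial>lborel)"
    using i1 U(4) by (intro integral_lebesgue_on_eq_lborel \<Omega> borel_measurable_sum) auto
  also have "\<dots> = (\<Sum>i\<in>UNIV. - (\<integral>x. A i (pd i \<phi> x) \<bullet> u x \<partial>lborel))" using i1 by (simp add: parts)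
  also have "\<dots> = - (\<integral>x. diff_op A \<phi> x \<bullet> u x \<partial>lborel)"
    using i2 by (simp add: diff_op_def inner_sum_left sum_negf)
  also have "(\<integral>x. diff_op A \<phi> x \<bullet> u x \<partial>lborel) = L2_inner \<Omega> (diff_op A \<phi>) u"
    unfolding L2_inner_def using U(3)
    by (intro integral_lebesgue_on_eq_lborel[symmetric] \<Omega> borel_measurable_continuous_onI
        smooth_continuous smooth_inner smooth_diff_op A \<phi> U(1)) auto
  finally show "(\<integral>x. (\<Sum>i\<in>UNIV. A i (\<phi> x) \<bullet> pd i u x) \<partial>lebesgue_on \<Omega>) = - L2_inner \<Omega> (diff_op A \<phi>) u" .
qed

lemma weak_opD:
  "weak_op A W \<Omega> f F \<Longrightarrow> u \<in> test_functions W \<Longrightarrow>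
    (\<integral>x. (\<Sum>i\<in>UNIV. A i (f x) \<bullet> pd i u x) \<partial>lebesgue_on \<Omega>) = - L2_inner \<Omega> F u"
  unfolding weak_op_def by blast

lemma weak_op_add:
  fixes A :: "3 \<Rightarrow> 'b::euclidean_space \<Rightarrow> 'c::euclidean_space"
  assumes "weak_op A W \<Omega> f F" "weak_op A W \<Omega> g G" "open \<Omega>" "bounded \<Omega>" "\<And>i. linear (A i)"
  shows "weak_op A W \<Omega> (\<lambda>x. f x + g x) (\<lambda>x. F x + G x)"
  unfolding weak_op_def
proof (intro conjI ballI)
  show "(\<lambda>x. f x + g x) \<in> L2 \<Omega>" "(\<lambda>x. F x + G x) \<in> L2 \<Omega>"
    using assms(1,2) by (auto simp: weak_op_def intro: L2_add)
  fix u :: "real^3 \<Rightarrow> 'c" assume u: "u \<in> test_functions W"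
  note U = test_functionsD[OF u]
  have bl: "bounded_linear (A i)" for i using assms(5) by (simp add: linear_conv_bounded_linear)
  have pL: "pd i u \<in> L2 \<Omega>" for i by (intro smooth_L2 assms smooth_pd U(1))
  have i: "integrable (lebesgue_on \<Omega>) (\<lambda>x. A i (h x) \<bullet> pd i u x)" if "h \<in> L2 \<Omega>" for i h
    by (rule L2_inner_integrable[OF L2_bounded_linear[OF that bl] pL])
  have fg: "f \<in> L2 \<Omega>" "g \<in> L2 \<Omega>" "F \<in> L2 \<Omega>" "G \<in> L2 \<Omega>" using assms(1,2) by (auto simp: weak_op_def)
  have uL: "u \<in> L2 \<Omega>" by (rule test_function_L2[OF assms(3,4) u])
  have "(\<integral>x. (\<Sum>i\<in>UNIV. A i (f x + g x) \<bullet> pd i u x) \<partial>lebesgue_on \<Omega>)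
     = (\<integral>x. (\<Sum>i\<in>UNIV. A i (f x) \<bullet> pd i u x) + (\<Sum>i\<in>UNIV. A i (g x) \<bullet> pd i u x) \<partial>lebesgue_on \<Omega>)"
    by (simp add: linear_add[OF assms(5)] inner_add_left sum.distrib)
  also have "\<dots> = (\<integral>x. (\<Sum>i\<in>UNIV. A i (f x) \<bullet> pd i u x) \<partial>lebesgue_on \<Omega>)
      + (\<integral>x. (\<Sum>i\<in>UNIV. A i (g x) \<bullet> pd i u x) \<partial>lebesgue_on \<Omega>)"
    by (intro Bochner_Integration.integral_add Bochner_Integration.integrable_sum i fg)
  also have "\<dots> = - L2_inner \<Omega> F u + - L2_inner \<Omega> G u"
    by (simp only: weak_opD[OF assms(1) u] weak_opD[OF assms(2) u])
  also have "\<dots> = - L2_inner \<Omega> (\<lambda>x. F x + G x) u"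
    using fg uL by (simp add: L2_inner_add_left)
  finally show "(\<integral>x. (\<Sum>i\<in>UNIV. A i (f x + g x) \<bullet> pd i u x) \<partial>lebesgue_on \<Omega>) = - L2_inner \<Omega> (\<lambda>x. F x + G x) u" .
qed

lemma weak_op_scaleR:
  assumes "weak_op A W \<Omega> f F" "\<And>i. linear (A i)"
  shows "weak_op A W \<Omega> (\<lambda>x. c *\<^sub>R f x) (\<lambda>x. c *\<^sub>R F x)"
  using assms
  by (auto simp: weak_op_def L2_scaleR L2_inner_scaleR_left linear_scale simp flip: sum_distrib_left)

lemma weak_op_diff:
  assumes "weak_op A W \<Omega> f F" "weak_op A W \<Omega> g G" "open \<Omega>" "bounded \<Omega>" "\<And>i. linear (A i)"
  shows "weak_op A W \<Omega> (\<lambda>x. f x - g x) (\<lambda>x. F x - G x)"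
  using weak_op_add[OF assms(1) weak_op_scaleR[OF assms(2,5), of "-1"] assms(3-5)] by simp

lemma test_functions_mult:
  assumes "u \<in> test_functions W" "smooth \<eta>"
  shows "(\<lambda>x. \<eta> x *\<^sub>R u x) \<in> test_functions W"
proof -
  have sub: "closure {x. \<eta> x *\<^sub>R u x \<noteq> 0} \<subseteq> closure {x. u x \<noteq> 0}" by (intro closure_mono) auto
  moreover have "compact (closure {x. \<eta> x *\<^sub>R u x \<noteq> 0})"
    using sub assms(1) by (metis (mono_tags, lifting) closed_closure closed_Int_compact inf.absorb1 mem_Collect_eq test_functions_def)
  ultimately show ?thesis using assms by (auto simp: test_functions_def intro: smooth_scaleR)
qed

text \<open>Test with \<open>\<eta> u\<close> in place of \<open>u\<close> and expand by the product
  rule. The extra term is of order zero in \<open>f\<close>, so it stays in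
  \<open>L2\<close>.\<close>

lemma weak_op_mult:
  fixes A :: "3 \<Rightarrow> 'b::euclidean_space \<Rightarrow> 'c::euclidean_space"
  assumes w: "weak_op A W \<Omega> f F" and \<Omega>: "open \<Omega>" "bounded \<Omega>" and A: "\<And>i. linear (A i)" and \<eta>: "smooth \<eta>"
  shows "weak_op A W \<Omega> (\<lambda>x. \<eta> x *\<^sub>R f x) (\<lambda>x. \<eta> x *\<^sub>R F x + (\<Sum>i\<in>UNIV. pd i \<eta> x *\<^sub>R A i (f x)))"
  unfolding weak_op_def
proof (intro conjI ballI)
  have bl: "bounded_linear (A i)" for i using A by (simp add: linear_conv_bounded_linear)
  have fL: "f \<in> L2 \<Omega>" "F \<in> L2 \<Omega>" using w by (auto simp: weak_op_def)
  have AL: "(\<lambda>x. A i (f x)) \<in> L2 \<Omega>" for i by (rule L2_bounded_linear[OF fL(1) bl])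
  have mL: "(\<lambda>x. pd i \<eta> x *\<^sub>R A i (f x)) \<in> L2 \<Omega>" for i
    by (intro bounded_continuous_mult_L2 \<Omega> AL smooth_continuous smooth_pd \<eta>)
  have eL: "(\<lambda>x. \<eta> x *\<^sub>R F x) \<in> L2 \<Omega>" "(\<lambda>x. \<eta> x *\<^sub>R f x) \<in> L2 \<Omega>"
    by (intro bounded_continuous_mult_L2 \<Omega> fL smooth_continuous \<eta>)+
  show "(\<lambda>x. \<eta> x *\<^sub>R f x) \<in> L2 \<Omega>" by fact
  show GL: "(\<lambda>x. \<eta> x *\<^sub>R F x + (\<Sum>i\<in>UNIV. pd i \<eta> x *\<^sub>R A i (f x))) \<in> L2 \<Omega>"
    by (intro L2_add eL L2_sum mL)
  have sL: "(\<lambda>x. \<Sum>i\<in>UNIV. pd i \<eta> x *\<^sub>R A i (f x)) \<in> L2 \<Omega>" by (intro L2_sum mL)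
  fix u :: "real^3 \<Rightarrow> 'c" assume u: "u \<in> test_functions W"
  note U = test_functionsD[OF u]
  have uL: "u \<in> L2 \<Omega>" by (rule test_function_L2[OF \<Omega> u])
  have "(\<integral>x. (\<Sum>i\<in>UNIV. A i (f x) \<bullet> pd i (\<lambda>x. \<eta> x *\<^sub>R u x) x) \<partial>lebesgue_on \<Omega>) = - L2_inner \<Omega> F (\<lambda>x. \<eta> x *\<^sub>R u x)"
    using w test_functions_mult[OF u \<eta>] by (auto simp: weak_op_def)
  moreover have "(\<Sum>i\<in>UNIV. A i (f x) \<bullet> pd i (\<lambda>x. \<eta> x *\<^sub>R u x) x)
      = (\<Sum>i\<in>UNIV. A i (\<eta> x *\<^sub>R f x) \<bullet> pd i u x) + (\<Sum>i\<in>UNIV. pd i \<eta> x *\<^sub>R A i (f x)) \<bullet> u x" for x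
    by (simp add: pd_scaleR[OF \<eta> U(1)] linear_scale[OF A] inner_add_right inner_sum_left sum.distrib)
  moreover have "integrable (lebesgue_on \<Omega>) (\<lambda>x. \<Sum>i\<in>UNIV. A i (\<eta> x *\<^sub>R f x) \<bullet> pd i u x)"
    by (intro Bochner_Integration.integrable_sum L2_inner_integrable L2_bounded_linear[OF eL(2) bl] smooth_L2 \<Omega> smooth_pd U(1))
  moreover have "integrable (lebesgue_on \<Omega>) (\<lambda>x. (\<Sum>i\<in>UNIV. pd i \<eta> x *\<^sub>R A i (f x)) \<bullet> u x)"
    by (intro L2_inner_integrable L2_sum mL uL)
  ultimately have "(\<integral>x. (\<Sum>i\<in>UNIV. A i (\<eta> x *\<^sub>R f x) \<bullet> pd i u x) \<partial>lebesgue_on \<Omega>)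
      = - L2_inner \<Omega> F (\<lambda>x. \<eta> x *\<^sub>R u x) - L2_inner \<Omega> (\<lambda>x. \<Sum>i\<in>UNIV. pd i \<eta> x *\<^sub>R A i (f x)) u"
    unfolding L2_inner_def by simp
  also have "L2_inner \<Omega> F (\<lambda>x. \<eta> x *\<^sub>R u x) = L2_inner \<Omega> (\<lambda>x. \<eta> x *\<^sub>R F x) u"
    by (simp add: L2_inner_def)
  finally show "(\<integral>x. (\<Sum>i\<in>UNIV. A i (\<eta> x *\<^sub>R f x) \<bullet> pd i u x) \<partial>lebesgue_on \<Omega>)
      = - L2_inner \<Omega> (\<lambda>x. \<eta> x *\<^sub>R F x + (\<Sum>i\<in>UNIV. pd i \<eta> x *\<^sub>R A i (f x))) u"
    using L2_inner_add_left[OF eL(1) sL uL] by simp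
qed

lemma smooth_reflect: "smooth \<rho> \<Longrightarrow> smooth (\<lambda>y. \<rho> (z - y))"
  using smooth_affine[of \<rho> z "-1"] by simp

lemma pd_reflect:
  fixes \<rho> :: "real^3 \<Rightarrow> real"
  assumes "smooth \<rho>"
  shows "pd i (\<lambda>y. \<rho> (z - y)) y = - pd i \<rho> (z - y)"
proof -
  have "((\<lambda>y. z - y) has_derivative (\<lambda>v. - v)) (at y)" by (auto intro!: derivative_eq_intros)
  from has_derivative_compose[OF this smooth_has_derivative[OF assms]]
  show ?thesis
    using linear_neg[OF frechet_derivative_linear[OF smoothD[OF assms]]] by (subst pd_eq) (auto simp: pd_def)
qed

lemma pd_kernel_support:
  assumes "kernel \<rho> a r" "pd i \<rho> x \<noteq> 0"
  shows "x \<in> cball a r"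
proof -
  have "x \<in> closure {x. \<rho> x \<noteq> 0}"
    using assms(2) frechet_derivative_outside_support[of x \<rho> "axis i 1"] unfolding pd_def by blast
  moreover have "closure {x. \<rho> x \<noteq> 0} \<subseteq> cball a r"
    using kernelD(3)[OF assms(1)] by (intro closure_minimal) force+
  ultimately show ?thesis by blast
qed

lemma kernel_test_function:
  fixes c :: "'b::euclidean_space"
  assumes "kernel \<rho> a r" "cball (z - a) r \<subseteq> W"
  shows "(\<lambda>y. \<rho> (z - y) *\<^sub>R c) \<in> test_functions W"
proof -
  have "y \<in> ball (z - a) r" if "\<rho> (z - y) *\<^sub>R c \<noteq> 0" for y
    using kernelD(3)[OF assms(1), of "z - y"] that by (auto simp: dist_norm algebra_simps norm_minus_commute)
  then have sub: "{y. \<rho> (z - y) *\<^sub>R c \<noteq> 0} \<subseteq> cball (z - a) r" by force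
  then have "closure {y. \<rho> (z - y) *\<^sub>R c \<noteq> 0} \<subseteq> cball (z - a) r" by (intro closure_minimal) auto
  moreover have "compact (closure {y. \<rho> (z - y) *\<^sub>R c \<noteq> 0})"
    using bounded_subset[OF bounded_cball sub] by (simp add: compact_closure)
  ultimately show ?thesis
    using assms(2) by (auto simp: test_functions_def intro!: smooth_scaleR smooth_const smooth_reflect kernelD(1)[OF assms(1)])
qed

lemma integral_lebesgue_on_eq_lborel_AE:
  fixes g h :: "real^3 \<Rightarrow> 'b::euclidean_space"
  assumes "open \<Omega>" "h \<in> borel_measurable borel" "\<And>x. x \<notin> \<Omega> \<Longrightarrow> h x = 0"
    "g \<in> borel_measurable (lebesgue_on \<Omega>)" "AE x in lebesgue_on \<Omega>. g x = h x"
  shows "(\<integral>x. g x \<partial>lebesgue_on \<Omega>) = (\<integral>x. h x \<partial>lborel)"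
  using integral_cong_AE[OF assms(4) borel_imp_lebesgue_on[OF assms(2)] assms(5)]
    integral_lebesgue_on_eq_lborel[OF assms(1-3)] by simp

text \<open>The function of \<open>y\<close> given by \<open>\<rho> (z - y)\<close> is admissible
  for testing as soon as its support lies in \<open>W\<close>. As \<open>W\<close> may extend beyond
  \<Omega>, the identity also holds across the part of the boundary where zero trace is encoded,
  with \<open>f'\<close> and \<open>F'\<close> extended by zero.\<close>

lemma diff_op_conv:
  fixes A :: "3 \<Rightarrow> 'b::euclidean_space \<Rightarrow> 'c::euclidean_space"
  assumes w: "weak_op A W \<Omega> f F" and \<Omega>: "open \<Omega>" "bounded \<Omega>" and A: "\<And>i. linear (A i)"
    and f': "f' \<in> borel_measurable borel" "\<And>x. x \<notin> \<Omega> \<Longrightarrow> f' x = 0" "AE x in lebesgue_on \<Omega>. f' x = f x" "integrable lborel f'"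
    and F': "F' \<in> borel_measurable borel" "\<And>x. x \<notin> \<Omega> \<Longrightarrow> F' x = 0" "AE x in lebesgue_on \<Omega>. F' x = F x" "integrable lborel F'"
    and \<rho>: "kernel \<rho> a r" and z: "cball (z - a) r \<subseteq> W"
  shows "diff_op A (conv \<rho> f') z = conv \<rho> F' z"
proof (rule euclidean_eqI)
  fix c :: 'c
  note k = kernelD[OF \<rho>]
  have bl: "bounded_linear (A i)" for i using A by (simp add: linear_conv_bounded_linear)
  have wL: "f \<in> L2 \<Omega>" "F \<in> L2 \<Omega>" using w by (auto simp: weak_op_def)
  define u where "u y = \<rho> (z - y) *\<^sub>R c" for y
  have u: "u \<in> test_functions W" unfolding u_def by (rule kernel_test_function[OF \<rho> z])
  note U = test_functionsD[OF u]
  have pu: "pd i u y = - (pd i \<rho> (z - y) *\<^sub>R c)" for i y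
    unfolding u_def by (simp add: pd_scaleR[OF smooth_reflect[OF k(1)] smooth_const] pd_reflect[OF k(1)])
  have ip: "integrable lborel (\<lambda>y. pd i \<rho> (z - y) *\<^sub>R f' y)" for i
    unfolding pd_def
    by (rule conv_integrable[where \<rho>="\<lambda>x. frechet_derivative \<rho> (at x) (axis i 1)"])
      (intro smooth_continuous smooth_frechet_derivative k bounded_support_frechet_derivative f')+
  have bl2: "bounded_linear (\<lambda>w. A i w \<bullet> c)" for i
    by (intro bounded_linear_compose[OF bounded_linear_inner_left bl])
  have ip2: "integrable lborel (\<lambda>y. A i (pd i \<rho> (z - y) *\<^sub>R f' y) \<bullet> c)" for i
    by (rule integrable_bounded_linear[OF bl2 ip])
  have ip3: "(\<integral>y. A i (pd i \<rho> (z - y) *\<^sub>R f' y) \<bullet> c \<partial>lborel) = A i (\<integral>y. pd i \<rho> (z - y) *\<^sub>R f' y \<partial>lborel) \<bullet> c" for i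
    by (rule integral_bounded_linear[OF bl2 ip])
  have "diff_op A (conv \<rho> f') z \<bullet> c = (\<Sum>i\<in>UNIV. A i (\<integral>y. pd i \<rho> (z - y) *\<^sub>R f' y \<partial>lborel) \<bullet> c)"
    unfolding diff_op_def by (simp add: pd_conv[OF k(1,5) f'(4)] conv_def inner_sum_left)
  also have "\<dots> = (\<Sum>i\<in>UNIV. (\<integral>y. A i (pd i \<rho> (z - y) *\<^sub>R f' y) \<bullet> c \<partial>lborel))"
    by (simp only: ip3)
  also have "\<dots> = (\<integral>y. (\<Sum>i\<in>UNIV. A i (pd i \<rho> (z - y) *\<^sub>R f' y) \<bullet> c) \<partial>lborel)"
    using ip2 by simp
  also have "\<dots> = - (\<integral>y. (\<Sum>i\<in>UNIV. A i (f' y) \<bullet> pd i u y) \<partial>lborel)"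
    by (simp add: pu linear_scale[OF A] sum_negf)
  also have "(\<integral>y. (\<Sum>i\<in>UNIV. A i (f' y) \<bullet> pd i u y) \<partial>lborel) = (\<integral>x. (\<Sum>i\<in>UNIV. A i (f x) \<bullet> pd i u x) \<partial>lebesgue_on \<Omega>)"
  proof (rule integral_lebesgue_on_eq_lborel_AE[OF \<Omega>(1), symmetric])
    have "(\<lambda>y. A i (f' y) \<bullet> pd i u y) \<in> borel_measurable borel" for i
    proof -
      have "A i \<in> borel_measurable borel" by (intro borel_measurable_continuous_onI linear_continuous_on bl)
      from measurable_compose[OF f'(1) this] show ?thesis
        by (intro borel_measurable_inner borel_measurable_continuous_onI[of "pd i u"] smooth_continuous smooth_pd U(1))
    qed
    then show "(\<lambda>y. \<Sum>i\<in>UNIV. A i (f' y) \<bullet> pd i u y) \<in> borel_measurable borel"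
      by (intro borel_measurable_sum)
    show "(\<lambda>x. \<Sum>i\<in>UNIV. A i (f x) \<bullet> pd i u x) \<in> borel_measurable (lebesgue_on \<Omega>)"
      by (intro borel_measurable_sum borel_measurable_inner L2_measurable[OF L2_bounded_linear[OF wL(1) bl]]
          L2_measurable[OF smooth_L2[OF \<Omega> smooth_pd[OF U(1)]]])
    show "AE x in lebesgue_on \<Omega>. (\<Sum>i\<in>UNIV. A i (f x) \<bullet> pd i u x) = (\<Sum>i\<in>UNIV. A i (f' x) \<bullet> pd i u x)"
      using f'(3) by eventually_elim simp
  qed (simp add: f'(2) linear_0[OF A])
  also have "\<dots> = - L2_inner \<Omega> F u" by (rule weak_opD[OF w u])
  also have "L2_inner \<Omega> F u = (\<integral>y. F' y \<bullet> u y \<partial>lborel)"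
    unfolding L2_inner_def
  proof (rule integral_lebesgue_on_eq_lborel_AE[OF \<Omega>(1)])
    show "(\<lambda>y. F' y \<bullet> u y) \<in> borel_measurable borel"
      by (intro borel_measurable_inner F'(1) borel_measurable_continuous_onI[of u] smooth_continuous U(1))
    show "(\<lambda>x. F x \<bullet> u x) \<in> borel_measurable (lebesgue_on \<Omega>)"
      by (intro borel_measurable_inner L2_measurable test_function_L2[OF \<Omega> u] wL)
    show "AE x in lebesgue_on \<Omega>. F x \<bullet> u x = F' x \<bullet> u x"
      using F'(3) by eventually_elim simp
  qed (simp add: F'(2))
  also have "\<dots> = (\<integral>y. (\<rho> (z - y) *\<^sub>R F' y) \<bullet> c \<partial>lborel)" by (simp add: u_def)
  also have "\<dots> = conv \<rho> F' z \<bullet> c"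
    unfolding conv_def by (rule integral_bounded_linear[OF bounded_linear_inner_left conv_integrable[OF k(6,5) F'(4)]])
  finally show "diff_op A (conv \<rho> f') z \<bullet> c = conv \<rho> F' z \<bullet> c" by simp
qed

text \<open>The last hypothesis asks for arbitrarily small kernels, off centre if necessary, with
  two properties. At each point of \<Omega> the averaging ball either lies in \<open>W\<close>,
  where mollification commutes with the operator, or misses the support, where both sides vanish;
  and the support moved by the kernel keeps a positive distance from \<gamma>.\<close>

lemma smoothly_approximable_local:
  fixes A :: "3 \<Rightarrow> 'b::euclidean_space \<Rightarrow> 'c::euclidean_space"
  assumes w: "weak_op A W \<Omega> f F" and \<Omega>: "open \<Omega>" "bounded \<Omega>" and A: "\<And>i. linear (A i)"
    and X: "open X" "\<And>x. x \<in> \<Omega> - X \<Longrightarrow> f x = 0" "\<And>x. x \<in> \<Omega> - X \<Longrightarrow> F x = 0"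
    and shift: "\<And>\<delta>. \<delta> > 0 \<Longrightarrow> \<exists>a r. r > 0 \<and> cball a r \<subseteq> ball 0 \<delta>
        \<and> (\<forall>z\<in>\<Omega>. cball (z - a) r \<subseteq> W \<or> cball (z - a) r \<inter> (X \<inter> \<Omega>) = {})
        \<and> (\<exists>d>0. \<forall>y\<in>X \<inter> \<Omega>. \<forall>s\<in>cball a r. \<forall>g\<in>\<gamma>. d \<le> dist (y + s) g)"
  shows "smoothly_approximable \<gamma> A \<Omega> f F"
  unfolding smoothly_approximable_def
proof (intro allI impI)
  fix e :: real assume e: "e > 0"
  have L: "f \<in> L2 \<Omega>" "F \<in> L2 \<Omega>" using w by (auto simp: weak_op_def)
  have XB: "X \<inter> \<Omega> \<in> sets borel" "X \<inter> \<Omega> \<subseteq> \<Omega>" using X \<Omega> by auto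
  have X': "\<And>x. x \<in> \<Omega> - (X \<inter> \<Omega>) \<Longrightarrow> f x = 0" "\<And>x. x \<in> \<Omega> - (X \<inter> \<Omega>) \<Longrightarrow> F x = 0" using X by auto
  obtain f' where f': "f' \<in> borel_measurable borel" "\<And>x. x \<notin> X \<inter> \<Omega> \<Longrightarrow> f' x = 0"
    "AE x in lebesgue_on \<Omega>. f' x = f x" "integrable lborel (\<lambda>x. (norm (f' x))\<^sup>2)" "integrable lborel f'"
    using L2_borel_representative[OF \<Omega> L(1) XB X'(1)] by blast
  obtain F' where F': "F' \<in> borel_measurable borel" "\<And>x. x \<notin> X \<inter> \<Omega> \<Longrightarrow> F' x = 0"
    "AE x in lebesgue_on \<Omega>. F' x = F x" "integrable lborel (\<lambda>x. (norm (F' x))\<^sup>2)" "integrable lborel F'"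
    using L2_borel_representative[OF \<Omega> L(2) XB X'(2)] by blast
  have bf: "bounded {x. f' x \<noteq> 0}" "bounded {x. F' x \<noteq> 0}"
    using f'(2) F'(2) by (auto intro!: bounded_subset[OF \<Omega>(2)])
  have e2: "e / 2 > 0" using e by simp
  obtain d1 where d1: "d1 > 0" "\<And>\<rho> a r. kernel \<rho> a r \<Longrightarrow> ball a r \<subseteq> ball 0 d1 \<Longrightarrow>
      (\<lambda>x. conv \<rho> f' x - f' x) \<in> L2 UNIV \<and> L2_norm UNIV (\<lambda>x. conv \<rho> f' x - f' x) \<le> e/2"
    using mollify_L2[OF f'(1) bf(1) f'(4,5) e2] by blast
  obtain d2 where d2: "d2 > 0" "\<And>\<rho> a r. kernel \<rho> a r \<Longrightarrow> ball a r \<subseteq> ball 0 d2 \<Longrightarrow>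
      (\<lambda>x. conv \<rho> F' x - F' x) \<in> L2 UNIV \<and> L2_norm UNIV (\<lambda>x. conv \<rho> F' x - F' x) \<le> e/2"
    using mollify_L2[OF F'(1) bf(2) F'(4,5) e2] by blast
  have "min d1 d2 > 0" using d1 d2 by simp
  from shift[OF this] obtain a r d where r: "r > 0" and sub: "cball a r \<subseteq> ball 0 (min d1 d2)"
    and alt: "\<And>z. z \<in> \<Omega> \<Longrightarrow> cball (z - a) r \<subseteq> W \<or> cball (z - a) r \<inter> (X \<inter> \<Omega>) = {}"
    and d: "d > 0" "\<And>y s g. y \<in> X \<inter> \<Omega> \<Longrightarrow> s \<in> cball a r \<Longrightarrow> g \<in> \<gamma> \<Longrightarrow> d \<le> dist (y + s) g" by blast
  obtain \<rho> where \<rho>: "kernel \<rho> a r" using kernel_exists[OF r] by blast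
  note k = kernelD[OF \<rho>]
  have "ball a r \<subseteq> ball 0 (min d1 d2)" using sub ball_subset_cball[of a r] by blast
  then have sub': "ball a r \<subseteq> ball 0 d1" "ball a r \<subseteq> ball 0 d2" by (auto simp: subset_iff)
  define \<phi> where "\<phi> = conv \<rho> f'"
  have sm: "smooth \<phi>" unfolding \<phi>_def by (rule smooth_conv[OF k(1,5) f'(5)])
  have smF: "smooth (conv \<rho> F')" by (rule smooth_conv[OF k(1,5) F'(5)])
  have van: "\<phi> \<in> C_inf_vanishing \<gamma> \<Omega>"
  proof -
    have "d \<le> dist x g" if "x \<in> closure {x \<in> \<Omega>. \<phi> x \<noteq> 0}" "g \<in> \<gamma>" for x g
    proof -
      have "{x \<in> \<Omega>. \<phi> x \<noteq> 0} \<subseteq> {x. d \<le> dist x g}"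
      proof safe
        fix x assume "\<phi> x \<noteq> 0"
        then obtain y s where "f' y \<noteq> 0" "s \<in> ball a r" "x = y + s"
          unfolding \<phi>_def by (rule conv_support[OF \<rho>])
        then show "d \<le> dist x g" using d(2)[of y s g] f'(2)[of y] that(2) by auto
      qed
      moreover have "closed {x. d \<le> dist x g}" by (intro closed_Collect_le continuous_intros)
      ultimately have "closure {x \<in> \<Omega>. \<phi> x \<noteq> 0} \<subseteq> {x. d \<le> dist x g}" by (rule closure_minimal)
      then show ?thesis using that(1) by blast
    qed
    then show ?thesis using sm d(1) by (auto simp: C_inf_vanishing_def)
  qed
  have D: "diff_op A \<phi> z = conv \<rho> F' z" if z: "z \<in> \<Omega>" for z
    using alt[OF z]
  proof
    assume "cball (z - a) r \<subseteq> W"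
    then show ?thesis unfolding \<phi>_def using f'(2) F'(2)
      by (intro diff_op_conv[OF w \<Omega> A f'(1) _ f'(3) f'(5) F'(1) _ F'(3) F'(5) \<rho>]) auto
  next
    assume dj: "cball (z - a) r \<inter> (X \<inter> \<Omega>) = {}"
    have out: "z - y \<notin> cball a r" if "y \<in> X \<inter> \<Omega>" for y
    proof
      assume "z - y \<in> cball a r"
      then have "y \<in> cball (z - a) r" by (simp add: dist_norm algebra_simps norm_minus_commute)
      then show False using dj that by blast
    qed
    have "conv (pd i \<rho>) f' z = 0" for i
    proof -
      have z0: "pd i \<rho> (z - y) *\<^sub>R f' y = 0" for y
        using out[of y] pd_kernel_support[OF \<rho>, of i "z - y"] f'(2)[of y] by (cases "y \<in> X \<inter> \<Omega>") auto
      show ?thesis unfolding conv_def z0 by simp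
    qed
    moreover have "conv \<rho> F' z = 0"
    proof -
      have z0: "\<rho> (z - y) *\<^sub>R F' y = 0" for y
        using out[of y] k(3)[of "z - y"] ball_subset_cball[of a r] F'(2)[of y] by (cases "y \<in> X \<inter> \<Omega>") auto
      show ?thesis unfolding conv_def z0 by simp
    qed
    ultimately show ?thesis
      by (simp add: diff_op_def \<phi>_def pd_conv[OF k(1,5) f'(5)] linear_0[OF A])
  qed
  have 1: "L2_norm \<Omega> (\<lambda>x. f x - \<phi> x) < e"
  proof -
    have "L2_norm \<Omega> (\<lambda>x. f x - \<phi> x) = L2_norm \<Omega> (\<lambda>x. f' x - conv \<rho> f' x)"
    proof (rule L2_norm_cong_AE)
      show "(\<lambda>x. f x - \<phi> x) \<in> borel_measurable (lebesgue_on \<Omega>)"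
        by (intro L2_measurable L2_diff L smooth_L2 \<Omega> sm)
      show "(\<lambda>x. f' x - conv \<rho> f' x) \<in> borel_measurable (lebesgue_on \<Omega>)"
        unfolding \<phi>_def[symmetric]
        by (intro borel_imp_lebesgue_on borel_measurable_diff f' borel_measurable_continuous_onI smooth_continuous sm)
      show "AE x in lebesgue_on \<Omega>. f x - \<phi> x = f' x - conv \<rho> f' x"
        using f'(3) by eventually_elim (simp add: \<phi>_def)
    qed
    also have "\<dots> \<le> L2_norm UNIV (\<lambda>x. f' x - conv \<rho> f' x)"
      using L2_restrict(2)[OF _ \<Omega>(1), of "\<lambda>x. conv \<rho> f' x - f' x"] d1(2)[OF \<rho> sub'(1)]
      by (simp add: L2_norm_minus_commute[of _ f'])
    also have "\<dots> \<le> e/2" using d1(2)[OF \<rho> sub'(1)] by (simp add: L2_norm_minus_commute[of _ f'])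
    finally show ?thesis using e by simp
  qed
  have 2: "L2_norm \<Omega> (\<lambda>x. F x - diff_op A \<phi> x) < e"
  proof -
    have "L2_norm \<Omega> (\<lambda>x. F x - diff_op A \<phi> x) = L2_norm \<Omega> (\<lambda>x. F' x - conv \<rho> F' x)"
    proof (rule L2_norm_cong_AE)
      show "(\<lambda>x. F x - diff_op A \<phi> x) \<in> borel_measurable (lebesgue_on \<Omega>)"
        by (intro L2_measurable L2_diff L smooth_L2 \<Omega> smooth_diff_op A sm)
      show "(\<lambda>x. F' x - conv \<rho> F' x) \<in> borel_measurable (lebesgue_on \<Omega>)"
        by (intro borel_imp_lebesgue_on borel_measurable_diff F' borel_measurable_continuous_onI smooth_continuous smF)
      show "AE x in lebesgue_on \<Omega>. F x - diff_op A \<phi> x = F' x - conv \<rho> F' x"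
        using F'(3) AE_space by eventually_elim (simp add: D)
    qed
    also have "\<dots> \<le> L2_norm UNIV (\<lambda>x. F' x - conv \<rho> F' x)"
      using L2_restrict(2)[OF _ \<Omega>(1), of "\<lambda>x. conv \<rho> F' x - F' x"] d2(2)[OF \<rho> sub'(2)]
      by (simp add: L2_norm_minus_commute[of _ F'])
    also have "\<dots> \<le> e/2" using d2(2)[OF \<rho> sub'(2)] by (simp add: L2_norm_minus_commute[of _ F'])
    finally show ?thesis using e by simp
  qed
  show "\<exists>\<phi>\<in>C_inf_vanishing \<gamma> \<Omega>. L2_norm \<Omega> (\<lambda>x. f x - \<phi> x) < e \<and> L2_norm \<Omega> (\<lambda>x. F x - diff_op A \<phi> x) < e"
    using van 1 2 by blast
qed

text \<open>The indicator of \<open>N\<close> is mollified at scale \<epsilon>. The derivative of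
  the kernel is at most a multiple of \<open>1 / \<epsilon>^4\<close> and is integrated over a ball
  of volume proportional to \<open>\<epsilon>^3\<close>. The constant is the same for every
  \<open>N\<close>.\<close>

lemma smooth_cutoff:
  obtains C where "C > 0"
    "\<And>N \<epsilon>. N \<in> sets borel \<Longrightarrow> bounded N \<Longrightarrow> \<epsilon> > 0 \<Longrightarrow> \<exists>\<theta>::real^3 \<Rightarrow> real. smooth \<theta> \<and> (\<forall>x. 0 \<le> \<theta> x \<and> \<theta> x \<le> 1)
      \<and> (\<forall>x. ball x \<epsilon> \<subseteq> N \<longrightarrow> \<theta> x = 1) \<and> (\<forall>x. ball x \<epsilon> \<inter> N = {} \<longrightarrow> \<theta> x = 0) \<and> (\<forall>i x. \<bar>pd i \<theta> x\<bar> \<le> C / \<epsilon>)"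
proof -
  obtain C where C: "C > 0"
    "\<And>a r. r > 0 \<Longrightarrow> \<exists>\<rho>. kernel \<rho> a r \<and> (\<forall>x v. norm (frechet_derivative \<rho> (at x) v) \<le> C / r^4 * norm v)"
    using kernel_exists_bounded_derivative by blast
  define V where "V = unit_ball_vol (real DIM(real^3))"
  have V: "V > 0" by (simp add: V_def)
  show thesis
  proof (rule that[of "C * V"])
    show "C * V > 0" using C V by simp
    fix N :: "(real^3) set" and \<epsilon> :: real
    assume N: "N \<in> sets borel" "bounded N" and \<epsilon>: "\<epsilon> > 0"
    obtain \<rho> where \<rho>: "kernel \<rho> 0 \<epsilon>" and D: "\<And>x v. norm (frechet_derivative \<rho> (at x) v) \<le> C / \<epsilon>^4 * norm v"
      using C(2)[OF \<epsilon>] by blast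
    note k = kernelD[OF \<rho>]
    define f :: "real^3 \<Rightarrow> real" where "f = indicator N"
    have [measurable]: "f \<in> borel_measurable borel" using N by (simp add: f_def)
    have f: "integrable lborel f"
      unfolding f_def using N emeasure_bounded_lborel_finite[OF N(2)] by (intro integrable_real_indicator) auto
    define \<theta> where "\<theta> = conv \<rho> f"
    have \<theta>: "\<theta> x = (\<integral>s. \<rho> s * f (x - s) \<partial>lborel)" for x
      unfolding \<theta>_def using conv_reflect[OF k(8), of f x] by simp
    have [measurable]: "\<rho> \<in> borel_measurable borel" by (rule k(8))
    have i: "integrable lborel (\<lambda>s. \<rho> s * f (x - s))" for x
    proof (rule Bochner_Integration.integrable_bound[OF k(7)])
      show "(\<lambda>s. \<rho> s * f (x - s)) \<in> borel_measurable lborel" by measurable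
    qed (auto simp: f_def indicator_def)
    have "smooth \<theta>" unfolding \<theta>_def by (rule smooth_conv[OF k(1,5) f])
    moreover have "0 \<le> \<theta> x" for x unfolding \<theta> using k(2) by (intro integral_nonneg_AE) (auto simp: f_def)
    moreover have "\<theta> x \<le> 1" for x
    proof -
      have "\<theta> x \<le> (\<integral>s. \<rho> s \<partial>lborel)"
        unfolding \<theta> using k(2) by (intro integral_mono i k(7)) (auto simp: f_def indicator_def)
      then show ?thesis by (simp add: k(4))
    qed
    moreover have "\<theta> x = 1" if "ball x \<epsilon> \<subseteq> N" for x
    proof -
      have z0: "\<rho> s * f (x - s) = \<rho> s" for s
      proof (cases "\<rho> s = 0")
        case False
        then have "x - s \<in> ball x \<epsilon>" using k(3)[of s] by (simp add: dist_norm)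
        then have "x - s \<in> N" using that by blast
        then show ?thesis by (simp add: f_def)
      qed simp
      show ?thesis unfolding \<theta> z0 by (rule k(4))
    qed
    moreover have "\<theta> x = 0" if "ball x \<epsilon> \<inter> N = {}" for x
    proof -
      have z0: "\<rho> s * f (x - s) = 0" for s
      proof (cases "\<rho> s = 0")
        case False
        then have "x - s \<in> ball x \<epsilon>" using k(3)[of s] by (simp add: dist_norm)
        then have "x - s \<notin> N" using that by blast
        then show ?thesis by (simp add: f_def)
      qed simp
      show ?thesis unfolding \<theta> z0 by simp
    qed
    moreover have "\<bar>pd i \<theta> x\<bar> \<le> C * V / \<epsilon>" for i x
    proof -
      have S: "cball x \<epsilon> \<in> sets lborel" "emeasure lborel (cball x \<epsilon>) < \<infinity>"
        by (simp_all add: emeasure_lborel_cball_finite[unfolded infinity_ennreal_def])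
      have i2: "integrable lborel (\<lambda>y. pd i \<rho> (x - y) *\<^sub>R f y)"
        by (intro conv_integrable smooth_continuous smooth_pd k f)
          (simp add: pd_def bounded_support_frechet_derivative k(5))
      have "pd i \<theta> x = (\<integral>y. pd i \<rho> (x - y) *\<^sub>R f y \<partial>lborel)"
        unfolding \<theta>_def pd_conv[OF k(1,5) f] by (simp add: conv_def)
      also have "norm \<dots> \<le> (\<integral>y. norm (pd i \<rho> (x - y) *\<^sub>R f y) \<partial>lborel)" by (rule integral_norm_bound)
      also have "\<dots> \<le> (\<integral>y. C / \<epsilon>^4 * indicator (cball x \<epsilon>) y \<partial>lborel)"
      proof (rule integral_mono)
        show "integrable lborel (\<lambda>y. norm (pd i \<rho> (x - y) *\<^sub>R f y))" using i2 by (rule integrable_norm)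
        show "integrable lborel (\<lambda>y. C / \<epsilon>^4 * indicator (cball x \<epsilon>) y)"
          using S by (intro integrable_mult_right integrable_real_indicator) auto
        fix y
        have b: "norm (pd i \<rho> (x - y)) \<le> C / \<epsilon>^4" using D[of "x - y" "axis i 1"] by (simp add: pd_def)
        have "norm (pd i \<rho> (x - y) *\<^sub>R f y) \<le> norm (pd i \<rho> (x - y))" by (simp add: f_def indicator_def)
        also have "\<dots> \<le> C / \<epsilon>^4 * indicator (cball x \<epsilon>) y"
        proof (cases "y \<in> cball x \<epsilon>")
          case True
          then show ?thesis using b by simp
        next
          case False
          then have "x - y \<notin> cball 0 \<epsilon>" by (simp add: dist_norm norm_minus_commute)
          then have "pd i \<rho> (x - y) = 0" using pd_kernel_support[OF \<rho>] by blast
          then show ?thesis using False by simp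
        qed
        finally show "norm (pd i \<rho> (x - y) *\<^sub>R f y) \<le> C / \<epsilon>^4 * indicator (cball x \<epsilon>) y" .
      qed
      also have "\<dots> = C / \<epsilon>^4 * measure lborel (cball x \<epsilon>)" by simp
      also have "measure lborel (cball x \<epsilon>) = V * \<epsilon>^3"
        using content_cball[of \<epsilon> x] \<epsilon> by (simp add: V_def)
      also have "C / \<epsilon>^4 * (V * \<epsilon>^3) = C * V / \<epsilon>" using \<epsilon> by (simp add: field_simps eval_nat_numeral)
      finally show ?thesis by simp
    qed
    ultimately show "\<exists>\<theta>::real^3 \<Rightarrow> real. smooth \<theta> \<and> (\<forall>x. 0 \<le> \<theta> x \<and> \<theta> x \<le> 1)
      \<and> (\<forall>x. ball x \<epsilon> \<subseteq> N \<longrightarrow> \<theta> x = 1) \<and> (\<forall>x. ball x \<epsilon> \<inter> N = {} \<longrightarrow> \<theta> x = 0) \<and> (\<forall>i x. \<bar>pd i \<theta> x\<bar> \<le> C * V / \<epsilon>)"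
      by (intro exI[of _ \<theta>]) auto
  qed
qed

lemma ball_cutoff:
  assumes "r > 0"
  obtains \<beta> :: "real^3 \<Rightarrow> real" where "smooth \<beta>" "\<And>y. y \<in> ball x r \<Longrightarrow> \<beta> y = 1" "\<And>y i. y \<in> ball x r \<Longrightarrow> pd i \<beta> y = 0"
    "\<And>y. y \<notin> ball x (2*r) \<Longrightarrow> \<beta> y = 0" "\<And>y i. y \<notin> ball x (2*r) \<Longrightarrow> pd i \<beta> y = 0"
proof -
  obtain C where "C > 0" and C: "\<And>N \<epsilon>. N \<in> sets borel \<Longrightarrow> bounded N \<Longrightarrow> \<epsilon> > 0 \<Longrightarrow> \<exists>\<theta>::real^3 \<Rightarrow> real. smooth \<theta> \<and> (\<forall>x. 0 \<le> \<theta> x \<and> \<theta> x \<le> 1)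
      \<and> (\<forall>x. ball x \<epsilon> \<subseteq> N \<longrightarrow> \<theta> x = 1) \<and> (\<forall>x. ball x \<epsilon> \<inter> N = {} \<longrightarrow> \<theta> x = 0) \<and> (\<forall>i x. \<bar>pd i \<theta> x\<bar> \<le> C / \<epsilon>)"
    by (rule smooth_cutoff, rule that)
  \<comment> \<open>Mollifying the indicator of the ball of radius \<open>5*r/4\<close> at scale
    \<open>r/4\<close> confines the transition to distances between \<open>r\<close> and
    \<open>3*r/2\<close>. The margin up to \<open>2*r\<close> makes the derivatives vanish on the
    sphere of radius \<open>2*r\<close> too.\<close>
  obtain \<beta> :: "real^3 \<Rightarrow> real" where \<beta>: "smooth \<beta>"
    and b1: "\<And>y. ball y (r/4) \<subseteq> ball x (5*r/4) \<Longrightarrow> \<beta> y = 1"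
    and b0: "\<And>y. ball y (r/4) \<inter> ball x (5*r/4) = {} \<Longrightarrow> \<beta> y = 0"
    using C[of "ball x (5*r/4)" "r/4"] assms by auto
  have one: "\<beta> y = 1" if "y \<in> ball x r" for y
    using that by (intro b1) (simp add: ball_subset_ball_iff dist_commute)
  have zero: "\<beta> y = 0" if "dist x y \<ge> 3*r/2" for y
  proof (rule b0, rule ccontr)
    assume "ball y (r/4) \<inter> ball x (5*r/4) \<noteq> {}"
    then obtain z where "dist y z < r/4" "dist x z < 5*r/4" by auto
    then show False using that dist_triangle2[of x y z] by linarith
  qed
  have d1: "pd i \<beta> y = 0" if y: "y \<in> ball x r" for y i
  proof -
    have "(\<beta> has_derivative (\<lambda>v. 0)) (at y)"
    proof (rule has_derivative_transform_within_open[of "\<lambda>x. 1" _ y UNIV "ball x r"])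
      show "((\<lambda>x. 1) has_derivative (\<lambda>v. 0)) (at y)" by (rule has_derivative_const)
    qed (use y one in auto)
    then show ?thesis by (rule pd_eq)
  qed
  have d0: "pd i \<beta> y = 0" if y: "y \<notin> ball x (2*r)" for y i
    unfolding pd_def
  proof (rule frechet_derivative_outside_support)
    have "closure {y. \<beta> y \<noteq> 0} \<subseteq> cball x (3*r/2)"
    proof (rule closure_minimal)
      show "{y. \<beta> y \<noteq> 0} \<subseteq> cball x (3*r/2)" using zero by (metis (mono_tags) linear mem_Collect_eq mem_cball subsetI)
    qed simp
    then show "y \<notin> closure {y. \<beta> y \<noteq> 0}" using y assms by auto
  qed
  show thesis using that[OF \<beta> one d1 _ d0] zero assms by auto
qed

section \<open>Algebra of smooth approximability\<close>

lemma C_inf_vanishing_smooth: "u \<in> C_inf_vanishing \<gamma> \<Omega> \<Longrightarrow> smooth u"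
  by (simp add: C_inf_vanishing_def)

lemma C_inf_vanishing_zero: "(\<lambda>x. 0) \<in> C_inf_vanishing \<gamma> \<Omega>"
  by (simp add: C_inf_vanishing_def smooth_const gt_ex)

lemma C_inf_vanishing_subset:
  assumes "u \<in> C_inf_vanishing \<gamma> \<Omega>" "smooth v" "{x \<in> \<Omega>. v x \<noteq> 0} \<subseteq> closure {x \<in> \<Omega>. u x \<noteq> 0}"
  shows "v \<in> C_inf_vanishing \<gamma> \<Omega>"
proof -
  have "closure {x \<in> \<Omega>. v x \<noteq> 0} \<subseteq> closure {x \<in> \<Omega>. u x \<noteq> 0}"
    using assms(3) by (intro closure_minimal) auto
  then show ?thesis using assms(1,2) unfolding C_inf_vanishing_def by blast
qed

lemma C_inf_vanishing_scaleR:
  assumes "u \<in> C_inf_vanishing \<gamma> \<Omega>"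
  shows "(\<lambda>x. c *\<^sub>R u x) \<in> C_inf_vanishing \<gamma> \<Omega>"
proof (rule C_inf_vanishing_subset[OF assms])
  show "smooth (\<lambda>x. c *\<^sub>R u x)" by (rule smooth_scaleR[OF smooth_const C_inf_vanishing_smooth[OF assms]])
  show "{x \<in> \<Omega>. c *\<^sub>R u x \<noteq> 0} \<subseteq> closure {x \<in> \<Omega>. u x \<noteq> 0}"
    using closure_subset[of "{x \<in> \<Omega>. u x \<noteq> 0}"] by auto
qed

lemma C_inf_vanishing_add:
  assumes "u \<in> C_inf_vanishing \<gamma> \<Omega>" "v \<in> C_inf_vanishing \<gamma> \<Omega>"
  shows "(\<lambda>x. u x + v x) \<in> C_inf_vanishing \<gamma> \<Omega>"
proof -
  obtain d1 d2 where d: "d1 > 0" "d2 > 0"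
    "\<And>x y. x \<in> closure {x \<in> \<Omega>. u x \<noteq> 0} \<Longrightarrow> y \<in> \<gamma> \<Longrightarrow> d1 \<le> dist x y"
    "\<And>x y. x \<in> closure {x \<in> \<Omega>. v x \<noteq> 0} \<Longrightarrow> y \<in> \<gamma> \<Longrightarrow> d2 \<le> dist x y"
    using assms unfolding C_inf_vanishing_def by blast
  have "closure {x \<in> \<Omega>. u x + v x \<noteq> 0} \<subseteq> closure ({x \<in> \<Omega>. u x \<noteq> 0} \<union> {x \<in> \<Omega>. v x \<noteq> 0})"
    by (intro closure_mono) auto
  then have "min d1 d2 \<le> dist x y" if "x \<in> closure {x \<in> \<Omega>. u x + v x \<noteq> 0}" "y \<in> \<gamma>" for x y
    using that d(3)[of x y] d(4)[of x y] by (auto simp: closure_Un min_le_iff_disj)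
  moreover have "min d1 d2 > 0" using d by simp
  moreover have "smooth (\<lambda>x. u x + v x)" by (intro smooth_add C_inf_vanishing_smooth[OF assms(1)] C_inf_vanishing_smooth[OF assms(2)])
  ultimately show ?thesis unfolding C_inf_vanishing_def by blast
qed

lemma diff_op_add:
  assumes "\<And>i. linear (A i)" "smooth u" "smooth v"
  shows "diff_op A (\<lambda>x. u x + v x) x = diff_op A u x + diff_op A v x"
  by (simp add: diff_op_def pd_add[OF assms(2,3)] linear_add[OF assms(1)] sum.distrib)

lemma diff_op_scaleR:
  assumes "\<And>i. linear (A i)" "smooth u"
  shows "diff_op A (\<lambda>x. c *\<^sub>R u x) x = c *\<^sub>R diff_op A u x"
  by (simp add: diff_op_def pd_scaleR[OF smooth_const assms(2)] linear_scale[OF assms(1)] scaleR_sum_right)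

lemma smoothly_approximable_add:
  assumes a: "smoothly_approximable \<gamma> A \<Omega> f F" "smoothly_approximable \<gamma> A \<Omega> g G"
    and L: "f \<in> L2 \<Omega>" "F \<in> L2 \<Omega>" "g \<in> L2 \<Omega>" "G \<in> L2 \<Omega>"
    and \<Omega>: "open \<Omega>" "bounded \<Omega>" and A: "\<And>i. linear (A i)"
  shows "smoothly_approximable \<gamma> A \<Omega> (\<lambda>x. f x + g x) (\<lambda>x. F x + G x)"
  unfolding smoothly_approximable_def
proof (intro allI impI)
  fix e :: real assume "e > 0"
  then have e: "e/2 > 0" by simp
  obtain \<phi> where \<phi>: "\<phi> \<in> C_inf_vanishing \<gamma> \<Omega>" "L2_norm \<Omega> (\<lambda>x. f x - \<phi> x) < e/2" "L2_norm \<Omega> (\<lambda>x. F x - diff_op A \<phi> x) < e/2"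
    using a(1) e unfolding smoothly_approximable_def by blast
  obtain \<psi> where \<psi>: "\<psi> \<in> C_inf_vanishing \<gamma> \<Omega>" "L2_norm \<Omega> (\<lambda>x. g x - \<psi> x) < e/2" "L2_norm \<Omega> (\<lambda>x. G x - diff_op A \<psi> x) < e/2"
    using a(2) e unfolding smoothly_approximable_def by blast
  note s = C_inf_vanishing_smooth[OF \<phi>(1)] C_inf_vanishing_smooth[OF \<psi>(1)]
  have "L2_norm \<Omega> (\<lambda>x. (f x - \<phi> x) + (g x - \<psi> x)) \<le> L2_norm \<Omega> (\<lambda>x. f x - \<phi> x) + L2_norm \<Omega> (\<lambda>x. g x - \<psi> x)"
    by (intro L2_norm_triangle L2_diff L smooth_L2 \<Omega> s)
  moreover have "L2_norm \<Omega> (\<lambda>x. (F x - diff_op A \<phi> x) + (G x - diff_op A \<psi> x)) \<le> L2_norm \<Omega> (\<lambda>x. F x - diff_op A \<phi> x) + L2_norm \<Omega> (\<lambda>x. G x - diff_op A \<psi> x)"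
    by (intro L2_norm_triangle L2_diff L smooth_L2 \<Omega> smooth_diff_op A s)
  ultimately show "\<exists>\<phi>\<in>C_inf_vanishing \<gamma> \<Omega>. L2_norm \<Omega> (\<lambda>x. f x + g x - \<phi> x) < e \<and> L2_norm \<Omega> (\<lambda>x. F x + G x - diff_op A \<phi> x) < e"
    using \<phi> \<psi> by (intro bexI[of _ "\<lambda>x. \<phi> x + \<psi> x"] C_inf_vanishing_add)
      (simp_all add: diff_op_add[OF A s] algebra_simps)
qed

lemma L2_norm_zero_on:
  assumes "\<And>x. x \<in> \<Omega> \<Longrightarrow> f x = 0"
  shows "L2_norm \<Omega> f = 0"
proof -
  have "(\<integral>x. (norm (f x))\<^sup>2 \<partial>lebesgue_on \<Omega>) = (\<integral>x. 0 \<partial>lebesgue_on \<Omega>)"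
    using assms by (intro Bochner_Integration.integral_cong) auto
  then show ?thesis by (simp add: L2_norm_def)
qed

lemma smoothly_approximable_zero:
  assumes "\<And>x. x \<in> \<Omega> \<Longrightarrow> f x = 0" "\<And>x. x \<in> \<Omega> \<Longrightarrow> F x = 0" "\<And>i. linear (A i)"
  shows "smoothly_approximable \<gamma> A \<Omega> f F"
  unfolding smoothly_approximable_def
proof (intro allI impI)
  fix e :: real assume e: "e > 0"
  show "\<exists>\<phi>\<in>C_inf_vanishing \<gamma> \<Omega>. L2_norm \<Omega> (\<lambda>x. f x - \<phi> x) < e \<and> L2_norm \<Omega> (\<lambda>x. F x - diff_op A \<phi> x) < e"
    using e assms(1,2) by (intro bexI[OF _ C_inf_vanishing_zero])
      (simp add: L2_norm_zero_on diff_op_def linear_0[OF assms(3)])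
qed

text \<open>Peeling off one ball at a time replaces a partition of unity: \<open>\<beta> f\<close>
  is supported near the ball and approximable by \<open>loc\<close>, while
  \<open>f - \<beta> f\<close> vanishes on it, so that the remaining balls cover its
  support.\<close>

lemma smoothly_approximable_finite_cover:
  fixes A :: "3 \<Rightarrow> 'b::euclidean_space \<Rightarrow> 'c::euclidean_space"
  assumes \<Omega>: "open \<Omega>" "bounded \<Omega>" and A: "\<And>i. linear (A i)" and fin: "finite K"
    and r: "\<And>x. x \<in> K \<Longrightarrow> r x > 0"
    and loc: "\<And>x f F. x \<in> K \<Longrightarrow> weak_op A W \<Omega> f F \<Longrightarrow> (\<And>y. y \<in> \<Omega> \<inter> Z \<Longrightarrow> f y = 0 \<and> F y = 0) \<Longrightarrow>
        (\<And>y. y \<in> \<Omega> - ball x (2 * r x) \<Longrightarrow> f y = 0 \<and> F y = 0) \<Longrightarrow> smoothly_approximable \<gamma> A \<Omega> f F"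
    and w: "weak_op A W \<Omega> f F" and Z: "\<And>y. y \<in> \<Omega> \<inter> Z \<Longrightarrow> f y = 0 \<and> F y = 0"
    and cover: "\<And>y. y \<in> \<Omega> - (\<Union>x\<in>K. ball x (r x)) \<Longrightarrow> f y = 0 \<and> F y = 0"
  shows "smoothly_approximable \<gamma> A \<Omega> f F"
  using fin r loc w Z cover
proof (induction K arbitrary: f F rule: finite_induct)
  case empty
  then show ?case by (intro smoothly_approximable_zero A) auto
next
  case (insert x K)
  have rx: "r x > 0" using insert.prems(1) by simp
  obtain \<beta> :: "real^3 \<Rightarrow> real" where \<beta>: "smooth \<beta>" "\<And>y. y \<in> ball x (r x) \<Longrightarrow> \<beta> y = 1" "\<And>y i. y \<in> ball x (r x) \<Longrightarrow> pd i \<beta> y = 0"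
    "\<And>y. y \<notin> ball x (2 * r x) \<Longrightarrow> \<beta> y = 0" "\<And>y i. y \<notin> ball x (2 * r x) \<Longrightarrow> pd i \<beta> y = 0"
    using ball_cutoff[OF rx, of x] by blast
  note w = insert.prems(3) and Z = insert.prems(4) and cov = insert.prems(5)
  \<comment> \<open>The order-zero term of the product rule. It vanishes wherever \<open>f\<close>
    does, so the condition on \<open>Z\<close> survives the splitting.\<close>
  define S where "S y = (\<Sum>i\<in>UNIV. pd i \<beta> y *\<^sub>R A i (f y))" for y
  have S0: "S y = 0" if "f y = 0" for y using that by (simp add: S_def linear_0[OF A])
  have w1: "weak_op A W \<Omega> (\<lambda>y. \<beta> y *\<^sub>R f y) (\<lambda>y. \<beta> y *\<^sub>R F y + S y)"
    unfolding S_def by (rule weak_op_mult[OF w \<Omega> A \<beta>(1)])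
  have "smoothly_approximable \<gamma> A \<Omega> (\<lambda>y. \<beta> y *\<^sub>R f y) (\<lambda>y. \<beta> y *\<^sub>R F y + S y)"
  proof (rule insert.prems(2)[OF _ w1])
    show "\<beta> y *\<^sub>R f y = 0 \<and> \<beta> y *\<^sub>R F y + S y = 0" if "y \<in> \<Omega> \<inter> Z" for y using Z[OF that] S0 by simp
    show "\<beta> y *\<^sub>R f y = 0 \<and> \<beta> y *\<^sub>R F y + S y = 0" if "y \<in> \<Omega> - ball x (2 * r x)" for y
      using that \<beta>(4,5) by (simp add: S_def)
  qed simp
  moreover have w2: "weak_op A W \<Omega> (\<lambda>y. f y - \<beta> y *\<^sub>R f y) (\<lambda>y. F y - (\<beta> y *\<^sub>R F y + S y))"
    by (rule weak_op_diff[OF w w1 \<Omega> A])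
  have "smoothly_approximable \<gamma> A \<Omega> (\<lambda>y. f y - \<beta> y *\<^sub>R f y) (\<lambda>y. F y - (\<beta> y *\<^sub>R F y + S y))"
  proof (rule insert.IH[OF _ _ w2])
    show "r z > 0" if "z \<in> K" for z using insert.prems(1) that by simp
    show "smoothly_approximable \<gamma> A \<Omega> g G" if "z \<in> K" "weak_op A W \<Omega> g G"
      "\<And>y. y \<in> \<Omega> \<inter> Z \<Longrightarrow> g y = 0 \<and> G y = 0" "\<And>y. y \<in> \<Omega> - ball z (2 * r z) \<Longrightarrow> g y = 0 \<and> G y = 0" for z g G
      by (rule insert.prems(2)[OF insertI2[OF that(1)] that(2-4)])
    show "f y - \<beta> y *\<^sub>R f y = 0 \<and> F y - (\<beta> y *\<^sub>R F y + S y) = 0" if "y \<in> \<Omega> \<inter> Z" for y using Z[OF that] S0 by simp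
    show "f y - \<beta> y *\<^sub>R f y = 0 \<and> F y - (\<beta> y *\<^sub>R F y + S y) = 0" if y: "y \<in> \<Omega> - (\<Union>x\<in>K. ball x (r x))" for y
    proof (cases "y \<in> ball x (r x)")
      case True
      then show ?thesis using \<beta>(2,3) by (simp add: S_def)
    next
      case False
      then have "f y = 0 \<and> F y = 0" using y by (intro cov) auto
      then show ?thesis using S0 by simp
    qed
  qed
  ultimately have "smoothly_approximable \<gamma> A \<Omega> (\<lambda>y. \<beta> y *\<^sub>R f y + (f y - \<beta> y *\<^sub>R f y)) (\<lambda>y. (\<beta> y *\<^sub>R F y + S y) + (F y - (\<beta> y *\<^sub>R F y + S y)))"
    using w1 w2 by (intro smoothly_approximable_add \<Omega> A) (auto simp: weak_op_def)
  then show ?case by simp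
qed

subsection \<open>Smooth approximation in Lipschitz domains\<close>

text \<open>In the chart at a boundary point, the kernels used below are supported in a ball around a
  multiple of the axis of the chart that lies inside the cone whose aperture is given by the
  Lipschitz constant; shifting by a point of the support moves the graph strictly to one side.\<close>

lemma cone_ball:
  fixes Q :: "real^3 \<Rightarrow> real^3"
  assumes Q: "orthogonal_transformation Q" and e: "Q e = axis 3 1" and L: "L \<ge> 0" and t: "t > 0"
    and s: "s \<in> cball (t *\<^sub>R e) (t / (2 * (L + 1)))"
  shows "Q s $ 3 - L * dist (0::real \<times> real) (Q s $ 1, Q s $ 2) \<ge> t / 2" "norm s \<le> 2 * t"
proof -
  \<comment> \<open>Chosen so that \<open>(L + 1) * \<kappa> = t / 2\<close>: a deviation \<kappa>
    in height together with \<open>L\<close> times the same deviation sideways uses up half of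
    \<open>t\<close>.\<close>
  define \<kappa> where "\<kappa> = t / (2 * (L + 1))"
  have \<kappa>: "\<kappa> > 0" "\<kappa> \<le> t" "(L + 1) * \<kappa> = t / 2"
    using L t by (auto simp: \<kappa>_def field_simps add_increasing)
  have lin: "linear Q" using Q by (rule orthogonal_transformation_linear)
  have ns: "norm (s - t *\<^sub>R e) \<le> \<kappa>" using s by (simp add: \<kappa>_def dist_norm norm_minus_commute)
  then have "norm (Q (s - t *\<^sub>R e)) \<le> \<kappa>" by (simp add: orthogonal_transformation_norm[OF Q])
  moreover have "Q (s - t *\<^sub>R e) = Q s - t *\<^sub>R axis 3 1"
    by (simp add: linear_diff[OF lin] linear_scale[OF lin] e)
  ultimately have n: "norm (Q s - t *\<^sub>R axis 3 1) \<le> \<kappa>" by simp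
  have "\<bar>(Q s - t *\<^sub>R axis 3 1) $ 3\<bar> \<le> \<kappa>" using component_le_norm_cart n order_trans by blast
  then have 3: "Q s $ 3 \<ge> t - \<kappa>" by (simp add: axis_def)
  have "(dist (0::real \<times> real) (Q s $ 1, Q s $ 2))\<^sup>2 = (Q s $ 1)\<^sup>2 + (Q s $ 2)\<^sup>2"
    by (simp add: dist_norm norm_Pair)
  also have "\<dots> \<le> (norm (Q s - t *\<^sub>R axis 3 1))\<^sup>2"
    unfolding power2_norm_eq_inner by (simp add: inner_vec_def sum_3 axis_def power2_eq_square)
  also have "\<dots> \<le> \<kappa>\<^sup>2" using n by (intro power_mono) auto
  finally have "dist (0::real \<times> real) (Q s $ 1, Q s $ 2) \<le> \<kappa>"
    by (rule power2_le_imp_le) (use \<kappa>(1) in simp)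
  then have "L * dist (0::real \<times> real) (Q s $ 1, Q s $ 2) \<le> L * \<kappa>" using L by (rule mult_left_mono)
  then show "Q s $ 3 - L * dist (0::real \<times> real) (Q s $ 1, Q s $ 2) \<ge> t / 2"
    using 3 \<kappa>(3) by (simp add: algebra_simps)
  have "norm e = 1" using orthogonal_transformation_norm[OF Q, of e] e by simp
  then show "norm s \<le> 2 * t"
    using ns \<kappa>(2) t norm_triangle_ineq2[of s "t *\<^sub>R e"] by simp
qed

lemma graph_shift:
  fixes g :: "real \<times> real \<Rightarrow> real" and Q :: "real^3 \<Rightarrow> real^3"
  assumes g: "L-lipschitz_on UNIV g" and Q: "linear Q"
  shows "g (Q (z + s) $ 1, Q (z + s) $ 2) \<ge> g (Q z $ 1, Q z $ 2) - L * dist (0::real \<times> real) (Q s $ 1, Q s $ 2)"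
proof -
  have "dist (Q (z + s) $ 1, Q (z + s) $ 2) (Q z $ 1, Q z $ 2) = dist (0::real \<times> real) (Q s $ 1, Q s $ 2)"
    by (simp add: linear_add[OF Q] dist_norm norm_Pair)
  then have "\<bar>g (Q (z + s) $ 1, Q (z + s) $ 2) - g (Q z $ 1, Q z $ 2)\<bar> \<le> L * dist (0::real \<times> real) (Q s $ 1, Q s $ 2)"
    using lipschitz_onD[OF g, of "(Q (z + s) $ 1, Q (z + s) $ 2)" "(Q z $ 1, Q z $ 2)"] by (simp add: dist_real_def)
  then show ?thesis by linarith
qed

text \<open>Near a boundary point in \<open>W\<close>, kernels centred at
  \<open>- (t *\<^sub>R e)\<close> push the support below the graph, away from \<gamma>. They may
  sample points above the graph, which is harmless because test fields may cross the boundary there.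
  Near a boundary point off \<open>closure \<gamma>\<close>, kernels centred at
  \<open>t *\<^sub>R e\<close> sample only points of \<Omega>. The two centres are opposite, so
  boundary points of \<open>closure \<gamma>\<close> outside \<open>W\<close> have to be absorbed by
  \<open>Z\<close>, near which nothing is left to approximate.\<close>

theorem smoothly_approximable_lipschitz:
  fixes A :: "3 \<Rightarrow> 'b::euclidean_space \<Rightarrow> 'c::euclidean_space"
  assumes \<Omega>: "open \<Omega>" "bounded \<Omega>" "lipschitz_boundary \<Omega>" and A: "\<And>i. linear (A i)"
    and W: "open W" "\<Omega> \<subseteq> W" and Z: "open Z" and \<gamma>: "\<gamma> \<inter> \<Omega> = {}"
    and bd: "\<And>x. x \<in> frontier \<Omega> \<Longrightarrow> x \<in> W \<or> x \<notin> closure \<gamma> \<or> x \<in> Z"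
    and w: "weak_op A W \<Omega> f F" and fZ: "\<And>y. y \<in> \<Omega> \<inter> Z \<Longrightarrow> f y = 0 \<and> F y = 0"
  shows "smoothly_approximable \<gamma> A \<Omega> f F"
proof -
  \<comment> \<open>Quantified over all pairs, since the covering argument applies it to products
    with cutoffs rather than to \<open>f\<close> and \<open>F\<close> themselves.\<close>
  define loc where "loc x r \<longleftrightarrow> r > 0 \<and> (\<forall>f F. weak_op A W \<Omega> f F \<longrightarrow> (\<forall>y\<in>\<Omega> \<inter> Z. f y = 0 \<and> F y = 0) \<longrightarrow>
      (\<forall>y\<in>\<Omega> - ball x (2 * r). f y = 0 \<and> F y = 0) \<longrightarrow> smoothly_approximable \<gamma> A \<Omega> f F)" for x r
  have inside: "\<exists>r. loc x r" if x: "x \<in> \<Omega>" for x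
  proof -
    obtain R where R: "R > 0" "ball x R \<subseteq> \<Omega>" using \<Omega>(1) x open_contains_ball by blast
    \<comment> \<open>Supports lie within radius \<open>2*r\<close>; the remaining
      \<open>2*r\<close> leaves room for the averaging ball and for the distance to
      \<gamma>.\<close>
    define r where "r = R / 4"
    have r: "r > 0" "ball x (4 * r) \<subseteq> \<Omega>" using R by (auto simp: r_def)
    have "loc x r"
      unfolding loc_def
    proof (intro conjI allI impI r(1))
      fix f F assume w: "weak_op A W \<Omega> f F" and f0: "\<forall>y\<in>\<Omega> - ball x (2 * r). f y = 0 \<and> F y = 0"
      show "smoothly_approximable \<gamma> A \<Omega> f F"
      proof (rule smoothly_approximable_local[OF w \<Omega>(1,2) A open_ball[of x "2 * r"]])
        fix \<delta> :: real assume \<delta>: "\<delta> > 0"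
        define q where "q = min (\<delta>/2) (r/2)"
        have q: "q > 0" "q < \<delta>" "q \<le> r/2" using \<delta> r by (auto simp: q_def)
        have sub: "cball 0 q \<subseteq> ball 0 \<delta>" using q by auto
        have "cball (z - 0) q \<subseteq> W \<or> cball (z - 0) q \<inter> (ball x (2*r) \<inter> \<Omega>) = {}" for z
        proof (rule disjCI)
          assume "cball (z - 0) q \<inter> (ball x (2*r) \<inter> \<Omega>) \<noteq> {}"
          then obtain y where y: "dist z y \<le> q" "dist x y < 2*r" by auto
          have "cball z q \<subseteq> ball x (4*r)"
          proof
            fix u assume "u \<in> cball z q"
            then show "u \<in> ball x (4*r)"
              using y q r dist_triangle[of x u y] dist_triangle[of y u z] by (simp add: dist_commute)
          qed
          then show "cball (z - 0) q \<subseteq> W" using r W by auto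
        qed
        moreover have "r \<le> dist (y + s) c" if "y \<in> ball x (2*r) \<inter> \<Omega>" "s \<in> cball 0 q" "c \<in> \<gamma>" for y s c
        proof -
          have "c \<notin> ball x (4*r)" using r \<gamma> that(3) by blast
          moreover have "dist y (y + s) \<le> r/2" using that(2) q by (simp add: dist_norm)
          ultimately show ?thesis
            using that(1) dist_triangle[of x c y] dist_triangle[of y c "y + s"] r by auto
        qed
        ultimately show "\<exists>a q. q > 0 \<and> cball a q \<subseteq> ball 0 \<delta> \<and> (\<forall>z\<in>\<Omega>. cball (z - a) q \<subseteq> W \<or> cball (z - a) q \<inter> (ball x (2*r) \<inter> \<Omega>) = {})
          \<and> (\<exists>d>0. \<forall>y\<in>ball x (2*r) \<inter> \<Omega>. \<forall>s\<in>cball a q. \<forall>g\<in>\<gamma>. d \<le> dist (y + s) g)"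
          using q(1) sub r(1) by (rule_tac exI[of _ 0], rule_tac exI[of _ q]) blast
      qed (use f0 in auto)
    qed
    then show ?thesis by blast
  qed
  have boundary: "\<exists>r. loc x r" if x: "x \<in> frontier \<Omega>" for x
  proof (cases "x \<in> Z")
    case True
    obtain R where R: "R > 0" "ball x R \<subseteq> Z" using Z True open_contains_ball by blast
    have "loc x (R/2)"
      unfolding loc_def
    proof (intro conjI allI impI)
      fix f :: "real^3 \<Rightarrow> 'b" and F :: "real^3 \<Rightarrow> 'c" assume "\<forall>y\<in>\<Omega> \<inter> Z. f y = 0 \<and> F y = 0" "\<forall>y\<in>\<Omega> - ball x (2 * (R/2)). f y = 0 \<and> F y = 0"
      then have "f y = 0 \<and> F y = 0" if "y \<in> \<Omega>" for y using R(2) that by (cases "y \<in> ball x R") auto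
      then show "smoothly_approximable \<gamma> A \<Omega> f F" by (intro smoothly_approximable_zero A) auto
    qed (use R in simp)
    then show ?thesis by blast
  next
    case nZ: False
    obtain U and Q :: "real^3 \<Rightarrow> real^3" and g :: "real \<times> real \<Rightarrow> real" and L
      where U: "open U" "x \<in> U" and Q: "orthogonal_transformation Q" and g: "L-lipschitz_on UNIV g"
        and \<Omega>U: "\<Omega> \<inter> U = {y \<in> U. Q y $ 3 < g (Q y $ 1, Q y $ 2)}"
      using bspec[OF \<Omega>(3)[unfolded lipschitz_boundary_def] x] by (elim exE conjE) (rule that)
    have L: "L \<ge> 0" using g by (rule lipschitz_on_nonneg)
    have lin: "linear Q" using Q by (rule orthogonal_transformation_linear)
    obtain e where e: "Q e = axis 3 1"
      using orthogonal_transformation_surj[OF Q] by (metis surjD)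
    show ?thesis
    proof (cases "x \<in> W")
      case xW: True
      have "open (U \<inter> W)" "x \<in> U \<inter> W" using U W xW by auto
      then obtain R where R: "R > 0" "ball x R \<subseteq> U \<inter> W" by (metis open_contains_ball)
      define r where "r = R / 4"
      have r: "r > 0" "ball x (4 * r) \<subseteq> U" "ball x (4 * r) \<subseteq> W" using R by (auto simp: r_def)
      have "loc x r"
        unfolding loc_def
      proof (intro conjI allI impI r(1))
        fix f F assume w: "weak_op A W \<Omega> f F" and f0: "\<forall>y\<in>\<Omega> - ball x (2 * r). f y = 0 \<and> F y = 0"
        show "smoothly_approximable \<gamma> A \<Omega> f F"
        proof (rule smoothly_approximable_local[OF w \<Omega>(1,2) A open_ball[of x "2 * r"]])
          fix \<delta> :: real assume \<delta>: "\<delta> > 0"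
          define t where "t = min (\<delta>/3) (r/4)"
          have t: "t > 0" "2 * t < \<delta>" "4 * t \<le> r" using \<delta> r by (auto simp: t_def)
          define q where "q = t / (2 * (L + 1))"
          have q: "q > 0" using t L by (simp add: q_def)
          have cone: "- (Q s $ 3) - L * dist (0::real \<times> real) (Q s $ 1, Q s $ 2) \<ge> t / 2" "norm s \<le> 2 * t"
            if "s \<in> cball (- (t *\<^sub>R e)) q" for s
          proof -
            have "- s \<in> cball (t *\<^sub>R e) q" using that by (simp add: dist_norm norm_minus_commute add.commute)
            then have "Q (-s) $ 3 - L * dist (0::real \<times> real) (Q (-s) $ 1, Q (-s) $ 2) \<ge> t / 2" "norm (-s) \<le> 2 * t"
              using cone_ball[OF Q e L t(1), of "-s"] by (simp_all add: q_def)
            then show "- (Q s $ 3) - L * dist (0::real \<times> real) (Q s $ 1, Q s $ 2) \<ge> t / 2" "norm s \<le> 2 * t"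
              by (simp_all add: linear_neg[OF lin] dist_norm norm_Pair)
          qed
          have "cball (z - (- (t *\<^sub>R e))) q \<subseteq> W \<or> cball (z - (- (t *\<^sub>R e))) q \<inter> (ball x (2*r) \<inter> \<Omega>) = {}" for z
          proof (rule disjCI)
            assume "cball (z - (- (t *\<^sub>R e))) q \<inter> (ball x (2*r) \<inter> \<Omega>) \<noteq> {}"
            then obtain y where y: "y \<in> cball (z - (- (t *\<^sub>R e))) q" "dist x y < 2*r" by auto
            have near: "dist z u \<le> 2 * t" if "u \<in> cball (z - (- (t *\<^sub>R e))) q" for u
            proof -
              have "z - u \<in> cball (- (t *\<^sub>R e)) q" using that by (simp add: dist_norm algebra_simps norm_minus_commute)
              then show ?thesis using cone(2) by (simp add: dist_norm)
            qed
            have "cball (z - (- (t *\<^sub>R e))) q \<subseteq> ball x (4*r)"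
            proof
              fix u assume "u \<in> cball (z - (- (t *\<^sub>R e))) q"
              then show "u \<in> ball x (4*r)"
                using near[of u] near[OF y(1)] y(2) t r dist_triangle[of x u y] dist_triangle[of y u z]
                by (simp add: dist_commute)
            qed
            then show "cball (z - (- (t *\<^sub>R e))) q \<subseteq> W" using r by auto
          qed
          \<comment> \<open>If \<open>c\<close> is outside the large ball, the distance is at least
            \<open>r\<close>. Inside it, \<open>y + s\<close> lies at least \<open>t / 2\<close>
            below the graph and \<open>c\<close> on or above it; relative to an
            \<open>L\<close>-Lipschitz graph a vector climbs by at most \<open>L + 1\<close> times
            its length.\<close>
          moreover have "min r (t / (2 * (L + 1))) \<le> dist (y + s) c"
            if y: "y \<in> ball x (2*r) \<inter> \<Omega>" and s: "s \<in> cball (- (t *\<^sub>R e)) q" and c: "c \<in> \<gamma>" for y s c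
          proof (cases "c \<in> ball x (4*r)")
            case False
            moreover have "dist y (y + s) \<le> r" using cone(2)[OF s] t by (simp add: dist_norm)
            ultimately have "r \<le> dist (y + s) c"
              using y dist_triangle[of x c y] dist_triangle[of y c "y + s"] r by auto
            then show ?thesis by simp
          next
            case True
            then have "c \<in> U" "c \<notin> \<Omega>" using r \<gamma> c by auto
            then have cg: "Q c $ 3 \<ge> g (Q c $ 1, Q c $ 2)" using \<Omega>U by force
            have "y \<in> ball x (4*r)" using y r(1) by auto
            then have "y \<in> \<Omega> \<inter> U" using y r(2) by blast
            then have yg: "Q y $ 3 < g (Q y $ 1, Q y $ 2)" unfolding \<Omega>U by simp
            have "g (Q (y + s) $ 1, Q (y + s) $ 2) \<ge> g (Q y $ 1, Q y $ 2) - L * dist (0::real \<times> real) (Q s $ 1, Q s $ 2)"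
              by (rule graph_shift[OF g lin])
            then have zg: "g (Q (y + s) $ 1, Q (y + s) $ 2) - Q (y + s) $ 3 \<ge> t / 2"
              using yg cone(1)[OF s] by (simp add: linear_add[OF lin])
            define v where "v = c - (y + s)"
            have vc: "c = (y + s) + v" by (simp add: v_def)
            have "g (Q c $ 1, Q c $ 2) \<ge> g (Q (y + s) $ 1, Q (y + s) $ 2) - L * dist (0::real \<times> real) (Q v $ 1, Q v $ 2)"
              unfolding vc by (rule graph_shift[OF g lin])
            moreover have "Q c $ 3 = Q (y + s) $ 3 + Q v $ 3" unfolding vc by (simp add: linear_add[OF lin])
            ultimately have "t / 2 \<le> Q v $ 3 + L * dist (0::real \<times> real) (Q v $ 1, Q v $ 2)" using zg cg by linarith
            also have "\<dots> \<le> norm v + L * norm v"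
            proof (intro add_mono mult_left_mono L)
              have nv: "norm (Q v) = norm v" by (rule orthogonal_transformation_norm[OF Q])
              show "Q v $ 3 \<le> norm v" using component_le_norm_cart[of "Q v" 3] nv by linarith
              have "(dist (0::real \<times> real) (Q v $ 1, Q v $ 2))\<^sup>2 \<le> (norm (Q v))\<^sup>2"
                unfolding power2_norm_eq_inner by (simp add: dist_norm norm_Pair inner_vec_def sum_3 power2_eq_square)
              then show "dist (0::real \<times> real) (Q v $ 1, Q v $ 2) \<le> norm v"
                unfolding nv by (rule power2_le_imp_le) simp
            qed
            also have "\<dots> = (L + 1) * dist (y + s) c" by (simp add: v_def dist_norm norm_minus_commute algebra_simps)
            finally have "t / (2 * (L + 1)) \<le> dist (y + s) c" using L by (simp add: field_simps)
            then show ?thesis by simp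
          qed
          moreover have "min r (t / (2 * (L + 1))) > 0" using r t L by simp
          moreover have "cball (- (t *\<^sub>R e)) q \<subseteq> ball 0 \<delta>" using cone(2) t by fastforce
          ultimately show "\<exists>a q. q > 0 \<and> cball a q \<subseteq> ball 0 \<delta> \<and> (\<forall>z\<in>\<Omega>. cball (z - a) q \<subseteq> W \<or> cball (z - a) q \<inter> (ball x (2*r) \<inter> \<Omega>) = {})
            \<and> (\<exists>d>0. \<forall>y\<in>ball x (2*r) \<inter> \<Omega>. \<forall>s\<in>cball a q. \<forall>g\<in>\<gamma>. d \<le> dist (y + s) g)"
            using q by (rule_tac exI[of _ "- (t *\<^sub>R e)"], rule_tac exI[of _ q]) blast
        qed (use f0 in auto)
      qed
      then show ?thesis by blast
    next
      case False
      then have "x \<in> - closure \<gamma>" using bd[OF x] nZ by auto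
      then have "open (U \<inter> - closure \<gamma>)" "x \<in> U \<inter> - closure \<gamma>" using U by auto
      then obtain R where R: "R > 0" "ball x R \<subseteq> U \<inter> - closure \<gamma>" by (metis open_contains_ball)
      define r where "r = R / 4"
      have r: "r > 0" "ball x (4 * r) \<subseteq> U" "ball x (4 * r) \<inter> \<gamma> = {}"
        using R closure_subset[of \<gamma>] by (auto simp: r_def)
      have "loc x r"
        unfolding loc_def
      proof (intro conjI allI impI r(1))
        fix f F assume w: "weak_op A W \<Omega> f F" and f0: "\<forall>y\<in>\<Omega> - ball x (2 * r). f y = 0 \<and> F y = 0"
        show "smoothly_approximable \<gamma> A \<Omega> f F"
        proof (rule smoothly_approximable_local[OF w \<Omega>(1,2) A open_ball[of x "2 * r"]])
          fix \<delta> :: real assume \<delta>: "\<delta> > 0"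
          define t where "t = min (\<delta>/3) (r/4)"
          have t: "t > 0" "2 * t < \<delta>" "4 * t \<le> r" using \<delta> r by (auto simp: t_def)
          define q where "q = t / (2 * (L + 1))"
          have q: "q > 0" using t L by (simp add: q_def)
          have cone: "Q s $ 3 - L * dist (0::real \<times> real) (Q s $ 1, Q s $ 2) \<ge> t / 2" "norm s \<le> 2 * t"
            if "s \<in> cball (t *\<^sub>R e) q" for s
            using cone_ball[OF Q e L t(1), of s] that by (simp_all add: q_def)
          \<comment> \<open>If the averaging ball at \<open>z\<close> meets the support, then
            \<open>z\<close> lies in the chart and below the graph. Subtracting a point of the
            kernel's support lowers it further relative to the graph, so the whole ball stays in
            \<Omega>.\<close>
          have "cball (z - t *\<^sub>R e) q \<subseteq> W \<or> cball (z - t *\<^sub>R e) q \<inter> (ball x (2*r) \<inter> \<Omega>) = {}" if z: "z \<in> \<Omega>" for z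
          proof (rule disjCI)
            assume "cball (z - t *\<^sub>R e) q \<inter> (ball x (2*r) \<inter> \<Omega>) \<noteq> {}"
            then obtain y where y: "y \<in> cball (z - t *\<^sub>R e) q" "dist x y < 2*r" by auto
            have sh: "z - u \<in> cball (t *\<^sub>R e) q" if "u \<in> cball (z - t *\<^sub>R e) q" for u
              using that by (simp add: dist_norm algebra_simps norm_minus_commute)
            have near: "dist z u \<le> 2 * t" if "u \<in> cball (z - t *\<^sub>R e) q" for u
              using cone(2)[OF sh[OF that]] by (simp add: dist_norm)
            have "cball (z - t *\<^sub>R e) q \<subseteq> \<Omega>"
            proof
              fix u assume u: "u \<in> cball (z - t *\<^sub>R e) q"
              have "u \<in> ball x (4*r)" "z \<in> ball x (4*r)"
                using near[OF u] near[OF y(1)] y(2) t r dist_triangle[of x u y] dist_triangle[of y u z] dist_triangle[of x z y]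
                by (simp_all add: dist_commute)
              then have uU: "u \<in> U" "z \<in> U" using r by auto
              have zg: "Q z $ 3 < g (Q z $ 1, Q z $ 2)" using z uU \<Omega>U by auto
              define s where "s = z - u"
              have zs: "u = z + (- s)" by (simp add: s_def)
              have dn: "dist (0::real \<times> real) (Q (-s) $ 1, Q (-s) $ 2) = dist (0::real \<times> real) (Q s $ 1, Q s $ 2)"
                by (simp add: linear_neg[OF lin] dist_norm norm_Pair)
              have "g (Q u $ 1, Q u $ 2) \<ge> g (Q z $ 1, Q z $ 2) - L * dist (0::real \<times> real) (Q s $ 1, Q s $ 2)"
                unfolding dn[symmetric] zs by (rule graph_shift[OF g lin])
              moreover have "Q u $ 3 = Q z $ 3 - Q s $ 3" unfolding zs by (simp add: linear_diff[OF lin])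
              ultimately have "Q u $ 3 < g (Q u $ 1, Q u $ 2)"
                using zg cone(1)[OF sh[OF u]] t(1) unfolding s_def[symmetric] by linarith
              then show "u \<in> \<Omega>" using uU \<Omega>U by auto
            qed
            then show "cball (z - t *\<^sub>R e) q \<subseteq> W" using W by blast
          qed
          moreover have "r \<le> dist (y + s) c"
            if y: "y \<in> ball x (2*r) \<inter> \<Omega>" and s: "s \<in> cball (t *\<^sub>R e) q" and c: "c \<in> \<gamma>" for y s c
          proof -
            have "c \<notin> ball x (4*r)" using r c by auto
            moreover have "dist y (y + s) \<le> r" using cone(2)[OF s] t by (simp add: dist_norm)
            ultimately show "r \<le> dist (y + s) c"
              using y dist_triangle[of x c y] dist_triangle[of y c "y + s"] r by auto
          qed
          moreover have "cball (t *\<^sub>R e) q \<subseteq> ball 0 \<delta>" using cone(2) t by fastforce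
          ultimately show "\<exists>a q. q > 0 \<and> cball a q \<subseteq> ball 0 \<delta> \<and> (\<forall>z\<in>\<Omega>. cball (z - a) q \<subseteq> W \<or> cball (z - a) q \<inter> (ball x (2*r) \<inter> \<Omega>) = {})
            \<and> (\<exists>d>0. \<forall>y\<in>ball x (2*r) \<inter> \<Omega>. \<forall>s\<in>cball a q. \<forall>g\<in>\<gamma>. d \<le> dist (y + s) g)"
            using q r(1) by (rule_tac exI[of _ "t *\<^sub>R e"], rule_tac exI[of _ q]) blast
        qed (use f0 in auto)
      qed
      then show ?thesis by blast
    qed
  qed
  have "\<exists>r. loc x r" if "x \<in> closure \<Omega>" for x
    using that inside boundary \<Omega>(1) by (cases "x \<in> \<Omega>") (auto simp: frontier_def interior_open)
  then obtain r where r: "\<And>x. x \<in> closure \<Omega> \<Longrightarrow> loc x (r x)" by metis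
  have comp: "compact (closure \<Omega>)" using \<Omega>(2) by (simp add: compact_closure)
  have cov: "closure \<Omega> \<subseteq> (\<Union>x\<in>closure \<Omega>. ball x (r x))"
    using r by (auto simp: loc_def)
  obtain K where K: "K \<subseteq> closure \<Omega>" "finite K" "closure \<Omega> \<subseteq> (\<Union>x\<in>K. ball x (r x))"
    by (rule compactE_image[of "closure \<Omega>" "closure \<Omega>" "\<lambda>x. ball x (r x)", OF comp _ cov], simp, rule that)
  show ?thesis
  proof (rule smoothly_approximable_finite_cover[OF \<Omega>(1,2) A K(2) _ _ w fZ])
    show "r x > 0" if "x \<in> K" for x using r K that by (auto simp: loc_def)
    show "smoothly_approximable \<gamma> A \<Omega> f F" if "x \<in> K" "weak_op A W \<Omega> f F" "\<And>y. y \<in> \<Omega> \<inter> Z \<Longrightarrow> f y = 0 \<and> F y = 0"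
      "\<And>y. y \<in> \<Omega> - ball x (2 * r x) \<Longrightarrow> f y = 0 \<and> F y = 0" for x f F
      using r[of x] K that unfolding loc_def by blast
    show "f y = 0 \<and> F y = 0" if "y \<in> \<Omega> - (\<Union>x\<in>K. ball x (r x))" for y
      using that K(3) closure_subset[of \<Omega>] by blast
  qed
qed

section \<open>Gradient, curl and divergence\<close>

definition op_curl :: "3 \<Rightarrow> real^3 \<Rightarrow> real^3" where
  "op_curl i v = cross3 (axis i 1) v"

definition op_grad :: "3 \<Rightarrow> real \<Rightarrow> real^3" where
  "op_grad i q = q *\<^sub>R axis i 1"

definition op_div :: "3 \<Rightarrow> real^3 \<Rightarrow> real" where
  "op_div i v = v $ i"

lemma linear_op_curl: "linear (op_curl i)"
  unfolding op_curl_def by (intro linearI) (auto simp: cross3_simps vec_eq_iff forall_3)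

lemma linear_op_grad: "linear (op_grad i)"
  unfolding op_grad_def by (intro linearI) (auto simp: scaleR_add_left)

lemma linear_op_div: "linear (op_div i)"
  unfolding op_div_def by (intro linearI) auto

text \<open>The minus sign is the skew symmetry of the cross product. It cancels the one in
  \<open>weak_op\<close>, which is why the weak curl is defined without a sign and the weak
  divergence with one.\<close>

lemma inner_classical_curl: "v \<bullet> classical_curl u x = - (\<Sum>i\<in>UNIV. op_curl i v \<bullet> pd i u x)"
  unfolding classical_curl_def Let_def pd_def[symmetric]
  by (simp add: op_curl_def cross3_def inner_vec_def sum_3 axis_def algebra_simps)

lemma diff_op_curl: "diff_op op_curl u x = classical_curl u x"
  unfolding classical_curl_def Let_def pd_def[symmetric]
  by (simp add: diff_op_def op_curl_def cross3_def sum_3 axis_def vec_eq_iff forall_3 algebra_simps)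

lemma diff_op_grad: "diff_op op_grad u x = classical_grad u x"
  unfolding classical_grad_def pd_def[symmetric]
  by (simp add: diff_op_def op_grad_def sum_3 axis_def vec_eq_iff forall_3)

lemma inner_classical_grad: "v \<bullet> classical_grad u x = (\<Sum>i\<in>UNIV. op_div i v \<bullet> pd i u x)"
  unfolding classical_grad_def pd_def[symmetric] by (simp add: op_div_def inner_vec_def sum_3)

lemma op_grad_inner: "(\<Sum>i\<in>UNIV. op_grad i q \<bullet> pd i u x) = q * diff_op op_div u x"
  by (simp add: op_grad_def op_div_def diff_op_def sum_3 inner_axis' algebra_simps)

lemma weak_op_curl_iff:
  "weak_op op_curl \<Omega> \<Omega> v w \<longleftrightarrow> v \<in> L2 \<Omega> \<and> w \<in> L2 \<Omega> \<and> has_weak_curl \<Omega> v w"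
proof -
  have *: "(a = - b) \<longleftrightarrow> (- a = b)" for a b :: real by auto
  show ?thesis by (simp add: weak_op_def * has_weak_curl_def L2_inner_def[of \<Omega> v] inner_classical_curl)
qed

lemma weak_op_div_iff:
  "weak_op op_div \<Omega> \<Omega> v w \<longleftrightarrow> v \<in> L2 \<Omega> \<and> w \<in> L2 \<Omega> \<and> has_weak_div \<Omega> v w"
  by (simp add: weak_op_def has_weak_div_def L2_inner_def[of \<Omega> v] inner_classical_grad)

text \<open>\<open>f\<close> is a weak image of the zero field under the zero operator, so
  \<open>diff_op_conv\<close> makes its mollifications vanish at every point of \<Omega> once the
  scale is small. Their distance from \<open>f\<close> in \<open>L2\<close> is at most
  \<open>e\<close> for all scales considered, and Fatou's lemma then bounds the norm of
  \<open>f\<close> by \<open>e\<close>.\<close>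

lemma fundamental_lemma:
  fixes f :: "real^3 \<Rightarrow> 'b::euclidean_space"
  assumes \<Omega>: "open \<Omega>" "bounded \<Omega>" and f: "f \<in> L2 \<Omega>"
    and 0: "\<And>u. u \<in> test_functions \<Omega> \<Longrightarrow> L2_inner \<Omega> f u = 0"
  shows "AE x in lebesgue_on \<Omega>. f x = 0"
proof -
  define A :: "3 \<Rightarrow> 'b \<Rightarrow> 'b" where "A i v = 0" for i v
  have A: "linear (A i)" for i unfolding A_def by (intro linearI) auto
  have w: "weak_op A \<Omega> \<Omega> (\<lambda>x. 0) f" unfolding weak_op_def using f 0 by (auto simp: A_def L2_zero)
  have B: "\<Omega> \<in> sets borel" using \<Omega> by simp
  obtain f' where f': "f' \<in> borel_measurable borel" "\<And>x. x \<notin> \<Omega> \<Longrightarrow> f' x = 0"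
    "AE x in lebesgue_on \<Omega>. f' x = f x" "integrable lborel (\<lambda>x. (norm (f' x))\<^sup>2)" "integrable lborel f'"
    using L2_borel_representative[OF \<Omega> f B order_refl] by auto
  have bf: "bounded {x. f' x \<noteq> 0}" using f'(2) by (auto intro!: bounded_subset[OF \<Omega>(2)])
  have f'L: "f' \<in> L2 \<Omega>" by (rule L2_cong_AE[OF f borel_imp_lebesgue_on[OF f'(1)] f'(3)])
  have z: "conv \<rho> f' x = 0" if "kernel \<rho> 0 r" "cball x r \<subseteq> \<Omega>" for \<rho> r x
    using diff_op_conv[OF w \<Omega> A _ _ _ _ f'(1,2,3,5) that(1), of "\<lambda>x. 0" x] that(2)
    by (simp add: diff_op_def A_def)
  have "L2_norm \<Omega> f' \<le> 0 + e" if e: "e > 0" for e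
  proof -
    obtain d where d: "d > 0" "\<And>\<rho> a r. kernel \<rho> a r \<Longrightarrow> ball a r \<subseteq> ball 0 d \<Longrightarrow>
      (\<lambda>x. conv \<rho> f' x - f' x) \<in> L2 UNIV \<and> L2_norm UNIV (\<lambda>x. conv \<rho> f' x - f' x) \<le> e"
      using mollify_L2[OF f'(1) bf f'(4,5) e] by blast
    define r where "r n = d / (real n + 1)" for n
    have r: "r n > 0" "r n \<le> d" for n
      using d(1) by (auto simp: r_def field_simps)
    have "\<exists>\<rho>. kernel \<rho> 0 (r n)" for n using kernel_exists[OF r(1)] by metis
    then obtain \<rho> where \<rho>: "\<And>n. kernel (\<rho> n) 0 (r n)" by metis
    have est: "(\<lambda>x. conv (\<rho> n) f' x - f' x) \<in> L2 UNIV \<and> L2_norm UNIV (\<lambda>x. conv (\<rho> n) f' x - f' x) \<le> e" for n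
      by (rule d(2)[OF \<rho>]) (use r(2)[of n] in auto)
    have estO: "(\<lambda>x. conv (\<rho> n) f' x - f' x) \<in> L2 \<Omega>" "L2_norm \<Omega> (\<lambda>x. conv (\<rho> n) f' x - f' x) \<le> e" for n
      using est[of n] L2_restrict[OF _ \<Omega>(1)] order_trans by blast+
    have rlim: "r \<longlonglongrightarrow> 0"
    proof -
      have "(\<lambda>n. d * (1 / real (Suc n))) \<longlonglongrightarrow> d * 0" by (intro tendsto_intros LIMSEQ_Suc[OF lim_1_over_n])
      then show ?thesis by (simp add: r_def[abs_def] add.commute)
    qed
    have lim: "(\<lambda>n. conv (\<rho> n) f' x - f' x) \<longlonglongrightarrow> - f' x" if x: "x \<in> \<Omega>" for x
    proof -
      obtain R where R: "R > 0" "cball x R \<subseteq> \<Omega>" using \<Omega>(1) x open_contains_cball by blast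
      have "eventually (\<lambda>n. r n < R) sequentially" using order_tendstoD(2)[OF rlim R(1)] .
      then have "eventually (\<lambda>n. conv (\<rho> n) f' x - f' x = - f' x) sequentially"
      proof eventually_elim
        case (elim n)
        then have "cball x (r n) \<subseteq> \<Omega>" using R(2) by auto
        then show ?case using z[OF \<rho>] by simp
      qed
      then show ?thesis by (rule tendsto_eventually)
    qed
    have ae: "AE x in lebesgue_on \<Omega>. (\<lambda>n. conv (\<rho> n) f' x - f' x) \<longlonglongrightarrow> - f' x"
      using lim by (intro AE_I2) simp
    have "L2_norm \<Omega> (\<lambda>x. - f' x) \<le> e"
      by (rule L2_Fatou(2)[OF estO(1) _ ae]) (use estO(2) e f'L in \<open>auto intro!: L2_measurable L2_uminus\<close>)
    then show ?thesis by (simp add: L2_norm_minus)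
  qed
  then have "L2_norm \<Omega> f' \<le> 0" by (rule field_le_epsilon)
  then have "L2_norm \<Omega> f' = 0" using L2_norm_nonneg[of \<Omega> f'] by linarith
  from L2_norm_eq_0_AE[OF f'L this] f'(3) show ?thesis by eventually_elim simp
qed

lemma weak_op_unique:
  fixes A :: "3 \<Rightarrow> 'b::euclidean_space \<Rightarrow> 'c::euclidean_space"
  assumes \<Omega>: "open \<Omega>" "bounded \<Omega>" and w: "weak_op A \<Omega> \<Omega> f F" "weak_op A \<Omega> \<Omega> f G"
  shows "AE x in lebesgue_on \<Omega>. F x = G x"
proof -
  have FG: "F \<in> L2 \<Omega>" "G \<in> L2 \<Omega>" using w by (auto simp: weak_op_def)
  have "AE x in lebesgue_on \<Omega>. F x - G x = 0"
  proof (rule fundamental_lemma[OF \<Omega> L2_diff[OF FG]])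
    fix u :: "real^3 \<Rightarrow> 'c" assume u: "u \<in> test_functions \<Omega>"
    have "L2_inner \<Omega> F u = L2_inner \<Omega> G u" using weak_opD[OF w(1) u] weak_opD[OF w(2) u] by simp
    then show "L2_inner \<Omega> (\<lambda>x. F x - G x) u = 0"
      using FG test_function_L2[OF \<Omega> u] by (simp add: L2_inner_diff_left)
  qed
  then show ?thesis by simp
qed

lemma weak_op_cong_AE:
  fixes A :: "3 \<Rightarrow> 'b::euclidean_space \<Rightarrow> 'c::euclidean_space"
  assumes \<Omega>: "open \<Omega>" "bounded \<Omega>" and w: "weak_op A W \<Omega> f F" and G: "G \<in> L2 \<Omega>" "AE x in lebesgue_on \<Omega>. G x = F x"
  shows "weak_op A W \<Omega> f G"
  unfolding weak_op_def
proof (intro conjI ballI)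
  have FL: "f \<in> L2 \<Omega>" "F \<in> L2 \<Omega>" using w by (auto simp: weak_op_def)
  then show "f \<in> L2 \<Omega>" "G \<in> L2 \<Omega>" using G by auto
  fix u :: "real^3 \<Rightarrow> 'c" assume u: "u \<in> test_functions W"
  have uL: "u \<in> L2 \<Omega>" by (rule test_function_L2[OF \<Omega> u])
  have "L2_inner \<Omega> G u = L2_inner \<Omega> F u" by (rule L2_inner_cong_AE[OF FL(2) uL G(1) uL G(2)]) simp
  then show "(\<integral>x. (\<Sum>i\<in>UNIV. A i (f x) \<bullet> pd i u x) \<partial>lebesgue_on \<Omega>) = - L2_inner \<Omega> G u"
    using weak_opD[OF w u] by simp
qed

lemma L2_inner_limit:
  assumes "f \<in> L2 \<Omega>" "g \<in> L2 \<Omega>"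
    and appr: "\<And>e. e > 0 \<Longrightarrow> \<exists>h\<in>L2 \<Omega>. L2_norm \<Omega> (\<lambda>x. f x - h x) < e \<and> L2_inner \<Omega> g h = 0"
  shows "L2_inner \<Omega> g f = 0"
proof -
  define D where "D = L2_norm \<Omega> g + 1"
  have D: "D > 0" by (simp add: D_def add_nonneg_pos)
  have "\<bar>L2_inner \<Omega> g f\<bar> \<le> 0 + e" if e: "e > 0" for e
  proof -
    obtain h where h: "h \<in> L2 \<Omega>" "L2_norm \<Omega> (\<lambda>x. f x - h x) < e / D" "L2_inner \<Omega> g h = 0"
      using appr[of "e / D"] e D by auto
    have "\<bar>L2_inner \<Omega> g f\<bar> = \<bar>L2_inner \<Omega> g (\<lambda>x. f x - h x)\<bar>"
      using assms h by (simp add: L2_inner_diff_right)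
    also have "\<dots> \<le> L2_norm \<Omega> g * L2_norm \<Omega> (\<lambda>x. f x - h x)"
      by (intro L2_Cauchy_Schwarz L2_diff assms h)
    also have "\<dots> \<le> D * (e / D)" using h(2) D by (intro mult_mono) (auto simp: D_def)
    also have "\<dots> = e" using D by simp
    finally show ?thesis by simp
  qed
  then have "\<bar>L2_inner \<Omega> g f\<bar> \<le> 0" by (rule field_le_epsilon)
  then show ?thesis by simp
qed

text \<open>Both sides of the weak identity depend continuously in \<open>L2\<close> on the pair,
  and the identity holds for smooth fields.\<close>

lemma smoothly_approximable_weak_op:
  fixes A :: "3 \<Rightarrow> 'b::euclidean_space \<Rightarrow> 'c::euclidean_space"
  assumes \<Omega>: "open \<Omega>" "bounded \<Omega>" and A: "\<And>i. linear (A i)" and L: "f \<in> L2 \<Omega>" "F \<in> L2 \<Omega>"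
    and a: "smoothly_approximable \<gamma> A \<Omega> f F"
  shows "weak_op A \<Omega> \<Omega> f F"
  unfolding weak_op_def
proof (intro conjI ballI L)
  fix u :: "real^3 \<Rightarrow> 'c" assume u: "u \<in> test_functions \<Omega>"
  note U = test_functionsD[OF u]
  have bl: "bounded_linear (A i)" for i using A by (simp add: linear_conv_bounded_linear)
  have uL: "u \<in> L2 \<Omega>" by (rule test_function_L2[OF \<Omega> u])
  have pL: "pd i u \<in> L2 \<Omega>" for i by (intro smooth_L2 \<Omega> smooth_pd U(1))
  obtain K where K: "\<And>i v. norm (A i v) \<le> norm v * K i" "\<And>i. K i \<ge> 0"
    using bounded_linear.nonneg_bounded[OF bl] by metis
  define q where "q f = (\<Sum>i\<in>UNIV. L2_inner \<Omega> (\<lambda>x. A i (f x)) (pd i u))" for f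
  have q: "(\<integral>x. (\<Sum>i\<in>UNIV. A i (f x) \<bullet> pd i u x) \<partial>lebesgue_on \<Omega>) = q f" if "f \<in> L2 \<Omega>" for f
    unfolding q_def L2_inner_def using that
    by (intro Bochner_Integration.integral_sum L2_inner_integrable L2_bounded_linear[OF _ bl] pL)
  have "q f + L2_inner \<Omega> F u = 0"
  proof -
    \<comment> \<open>Collects the operator bounds against the derivatives of \<open>u\<close> and
      the norm of \<open>u\<close>; the summand 1 makes it positive.\<close>
    define C where "C = (\<Sum>i\<in>UNIV. K i * L2_norm \<Omega> (pd i u)) + L2_norm \<Omega> u + 1"
    have C: "C > 0" unfolding C_def using K(2) by (intro add_nonneg_pos add_nonneg_nonneg sum_nonneg) auto
    have "\<bar>q f + L2_inner \<Omega> F u\<bar> \<le> 0 + e" if e: "e > 0" for e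
    proof -
      have "e / C > 0" using e C by simp
      then obtain \<phi> where \<phi>: "\<phi> \<in> C_inf_vanishing \<gamma> \<Omega>" "L2_norm \<Omega> (\<lambda>x. f x - \<phi> x) < e / C" "L2_norm \<Omega> (\<lambda>x. F x - diff_op A \<phi> x) < e / C"
        using a unfolding smoothly_approximable_def by blast
      note s = C_inf_vanishing_smooth[OF \<phi>(1)]
      have \<phi>L: "\<phi> \<in> L2 \<Omega>" "diff_op A \<phi> \<in> L2 \<Omega>"
        by (intro smooth_L2 \<Omega> s smooth_diff_op A)+
      have w: "q \<phi> = - L2_inner \<Omega> (diff_op A \<phi>) u"
        using weak_opD[OF smooth_weak_op[of \<Omega> A, OF \<Omega> A s] u] q[OF \<phi>L(1)] by simp
      have "q f + L2_inner \<Omega> F u = (\<Sum>i\<in>UNIV. L2_inner \<Omega> (\<lambda>x. A i (f x - \<phi> x)) (pd i u)) + L2_inner \<Omega> (\<lambda>x. F x - diff_op A \<phi> x) u"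
      proof -
        have "(\<Sum>i\<in>UNIV. L2_inner \<Omega> (\<lambda>x. A i (f x - \<phi> x)) (pd i u)) = q f - q \<phi>"
          unfolding q_def sum_subtractf[symmetric]
          by (intro sum.cong refl, subst L2_inner_diff_left[symmetric])
            (auto simp: linear_diff[OF A] intro!: L2_bounded_linear[OF _ bl] L \<phi>L pL)
        moreover have "L2_inner \<Omega> (\<lambda>x. F x - diff_op A \<phi> x) u = L2_inner \<Omega> F u - L2_inner \<Omega> (diff_op A \<phi>) u"
          using L \<phi>L uL by (simp add: L2_inner_diff_left)
        ultimately show ?thesis using w by simp
      qed
      also have "\<bar>\<dots>\<bar> \<le> (\<Sum>i\<in>UNIV. (K i * (e / C)) * L2_norm \<Omega> (pd i u)) + (e / C) * L2_norm \<Omega> u"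
      proof (rule order_trans[OF abs_triangle_ineq add_mono])
        have "\<bar>L2_inner \<Omega> (\<lambda>x. A i (f x - \<phi> x)) (pd i u)\<bar> \<le> (K i * (e / C)) * L2_norm \<Omega> (pd i u)" for i
        proof -
          have dL: "(\<lambda>x. f x - \<phi> x) \<in> L2 \<Omega>" by (intro L2_diff L \<phi>L)
          have "L2_norm \<Omega> (\<lambda>x. A i (f x - \<phi> x)) \<le> L2_norm \<Omega> (\<lambda>x. K i *\<^sub>R (f x - \<phi> x))"
            using K by (intro L2_norm_mono_AE L2_bounded_linear[OF _ bl] L2_scaleR dL) (auto simp: mult.commute)
          also have "\<dots> = K i * L2_norm \<Omega> (\<lambda>x. f x - \<phi> x)" using K(2) by (simp add: L2_norm_scaleR)
          also have "\<dots> \<le> K i * (e / C)" using K(2) \<phi>(2) by (intro mult_left_mono) auto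
          finally have *: "L2_norm \<Omega> (\<lambda>x. A i (f x - \<phi> x)) \<le> K i * (e / C)" .
          have "\<bar>L2_inner \<Omega> (\<lambda>x. A i (f x - \<phi> x)) (pd i u)\<bar> \<le> L2_norm \<Omega> (\<lambda>x. A i (f x - \<phi> x)) * L2_norm \<Omega> (pd i u)"
            by (rule L2_Cauchy_Schwarz[OF L2_bounded_linear[OF dL bl] pL])
          also have "\<dots> \<le> (K i * (e / C)) * L2_norm \<Omega> (pd i u)" using * by (intro mult_right_mono) auto
          finally show ?thesis .
        qed
        then show "\<bar>\<Sum>i\<in>UNIV. L2_inner \<Omega> (\<lambda>x. A i (f x - \<phi> x)) (pd i u)\<bar> \<le> (\<Sum>i\<in>UNIV. (K i * (e / C)) * L2_norm \<Omega> (pd i u))"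
          by (intro order_trans[OF sum_abs] sum_mono)
        have "\<bar>L2_inner \<Omega> (\<lambda>x. F x - diff_op A \<phi> x) u\<bar> \<le> L2_norm \<Omega> (\<lambda>x. F x - diff_op A \<phi> x) * L2_norm \<Omega> u"
          by (intro L2_Cauchy_Schwarz L2_diff L \<phi>L uL)
        also have "\<dots> \<le> (e / C) * L2_norm \<Omega> u" using \<phi>(3) by (intro mult_right_mono) auto
        finally show "\<bar>L2_inner \<Omega> (\<lambda>x. F x - diff_op A \<phi> x) u\<bar> \<le> (e / C) * L2_norm \<Omega> u" .
      qed
      also have "\<dots> = (e / C) * ((\<Sum>i\<in>UNIV. K i * L2_norm \<Omega> (pd i u)) + L2_norm \<Omega> u)"
        by (simp add: sum_distrib_left algebra_simps)
      also have "\<dots> \<le> (e / C) * C" using e C by (intro mult_left_mono) (auto simp: C_def)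
      also have "\<dots> = e" using C by simp
      finally show ?thesis by simp
    qed
    then have "\<bar>q f + L2_inner \<Omega> F u\<bar> \<le> 0" by (rule field_le_epsilon)
    then show ?thesis by simp
  qed
  then show "(\<integral>x. (\<Sum>i\<in>UNIV. A i (f x) \<bullet> pd i u x) \<partial>lebesgue_on \<Omega>) = - L2_inner \<Omega> F u"
    using q[OF L(1)] by linarith
qed

lemma smoothly_approximable_closed:
  fixes A :: "3 \<Rightarrow> 'b::euclidean_space \<Rightarrow> 'c::euclidean_space"
  assumes \<Omega>: "open \<Omega>" "bounded \<Omega>" and f: "f \<in> L2 \<Omega>"
    and appr: "\<And>e. e > 0 \<Longrightarrow> \<exists>g\<in>L2 \<Omega>. smoothly_approximable \<gamma> A \<Omega> g F \<and> L2_norm \<Omega> (\<lambda>x. f x - g x) < e"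
  shows "smoothly_approximable \<gamma> A \<Omega> f F"
  unfolding smoothly_approximable_def
proof (intro allI impI)
  fix e :: real assume e: "e > 0"
  then obtain g where g: "g \<in> L2 \<Omega>" "smoothly_approximable \<gamma> A \<Omega> g F" "L2_norm \<Omega> (\<lambda>x. f x - g x) < e/2"
    using appr[of "e/2"] by auto
  have "e/2 > 0" using e by simp
  then obtain \<phi> where \<phi>: "\<phi> \<in> C_inf_vanishing \<gamma> \<Omega>" "L2_norm \<Omega> (\<lambda>x. g x - \<phi> x) < e/2" "L2_norm \<Omega> (\<lambda>x. F x - diff_op A \<phi> x) < e/2"
    using g(2) unfolding smoothly_approximable_def by blast
  have "L2_norm \<Omega> (\<lambda>x. f x - \<phi> x) \<le> L2_norm \<Omega> (\<lambda>x. f x - g x) + L2_norm \<Omega> (\<lambda>x. g x - \<phi> x)"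
    by (intro L2_norm_triangle_diff f g smooth_L2 \<Omega> C_inf_vanishing_smooth[OF \<phi>(1)])
  then show "\<exists>\<phi>\<in>C_inf_vanishing \<gamma> \<Omega>. L2_norm \<Omega> (\<lambda>x. f x - \<phi> x) < e \<and> L2_norm \<Omega> (\<lambda>x. F x - diff_op A \<phi> x) < e"
    using \<phi> g(3) e by (intro bexI[of _ \<phi>]) auto
qed

section \<open>Truncation of weakly differentiable functions\<close>

lemma L2_borel_representative_extend:
  fixes f :: "real^3 \<Rightarrow> 'b::euclidean_space"
  assumes \<Omega>: "open \<Omega>" "bounded \<Omega>" and f: "f \<in> L2 \<Omega>"
  obtains f' where "f' \<in> borel_measurable borel" "\<And>x. x \<notin> \<Omega> \<Longrightarrow> f' x = 0"
    "AE x in lebesgue_on \<Omega>. f' x = f x" "integrable lborel (\<lambda>x. (norm (f' x))\<^sup>2)" "integrable lborel f'"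
proof -
  have B: "\<Omega> \<in> sets borel" and z: "\<And>x. x \<in> \<Omega> - \<Omega> \<Longrightarrow> f x = 0" using \<Omega> by auto
  show thesis by (rule L2_borel_representative[OF \<Omega> f B order_refl z]) (simp, rule that)
qed

lemma continuous_bounded_support_L2:
  fixes h :: "real^3 \<Rightarrow> 'b::euclidean_space"
  assumes "continuous_on UNIV h" "bounded {x. h x \<noteq> 0}"
  shows "h \<in> L2 UNIV"
proof -
  have "integrable lborel (\<lambda>x. (norm (h x))\<^sup>2)"
    using assms by (intro integrable_continuous_bounded_support continuous_intros) auto
  then show ?thesis using assms by (simp add: L2_UNIV_iff borel_measurable_continuous_onI)
qed

text \<open>\<open>q\<close> and \<open>w\<close> are extended by zero and mollified at a scale that
  keeps the averaging balls around the support of the test field inside \<open>W\<close>; there the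
  classical chain rule holds, and it passes to the limit. The condition \<open>\<psi> 0 = 0\<close>
  keeps the composition zero outside \<Omega>, and the Lipschitz bound on \<open>\<psi>'\<close>
  turns \<open>L2\<close> convergence of the argument into \<open>L2\<close> convergence of the
  derivative factor.\<close>

lemma weak_op_grad_compose:
  fixes \<psi> \<psi>' :: "real \<Rightarrow> real"
  assumes \<Omega>: "open \<Omega>" "bounded \<Omega>" and W: "open W" and w: "weak_op op_grad W \<Omega> q w"
    and \<psi>: "\<And>s. (\<psi> has_real_derivative \<psi>' s) (at s)" and \<psi>0: "\<psi> 0 = 0"
    and b: "\<And>s. \<bar>\<psi>' s\<bar> \<le> 1" and K: "K \<ge> 0" "\<And>s t. \<bar>\<psi>' s - \<psi>' t\<bar> \<le> K * \<bar>s - t\<bar>"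
  shows "weak_op op_grad W \<Omega> (\<lambda>x. \<psi> (q x)) (\<lambda>x. \<psi>' (q x) *\<^sub>R w x)"
  unfolding weak_op_def
proof (intro conjI ballI)
  have qL: "q \<in> L2 \<Omega>" "w \<in> L2 \<Omega>" using w by (auto simp: weak_op_def)
  have lip: "\<bar>\<psi> s - \<psi> t\<bar> \<le> \<bar>s - t\<bar>" for s t
  proof -
    have "norm (\<psi> s - \<psi> t) \<le> 1 * norm (s - t)"
      by (rule field_differentiable_bound[of UNIV \<psi> \<psi>']) (use \<psi> b in \<open>auto intro: has_field_derivative_at_within\<close>)
    then show ?thesis by simp
  qed
  have \<psi>b: "\<bar>\<psi> s\<bar> \<le> \<bar>s\<bar>" for s using lip[of s 0] by (simp add: \<psi>0)
  have cont: "continuous_on UNIV \<psi>" using \<psi> by (auto intro!: continuous_at_imp_continuous_on DERIV_isCont)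
  have cont': "continuous_on UNIV \<psi>'"
  proof (rule lipschitz_on_continuous_on)
    show "K-lipschitz_on UNIV \<psi>'" using K by (intro lipschitz_onI) (auto simp: dist_real_def)
  qed
  have [measurable]: "\<psi> \<in> borel_measurable borel" "\<psi>' \<in> borel_measurable borel"
    using cont cont' by (auto intro: borel_measurable_continuous_onI)
  have mq: "q \<in> borel_measurable (lebesgue_on \<Omega>)" and mw: "w \<in> borel_measurable (lebesgue_on \<Omega>)"
    using qL L2_measurable by auto
  have m1: "(\<lambda>x. \<psi> (q x)) \<in> borel_measurable (lebesgue_on \<Omega>)"
    by (rule measurable_compose[OF mq]) simp
  have m1': "(\<lambda>x. \<psi>' (q x)) \<in> borel_measurable (lebesgue_on \<Omega>)"
    by (rule measurable_compose[OF mq]) simp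
  have m2: "(\<lambda>x. \<psi>' (q x) *\<^sub>R w x) \<in> borel_measurable (lebesgue_on \<Omega>)"
    by (rule borel_measurable_scaleR[OF m1' mw])
  have scb: "norm (\<psi>' s *\<^sub>R v) \<le> norm v" for s and v :: "real^3"
    using b[of s] by (simp add: mult_left_le_one_le)
  show gL: "(\<lambda>x. \<psi> (q x)) \<in> L2 \<Omega>"
    by (rule L2_dominated[OF m1 qL(1), of 1]) (simp add: \<psi>b)
  show GL: "(\<lambda>x. \<psi>' (q x) *\<^sub>R w x) \<in> L2 \<Omega>"
    by (rule L2_dominated[OF m2 qL(2), of 1]) (use scb in simp)
  fix u :: "real^3 \<Rightarrow> real^3" assume u: "u \<in> test_functions W"
  note U = test_functionsD[OF u]
  define D where "D = diff_op op_div u"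
  have sD: "smooth D" unfolding D_def by (rule smooth_diff_op[OF linear_op_div U(1)])
  have bD: "bounded {x. D x \<noteq> 0}"
  proof -
    have D0: "D x = 0" if "\<And>i. pd i u x = 0" for x using that by (simp add: D_def diff_op_def op_div_def)
    have "{x. D x \<noteq> 0} \<subseteq> (\<Union>i\<in>UNIV. {x. pd i u x \<noteq> 0})"
      using D0 by blast
    moreover have "bounded (\<Union>i\<in>UNIV. {x. pd i u x \<noteq> 0})" using U(5) by (intro bounded_UN) auto
    ultimately show ?thesis using bounded_subset by blast
  qed
  have DL: "D \<in> L2 UNIV" by (rule continuous_bounded_support_L2[OF smooth_continuous[OF sD] bD])
  have uL: "u \<in> L2 UNIV" by (rule continuous_bounded_support_L2[OF smooth_continuous[OF U(1)] U(2)])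
  obtain Bu where Bu: "Bu > 0" "\<And>x. norm (u x) \<le> Bu"
    using bounded_image_bounded_support[OF smooth_continuous[OF U(1)] U(2)] by blast
  obtain q' where q': "q' \<in> borel_measurable borel" "\<And>x. x \<notin> \<Omega> \<Longrightarrow> q' x = 0"
    "AE x in lebesgue_on \<Omega>. q' x = q x" "integrable lborel (\<lambda>x. (norm (q' x))\<^sup>2)" "integrable lborel q'"
    by (rule L2_borel_representative_extend[OF \<Omega> qL(1)], rule that)
  obtain w' where w': "w' \<in> borel_measurable borel" "\<And>x. x \<notin> \<Omega> \<Longrightarrow> w' x = 0"
    "AE x in lebesgue_on \<Omega>. w' x = w x" "integrable lborel (\<lambda>x. (norm (w' x))\<^sup>2)" "integrable lborel w'"
    by (rule L2_borel_representative_extend[OF \<Omega> qL(2)], rule that)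
  have bq: "bounded {x. q' x \<noteq> 0}" "bounded {x. w' x \<noteq> 0}"
    using q'(2) w'(2) by (auto intro!: bounded_subset[OF \<Omega>(2)])
  have q'L: "q' \<in> L2 UNIV" "w' \<in> L2 UNIV" using L2_UNIV_iff[OF q'(1)] q'(4) L2_UNIV_iff[OF w'(1)] w'(4) by auto
  note mU = borel_imp_lebesgue_on
  have \<psi>L: "(\<lambda>x. \<psi> (h x)) \<in> L2 UNIV" if "h \<in> borel_measurable borel" "h \<in> L2 UNIV" for h :: "real^3 \<Rightarrow> real"
    by (rule L2_dominated[OF mU[OF measurable_compose[OF that(1)]] that(2), of \<psi> 1]) (simp_all add: \<psi>b)
  have \<psi>'L: "(\<lambda>x. \<psi>' (h x) *\<^sub>R v x) \<in> L2 UNIV" if "h \<in> borel_measurable borel" "v \<in> borel_measurable borel" "v \<in> L2 UNIV"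
    for h :: "real^3 \<Rightarrow> real" and v :: "real^3 \<Rightarrow> real^3"
    by (rule L2_dominated[OF mU[OF borel_measurable_scaleR[OF measurable_compose[OF that(1)] that(2)]] that(3), of \<psi>' 1])
      (use scb in simp_all)
  define a1 a2 where "a1 = L2_inner UNIV (\<lambda>x. \<psi> (q' x)) D" and "a2 = L2_inner UNIV (\<lambda>x. \<psi>' (q' x) *\<^sub>R w' x) u"
  have zero: "a1 + a2 = 0"
  proof -
    \<comment> \<open>Collects the coefficients of \<open>e'\<close> in the three error terms below,
      with 1 added for positivity.\<close>
    define C where "C = L2_norm UNIV D + K * (Bu * L2_norm UNIV w') + L2_norm UNIV u + 1"
    have C: "C > 0" unfolding C_def using K Bu by (intro add_nonneg_pos add_nonneg_nonneg mult_nonneg_nonneg) auto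
    have "\<bar>a1 + a2\<bar> \<le> 0 + e" if e: "e > 0" for e
    proof -
      have eC: "e / C > 0" using e C by simp
      define e' where "e' = e / C"
      have e': "e' > 0" using eC by (simp add: e'_def)
      obtain d1 where d1: "d1 > 0" "\<And>\<rho> a r. kernel \<rho> a r \<Longrightarrow> ball a r \<subseteq> ball 0 d1 \<Longrightarrow>
        (\<lambda>x. conv \<rho> q' x - q' x) \<in> L2 UNIV \<and> L2_norm UNIV (\<lambda>x. conv \<rho> q' x - q' x) \<le> e'"
        using mollify_L2[OF q'(1) bq(1) q'(4,5) e'] by blast
      obtain d2 where d2: "d2 > 0" "\<And>\<rho> a r. kernel \<rho> a r \<Longrightarrow> ball a r \<subseteq> ball 0 d2 \<Longrightarrow>
        (\<lambda>x. conv \<rho> w' x - w' x) \<in> L2 UNIV \<and> L2_norm UNIV (\<lambda>x. conv \<rho> w' x - w' x) \<le> e'"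
        using mollify_L2[OF w'(1) bq(2) w'(4,5) e'] by blast
      have "compact (closure {x. u x \<noteq> 0})" "closure {x. u x \<noteq> 0} \<subseteq> W" using u by (auto simp: test_functions_def)
      then obtain d3 where d3: "d3 > 0" "(\<Union>x\<in>closure {x. u x \<noteq> 0}. cball x d3) \<subseteq> W"
        using compact_subset_open_imp_cball_epsilon_subset[OF _ W] by metis
      define r where "r = min d1 (min d2 d3)"
      have r: "r > 0" "r \<le> d1" "r \<le> d2" "r \<le> d3" using d1 d2 d3 by (auto simp: r_def)
      obtain \<rho> where \<rho>: "kernel \<rho> 0 r" using kernel_exists[OF r(1)] by blast
      note k = kernelD[OF \<rho>]
      define \<phi> \<omega> where "\<phi> = conv \<rho> q'" and "\<omega> = conv \<rho> w'"
      have s\<phi>: "smooth \<phi>" unfolding \<phi>_def by (rule smooth_conv[OF k(1,5) q'(5)])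
      have s\<omega>: "smooth \<omega>" unfolding \<omega>_def by (rule smooth_conv[OF k(1,5) w'(5)])
      have m\<phi>: "\<phi> \<in> borel_measurable borel" by (intro borel_measurable_continuous_onI smooth_continuous s\<phi>)
      have m\<omega>: "\<omega> \<in> borel_measurable borel" by (intro borel_measurable_continuous_onI smooth_continuous s\<omega>)
      have 1: "(\<lambda>x. \<phi> x - q' x) \<in> L2 UNIV" "L2_norm UNIV (\<lambda>x. \<phi> x - q' x) \<le> e'"
        using d1(2)[OF \<rho> subset_ball[OF r(2)]] by (auto simp: \<phi>_def)
      have 2: "(\<lambda>x. \<omega> x - w' x) \<in> L2 UNIV" "L2_norm UNIV (\<lambda>x. \<omega> x - w' x) \<le> e'"
        using d2(2)[OF \<rho> subset_ball[OF r(3)]] by (auto simp: \<omega>_def)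
      have \<phi>L: "\<phi> \<in> L2 UNIV" using L2_add[OF 1(1) q'L(1)] by simp
      have \<omega>L: "\<omega> \<in> L2 UNIV" using L2_add[OF 2(1) q'L(2)] by simp
      have grad: "pd i \<phi> z = \<omega> z $ i" if "u z \<noteq> 0" for i z
      proof -
        have "z \<in> closure {x. u x \<noteq> 0}" using that closure_subset[of "{x. u x \<noteq> 0}"] by auto
        then have "cball (z - 0) r \<subseteq> W" using d3(2) r(4) subset_cball[of r d3 z] by auto
        then have "diff_op op_grad \<phi> z = \<omega> z"
          unfolding \<phi>_def \<omega>_def
          by (intro diff_op_conv[OF w \<Omega> linear_op_grad q'(1,2,3,5) w'(1,2,3,5) \<rho>])
        then have "classical_grad \<phi> z $ i = \<omega> z $ i" by (simp add: diff_op_grad)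
        then show ?thesis by (simp add: classical_grad_def pd_def)
      qed
      define b1 b2 where "b1 = L2_inner UNIV (\<lambda>x. \<psi> (\<phi> x)) D" and "b2 = L2_inner UNIV (\<lambda>x. \<psi>' (\<phi> x) *\<^sub>R \<omega> x) u"
      have parts: "b1 + b2 = 0"
      proof -
        \<comment> \<open>The components of the field \<open>\<psi>(\<phi>) u\<close>. It has
          compact support, so its divergence integrates to zero; as \<psi> is only once continuously
          differentiable, the version of integration by parts for \<open>C_k (Suc 0)\<close> is
          needed.\<close>
        define g where "g i x = \<psi> (\<phi> x) * (u x $ i)" for i x
        have su: "smooth (\<lambda>x. u x $ i)" for i by (rule smooth_bounded_linear_comp[OF U(1) bounded_linear_vec_nth])
        have c\<psi>: "continuous_on UNIV (\<lambda>x. \<psi> (\<phi> x))" "continuous_on UNIV (\<lambda>x. \<psi>' (\<phi> x))"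
          using continuous_on_compose2[OF cont smooth_continuous[OF s\<phi>]] continuous_on_compose2[OF cont' smooth_continuous[OF s\<phi>]] by auto
        have "((\<lambda>x. \<psi> (\<phi> x)) has_derivative (\<lambda>v. \<psi>' (\<phi> x) * frechet_derivative \<phi> (at x) v)) (at x)" for x
          using has_derivative_compose[OF smooth_has_derivative[OF s\<phi>] \<psi>[unfolded has_field_derivative_def]] by simp
        from has_derivative_mult[OF this smooth_has_derivative[OF su]]
        have dg: "(g i has_derivative (\<lambda>v. \<psi> (\<phi> x) * frechet_derivative (\<lambda>x. u x $ i) (at x) v
            + \<psi>' (\<phi> x) * frechet_derivative \<phi> (at x) v * (u x $ i))) (at x)" for i x
          unfolding g_def .
        have C1: "C_k (Suc 0) (g i)" for i
          by (rule C_k_SucI[OF dg], simp only: C_k.simps(1))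
            (intro continuous_on_add continuous_on_mult c\<psi> smooth_continuous[OF smooth_frechet_derivative[OF su]]
              smooth_continuous[OF smooth_frechet_derivative[OF s\<phi>]] smooth_continuous[OF su])
        have bg: "bounded {x. g i x \<noteq> 0}" for i
          by (rule bounded_subset[OF U(2)]) (auto simp: g_def)
        have pg: "pd i (g i) x = \<psi> (\<phi> x) * (pd i u x $ i) + \<psi>' (\<phi> x) * (\<omega> x $ i) * (u x $ i)" for i x
        proof -
          have "pd i (\<lambda>x. u x $ i) x = pd i u x $ i" by (rule pd_bounded_linear[OF U(1) bounded_linear_vec_nth])
          then have "pd i (g i) x = \<psi> (\<phi> x) * (pd i u x $ i) + \<psi>' (\<phi> x) * pd i \<phi> x * (u x $ i)"
            unfolding pd_eq[OF dg] by (simp add: pd_def)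
          moreover have "pd i \<phi> x * (u x $ i) = \<omega> x $ i * (u x $ i)" using grad[of x i] by (cases "u x = 0") auto
          ultimately show ?thesis by (simp add: mult.assoc)
        qed
        have "continuous_on UNIV (\<lambda>x. pd i (g i) x)" for i using C1[of i] by (simp add: pd_def)
        then have ig: "integrable lborel (pd i (g i))" for i
          unfolding pd_def by (intro integrable_continuous_bounded_support bounded_support_frechet_derivative bg) simp
        have "(\<integral>x. (\<Sum>i\<in>UNIV. pd i (g i) x) \<partial>lborel) = (\<Sum>i\<in>UNIV. \<integral>x. pd i (g i) x \<partial>lborel)"
          using ig by (intro Bochner_Integration.integral_sum) auto
        also have "\<dots> = 0"
          unfolding pd_def using integral_frechet_derivative_eq_0[OF C1 bg] by simp
        finally have "(\<integral>x. (\<Sum>i\<in>UNIV. pd i (g i) x) \<partial>lborel) = 0" .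
        moreover have "(\<Sum>i\<in>UNIV. pd i (g i) x) = \<psi> (\<phi> x) \<bullet> D x + (\<psi>' (\<phi> x) *\<^sub>R \<omega> x) \<bullet> u x" for x
          unfolding pg by (simp add: D_def diff_op_def op_div_def sum_3 inner_vec_def algebra_simps)
        moreover have "(\<integral>x. (\<Sum>i\<in>UNIV. pd i (g i) x) \<partial>lborel) = (\<integral>x. (\<Sum>i\<in>UNIV. pd i (g i) x) \<partial>lebesgue_on UNIV)"
          using ig by (intro integral_lebesgue_on_eq_lborel[symmetric] borel_measurable_sum) auto
        ultimately have "(\<integral>x. \<psi> (\<phi> x) \<bullet> D x + (\<psi>' (\<phi> x) *\<^sub>R \<omega> x) \<bullet> u x \<partial>lebesgue_on UNIV) = 0" by simp
        then show ?thesis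
          unfolding b1_def b2_def L2_inner_def
          using L2_inner_integrable[OF \<psi>L[OF m\<phi> \<phi>L] DL] L2_inner_integrable[OF \<psi>'L[OF m\<phi> m\<omega> \<omega>L] uL]
          by (subst (asm) Bochner_Integration.integral_add) simp_all
      qed
      have "\<bar>a1 - b1\<bar> \<le> e' * L2_norm UNIV D"
      proof -
        have "a1 - b1 = L2_inner UNIV (\<lambda>x. \<psi> (q' x) - \<psi> (\<phi> x)) D"
          unfolding a1_def b1_def using \<psi>L[OF q'(1) q'L(1)] \<psi>L[OF m\<phi> \<phi>L] DL by (simp add: L2_inner_diff_left)
        also have "\<bar>\<dots>\<bar> \<le> L2_norm UNIV (\<lambda>x. \<psi> (q' x) - \<psi> (\<phi> x)) * L2_norm UNIV D"
          by (intro L2_Cauchy_Schwarz L2_diff \<psi>L q' q'L m\<phi> \<phi>L DL)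
        also have "\<dots> \<le> e' * L2_norm UNIV D"
        proof (rule mult_right_mono)
          have "L2_norm UNIV (\<lambda>x. \<psi> (q' x) - \<psi> (\<phi> x)) \<le> L2_norm UNIV (\<lambda>x. \<phi> x - q' x)"
            using lip by (intro L2_norm_mono_AE L2_diff \<psi>L q' q'L m\<phi> \<phi>L) (auto simp: abs_minus_commute)
          then show "L2_norm UNIV (\<lambda>x. \<psi> (q' x) - \<psi> (\<phi> x)) \<le> e'" using 1(2) by linarith
        qed simp
        finally show ?thesis .
      qed
      moreover have "\<bar>a2 - b2\<bar> \<le> e' * (K * (Bu * L2_norm UNIV w')) + e' * L2_norm UNIV u"
      proof -
        define h where "h x = \<psi>' (q' x) - \<psi>' (\<phi> x)" for x
        have mh: "h \<in> borel_measurable borel" unfolding h_def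
          by (intro borel_measurable_diff measurable_compose[OF q'(1)] measurable_compose[OF m\<phi>]) auto
        have hb: "\<bar>h x\<bar> \<le> K * \<bar>\<phi> x - q' x\<bar>" for x using K(2)[of "q' x" "\<phi> x"] by (simp add: h_def abs_minus_commute)
        have hL: "h \<in> L2 UNIV" by (rule L2_dominated[OF mU[OF mh] 1(1), of K]) (use hb in simp)
        have "L2_norm UNIV h \<le> L2_norm UNIV (\<lambda>x. K *\<^sub>R (\<phi> x - q' x))"
          using hb K by (intro L2_norm_mono_AE hL L2_scaleR 1) (auto simp: abs_mult)
        also have "\<dots> = K * L2_norm UNIV (\<lambda>x. \<phi> x - q' x)" using K by (simp add: L2_norm_scaleR del: real_scaleR_def)
        also have "\<dots> \<le> K * e'" using K 1(2) by (intro mult_left_mono)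
        finally have hn: "L2_norm UNIV h \<le> K * e'" .
        have mwu: "(\<lambda>x. w' x \<bullet> u x) \<in> borel_measurable borel"
          by (intro borel_measurable_inner w' borel_measurable_continuous_onI[of u] smooth_continuous U)
        have wub: "norm (w' x \<bullet> u x) \<le> Bu * norm (w' x)" for x
        proof -
          have "norm (w' x \<bullet> u x) \<le> norm (w' x) * norm (u x)" by (simp add: Cauchy_Schwarz_ineq2)
          also have "\<dots> \<le> norm (w' x) * Bu" using Bu by (intro mult_left_mono) auto
          finally show ?thesis by (simp add: mult.commute)
        qed
        have wuL: "(\<lambda>x. w' x \<bullet> u x) \<in> L2 UNIV" by (rule L2_dominated[OF mU[OF mwu] q'L(2), of Bu]) (use wub in simp)
        have wun: "L2_norm UNIV (\<lambda>x. w' x \<bullet> u x) \<le> Bu * L2_norm UNIV w'"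
        proof -
          have "L2_norm UNIV (\<lambda>x. w' x \<bullet> u x) \<le> L2_norm UNIV (\<lambda>x. Bu *\<^sub>R w' x)"
            using wub Bu by (intro L2_norm_mono_AE wuL L2_scaleR q'L) auto
          then show ?thesis using Bu by (simp add: L2_norm_scaleR)
        qed
        have "a2 - b2 = L2_inner UNIV (\<lambda>x. \<psi>' (q' x) *\<^sub>R w' x - \<psi>' (\<phi> x) *\<^sub>R \<omega> x) u"
          unfolding a2_def b2_def using \<psi>'L[OF q'(1) w'(1) q'L(2)] \<psi>'L[OF m\<phi> m\<omega> \<omega>L] uL by (simp add: L2_inner_diff_left)
        \<comment> \<open>Split so that each product contains one convergent factor: the difference
          of the derivatives meets the fixed \<open>w'\<close>, and the bounded derivative meets the
          small \<open>\<omega> - w'\<close>.\<close>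
        also have "(\<lambda>x. \<psi>' (q' x) *\<^sub>R w' x - \<psi>' (\<phi> x) *\<^sub>R \<omega> x) = (\<lambda>x. h x *\<^sub>R w' x - \<psi>' (\<phi> x) *\<^sub>R (\<omega> x - w' x))"
          by (auto simp: h_def algebra_simps)
        also have "L2_inner UNIV (\<lambda>x. h x *\<^sub>R w' x - \<psi>' (\<phi> x) *\<^sub>R (\<omega> x - w' x)) u
          = L2_inner UNIV h (\<lambda>x. w' x \<bullet> u x) - L2_inner UNIV (\<lambda>x. \<psi>' (\<phi> x) *\<^sub>R (\<omega> x - w' x)) u"
          using L2_inner_integrable[OF hL wuL]
            L2_inner_integrable[OF \<psi>'L[OF m\<phi> borel_measurable_diff[OF m\<omega> w'(1)] 2(1)] uL]
          unfolding L2_inner_def by (simp add: inner_diff_left)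
        also have "\<bar>\<dots>\<bar> \<le> \<bar>L2_inner UNIV h (\<lambda>x. w' x \<bullet> u x)\<bar> + \<bar>L2_inner UNIV (\<lambda>x. \<psi>' (\<phi> x) *\<^sub>R (\<omega> x - w' x)) u\<bar>"
          by (rule abs_triangle_ineq4)
        also have "\<dots> \<le> (K * e') * (Bu * L2_norm UNIV w') + e' * L2_norm UNIV u"
        proof (rule add_mono)
          have "\<bar>L2_inner UNIV h (\<lambda>x. w' x \<bullet> u x)\<bar> \<le> L2_norm UNIV h * L2_norm UNIV (\<lambda>x. w' x \<bullet> u x)"
            by (rule L2_Cauchy_Schwarz[OF hL wuL])
          also have "\<dots> \<le> (K * e') * (Bu * L2_norm UNIV w')" using hn wun K e' by (intro mult_mono) auto
          finally show "\<bar>L2_inner UNIV h (\<lambda>x. w' x \<bullet> u x)\<bar> \<le> (K * e') * (Bu * L2_norm UNIV w')" .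
          have l: "(\<lambda>x. \<psi>' (\<phi> x) *\<^sub>R (\<omega> x - w' x)) \<in> L2 UNIV" by (rule \<psi>'L[OF m\<phi> borel_measurable_diff[OF m\<omega> w'(1)] 2(1)])
          have "L2_norm UNIV (\<lambda>x. \<psi>' (\<phi> x) *\<^sub>R (\<omega> x - w' x)) \<le> L2_norm UNIV (\<lambda>x. \<omega> x - w' x)"
            using scb by (intro L2_norm_mono_AE l 2) auto
          then have ln: "L2_norm UNIV (\<lambda>x. \<psi>' (\<phi> x) *\<^sub>R (\<omega> x - w' x)) \<le> e'" using 2(2) by linarith
          have "\<bar>L2_inner UNIV (\<lambda>x. \<psi>' (\<phi> x) *\<^sub>R (\<omega> x - w' x)) u\<bar> \<le> L2_norm UNIV (\<lambda>x. \<psi>' (\<phi> x) *\<^sub>R (\<omega> x - w' x)) * L2_norm UNIV u"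
            by (rule L2_Cauchy_Schwarz[OF l uL])
          also have "\<dots> \<le> e' * L2_norm UNIV u" using ln by (intro mult_right_mono) auto
          finally show "\<bar>L2_inner UNIV (\<lambda>x. \<psi>' (\<phi> x) *\<^sub>R (\<omega> x - w' x)) u\<bar> \<le> e' * L2_norm UNIV u" .
        qed
        finally show ?thesis by (simp add: mult_ac)
      qed
      ultimately have "\<bar>a1 + a2\<bar> \<le> e' * (L2_norm UNIV D + K * (Bu * L2_norm UNIV w') + L2_norm UNIV u)"
        using parts by (simp add: algebra_simps)
      also have "\<dots> \<le> e' * C" using e' by (intro mult_left_mono) (auto simp: C_def)
      also have "\<dots> = e" using C by (simp add: e'_def)
      finally show ?thesis by simp
    qed
    then have "\<bar>a1 + a2\<bar> \<le> 0" by (rule field_le_epsilon)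
    then show ?thesis by simp
  qed
  have uLO: "u \<in> L2 \<Omega>" by (rule test_function_L2[OF \<Omega> u])
  have mD: "D \<in> borel_measurable borel" by (intro borel_measurable_continuous_onI smooth_continuous sD)
  have mu: "u \<in> borel_measurable borel" by (intro borel_measurable_continuous_onI smooth_continuous U)
  have b1: "(\<lambda>x. \<psi> (q' x) * D x) \<in> borel_measurable borel"
    by (intro borel_measurable_times mD measurable_compose[OF q'(1)]) simp
  have b2: "(\<lambda>x. (\<psi>' (q' x) *\<^sub>R w' x) \<bullet> u x) \<in> borel_measurable borel"
    by (intro borel_measurable_inner borel_measurable_scaleR mu w' measurable_compose[OF q'(1)]) simp
  have "(\<integral>x. (\<Sum>i\<in>UNIV. op_grad i (\<psi> (q x)) \<bullet> pd i u x) \<partial>lebesgue_on \<Omega>) = (\<integral>x. \<psi> (q x) * D x \<partial>lebesgue_on \<Omega>)"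
    by (simp add: op_grad_inner D_def)
  also have "\<dots> = (\<integral>x. \<psi> (q' x) * D x \<partial>lborel)"
  proof (rule integral_lebesgue_on_eq_lborel_AE[OF \<Omega>(1) b1])
    show "(\<lambda>x. \<psi> (q x) * D x) \<in> borel_measurable (lebesgue_on \<Omega>)"
      by (intro borel_measurable_times m1 borel_imp_lebesgue_on mD)
    show "AE x in lebesgue_on \<Omega>. \<psi> (q x) * D x = \<psi> (q' x) * D x" using q'(3) by eventually_elim simp
  qed (simp add: q'(2) \<psi>0)
  also have "\<dots> = a1"
    unfolding a1_def L2_inner_def inner_real_def
    by (rule integral_lebesgue_on_eq_lborel[OF open_UNIV b1, symmetric]) simp
  also have "\<dots> = - a2" using zero by simp
  also have "a2 = (\<integral>x. (\<psi>' (q' x) *\<^sub>R w' x) \<bullet> u x \<partial>lborel)"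
    unfolding a2_def L2_inner_def by (rule integral_lebesgue_on_eq_lborel[OF open_UNIV b2]) simp
  also have "\<dots> = L2_inner \<Omega> (\<lambda>x. \<psi>' (q x) *\<^sub>R w x) u"
    unfolding L2_inner_def
  proof (rule integral_lebesgue_on_eq_lborel_AE[OF \<Omega>(1) b2, symmetric])
    show "(\<lambda>x. (\<psi>' (q x) *\<^sub>R w x) \<bullet> u x) \<in> borel_measurable (lebesgue_on \<Omega>)"
      by (intro borel_measurable_inner m2 borel_imp_lebesgue_on mu)
    show "AE x in lebesgue_on \<Omega>. (\<psi>' (q x) *\<^sub>R w x) \<bullet> u x = (\<psi>' (q' x) *\<^sub>R w' x) \<bullet> u x"
      using q'(3) w'(3) by eventually_elim simp
  qed (simp add: w'(2))
  finally show "(\<integral>x. (\<Sum>i\<in>UNIV. op_grad i (\<psi> (q x)) \<bullet> pd i u x) \<partial>lebesgue_on \<Omega>) = - L2_inner \<Omega> (\<lambda>x. \<psi>' (q x) *\<^sub>R w x) u" .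
qed

text \<open>A smooth substitute for cutting off the values at height \<open>n\<close>: it is bounded
  by \<open>n * pi / 2\<close>, its slope is positive, at most 1 and Lipschitz with constant
  \<open>1 / n\<close>, and it tends to the identity as \<open>n\<close> grows.\<close>

lemma weak_op_grad_truncate:
  assumes \<Omega>: "open \<Omega>" "bounded \<Omega>" and W: "open W" and w: "weak_op op_grad W \<Omega> q w" and n: "n > 0"
  shows "weak_op op_grad W \<Omega> (\<lambda>x. n * arctan (q x / n)) (\<lambda>x. inverse (1 + (q x / n)\<^sup>2) *\<^sub>R w x)"
proof (rule weak_op_grad_compose[OF \<Omega> W w])
  show "((\<lambda>s. n * arctan (s / n)) has_real_derivative inverse (1 + (s / n)\<^sup>2)) (at s)" for s
    using n by (auto intro!: derivative_eq_intros)
  show "n * arctan (0 / n) = 0" by simp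
  have pos: "1 + a\<^sup>2 > 0" for a :: real by (simp add: add_pos_nonneg)
  show "\<bar>inverse (1 + (s / n)\<^sup>2)\<bar> \<le> 1" for s
    using pos[of "s / n"] by (simp add: inverse_le_1_iff)
  show "0 \<le> 1 / n" using n by simp
  show "\<bar>inverse (1 + (s / n)\<^sup>2) - inverse (1 + (t / n)\<^sup>2)\<bar> \<le> 1 / n * \<bar>s - t\<bar>" for s t
  proof -
    define a b where "a = s / n" and "b = t / n"
    have half: "\<bar>c\<bar> \<le> (1 + c\<^sup>2) / 2" for c :: real
      using sum_squares_bound[of 1 "\<bar>c\<bar>"] by simp
    have "inverse (1 + a\<^sup>2) - inverse (1 + b\<^sup>2) = (b - a) * (a + b) / ((1 + a\<^sup>2) * (1 + b\<^sup>2))"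
      using pos[of a] pos[of b] by (simp add: field_simps power2_eq_square)
    also have "\<bar>\<dots>\<bar> = \<bar>a - b\<bar> * (\<bar>a + b\<bar> / ((1 + a\<^sup>2) * (1 + b\<^sup>2)))"
      using pos[of a] pos[of b] by (simp add: abs_mult abs_minus_commute)
    also have "\<dots> \<le> \<bar>a - b\<bar> * 1"
    proof (rule mult_left_mono)
      have "\<bar>a + b\<bar> \<le> (1 + a\<^sup>2) / 2 + (1 + b\<^sup>2) / 2" using half[of a] half[of b] by linarith
      also have "\<dots> \<le> (1 + a\<^sup>2) * (1 + b\<^sup>2)"
      proof -
        have eq: "(1 + a\<^sup>2) * (1 + b\<^sup>2) = 1 + a\<^sup>2 + b\<^sup>2 + a\<^sup>2 * b\<^sup>2" by (simp add: algebra_simps)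
        have "a\<^sup>2 * b\<^sup>2 \<ge> 0" "a\<^sup>2 \<ge> 0" "b\<^sup>2 \<ge> 0" by auto
        then show ?thesis unfolding eq by (simp add: field_simps)
      qed
      finally show "\<bar>a + b\<bar> / ((1 + a\<^sup>2) * (1 + b\<^sup>2)) \<le> 1" using pos[of a] pos[of b] by (simp add: divide_le_eq_1)
    qed simp
    also have "\<bar>a - b\<bar> * 1 = 1 / n * \<bar>s - t\<bar>"
      using n by (simp add: a_def b_def diff_divide_distrib[symmetric])
    finally show ?thesis by (simp add: a_def b_def)
  qed
qed

section \<open>The interface has zero capacity\<close>

definition nbhd :: "real \<Rightarrow> (real^3) set \<Rightarrow> (real^3) set" where
  "nbhd \<epsilon> S = (\<Union>y\<in>S. ball y \<epsilon>)"

lemma mem_nbhd: "x \<in> nbhd \<epsilon> S \<longleftrightarrow> (\<exists>y\<in>S. dist x y < \<epsilon>)"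
  by (auto simp: nbhd_def dist_commute)

lemma open_nbhd: "open (nbhd \<epsilon> S)"
  by (auto simp: nbhd_def)

lemma bounded_nbhd:
  assumes "bounded S"
  shows "bounded (nbhd \<epsilon> S)"
proof -
  obtain B where B: "\<And>y. y \<in> S \<Longrightarrow> norm y \<le> B" using assms unfolding bounded_iff by blast
  have "norm x \<le> B + \<epsilon>" if x: "x \<in> nbhd \<epsilon> S" for x
  proof -
    obtain y where y: "y \<in> S" "dist x y < \<epsilon>" using x unfolding mem_nbhd by blast
    then show ?thesis using B[OF y(1)] norm_triangle_ineq2[of x y] by (simp add: dist_norm)
  qed
  then show ?thesis unfolding bounded_iff by blast
qed

text \<open>The inverse of \<open>h\<close> on \<open>S\<close> is Lipschitz, so \<open>S\<close> is
  at most one-dimensional: the cells of length \<epsilon> in the range of \<open>h\<close> number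
  about \<open>1 / \<epsilon>\<close>, and the part of the neighbourhood belonging to each cell fits
  in a ball of radius \<open>(L + 1) * \<epsilon>\<close>. The total volume is of order
  \<open>\<epsilon>^3 / \<epsilon>\<close>.\<close>

lemma volume_nbhd_curve:
  fixes h :: "real^3 \<Rightarrow> real"
  assumes S: "bounded S" and M: "\<And>y. y \<in> S \<Longrightarrow> \<bar>h y\<bar> \<le> M" and L: "L \<ge> 0"
    and lip: "\<And>y z. y \<in> S \<Longrightarrow> z \<in> S \<Longrightarrow> dist y z \<le> L * \<bar>h y - h z\<bar>"
  obtains C where "C \<ge> 0" "\<And>\<epsilon>. 0 < \<epsilon> \<Longrightarrow> \<epsilon> \<le> 1 \<Longrightarrow> measure lborel (nbhd \<epsilon> S) \<le> C * \<epsilon>\<^sup>2"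
proof -
  define M' where "M' = \<bar>M\<bar>"
  have M': "M' \<ge> 0" "\<And>y. y \<in> S \<Longrightarrow> \<bar>h y\<bar> \<le> M'" using M by (auto simp: M'_def intro: order_trans[OF _ abs_ge_self])
  define V where "V = unit_ball_vol (real DIM(real^3))"
  have V: "V \<ge> 0" by (simp add: V_def)
  define C where "C = (2 * M' + 4) * (V * (L + 1)^3)"
  have C: "C \<ge> 0" unfolding C_def using M' V L by (intro mult_nonneg_nonneg) auto
  have "measure lborel (nbhd \<epsilon> S) \<le> C * \<epsilon>\<^sup>2" if \<epsilon>: "0 < \<epsilon>" "\<epsilon> \<le> 1" for \<epsilon>
  proof -
    define m where "m = \<lceil>M' / \<epsilon>\<rceil>"
    \<comment> \<open>A point of \<open>S\<close> in the cell with index \<open>k\<close>. For an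
      empty cell the choice is arbitrary, and its ball merely enlarges the cover.\<close>
    define c where "c k = (SOME y. y \<in> S \<and> \<lfloor>h y / \<epsilon>\<rfloor> = k)" for k :: int
    define B where "B k = ball (c k) ((L + 1) * \<epsilon>)" for k
    have sub: "nbhd \<epsilon> S \<subseteq> (\<Union>k\<in>{-m-1..m}. B k)"
    proof
      fix x assume "x \<in> nbhd \<epsilon> S"
      then obtain y where y: "y \<in> S" "dist x y < \<epsilon>" unfolding mem_nbhd by blast
      define k where "k = \<lfloor>h y / \<epsilon>\<rfloor>"
      have ck: "c k \<in> S \<and> \<lfloor>h (c k) / \<epsilon>\<rfloor> = k"
        unfolding c_def by (rule someI[of _ y]) (simp add: y k_def)
      have "\<bar>h y / \<epsilon> - h (c k) / \<epsilon>\<bar> \<le> 1"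
        using ck unfolding k_def by linarith
      then have "\<bar>h y - h (c k)\<bar> \<le> \<epsilon>"
        using \<epsilon>(1) by (simp add: diff_divide_distrib[symmetric] abs_divide divide_le_eq_1)
      then have "dist y (c k) \<le> L * \<epsilon>" using lip[OF y(1)] ck L by (meson mult_left_mono order_trans)
      then have "dist (c k) x < (L + 1) * \<epsilon>"
        using y(2) dist_triangle[of "c k" x y] by (simp add: algebra_simps dist_commute)
      moreover have "k \<in> {-m-1..m}"
      proof -
        have "\<bar>h y / \<epsilon>\<bar> \<le> M' / \<epsilon>" using M'(2)[OF y(1)] \<epsilon>(1) by (simp add: divide_right_mono)
        then show ?thesis unfolding k_def m_def by (simp, linarith)
      qed
      ultimately show "x \<in> (\<Union>k\<in>{-m-1..m}. B k)" by (auto simp: B_def)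
    qed
    have meas: "measure lborel (B k) = V * ((L + 1) * \<epsilon>)^3" for k
      unfolding B_def V_def using content_ball[of "(L + 1) * \<epsilon>" "c k"] L \<epsilon> by simp
    have fin: "(\<Union>k\<in>{-m-1..m}. B k) \<in> fmeasurable lborel"
    proof -
      have "bounded (\<Union>k\<in>{-m-1..m}. B k)" by (intro bounded_UN) (auto simp: B_def)
      then show ?thesis
        unfolding fmeasurable_def using emeasure_bounded_finite by (auto simp: B_def)
    qed
    have "measure lborel (nbhd \<epsilon> S) \<le> measure lborel (\<Union>k\<in>{-m-1..m}. B k)"
      by (rule measure_mono_fmeasurable[OF sub _ fin]) (simp add: open_nbhd)
    also have "\<dots> \<le> (\<Sum>k\<in>{-m-1..m}. measure lborel (B k))"
      by (rule measure_UNION_le) (auto simp: B_def)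
    also have "\<dots> = real_of_int (2 * m + 2) * (V * ((L + 1) * \<epsilon>)^3)"
    proof -
      have "M' / \<epsilon> \<ge> 0" using M' \<epsilon> by simp
      then have "m \<ge> 0" unfolding m_def by linarith
      then show ?thesis by (simp add: meas)
    qed
    also have "\<dots> \<le> ((2 * M' + 4) / \<epsilon>) * (V * ((L + 1) * \<epsilon>)^3)"
    proof (rule mult_right_mono)
      \<comment> \<open>There are \<open>2 * m + 2\<close> indices, and
        \<open>\<epsilon> \<le> 1\<close> turns the constant 4 into
        \<open>4 / \<epsilon>\<close>.\<close>
      have "real_of_int m \<le> M' / \<epsilon> + 1" unfolding m_def by linarith
      then have "real_of_int (2 * m + 2) \<le> 2 * (M' / \<epsilon>) + 4" by simp
      also have "\<dots> \<le> 2 * (M' / \<epsilon>) + 4 / \<epsilon>" using \<epsilon> by (simp add: field_simps)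
      also have "\<dots> = (2 * M' + 4) / \<epsilon>" by (simp add: add_divide_distrib)
      finally show "real_of_int (2 * m + 2) \<le> (2 * M' + 4) / \<epsilon>" .
    qed (use V L \<epsilon> in simp)
    also have "\<dots> = ((2 * M' + 4) * (V * (L + 1)^3)) * \<epsilon>\<^sup>2"
      using \<epsilon> by (simp add: power_mult_distrib eval_nat_numeral)
    finally show ?thesis by (simp add: C_def)
  qed
  then show thesis using that C by blast
qed

text \<open>Finitely many local parametrisations suffice, and the neighbourhood of a union is the
  union of the neighbourhoods.\<close>

lemma volume_nbhd_compact:
  assumes I: "compact I"
    and loc: "\<And>x. x \<in> I \<Longrightarrow> \<exists>V (h :: real^3 \<Rightarrow> real) M L. open V \<and> x \<in> V \<and> L \<ge> 0 \<and> (\<forall>y\<in>V \<inter> I. \<bar>h y\<bar> \<le> M)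
        \<and> (\<forall>y\<in>V \<inter> I. \<forall>z\<in>V \<inter> I. dist y z \<le> L * \<bar>h y - h z\<bar>)"
  obtains C where "C \<ge> 0" "\<And>\<epsilon>. 0 < \<epsilon> \<Longrightarrow> \<epsilon> \<le> 1 \<Longrightarrow> measure lborel (nbhd \<epsilon> I) \<le> C * \<epsilon>\<^sup>2"
proof -
  have "\<exists>V C. open V \<and> x \<in> V \<and> C \<ge> 0 \<and> (\<forall>\<epsilon>. 0 < \<epsilon> \<longrightarrow> \<epsilon> \<le> 1 \<longrightarrow> measure lborel (nbhd \<epsilon> (V \<inter> I)) \<le> C * \<epsilon>\<^sup>2)"
    if x: "x \<in> I" for x
  proof -
    obtain V M L and h :: "real^3 \<Rightarrow> real" where V: "open V" "x \<in> V" "L \<ge> 0" "\<And>y. y \<in> V \<inter> I \<Longrightarrow> \<bar>h y\<bar> \<le> M"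
      "\<And>y z. y \<in> V \<inter> I \<Longrightarrow> z \<in> V \<inter> I \<Longrightarrow> dist y z \<le> L * \<bar>h y - h z\<bar>"
      using loc[OF x] by blast
    have "bounded (V \<inter> I)" using compact_imp_bounded[OF I] by (rule bounded_subset) auto
    from volume_nbhd_curve[OF this V(4) V(3) V(5)] obtain C where "C \<ge> 0"
      "\<And>\<epsilon>. 0 < \<epsilon> \<Longrightarrow> \<epsilon> \<le> 1 \<Longrightarrow> measure lborel (nbhd \<epsilon> (V \<inter> I)) \<le> C * \<epsilon>\<^sup>2" by metis
    then show ?thesis using V(1,2) by blast
  qed
  then obtain V C where VC: "\<And>x. x \<in> I \<Longrightarrow> open (V x) \<and> x \<in> V x \<and> C x \<ge> 0
      \<and> (\<forall>\<epsilon>. 0 < \<epsilon> \<longrightarrow> \<epsilon> \<le> 1 \<longrightarrow> measure lborel (nbhd \<epsilon> (V x \<inter> I)) \<le> C x * \<epsilon>\<^sup>2)" by metis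
  have op: "open (V x)" if "x \<in> I" for x using VC that by blast
  have cov: "I \<subseteq> (\<Union>x\<in>I. V x)" using VC by blast
  obtain K where K: "K \<subseteq> I" "finite K" "I \<subseteq> (\<Union>x\<in>K. V x)"
    by (rule compactE_image[of I I V, OF I op cov], assumption, rule that)
  show thesis
  proof (rule that[of "\<Sum>x\<in>K. C x"])
    show "0 \<le> (\<Sum>x\<in>K. C x)" using VC K by (intro sum_nonneg) auto
    fix \<epsilon> :: real assume \<epsilon>: "0 < \<epsilon>" "\<epsilon> \<le> 1"
    have eq: "nbhd \<epsilon> I = (\<Union>x\<in>K. nbhd \<epsilon> (V x \<inter> I))" using K unfolding nbhd_def by blast
    have "measure lborel (nbhd \<epsilon> I) \<le> (\<Sum>x\<in>K. measure lborel (nbhd \<epsilon> (V x \<inter> I)))"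
      unfolding eq by (rule measure_UNION_le[OF K(2)]) (simp add: open_nbhd)
    also have "\<dots> \<le> (\<Sum>x\<in>K. C x * \<epsilon>\<^sup>2)" using VC K \<epsilon> by (intro sum_mono) blast
    finally show "measure lborel (nbhd \<epsilon> I) \<le> (\<Sum>x\<in>K. C x) * \<epsilon>\<^sup>2" by (simp add: sum_distrib_right)
  qed
qed

lemma L2_norm_indicator:
  assumes "open N" "bounded N" "c \<ge> 0"
  shows "(\<lambda>x. c * indicator N x :: real) \<in> L2 UNIV" "L2_norm UNIV (\<lambda>x. c * indicator N x) = c * sqrt (measure lborel N)"
proof -
  have sq: "(\<lambda>x. (norm (c * indicator N x))\<^sup>2) = (\<lambda>x. c\<^sup>2 * indicator N x)"
    by (auto simp: indicator_def power_mult_distrib)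
  have i: "integrable lborel (\<lambda>x. c\<^sup>2 * indicator N x)"
    using assms emeasure_bounded_lborel_finite[of N] by (intro integrable_mult_right integrable_real_indicator) auto
  have m: "(\<lambda>x. c * indicator N x) \<in> borel_measurable borel" using assms by (intro borel_measurable_times) auto
  show "(\<lambda>x. c * indicator N x) \<in> L2 UNIV" unfolding L2_UNIV_iff[OF m] sq by (rule i)
  have "(\<integral>x. (norm (c * indicator N x))\<^sup>2 \<partial>lebesgue_on UNIV) = (\<integral>x. c\<^sup>2 * indicator N x \<partial>lborel)"
    unfolding sq using assms by (intro integral_lebesgue_on_eq_lborel) auto
  also have "\<dots> = c\<^sup>2 * measure lborel N" by simp
  finally show "L2_norm UNIV (\<lambda>x. c * indicator N x) = c * sqrt (measure lborel N)"
    unfolding L2_norm_def using assms(3) by (simp add: real_sqrt_mult)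
qed

text \<open>The cutoffs around the interface have gradients of size \<open>1/\<epsilon>\<close> on a set of volume \<open>\<epsilon>\<^sup>2\<close>: they
  are bounded in \<open>L2\<close> and live on shrinking sets, hence converge weakly to zero.\<close>

lemma grad_orthogonal_bounded:
  fixes q :: "real^3 \<Rightarrow> real" and w s :: "real^3 \<Rightarrow> real^3"
  assumes \<Omega>: "open \<Omega>" "bounded \<Omega>" "lipschitz_boundary \<Omega>"
    and \<gamma>: "\<gamma> \<inter> \<Omega> = {}" and E: "closed E" "E \<inter> \<Omega> = {}"
    and I: "compact I" "I \<inter> \<Omega> = {}" "closure \<gamma> \<inter> E \<inter> frontier \<Omega> \<subseteq> I"
    and C0: "C0 \<ge> 0" "\<And>\<epsilon>. 0 < \<epsilon> \<Longrightarrow> \<epsilon> \<le> 1 \<Longrightarrow> measure lborel (nbhd \<epsilon> I) \<le> C0 * \<epsilon>\<^sup>2"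
    and w: "weak_op op_grad (- E) \<Omega> q w" and M: "\<And>x. x \<in> \<Omega> \<Longrightarrow> \<bar>q x\<bar> \<le> M"
    and s: "s \<in> L2 \<Omega>" and orth: "\<And>\<phi>. \<phi> \<in> C_inf_vanishing \<gamma> \<Omega> \<Longrightarrow> L2_inner \<Omega> s (classical_grad \<phi>) = 0"
  shows "L2_inner \<Omega> s w = 0"
proof -
  have M0: "\<bar>M\<bar> \<ge> 0" by simp
  obtain C1 where C1: "C1 > 0" and cut: "\<And>N \<epsilon>. N \<in> sets borel \<Longrightarrow> bounded N \<Longrightarrow> \<epsilon> > 0 \<Longrightarrow> \<exists>\<theta>::real^3 \<Rightarrow> real. smooth \<theta> \<and> (\<forall>x. 0 \<le> \<theta> x \<and> \<theta> x \<le> 1)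
      \<and> (\<forall>x. ball x \<epsilon> \<subseteq> N \<longrightarrow> \<theta> x = 1) \<and> (\<forall>x. ball x \<epsilon> \<inter> N = {} \<longrightarrow> \<theta> x = 0) \<and> (\<forall>i x. \<bar>pd i \<theta> x\<bar> \<le> C1 / \<epsilon>)"
    by (rule smooth_cutoff, rule that)
  have qL: "q \<in> L2 \<Omega>" "w \<in> L2 \<Omega>" using w by (auto simp: weak_op_def)
  \<comment> \<open>Bounds \<open>w - F\<close> at every scale: the cutoff has slope at most
    \<open>C1 / \<epsilon>\<close> in each of 3 directions, the function is at most
    \<open>\<bar>M\<bar>\<close>, and the root of the volume of the support is at most
    \<open>4 * sqrt C0 * \<epsilon>\<close>, so that \<epsilon> cancels.\<close>
  define B where "B = L2_norm \<Omega> w + 3 * C1 * \<bar>M\<bar> * (4 * sqrt C0)"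
  define sn where "sn n x = indicator (nbhd (1 / real (Suc n)) I) x *\<^sub>R s x" for n x
  have main: "\<bar>L2_inner \<Omega> s w\<bar> \<le> L2_norm \<Omega> (sn n) * B" and snL: "sn n \<in> L2 \<Omega>" for n
  proof -
    \<comment> \<open>Four nested neighbourhoods of \<open>I\<close>: \<theta> is 1 on the one of
      size \<epsilon>, arises from the indicator of the one of size \<open>2 * \<epsilon>\<close>,
      and vanishes off the one of size \<open>3 * \<epsilon>\<close>; its gradient vanishes off the
      one of size \<open>4 * \<epsilon> = 1 / Suc n\<close>.\<close>
    define \<epsilon> where "\<epsilon> = 1 / (4 * real (Suc n))"
    have \<epsilon>: "\<epsilon> > 0" "4 * \<epsilon> \<le> 1" by (auto simp: \<epsilon>_def field_simps)
    define N where "N = nbhd (4 * \<epsilon>) I"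
    have N: "open N" "bounded N" unfolding N_def by (auto intro: open_nbhd bounded_nbhd compact_imp_bounded I)
    have "4 * \<epsilon> = 1 / real (Suc n)" unfolding \<epsilon>_def by (simp add: divide_simps del: of_nat_Suc)
    then have sn: "sn n = (\<lambda>x. indicator N x *\<^sub>R s x)" by (simp add: sn_def[abs_def] N_def)
    have mN: "(indicator N :: _ \<Rightarrow> real) \<in> borel_measurable (lebesgue_on \<Omega>)"
      using N by (intro borel_imp_lebesgue_on) auto
    show snL: "sn n \<in> L2 \<Omega>"
      unfolding sn
    proof (rule L2_dominated[OF _ s, of _ 1])
      show "(\<lambda>x. indicator N x *\<^sub>R s x) \<in> borel_measurable (lebesgue_on \<Omega>)"
        by (rule borel_measurable_scaleR[OF mN L2_measurable[OF s]])
    qed (auto simp: indicator_def)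
    have "nbhd (2 * \<epsilon>) I \<in> sets borel" by (simp add: open_nbhd)
    from cut[OF this bounded_nbhd[OF compact_imp_bounded[OF I(1)]] \<epsilon>(1)]
    obtain \<theta> :: "real^3 \<Rightarrow> real" where \<theta>: "smooth \<theta>" "\<And>x. 0 \<le> \<theta> x \<and> \<theta> x \<le> 1"
      "\<And>x. ball x \<epsilon> \<subseteq> nbhd (2 * \<epsilon>) I \<Longrightarrow> \<theta> x = 1" "\<And>x. ball x \<epsilon> \<inter> nbhd (2 * \<epsilon>) I = {} \<Longrightarrow> \<theta> x = 0"
      "\<And>i x. \<bar>pd i \<theta> x\<bar> \<le> C1 / \<epsilon>" by blast
    define Z where "Z = nbhd \<epsilon> I"
    have Z: "open Z" by (simp add: Z_def open_nbhd)
    have one: "\<theta> x = 1" if x: "x \<in> Z" for x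
    proof (rule \<theta>(3))
      obtain y where y: "y \<in> I" "dist x y < \<epsilon>" using x by (auto simp: Z_def mem_nbhd)
      show "ball x \<epsilon> \<subseteq> nbhd (2 * \<epsilon>) I"
      proof
        fix z assume "z \<in> ball x \<epsilon>"
        then have "dist z y < 2 * \<epsilon>" using y dist_triangle[of z y x] by (simp add: dist_commute)
        then show "z \<in> nbhd (2 * \<epsilon>) I" using y by (auto simp: mem_nbhd)
      qed
    qed
    have dZ: "pd i \<theta> x = 0" if x: "x \<in> Z" for x i
    proof -
      have "(\<theta> has_derivative (\<lambda>v. 0)) (at x)"
        by (rule has_derivative_transform_within_open[of "\<lambda>x. 1" _ x UNIV Z])
          (use x one Z in auto)
      then show ?thesis by (rule pd_eq)
    qed
    have zero: "\<theta> x = 0" if x: "x \<notin> nbhd (3 * \<epsilon>) I" for x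
    proof (rule \<theta>(4), rule ccontr)
      assume "ball x \<epsilon> \<inter> nbhd (2 * \<epsilon>) I \<noteq> {}"
      then obtain z y where "dist x z < \<epsilon>" "y \<in> I" "dist z y < 2 * \<epsilon>" by (auto simp: mem_nbhd)
      then show False using x dist_triangle[of x y z] by (force simp: mem_nbhd)
    qed
    have zeroN: "\<theta> x = 0 \<and> pd i \<theta> x = 0" if x: "x \<notin> N" for x i
    proof
      show "\<theta> x = 0" using x \<epsilon> by (intro zero) (fastforce simp: N_def mem_nbhd)
      have "x \<notin> closure {y. \<theta> y \<noteq> 0}"
      proof
        assume "x \<in> closure {y. \<theta> y \<noteq> 0}"
        then obtain z where z: "\<theta> z \<noteq> 0" "dist z x < \<epsilon>" using \<epsilon>(1) unfolding closure_approachable by blast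
        then obtain y where "y \<in> I" "dist z y < 3 * \<epsilon>" using zero[of z] by (auto simp: mem_nbhd)
        then have "dist x y < 4 * \<epsilon>" using z dist_triangle[of x y z] by (simp add: dist_commute)
        then show False using x \<open>y \<in> I\<close> by (auto simp: N_def mem_nbhd)
      qed
      then show "pd i \<theta> x = 0" unfolding pd_def by (rule frechet_derivative_outside_support)
    qed
    \<comment> \<open>\<open>\<eta> q\<close> vanishes near \<open>I\<close>, the only place where
      no direction of shift is admissible.\<close>
    define \<eta> where "\<eta> x = 1 - \<theta> x" for x
    have s\<eta>: "smooth \<eta>" unfolding \<eta>_def by (intro smooth_diff smooth_const \<theta>(1))
    have p\<eta>: "pd i \<eta> x = - pd i \<theta> x" for i x unfolding \<eta>_def by (simp add: pd_diff[OF smooth_const \<theta>(1)])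
    define F where "F x = \<eta> x *\<^sub>R w x + (\<Sum>i\<in>UNIV. pd i \<eta> x *\<^sub>R op_grad i (q x))" for x
    have wF: "weak_op op_grad (- E) \<Omega> (\<lambda>x. \<eta> x *\<^sub>R q x) F"
      unfolding F_def by (rule weak_op_mult[OF w \<Omega>(1,2) linear_op_grad s\<eta>])
    have FL: "F \<in> L2 \<Omega>" using wF by (simp add: weak_op_def)
    have appr: "smoothly_approximable \<gamma> op_grad \<Omega> (\<lambda>x. \<eta> x *\<^sub>R q x) F"
    proof (rule smoothly_approximable_lipschitz[OF \<Omega> linear_op_grad _ _ Z \<gamma> _ wF])
      show "open (- E)" using E by auto
      show "\<Omega> \<subseteq> - E" using E by auto
      \<comment> \<open>A boundary point that lies both in \<open>E\<close> and in
        \<open>closure \<gamma>\<close> belongs to \<open>I\<close>, hence to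
        \<open>Z\<close>.\<close>
      show "x \<in> - E \<or> x \<notin> closure \<gamma> \<or> x \<in> Z" if "x \<in> frontier \<Omega>" for x
        using that I(3) \<epsilon>(1) by (auto simp: Z_def mem_nbhd intro!: bexI[of _ x])
      show "\<eta> y *\<^sub>R q y = 0 \<and> F y = 0" if "y \<in> \<Omega> \<inter> Z" for y
        using that one[of y] dZ[of y] by (simp add: F_def p\<eta>) (simp add: \<eta>_def)
    qed
    have "L2_inner \<Omega> s F = 0"
    proof (rule L2_inner_limit[OF FL s])
      fix e :: real assume "e > 0"
      then obtain \<phi> where \<phi>: "\<phi> \<in> C_inf_vanishing \<gamma> \<Omega>" "L2_norm \<Omega> (\<lambda>x. F x - diff_op op_grad \<phi> x) < e"
        using appr unfolding smoothly_approximable_def by blast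
      have "diff_op op_grad \<phi> \<in> L2 \<Omega>"
        by (intro smooth_L2 \<Omega> smooth_diff_op linear_op_grad C_inf_vanishing_smooth[OF \<phi>(1)])
      moreover have "diff_op op_grad \<phi> = classical_grad \<phi>" by (auto simp: diff_op_grad)
      ultimately show "\<exists>h\<in>L2 \<Omega>. L2_norm \<Omega> (\<lambda>x. F x - h x) < e \<and> L2_inner \<Omega> s h = 0"
        using \<phi> orth[OF \<phi>(1)] by (intro bexI[of _ "diff_op op_grad \<phi>"]) auto
    qed
    \<comment> \<open>\<open>F\<close> contributes nothing, and \<open>w - F\<close> vanishes off
      \<open>N\<close>, so that \<open>s\<close> may be replaced by its restriction to
      \<open>N\<close>.\<close>
    then have "L2_inner \<Omega> s w = L2_inner \<Omega> s (\<lambda>x. w x - F x)"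
      using L2_inner_diff_right[OF qL(2) FL s] by simp
    also have "\<dots> = L2_inner \<Omega> (sn n) (\<lambda>x. w x - F x)"
    proof -
      have "s x \<bullet> (w x - F x) = sn n x \<bullet> (w x - F x)" for x
      proof (cases "x \<in> N")
        case False
        then have "w x - F x = 0" using zeroN[OF False] by (simp add: F_def p\<eta>) (simp add: \<eta>_def)
        then show ?thesis by simp
      qed (simp add: sn)
      then show ?thesis by (simp add: L2_inner_def)
    qed
    finally have eq: "L2_inner \<Omega> s w = L2_inner \<Omega> (sn n) (\<lambda>x. w x - F x)" .
    define c where "c = 3 * C1 * \<bar>M\<bar> / \<epsilon>"
    have c: "c \<ge> 0" using C1 \<epsilon> by (simp add: c_def)
    have "L2_norm \<Omega> (\<lambda>x. w x - F x) \<le> B"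
    proof -
      define G where "G x = (\<Sum>i\<in>UNIV. pd i \<theta> x *\<^sub>R op_grad i (q x))" for x
      have GL: "G \<in> L2 \<Omega>"
        unfolding G_def
        by (intro L2_sum bounded_continuous_mult_L2 \<Omega> smooth_continuous smooth_pd \<theta>(1) L2_bounded_linear[OF qL(1)])
          (simp add: linear_op_grad linear_conv_bounded_linear[symmetric])
      have \<theta>wL: "(\<lambda>x. \<theta> x *\<^sub>R w x) \<in> L2 \<Omega>" by (intro bounded_continuous_mult_L2 \<Omega> smooth_continuous \<theta>(1) qL)
      have wF: "w x - F x = \<theta> x *\<^sub>R w x + G x" for x
        by (simp add: F_def G_def p\<eta> sum_negf) (simp add: \<eta>_def scaleR_diff_left)
      have "L2_norm \<Omega> (\<lambda>x. w x - F x) \<le> L2_norm \<Omega> (\<lambda>x. \<theta> x *\<^sub>R w x) + L2_norm \<Omega> G"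
        unfolding wF by (rule L2_norm_triangle[OF \<theta>wL GL])
      also have "L2_norm \<Omega> (\<lambda>x. \<theta> x *\<^sub>R w x) \<le> L2_norm \<Omega> w"
        using \<theta>(2) by (intro L2_norm_mono_AE \<theta>wL qL) (auto intro!: AE_I2 mult_left_le_one_le)
      also have "L2_norm \<Omega> G \<le> L2_norm \<Omega> (\<lambda>x. c * indicator N x)"
      proof (rule L2_norm_mono_AE[OF GL L2_restrict(1)[OF L2_norm_indicator(1)[OF N c] \<Omega>(1)]])
        have "norm (G x) \<le> norm (c * indicator N x)" if x: "x \<in> \<Omega>" for x
        proof (cases "x \<in> N")
          case True
          have "norm (G x) \<le> (\<Sum>i\<in>(UNIV::3 set). (C1 / \<epsilon>) * \<bar>M\<bar>)"
            unfolding G_def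
          proof (rule sum_norm_le)
            fix i :: 3
            have "\<bar>q x\<bar> \<le> \<bar>M\<bar>" using M[OF x] by linarith
            then have "\<bar>pd i \<theta> x\<bar> * \<bar>q x\<bar> \<le> (C1 / \<epsilon>) * \<bar>M\<bar>"
              using \<theta>(5)[of i x] C1 \<epsilon> by (intro mult_mono) auto
            then show "norm (pd i \<theta> x *\<^sub>R op_grad i (q x)) \<le> (C1 / \<epsilon>) * \<bar>M\<bar>"
              by (simp add: op_grad_def abs_mult)
          qed
          also have "\<dots> = c" by (simp add: c_def)
          finally show ?thesis using True c by simp
        next
          case False
          then show ?thesis using zeroN[OF False] by (simp add: G_def)
        qed
        then show "AE x in lebesgue_on \<Omega>. norm (G x) \<le> norm (c * indicator N x)" by (intro AE_I2) simp
      qed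
      also have "\<dots> \<le> L2_norm UNIV (\<lambda>x. c * indicator N x)"
        by (rule L2_restrict(2)[OF L2_norm_indicator(1)[OF N c] \<Omega>(1)])
      also have "\<dots> = c * sqrt (measure lborel N)" by (rule L2_norm_indicator(2)[OF N c])
      also have "\<dots> \<le> c * (4 * sqrt C0 * \<epsilon>)"
      proof (rule mult_left_mono[OF _ c])
        have "measure lborel N \<le> C0 * (4 * \<epsilon>)\<^sup>2" unfolding N_def by (rule C0(2)) (use \<epsilon> in auto)
        then have "sqrt (measure lborel N) \<le> sqrt (C0 * (4 * \<epsilon>)\<^sup>2)" by (rule real_sqrt_le_mono)
        also have "\<dots> = sqrt C0 * (4 * \<epsilon>)" using \<epsilon> by (simp add: real_sqrt_mult)
        finally show "sqrt (measure lborel N) \<le> 4 * sqrt C0 * \<epsilon>" by simp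
      qed
      also have "c * (4 * sqrt C0 * \<epsilon>) = 3 * C1 * \<bar>M\<bar> * (4 * sqrt C0)" using \<epsilon> by (simp add: c_def)
      finally show ?thesis by (simp add: B_def)
    qed
    then have "L2_norm \<Omega> (sn n) * L2_norm \<Omega> (\<lambda>x. w x - F x) \<le> L2_norm \<Omega> (sn n) * B"
      by (intro mult_left_mono) auto
    then show "\<bar>L2_inner \<Omega> s w\<bar> \<le> L2_norm \<Omega> (sn n) * B"
      using L2_Cauchy_Schwarz[OF snL L2_diff[OF qL(2) FL]] eq by linarith
  qed
  \<comment> \<open>Every point of \<Omega> has positive distance from \<open>I\<close>, so the
    restrictions of \<open>s\<close> vanish eventually at each point and are dominated by
    \<open>s\<close>.\<close>
  have "(\<lambda>n. \<integral>x. (norm (sn n x))\<^sup>2 \<partial>lebesgue_on \<Omega>) \<longlonglongrightarrow> (\<integral>x. 0 \<partial>lebesgue_on \<Omega>)"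
  proof (rule integral_dominated_convergence[where w="\<lambda>x. (norm (s x))\<^sup>2"])
    show "(\<lambda>x. (norm (sn n x))\<^sup>2) \<in> borel_measurable (lebesgue_on \<Omega>)" for n
      using borel_measurable_integrable[OF L2_integrable_sq[OF snL]] .
    show "integrable (lebesgue_on \<Omega>) (\<lambda>x. (norm (s x))\<^sup>2)" by (rule L2_integrable_sq[OF s])
    show "AE x in lebesgue_on \<Omega>. norm ((norm (sn n x))\<^sup>2) \<le> (norm (s x))\<^sup>2" for n
      by (auto simp: sn_def indicator_def)
    show "AE x in lebesgue_on \<Omega>. (\<lambda>n. (norm (sn n x))\<^sup>2) \<longlonglongrightarrow> 0"
    proof (rule AE_I2)
      fix x assume "x \<in> space (lebesgue_on \<Omega>)"
      then have "x \<in> - I" using I(2) by auto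
      then obtain d where d: "d > 0" "ball x d \<subseteq> - I"
        using compact_imp_closed[OF I(1)] open_contains_ball by (metis open_Compl)
      have "eventually (\<lambda>n. 1 / real (Suc n) < d) sequentially"
        using order_tendstoD(2)[OF LIMSEQ_Suc[OF lim_1_over_n] d(1)] .
      then have "eventually (\<lambda>n. (norm (sn n x))\<^sup>2 = 0) sequentially"
      proof eventually_elim
        case (elim n)
        have "x \<notin> nbhd (1 / real (Suc n)) I"
        proof
          assume "x \<in> nbhd (1 / real (Suc n)) I"
          then obtain y where "y \<in> I" "dist x y < 1 / real (Suc n)" unfolding mem_nbhd by blast
          then show False using d(2) elim by (auto simp: subset_iff)
        qed
        then show ?case by (simp add: sn_def)
      qed
      then show "(\<lambda>n. (norm (sn n x))\<^sup>2) \<longlonglongrightarrow> 0" by (rule tendsto_eventually)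
    qed
  qed simp
  then have "(\<lambda>n. sqrt (\<integral>x. (norm (sn n x))\<^sup>2 \<partial>lebesgue_on \<Omega>)) \<longlonglongrightarrow> sqrt 0"
    by (intro tendsto_real_sqrt) simp
  then have "(\<lambda>n. L2_norm \<Omega> (sn n) * B) \<longlonglongrightarrow> 0 * B" unfolding L2_norm_def by (intro tendsto_intros) simp
  then have "\<bar>L2_inner \<Omega> s w\<bar> \<le> 0"
    using main by (intro LIMSEQ_le_const[of "\<lambda>n. L2_norm \<Omega> (sn n) * B"]) auto
  then show ?thesis by simp
qed

text \<open>The truncations of \<open>q\<close> are bounded and have gradients
  \<open>t n x *\<^sub>R w x\<close>, where \<open>t n x\<close> lies between 0 and 1 and tends to
  1; dominated convergence removes the truncation.\<close>

lemma grad_orthogonal: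
  fixes q :: "real^3 \<Rightarrow> real" and w s :: "real^3 \<Rightarrow> real^3"
  assumes \<Omega>: "open \<Omega>" "bounded \<Omega>" "lipschitz_boundary \<Omega>"
    and \<gamma>: "\<gamma> \<inter> \<Omega> = {}" and E: "closed E" "E \<inter> \<Omega> = {}"
    and I: "compact I" "I \<inter> \<Omega> = {}" "closure \<gamma> \<inter> E \<inter> frontier \<Omega> \<subseteq> I"
    and C0: "C0 \<ge> 0" "\<And>\<epsilon>. 0 < \<epsilon> \<Longrightarrow> \<epsilon> \<le> 1 \<Longrightarrow> measure lborel (nbhd \<epsilon> I) \<le> C0 * \<epsilon>\<^sup>2"
    and w: "weak_op op_grad (- E) \<Omega> q w"
    and s: "s \<in> L2 \<Omega>" and orth: "\<And>\<phi>. \<phi> \<in> C_inf_vanishing \<gamma> \<Omega> \<Longrightarrow> L2_inner \<Omega> s (classical_grad \<phi>) = 0"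
  shows "L2_inner \<Omega> s w = 0"
proof -
  have qL: "q \<in> L2 \<Omega>" "w \<in> L2 \<Omega>" using w by (auto simp: weak_op_def)
  define t where "t n x = inverse (1 + (q x / real (Suc n))\<^sup>2)" for n x
  have tb: "0 \<le> t n x" "t n x \<le> 1" for n x
    unfolding t_def by (auto simp: inverse_le_1_iff)
  have z: "L2_inner \<Omega> s (\<lambda>x. t n x *\<^sub>R w x) = 0" and wnL: "(\<lambda>x. t n x *\<^sub>R w x) \<in> L2 \<Omega>" for n
  proof -
    have oE: "open (- E)" using E by auto
    have wn: "weak_op op_grad (- E) \<Omega> (\<lambda>x. real (Suc n) * arctan (q x / real (Suc n))) (\<lambda>x. t n x *\<^sub>R w x)"
      unfolding t_def by (rule weak_op_grad_truncate[OF \<Omega>(1,2) oE w]) simp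
    then show "(\<lambda>x. t n x *\<^sub>R w x) \<in> L2 \<Omega>" by (simp add: weak_op_def)
    show "L2_inner \<Omega> s (\<lambda>x. t n x *\<^sub>R w x) = 0"
    proof (rule grad_orthogonal_bounded[OF \<Omega> \<gamma> E I C0 wn _ s orth])
      fix x
      have "\<bar>arctan (q x / real (Suc n))\<bar> \<le> pi / 2"
        using arctan_bounded[of "q x / real (Suc n)"] by linarith
      then show "\<bar>real (Suc n) * arctan (q x / real (Suc n))\<bar> \<le> real (Suc n) * (pi / 2)"
        unfolding abs_mult by (simp add: mult_left_mono)
    qed
  qed
  have "(\<lambda>n. \<integral>x. s x \<bullet> (t n x *\<^sub>R w x) \<partial>lebesgue_on \<Omega>) \<longlonglongrightarrow> (\<integral>x. s x \<bullet> w x \<partial>lebesgue_on \<Omega>)"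
  proof (rule integral_dominated_convergence[where w="\<lambda>x. \<bar>s x \<bullet> w x\<bar>"])
    show "(\<lambda>x. s x \<bullet> w x) \<in> borel_measurable (lebesgue_on \<Omega>)"
      using borel_measurable_integrable[OF L2_inner_integrable[OF s qL(2)]] .
    show "(\<lambda>x. s x \<bullet> (t n x *\<^sub>R w x)) \<in> borel_measurable (lebesgue_on \<Omega>)" for n
      using borel_measurable_integrable[OF L2_inner_integrable[OF s wnL]] .
    show "integrable (lebesgue_on \<Omega>) (\<lambda>x. \<bar>s x \<bullet> w x\<bar>)"
      by (rule integrable_abs[OF L2_inner_integrable[OF s qL(2)]])
    show "AE x in lebesgue_on \<Omega>. norm (s x \<bullet> (t n x *\<^sub>R w x)) \<le> \<bar>s x \<bullet> w x\<bar>" for n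
      using tb by (auto simp: abs_mult intro!: AE_I2 mult_left_le_one_le)
    show "AE x in lebesgue_on \<Omega>. (\<lambda>n. s x \<bullet> (t n x *\<^sub>R w x)) \<longlonglongrightarrow> s x \<bullet> w x"
    proof (rule AE_I2)
      fix x
      have "(\<lambda>n. q x * (1 / real (Suc n))) \<longlonglongrightarrow> q x * 0" by (intro tendsto_intros LIMSEQ_Suc[OF lim_1_over_n])
      then have "(\<lambda>n. q x / real (Suc n)) \<longlonglongrightarrow> 0" by simp
      then have "(\<lambda>n. inverse (1 + (q x / real (Suc n))\<^sup>2)) \<longlonglongrightarrow> inverse (1 + 0\<^sup>2)"
        by (intro tendsto_intros) auto
      then have "(\<lambda>n. s x \<bullet> (t n x *\<^sub>R w x)) \<longlonglongrightarrow> s x \<bullet> (1 *\<^sub>R w x)"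
        unfolding t_def by (intro tendsto_intros) simp
      then show "(\<lambda>n. s x \<bullet> (t n x *\<^sub>R w x)) \<longlonglongrightarrow> s x \<bullet> w x" by simp
    qed
  qed
  then have "(\<lambda>n. 0) \<longlonglongrightarrow> L2_inner \<Omega> s w" using z by (simp add: L2_inner_def)
  then show ?thesis by (simp add: LIMSEQ_const_iff)
qed

section \<open>The Helmholtz decomposition\<close>

lemma has_real_derivative_along_line:
  fixes f :: "real^3 \<Rightarrow> real"
  assumes "smooth f"
  shows "((\<lambda>t. f (c + t *\<^sub>R a)) has_real_derivative frechet_derivative f (at (c + t *\<^sub>R a)) a) (at t)"
proof -
  have "((\<lambda>t. c + t *\<^sub>R a) has_derivative (\<lambda>v. v *\<^sub>R a)) (at t)" by (auto intro!: derivative_eq_intros)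
  from has_derivative_compose[OF this smooth_has_derivative[OF assms]]
  show ?thesis
    by (simp add: has_field_derivative_def linear_scale[OF frechet_derivative_linear[OF smoothD[OF assms]]] mult_commute_abs)
qed

lemma second_difference:
  fixes f :: "real^3 \<Rightarrow> real"
  assumes f: "smooth f" and h: "h > 0"
  obtains p where "dist p x \<le> h * (norm a + norm b)"
    "f (x + h *\<^sub>R a + h *\<^sub>R b) - f (x + h *\<^sub>R a) - f (x + h *\<^sub>R b) + f x
      = h * (h * frechet_derivative (\<lambda>y. frechet_derivative f (at y) a) (at p) b)"
proof -
  \<comment> \<open>The mean value theorem is used first in direction \<open>a\<close> on the
    increment in direction \<open>b\<close>, then in direction \<open>b\<close> on the derivative so
    obtained.\<close>
  define G where "G t = f ((x + h *\<^sub>R b) + t *\<^sub>R a) - f (x + t *\<^sub>R a)" for t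
  define G' where "G' t = frechet_derivative f (at ((x + h *\<^sub>R b) + t *\<^sub>R a)) a - frechet_derivative f (at (x + t *\<^sub>R a)) a" for t
  have "(G has_real_derivative G' t) (at t)" for t
    unfolding G_def[abs_def] G'_def by (intro DERIV_diff has_real_derivative_along_line f)
  then obtain \<tau> where \<tau>: "0 < \<tau>" "\<tau> < h" "G h - G 0 = (h - 0) * G' \<tau>" using MVT2[OF h, of G G'] by blast
  define H where "H t = frechet_derivative f (at ((x + \<tau> *\<^sub>R a) + t *\<^sub>R b)) a" for t
  have "(H has_real_derivative frechet_derivative (\<lambda>y. frechet_derivative f (at y) a) (at ((x + \<tau> *\<^sub>R a) + t *\<^sub>R b)) b) (at t)" for t
    unfolding H_def[abs_def] by (rule has_real_derivative_along_line[OF smooth_frechet_derivative[OF f]])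
  then obtain \<sigma> where \<sigma>: "0 < \<sigma>" "\<sigma> < h"
    "H h - H 0 = (h - 0) * frechet_derivative (\<lambda>y. frechet_derivative f (at y) a) (at ((x + \<tau> *\<^sub>R a) + \<sigma> *\<^sub>R b)) b"
    using MVT2[OF h, of H "\<lambda>t. frechet_derivative (\<lambda>y. frechet_derivative f (at y) a) (at ((x + \<tau> *\<^sub>R a) + t *\<^sub>R b)) b"] by blast
  show thesis
  proof (rule that[of "(x + \<tau> *\<^sub>R a) + \<sigma> *\<^sub>R b"])
    have "norm (\<tau> *\<^sub>R a + \<sigma> *\<^sub>R b) \<le> \<tau> * norm a + \<sigma> * norm b"
      using norm_triangle_ineq[of "\<tau> *\<^sub>R a" "\<sigma> *\<^sub>R b"] \<tau> \<sigma> by simp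
    also have "\<dots> \<le> h * norm a + h * norm b" using \<tau> \<sigma> by (intro add_mono mult_right_mono) auto
    finally show "dist ((x + \<tau> *\<^sub>R a) + \<sigma> *\<^sub>R b) x \<le> h * (norm a + norm b)"
      by (simp add: dist_norm algebra_simps)
    have "G' \<tau> = H h - H 0" by (simp add: G'_def H_def algebra_simps)
    then have "G h - G 0 = h * (h * frechet_derivative (\<lambda>y. frechet_derivative f (at y) a) (at ((x + \<tau> *\<^sub>R a) + \<sigma> *\<^sub>R b)) b)"
      using \<tau>(3) \<sigma>(3) by simp
    then show "f (x + h *\<^sub>R a + h *\<^sub>R b) - f (x + h *\<^sub>R a) - f (x + h *\<^sub>R b) + f x
      = h * (h * frechet_derivative (\<lambda>y. frechet_derivative f (at y) a) (at ((x + \<tau> *\<^sub>R a) + \<sigma> *\<^sub>R b)) b)"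
      by (simp add: G_def algebra_simps)
  qed
qed

text \<open>The second difference over the parallelogram spanned by \<open>h a\<close> and
  \<open>h b\<close> is symmetric in \<open>a\<close> and \<open>b\<close>, and it equals
  \<open>h\<^sup>2\<close> times either mixed derivative at some point near \<open>x\<close>.
  Continuity identifies the two as \<open>h\<close> tends to zero.\<close>

lemma mixed_derivatives_commute:
  fixes f :: "real^3 \<Rightarrow> real"
  assumes f: "smooth f"
  shows "frechet_derivative (\<lambda>y. frechet_derivative f (at y) a) (at x) b
    = frechet_derivative (\<lambda>y. frechet_derivative f (at y) b) (at x) a"
proof -
  define P where "P p = frechet_derivative (\<lambda>y. frechet_derivative f (at y) a) (at p) b" for p
  define Q where "Q p = frechet_derivative (\<lambda>y. frechet_derivative f (at y) b) (at p) a" for p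
  have cP: "continuous_on UNIV P" "continuous_on UNIV Q"
    unfolding P_def Q_def by (intro smooth_continuous smooth_frechet_derivative f)+
  define h where "h n = 1 / real (Suc n)" for n
  have h: "h n > 0" for n by (simp add: h_def)
  have hl: "h \<longlonglongrightarrow> 0" unfolding h_def by (rule LIMSEQ_Suc[OF lim_1_over_n])
  have "\<exists>p q. dist p x \<le> h n * (norm a + norm b) \<and> dist q x \<le> h n * (norm a + norm b) \<and> P p = Q q" for n
  proof -
    obtain p where p: "dist p x \<le> h n * (norm a + norm b)"
      "f (x + h n *\<^sub>R a + h n *\<^sub>R b) - f (x + h n *\<^sub>R a) - f (x + h n *\<^sub>R b) + f x = h n * (h n * P p)"
      by (rule second_difference[OF f h[of n], of x a b]) (rule that, assumption, simp add: P_def)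
    obtain q where q: "dist q x \<le> h n * (norm b + norm a)"
      "f (x + h n *\<^sub>R b + h n *\<^sub>R a) - f (x + h n *\<^sub>R b) - f (x + h n *\<^sub>R a) + f x = h n * (h n * Q q)"
      by (rule second_difference[OF f h[of n], of x b a]) (rule that, assumption, simp add: Q_def)
    have "x + h n *\<^sub>R b + h n *\<^sub>R a = x + h n *\<^sub>R a + h n *\<^sub>R b" by (simp add: algebra_simps)
    then have "f (x + h n *\<^sub>R b + h n *\<^sub>R a) = f (x + h n *\<^sub>R a + h n *\<^sub>R b)" by (rule arg_cong)
    then have "h n * (h n * P p) = h n * (h n * Q q)" using p(2) q(2) by linarith
    then have "P p = Q q" using h[of n] by simp
    then show ?thesis using p(1) q(1) by (auto simp: add.commute)
  qed
  then obtain p q where pq: "\<And>n. dist (p n) x \<le> h n * (norm a + norm b)" "\<And>n. dist (q n) x \<le> h n * (norm a + norm b)"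
    "\<And>n. P (p n) = Q (q n)" by metis
  have z: "(\<lambda>n. h n * (norm a + norm b)) \<longlonglongrightarrow> 0" by (rule tendsto_mult_left_zero[OF hl])
  have "p \<longlonglongrightarrow> x" "q \<longlonglongrightarrow> x"
    using pq(1,2) by (auto intro!: tendsto_dist_iff[THEN iffD2] Lim_null_comparison[OF _ z] always_eventually)
  then have "(\<lambda>n. P (p n)) \<longlonglongrightarrow> P x" "(\<lambda>n. Q (q n)) \<longlonglongrightarrow> Q x"
    using cP by (auto intro!: isCont_tendsto_compose[of x] simp: continuous_on_eq_continuous_at)
  then have "P x = Q x" using pq(3) LIMSEQ_unique by fastforce
  then show ?thesis by (simp add: P_def Q_def)
qed

lemma smooth_classical_grad: "smooth \<phi> \<Longrightarrow> smooth (classical_grad \<phi>)"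
  using smooth_diff_op[of op_grad \<phi>, OF linear_op_grad] by (simp add: diff_op_grad[abs_def])

lemma classical_curl_grad:
  assumes "smooth \<phi>"
  shows "classical_curl (classical_grad \<phi>) x = 0"
proof -
  have "pd i (classical_grad \<phi>) x $ j = pd i (pd j \<phi>) x" for i j
  proof -
    have "pd i (\<lambda>x. classical_grad \<phi> x $ j) x = pd i (classical_grad \<phi>) x $ j"
      by (rule pd_bounded_linear[OF smooth_classical_grad[OF assms] bounded_linear_vec_nth])
    moreover have "(\<lambda>x. classical_grad \<phi> x $ j) = pd j \<phi>" by (simp add: classical_grad_def pd_def fun_eq_iff)
    ultimately show ?thesis by simp
  qed
  moreover have "pd i (pd j \<phi>) x = pd j (pd i \<phi>) x" for i j
    using mixed_derivatives_commute[OF assms] by (simp add: pd_def[abs_def])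
  ultimately show ?thesis
    unfolding classical_curl_def Let_def pd_def[symmetric] by (simp add: vec_eq_iff forall_3)
qed

text \<open>As \<Omega> is open, the function is zero on a whole neighbourhood of each point of
  \<Omega> outside its relative support, so the gradient has no larger support.\<close>

lemma C_inf_vanishing_classical_grad:
  assumes "\<phi> \<in> C_inf_vanishing \<gamma> \<Omega>" "open \<Omega>"
  shows "classical_grad \<phi> \<in> C_inf_vanishing \<gamma> \<Omega>"
proof (rule C_inf_vanishing_subset[OF assms(1)])
  have s: "smooth \<phi>" by (rule C_inf_vanishing_smooth[OF assms(1)])
  show "smooth (classical_grad \<phi>)" by (rule smooth_classical_grad[OF s])
  show "{x \<in> \<Omega>. classical_grad \<phi> x \<noteq> 0} \<subseteq> closure {x \<in> \<Omega>. \<phi> x \<noteq> 0}"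
  proof (rule ccontr)
    assume "\<not> {x \<in> \<Omega>. classical_grad \<phi> x \<noteq> 0} \<subseteq> closure {x \<in> \<Omega>. \<phi> x \<noteq> 0}"
    then obtain x where x: "x \<in> \<Omega>" "classical_grad \<phi> x \<noteq> 0" "x \<notin> closure {x \<in> \<Omega>. \<phi> x \<noteq> 0}" by blast
    define O' where "O' = \<Omega> \<inter> - closure {x \<in> \<Omega>. \<phi> x \<noteq> 0}"
    have O': "open O'" "x \<in> O'" using assms(2) x by (auto simp: O'_def)
    have z: "\<phi> y = 0" if "y \<in> O'" for y
      using that closure_subset[of "{x \<in> \<Omega>. \<phi> x \<noteq> 0}"] by (auto simp: O'_def)
    have "(\<phi> has_derivative (\<lambda>v. 0)) (at x)"
      by (rule has_derivative_transform_within_open[of "\<lambda>x. 0" _ x UNIV O']) (use O' z in auto)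
    then have "frechet_derivative \<phi> (at x) = (\<lambda>v. 0)" using frechet_derivative_at by metis
    then have "classical_grad \<phi> x = 0" by (simp add: classical_grad_def vec_eq_iff)
    then show False using x by simp
  qed
qed

section \<open>The function spaces in terms of weak operators and smooth approximation\<close>

lemma H_curl_iff: "v \<in> H_curl \<Omega> \<longleftrightarrow> (\<exists>w. weak_op op_curl \<Omega> \<Omega> v w)"
  by (auto simp: H_curl_def weak_op_curl_iff)

lemma H_div_iff: "v \<in> H_div \<Omega> \<longleftrightarrow> (\<exists>w. weak_op op_div \<Omega> \<Omega> v w)"
  by (auto simp: H_div_def weak_op_div_iff)

lemma weak_op_weak_curl: "v \<in> H_curl \<Omega> \<Longrightarrow> weak_op op_curl \<Omega> \<Omega> v (weak_curl \<Omega> v)"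
  unfolding H_curl_def weak_op_curl_iff weak_curl_def
  using someI_ex[of "\<lambda>w. w \<in> L2 \<Omega> \<and> has_weak_curl \<Omega> v w"] by blast

lemma weak_op_weak_div: "v \<in> H_div \<Omega> \<Longrightarrow> weak_op op_div \<Omega> \<Omega> v (weak_div \<Omega> v)"
  unfolding H_div_def weak_op_div_iff weak_div_def
  using someI_ex[of "\<lambda>w. w \<in> L2 \<Omega> \<and> has_weak_div \<Omega> v w"] by blast

lemma weak_op_L2: "weak_op A W \<Omega> v w \<Longrightarrow> v \<in> L2 \<Omega>" "weak_op A W \<Omega> v w \<Longrightarrow> w \<in> L2 \<Omega>"
  by (simp_all add: weak_op_def)

lemma weak_curl_AE:
  assumes "open \<Omega>" "bounded \<Omega>" "weak_op op_curl \<Omega> \<Omega> v w"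
  shows "AE x in lebesgue_on \<Omega>. weak_curl \<Omega> v x = w x" "L2_norm \<Omega> (weak_curl \<Omega> v) = L2_norm \<Omega> w"
proof -
  have "v \<in> H_curl \<Omega>" using assms(3) H_curl_iff by blast
  note W = weak_op_weak_curl[OF this]
  show ae: "AE x in lebesgue_on \<Omega>. weak_curl \<Omega> v x = w x" by (rule weak_op_unique[OF assms(1,2) W assms(3)])
  show "L2_norm \<Omega> (weak_curl \<Omega> v) = L2_norm \<Omega> w"
    by (rule L2_norm_cong_AE[OF L2_measurable[OF weak_op_L2(2)[OF W]] L2_measurable[OF weak_op_L2(2)[OF assms(3)]] ae])
qed

lemma weak_div_AE:
  assumes "open \<Omega>" "bounded \<Omega>" "weak_op op_div \<Omega> \<Omega> v w"
  shows "AE x in lebesgue_on \<Omega>. weak_div \<Omega> v x = w x" "L2_norm \<Omega> (weak_div \<Omega> v) = L2_norm \<Omega> w"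
proof -
  have "v \<in> H_div \<Omega>" using assms(3) H_div_iff by blast
  note W = weak_op_weak_div[OF this]
  show ae: "AE x in lebesgue_on \<Omega>. weak_div \<Omega> v x = w x" by (rule weak_op_unique[OF assms(1,2) W assms(3)])
  show "L2_norm \<Omega> (weak_div \<Omega> v) = L2_norm \<Omega> w"
    by (rule L2_norm_cong_AE[OF L2_measurable[OF weak_op_L2(2)[OF W]] L2_measurable[OF weak_op_L2(2)[OF assms(3)]] ae])
qed

text \<open>Whatever representative \<open>weak_curl\<close> selects, its norm is that of any other
  weak curl, so smallness in the graph norm splits into the two inequalities of
  \<open>smoothly_approximable\<close>.\<close>

lemma H_curl_bc_iff:
  assumes \<Omega>: "open \<Omega>" "bounded \<Omega>" and w: "weak_op op_curl \<Omega> \<Omega> v w"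
  shows "v \<in> H_curl_bc \<gamma> \<Omega> \<longleftrightarrow> smoothly_approximable \<gamma> op_curl \<Omega> v w"
proof -
  have v: "v \<in> H_curl \<Omega>" using w H_curl_iff by blast
  have n: "H_curl_norm \<Omega> (\<lambda>x. v x - u x) = sqrt ((L2_norm \<Omega> (\<lambda>x. v x - u x))\<^sup>2 + (L2_norm \<Omega> (\<lambda>x. w x - diff_op op_curl u x))\<^sup>2)"
    if "u \<in> C_inf_vanishing \<gamma> \<Omega>" for u
    unfolding H_curl_norm_def
    using weak_curl_AE(2)[OF \<Omega> weak_op_diff[OF w smooth_weak_op[OF \<Omega> linear_op_curl C_inf_vanishing_smooth[OF that]] \<Omega> linear_op_curl]]
    by simp
  show ?thesis
  proof
    assume bc: "v \<in> H_curl_bc \<gamma> \<Omega>"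
    show "smoothly_approximable \<gamma> op_curl \<Omega> v w"
      unfolding smoothly_approximable_def
    proof (intro allI impI)
      fix e :: real assume "e > 0"
      then obtain u where u: "u \<in> C_inf_vanishing \<gamma> \<Omega>" "H_curl_norm \<Omega> (\<lambda>x. v x - u x) < e"
        using bc unfolding H_curl_bc_def by blast
      have "L2_norm \<Omega> (\<lambda>x. v x - u x) < e" "L2_norm \<Omega> (\<lambda>x. w x - diff_op op_curl u x) < e"
        using u(2) n[OF u(1)] real_sqrt_sum_squares_ge1[of "L2_norm \<Omega> (\<lambda>x. v x - u x)" "L2_norm \<Omega> (\<lambda>x. w x - diff_op op_curl u x)"]
          real_sqrt_sum_squares_ge2[of "L2_norm \<Omega> (\<lambda>x. w x - diff_op op_curl u x)" "L2_norm \<Omega> (\<lambda>x. v x - u x)"] by linarith+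
      with u(1) show "\<exists>\<phi>\<in>C_inf_vanishing \<gamma> \<Omega>. L2_norm \<Omega> (\<lambda>x. v x - \<phi> x) < e \<and> L2_norm \<Omega> (\<lambda>x. w x - diff_op op_curl \<phi> x) < e"
        by blast
    qed
  next
    assume a: "smoothly_approximable \<gamma> op_curl \<Omega> v w"
    show "v \<in> H_curl_bc \<gamma> \<Omega>"
      unfolding H_curl_bc_def
    proof (intro CollectI conjI v allI impI)
      fix e :: real assume "e > 0"
      then have "e / 2 > 0" by simp
      then obtain u where u: "u \<in> C_inf_vanishing \<gamma> \<Omega>" "L2_norm \<Omega> (\<lambda>x. v x - u x) < e/2" "L2_norm \<Omega> (\<lambda>x. w x - diff_op op_curl u x) < e/2"
        using a unfolding smoothly_approximable_def by blast
      have "H_curl_norm \<Omega> (\<lambda>x. v x - u x) \<le> L2_norm \<Omega> (\<lambda>x. v x - u x) + L2_norm \<Omega> (\<lambda>x. w x - diff_op op_curl u x)"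
        unfolding n[OF u(1)] by (rule sqrt_sum_squares_le_sum) auto
      then show "\<exists>u\<in>C_inf_vanishing \<gamma> \<Omega>. H_curl_norm \<Omega> (\<lambda>x. v x - u x) < e" using u by (intro bexI[of _ u]) auto
    qed
  qed
qed

lemma H_div_bcI:
  assumes \<Omega>: "open \<Omega>" "bounded \<Omega>" and w: "weak_op op_div \<Omega> \<Omega> v w" and a: "smoothly_approximable \<gamma> op_div \<Omega> v w"
  shows "v \<in> H_div_bc \<gamma> \<Omega>"
  unfolding H_div_bc_def
proof (intro CollectI conjI allI impI)
  show "v \<in> H_div \<Omega>" using w H_div_iff by blast
  fix e :: real assume "e > 0"
  then have "e / 2 > 0" by simp
  then obtain u where u: "u \<in> C_inf_vanishing \<gamma> \<Omega>" "L2_norm \<Omega> (\<lambda>x. v x - u x) < e/2" "L2_norm \<Omega> (\<lambda>x. w x - diff_op op_div u x) < e/2"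
    using a unfolding smoothly_approximable_def by blast
  have "L2_norm \<Omega> (weak_div \<Omega> (\<lambda>x. v x - u x)) = L2_norm \<Omega> (\<lambda>x. w x - diff_op op_div u x)"
    by (rule weak_div_AE(2)[OF \<Omega> weak_op_diff[OF w smooth_weak_op[OF \<Omega> linear_op_div C_inf_vanishing_smooth[OF u(1)]] \<Omega> linear_op_div]])
  then have "H_div_norm \<Omega> (\<lambda>x. v x - u x) \<le> L2_norm \<Omega> (\<lambda>x. v x - u x) + L2_norm \<Omega> (\<lambda>x. w x - diff_op op_div u x)"
    unfolding H_div_norm_def using sqrt_sum_squares_le_sum[OF L2_norm_nonneg L2_norm_nonneg] by simp
  then show "\<exists>u\<in>C_inf_vanishing \<gamma> \<Omega>. H_div_norm \<Omega> (\<lambda>x. v x - u x) < e" using u by (intro bexI[of _ u]) auto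
qed

text \<open>Density of smooth fields: the approximation theorem with \<open>W = \<Omega>\<close> and
  no boundary part to avoid. It makes the case without boundary condition an instance of the general
  one.\<close>

lemma H_curl_eq_bc_empty:
  assumes \<Omega>: "open \<Omega>" "bounded \<Omega>" "lipschitz_boundary \<Omega>"
  shows "H_curl_bc {} \<Omega> = H_curl \<Omega>"
proof
  show "H_curl_bc {} \<Omega> \<subseteq> H_curl \<Omega>" by (auto simp: H_curl_bc_def)
  show "H_curl \<Omega> \<subseteq> H_curl_bc {} \<Omega>"
  proof
    fix v assume "v \<in> H_curl \<Omega>"
    note w = weak_op_weak_curl[OF this]
    have "smoothly_approximable {} op_curl \<Omega> v (weak_curl \<Omega> v)"
      by (rule smoothly_approximable_lipschitz[OF \<Omega> linear_op_curl \<Omega>(1) order_refl open_empty _ _ w]) auto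
    then show "v \<in> H_curl_bc {} \<Omega>" using H_curl_bc_iff[OF \<Omega>(1,2) w] by blast
  qed
qed

lemma H_curl0_iff:
  assumes \<Omega>: "open \<Omega>" "bounded \<Omega>"
  shows "v \<in> H_curl0 \<Omega> \<longleftrightarrow> weak_op op_curl \<Omega> \<Omega> v (\<lambda>x. 0)"
proof
  assume "v \<in> H_curl0 \<Omega>"
  then have v: "v \<in> H_curl \<Omega>" "AE x in lebesgue_on \<Omega>. weak_curl \<Omega> v x = 0" by (auto simp: H_curl0_def)
  have "AE x in lebesgue_on \<Omega>. 0 = weak_curl \<Omega> v x" using v(2) by eventually_elim simp
  then show "weak_op op_curl \<Omega> \<Omega> v (\<lambda>x. 0)" by (rule weak_op_cong_AE[OF \<Omega> weak_op_weak_curl[OF v(1)] L2_zero])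
next
  assume w: "weak_op op_curl \<Omega> \<Omega> v (\<lambda>x. 0)"
  then show "v \<in> H_curl0 \<Omega>" using weak_curl_AE(1)[OF \<Omega> w] H_curl_iff by (auto simp: H_curl0_def)
qed

lemma H_curl0_bc_iff:
  assumes \<Omega>: "open \<Omega>" "bounded \<Omega>"
  shows "v \<in> H_curl0_bc \<gamma> \<Omega> \<longleftrightarrow> v \<in> L2 \<Omega> \<and> smoothly_approximable \<gamma> op_curl \<Omega> v (\<lambda>x. 0)"
proof
  assume "v \<in> H_curl0_bc \<gamma> \<Omega>"
  then have v: "v \<in> H_curl_bc \<gamma> \<Omega>" "v \<in> H_curl0 \<Omega>" by (auto simp: H_curl0_bc_def H_curl0_def H_curl_bc_def)
  have w: "weak_op op_curl \<Omega> \<Omega> v (\<lambda>x. 0)" using v(2) H_curl0_iff[OF \<Omega>] by blast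
  then show "v \<in> L2 \<Omega> \<and> smoothly_approximable \<gamma> op_curl \<Omega> v (\<lambda>x. 0)"
    using H_curl_bc_iff[OF \<Omega> w] v(1) weak_op_L2(1)[OF w] by blast
next
  assume a: "v \<in> L2 \<Omega> \<and> smoothly_approximable \<gamma> op_curl \<Omega> v (\<lambda>x. 0)"
  then have w: "weak_op op_curl \<Omega> \<Omega> v (\<lambda>x. 0)"
    by (intro smoothly_approximable_weak_op[OF \<Omega> linear_op_curl _ L2_zero]) auto
  then show "v \<in> H_curl0_bc \<gamma> \<Omega>"
    using H_curl_bc_iff[OF \<Omega> w] a weak_curl_AE(1)[OF \<Omega> w] by (auto simp: H_curl0_bc_def)
qed

lemma H_curl0_eq_bc_empty:
  assumes "open \<Omega>" "bounded \<Omega>" "lipschitz_boundary \<Omega>"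
  shows "H_curl0_bc {} \<Omega> = H_curl0 \<Omega>"
  unfolding H_curl0_bc_def H_curl0_def H_curl_eq_bc_empty[OF assms] ..

lemma smoothly_approximable_scaleR:
  assumes a: "smoothly_approximable \<gamma> A \<Omega> f F" and A: "\<And>i. linear (A i)"
  shows "smoothly_approximable \<gamma> A \<Omega> (\<lambda>x. c *\<^sub>R f x) (\<lambda>x. c *\<^sub>R F x)"
  unfolding smoothly_approximable_def
proof (intro allI impI)
  fix e :: real assume e: "e > 0"
  have c: "\<bar>c\<bar> + 1 > 0" by linarith
  then have "e / (\<bar>c\<bar> + 1) > 0" using e by simp
  then obtain \<phi> where \<phi>: "\<phi> \<in> C_inf_vanishing \<gamma> \<Omega>" "L2_norm \<Omega> (\<lambda>x. f x - \<phi> x) < e / (\<bar>c\<bar> + 1)" "L2_norm \<Omega> (\<lambda>x. F x - diff_op A \<phi> x) < e / (\<bar>c\<bar> + 1)"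
    using a unfolding smoothly_approximable_def by blast
  have bd: "\<bar>c\<bar> * d < e" if "0 \<le> d" "d < e / (\<bar>c\<bar> + 1)" for d
  proof -
    have "\<bar>c\<bar> * d \<le> (\<bar>c\<bar> + 1) * d" using that by (intro mult_right_mono) auto
    also have "\<dots> < e" using that(2) c by (simp add: field_simps)
    finally show ?thesis .
  qed
  have "L2_norm \<Omega> (\<lambda>x. c *\<^sub>R f x - c *\<^sub>R \<phi> x) = \<bar>c\<bar> * L2_norm \<Omega> (\<lambda>x. f x - \<phi> x)"
    by (simp add: L2_norm_scaleR scaleR_diff_right[symmetric])
  moreover have "L2_norm \<Omega> (\<lambda>x. c *\<^sub>R F x - diff_op A (\<lambda>x. c *\<^sub>R \<phi> x) x) = \<bar>c\<bar> * L2_norm \<Omega> (\<lambda>x. F x - diff_op A \<phi> x)"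
    by (simp add: diff_op_scaleR[OF A C_inf_vanishing_smooth[OF \<phi>(1)]] L2_norm_scaleR scaleR_diff_right[symmetric])
  ultimately show "\<exists>\<phi>\<in>C_inf_vanishing \<gamma> \<Omega>. L2_norm \<Omega> (\<lambda>x. c *\<^sub>R f x - \<phi> x) < e \<and> L2_norm \<Omega> (\<lambda>x. c *\<^sub>R F x - diff_op A \<phi> x) < e"
    using bd[OF L2_norm_nonneg \<phi>(2)] bd[OF L2_norm_nonneg \<phi>(3)]
    by (intro bexI[of _ "\<lambda>x. c *\<^sub>R \<phi> x"] C_inf_vanishing_scaleR[OF \<phi>(1)]) auto
qed

section \<open>The projection onto curl-free fields\<close>

lemma L2_subspace_H_curl0_bc:
  assumes \<Omega>: "open \<Omega>" "bounded \<Omega>"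
  shows "L2_subspace \<Omega> (H_curl0_bc \<gamma> \<Omega>)"
  unfolding L2_subspace_def
proof (intro conjI ballI allI)
  show "H_curl0_bc \<gamma> \<Omega> \<subseteq> L2 \<Omega>" using H_curl0_bc_iff[OF \<Omega>] by blast
  show "(\<lambda>x. 0) \<in> H_curl0_bc \<gamma> \<Omega>"
    unfolding H_curl0_bc_iff[OF \<Omega>] by (auto intro: L2_zero smoothly_approximable_zero linear_op_curl)
next
  fix u v assume "u \<in> H_curl0_bc \<gamma> \<Omega>" "v \<in> H_curl0_bc \<gamma> \<Omega>"
  then have uv: "u \<in> L2 \<Omega>" "smoothly_approximable \<gamma> op_curl \<Omega> u (\<lambda>x. 0)" "v \<in> L2 \<Omega>" "smoothly_approximable \<gamma> op_curl \<Omega> v (\<lambda>x. 0)"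
    unfolding H_curl0_bc_iff[OF \<Omega>] by auto
  have "smoothly_approximable \<gamma> op_curl \<Omega> (\<lambda>x. u x + v x) (\<lambda>x. 0 + 0)"
    by (intro smoothly_approximable_add uv L2_zero \<Omega> linear_op_curl)
  then show "(\<lambda>x. u x + v x) \<in> H_curl0_bc \<gamma> \<Omega>"
    unfolding H_curl0_bc_iff[OF \<Omega>] using L2_add[OF uv(1,3)] by simp
next
  fix u c assume "u \<in> H_curl0_bc \<gamma> \<Omega>"
  then have u: "u \<in> L2 \<Omega>" "smoothly_approximable \<gamma> op_curl \<Omega> u (\<lambda>x. 0)"
    unfolding H_curl0_bc_iff[OF \<Omega>] by auto
  show "(\<lambda>x. c *\<^sub>R u x) \<in> H_curl0_bc \<gamma> \<Omega>"
    unfolding H_curl0_bc_iff[OF \<Omega>]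
    using L2_scaleR[OF u(1)] smoothly_approximable_scaleR[OF u(2) linear_op_curl, of c] by simp
qed

text \<open>The curl-free space is closed in \<open>L2\<close>: a limit of fields whose
  approximations have image near 0 is itself approximable with image 0. So the projection onto the
  closure already lies in the space.\<close>

lemma curl_free_projection:
  assumes \<Omega>: "open \<Omega>" "bounded \<Omega>" and v: "v \<in> L2 \<Omega>"
  obtains p where "p \<in> H_curl0_bc \<gamma> \<Omega>" "\<And>u. u \<in> H_curl0_bc \<gamma> \<Omega> \<Longrightarrow> L2_inner \<Omega> (\<lambda>x. v x - p x) u = 0"
proof -
  obtain p where p: "p \<in> L2 \<Omega>" "\<And>e. e > 0 \<Longrightarrow> \<exists>u\<in>H_curl0_bc \<gamma> \<Omega>. L2_norm \<Omega> (\<lambda>x. p x - u x) < e"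
    "\<And>u. u \<in> H_curl0_bc \<gamma> \<Omega> \<Longrightarrow> L2_inner \<Omega> (\<lambda>x. v x - p x) u = 0"
    by (rule L2_projection_onto_closure[OF L2_subspace_H_curl0_bc[OF \<Omega>] v], rule that)
  have "smoothly_approximable \<gamma> op_curl \<Omega> p (\<lambda>x. 0)"
    by (rule smoothly_approximable_closed[OF \<Omega> p(1)]) (use p(2) H_curl0_bc_iff[OF \<Omega>] in blast)
  then have "p \<in> H_curl0_bc \<gamma> \<Omega>" using p(1) H_curl0_bc_iff[OF \<Omega>] by blast
  then show thesis using that p(3) by blast
qed

lemma frontier_disjoint_open: "open S \<Longrightarrow> frontier S \<inter> S = {}"
  by (auto simp: frontier_def interior_open)

text \<open>The closures of \<Gamma>t and \<Gamma>n meet only in the interface. There the first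
  chart coordinate serves as \<open>h\<close>: the second is a Lipschitz function of it, so
  distances are controlled by differences of the first coordinate alone.\<close>

lemma interface_volume:
  assumes \<Omega>: "open \<Omega>" "bounded \<Omega>" and \<Gamma>t: "openin (top_of_set (frontier \<Omega>)) \<Gamma>t" and sep: "lipschitz_separated \<Omega> \<Gamma>t"
  obtains C where "C \<ge> 0" "\<And>\<epsilon>. 0 < \<epsilon> \<Longrightarrow> \<epsilon> \<le> 1 \<Longrightarrow> measure lborel (nbhd \<epsilon> (closure \<Gamma>t \<inter> closure (Gamma_n \<Omega> \<Gamma>t))) \<le> C * \<epsilon>\<^sup>2"
proof -
  define G where "G = Gamma_n \<Omega> \<Gamma>t"
  define I where "I = closure \<Gamma>t \<inter> closure G"
  have sub: "\<Gamma>t \<subseteq> frontier \<Omega>" "G \<subseteq> frontier \<Omega>" using openin_imp_subset[OF \<Gamma>t] by (auto simp: G_def Gamma_n_def)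
  have cl: "closure \<Gamma>t \<subseteq> frontier \<Omega>" "closure G \<subseteq> frontier \<Omega>" by (rule closure_minimal[OF sub(1) frontier_closed], rule closure_minimal[OF sub(2) frontier_closed])
  have bF: "bounded (frontier \<Omega>)" unfolding frontier_def by (rule bounded_subset[OF bounded_closure[OF \<Omega>(2)]]) auto
  have I: "compact I"
    unfolding I_def compact_eq_bounded_closed using bounded_subset[OF bF, of "closure \<Gamma>t \<inter> closure G"] cl by auto
  \<comment> \<open>A common point of the closures lies in neither set: \<Gamma>t is relatively open
    and disjoint from \<Gamma>n, and \<Gamma>n avoids \<open>closure \<Gamma>t\<close>. It is
    therefore outside both relative interiors.\<close>
  have Iint: "I \<subseteq> interface \<Omega> \<Gamma>t"
  proof
    fix x assume x: "x \<in> I"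
    obtain S where S: "open S" "\<Gamma>t = frontier \<Omega> \<inter> S" using \<Gamma>t by (auto simp: openin_open)
    have "x \<notin> \<Gamma>t"
    proof
      assume "x \<in> \<Gamma>t"
      then have "S \<inter> G \<noteq> {}" using S x open_Int_closure_eq_empty[OF S(1), of G] by (auto simp: I_def)
      then show False using S(2) sub(2) closure_subset[of \<Gamma>t] by (auto simp: G_def Gamma_n_def)
    qed
    moreover have "x \<notin> G" using x by (auto simp: I_def G_def Gamma_n_def)
    moreover have "x \<in> frontier \<Omega>" using x cl by (auto simp: I_def)
    moreover have "top_of_set (frontier \<Omega>) interior_of \<Gamma>t \<subseteq> \<Gamma>t" "top_of_set (frontier \<Omega>) interior_of G \<subseteq> G"
      by (rule interior_of_subset)+
    moreover have "top_of_set (frontier \<Omega>) closure_of \<Gamma>t = frontier \<Omega> \<inter> closure \<Gamma>t" "top_of_set (frontier \<Omega>) closure_of G = frontier \<Omega> \<inter> closure G"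
      using sub by (simp_all add: closure_of_subtopology Int_absorb1)
    ultimately show "x \<in> interface \<Omega> \<Gamma>t"
      using x unfolding interface_def frontier_of_def G_def[symmetric] by (auto simp: I_def)
  qed
  have loc: "\<exists>V (h :: real^3 \<Rightarrow> real) M L. open V \<and> x \<in> V \<and> L \<ge> 0 \<and> (\<forall>y\<in>V \<inter> I. \<bar>h y\<bar> \<le> M)
        \<and> (\<forall>y\<in>V \<inter> I. \<forall>z\<in>V \<inter> I. dist y z \<le> L * \<bar>h y - h z\<bar>)" if x: "x \<in> I" for x
  proof -
    have "x \<in> interface \<Omega> \<Gamma>t" using Iint x by blast
    then obtain U L and \<phi> :: "real^3 \<Rightarrow> real \<times> real" and g :: "real \<Rightarrow> real" where
      U: "openin (top_of_set (frontier \<Omega>)) U" "x \<in> U" and bl: "bilipschitz_on U \<phi>" and g: "L-lipschitz_on UNIV g"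
      and eq: "U \<inter> interface \<Omega> \<Gamma>t = {y \<in> U. snd (\<phi> y) = g (fst (\<phi> y))}"
      using sep unfolding lipschitz_separated_def by (elim ballE exE conjE) (rule that, assumption+, blast)
    obtain V where V: "open V" "U = frontier \<Omega> \<inter> V" using U(1) by (auto simp: openin_open)
    obtain K where K: "K > 0" "\<And>y z. y \<in> U \<Longrightarrow> z \<in> U \<Longrightarrow> dist (\<phi> y) (\<phi> z) \<le> K * dist y z"
      "\<And>y z. y \<in> U \<Longrightarrow> z \<in> U \<Longrightarrow> dist y z \<le> K * dist (\<phi> y) (\<phi> z)" using bl unfolding bilipschitz_on_def by blast
    have VI: "y \<in> U \<and> snd (\<phi> y) = g (fst (\<phi> y))" if "y \<in> V \<inter> I" for y
    proof -
      have "y \<in> U \<inter> interface \<Omega> \<Gamma>t" using that Iint cl V by (auto simp: I_def)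
      then show ?thesis unfolding eq by simp
    qed
    have L: "L \<ge> 0" using g by (rule lipschitz_on_nonneg)
    obtain D where D: "\<And>y z. y \<in> frontier \<Omega> \<Longrightarrow> z \<in> frontier \<Omega> \<Longrightarrow> dist y z \<le> D"
      using bounded_two_points[of "frontier \<Omega>"] bF by blast
    show ?thesis
    proof (rule exI[of _ V], rule exI[of _ "\<lambda>y. fst (\<phi> y)"], rule exI[of _ "\<bar>fst (\<phi> x)\<bar> + K * D"], rule exI[of _ "K * (1 + L)"],
        intro conjI ballI)
      show "open V" "x \<in> V" using V U by auto
      show "0 \<le> K * (1 + L)" using K L by simp
      fix y assume y: "y \<in> V \<inter> I"
      have "\<bar>fst (\<phi> y) - fst (\<phi> x)\<bar> \<le> dist (\<phi> y) (\<phi> x)" using dist_fst_le[of "\<phi> y" "\<phi> x"] by (simp add: dist_real_def)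
      also have "\<dots> \<le> K * dist y x" using K(2) VI[OF y] U(2) by blast
      also have "\<dots> \<le> K * D" using D[of y x] VI[OF y] U(2) V(2) K(1) by (intro mult_left_mono) auto
      finally show "\<bar>fst (\<phi> y)\<bar> \<le> \<bar>fst (\<phi> x)\<bar> + K * D" by linarith
      fix z assume z: "z \<in> V \<inter> I"
      have "dist y z \<le> K * dist (\<phi> y) (\<phi> z)" using K(3) VI[OF y] VI[OF z] by blast
      also have "\<dots> \<le> K * (\<bar>fst (\<phi> y) - fst (\<phi> z)\<bar> + L * \<bar>fst (\<phi> y) - fst (\<phi> z)\<bar>)"
      proof (intro mult_left_mono)
        have "dist (\<phi> y) (\<phi> z) \<le> dist (fst (\<phi> y)) (fst (\<phi> z)) + dist (snd (\<phi> y)) (snd (\<phi> z))"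
          unfolding dist_prod_def by (rule sqrt_sum_squares_le_sum) auto
        also have "dist (snd (\<phi> y)) (snd (\<phi> z)) \<le> L * dist (fst (\<phi> y)) (fst (\<phi> z))"
          using VI[OF y] VI[OF z] lipschitz_onD[OF g] by simp
        finally show "dist (\<phi> y) (\<phi> z) \<le> \<bar>fst (\<phi> y) - fst (\<phi> z)\<bar> + L * \<bar>fst (\<phi> y) - fst (\<phi> z)\<bar>"
          by (simp add: dist_real_def)
      qed (use K in simp)
      finally show "dist y z \<le> K * (1 + L) * \<bar>fst (\<phi> y) - fst (\<phi> z)\<bar>" by (simp add: algebra_simps)
    qed
  qed
  show thesis
    using volume_nbhd_compact[OF I loc] that unfolding I_def G_def by blast
qed

lemma abs_le_sqrt_sum: "\<bar>b\<bar> \<le> sqrt (a\<^sup>2 + b\<^sup>2)"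
  by (rule real_le_rsqrt) simp

text \<open>The residual \<open>r\<close> is orthogonal to the projection \<open>p\<close> by
  construction. Orthogonality to \<open>(s, 0)\<close> is the point: it says that \<open>s\<close>
  is orthogonal to the gradient \<open>fst r\<close>. Together they give \<open>r = 0\<close>, so
  \<open>(s, 0)\<close> is a limit of pairs in \<open>V\<close>: the divergence vanishes, and the
  approximating fields carry the boundary condition.\<close>

theorem orthogonal_curl_free_imp_H_div_bc:
  fixes s :: "real^3 \<Rightarrow> real^3"
  assumes \<Omega>: "open \<Omega>" "bounded \<Omega>" "lipschitz_boundary \<Omega>"
    and \<Gamma>t: "openin (top_of_set (frontier \<Omega>)) \<Gamma>t" and sep: "lipschitz_separated \<Omega> \<Gamma>t"
    and s: "s \<in> L2 \<Omega>" and orth: "\<And>u. u \<in> H_curl0_bc \<Gamma>t \<Omega> \<Longrightarrow> L2_inner \<Omega> s u = 0"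
  shows "s \<in> H_div_bc (Gamma_n \<Omega> \<Gamma>t) \<Omega>" "L2_norm \<Omega> (weak_div \<Omega> s) = 0"
proof -
  define G where "G = Gamma_n \<Omega> \<Gamma>t"
  have sub: "\<Gamma>t \<subseteq> frontier \<Omega>" "G \<subseteq> frontier \<Omega>" using openin_imp_subset[OF \<Gamma>t] by (auto simp: G_def Gamma_n_def)
  have cl: "closure \<Gamma>t \<subseteq> frontier \<Omega>" "closure G \<subseteq> frontier \<Omega>" by (rule closure_minimal[OF sub(1) frontier_closed], rule closure_minimal[OF sub(2) frontier_closed])
  note fd = frontier_disjoint_open[OF \<Omega>(1)]
  \<comment> \<open>The gradient of a smooth function vanishing near \<Gamma>t is curl-free and
    vanishes there too, so it is among the fields to which \<open>s\<close> is orthogonal.\<close>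
  have grad: "L2_inner \<Omega> s (classical_grad \<phi>) = 0" if \<phi>: "\<phi> \<in> C_inf_vanishing \<Gamma>t \<Omega>" for \<phi>
  proof (rule orth)
    have sm: "smooth \<phi>" by (rule C_inf_vanishing_smooth[OF \<phi>])
    have "classical_grad \<phi> \<in> L2 \<Omega>" by (intro smooth_L2 \<Omega> smooth_classical_grad sm)
    moreover have "smoothly_approximable \<Gamma>t op_curl \<Omega> (classical_grad \<phi>) (\<lambda>x. 0)"
      unfolding smoothly_approximable_def
      by (intro allI impI bexI[OF _ C_inf_vanishing_classical_grad[OF \<phi> \<Omega>(1)]])
        (simp add: diff_op_curl classical_curl_grad[OF sm])
    ultimately show "classical_grad \<phi> \<in> H_curl0_bc \<Gamma>t \<Omega>" using H_curl0_bc_iff[OF \<Omega>(1,2)] by blast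
  qed
  define V :: "(real^3 \<Rightarrow> (real^3) \<times> real) set" where "V = {\<lambda>x. (u x, diff_op op_div u x) | u. u \<in> C_inf_vanishing G \<Omega>}"
  have VI: "(\<lambda>x. (u x, diff_op op_div u x)) \<in> V" if "u \<in> C_inf_vanishing G \<Omega>" for u
    unfolding V_def using that by blast
  have bfst: "bounded_linear (\<lambda>v::real^3. (v, 0::real))" and bsnd: "bounded_linear (\<lambda>v::real. (0::real^3, v))"
    by (auto intro!: bounded_linear_Pair bounded_linear_ident bounded_linear_zero)
  have pairL: "(\<lambda>x. (f x, g x)) \<in> L2 \<Omega>" if "f \<in> L2 \<Omega>" "g \<in> L2 \<Omega>" for f :: "real^3 \<Rightarrow> real^3" and g :: "real^3 \<Rightarrow> real"
    using L2_add[OF L2_bounded_linear[OF that(1) bfst] L2_bounded_linear[OF that(2) bsnd]] by simp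
  have uL: "u \<in> L2 \<Omega>" "diff_op op_div u \<in> L2 \<Omega>" if "u \<in> C_inf_vanishing G \<Omega>" for u
    by (intro smooth_L2 \<Omega> smooth_diff_op linear_op_div C_inf_vanishing_smooth[OF that])+
  have sV: "L2_subspace \<Omega> V"
    unfolding L2_subspace_def
  proof (intro conjI ballI allI)
    show "V \<subseteq> L2 \<Omega>" unfolding V_def using pairL uL by blast
    have "(\<lambda>x. (0, diff_op op_div (\<lambda>x. 0) x)) \<in> V" by (rule VI[OF C_inf_vanishing_zero])
    then show "(\<lambda>x. 0) \<in> V" by (simp add: diff_op_def linear_0[OF linear_op_div] zero_prod_def)
  next
    fix a b assume "a \<in> V" "b \<in> V"
    then obtain u v where u: "u \<in> C_inf_vanishing G \<Omega>" "a = (\<lambda>x. (u x, diff_op op_div u x))"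
      and v: "v \<in> C_inf_vanishing G \<Omega>" "b = (\<lambda>x. (v x, diff_op op_div v x))" unfolding V_def by blast
    have "(\<lambda>x. a x + b x) = (\<lambda>x. (u x + v x, diff_op op_div (\<lambda>x. u x + v x) x))"
      by (simp add: u(2) v(2) diff_op_add[OF linear_op_div C_inf_vanishing_smooth[OF u(1)] C_inf_vanishing_smooth[OF v(1)]])
    then show "(\<lambda>x. a x + b x) \<in> V" using VI[OF C_inf_vanishing_add[OF u(1) v(1)]] by simp
  next
    fix a c assume "a \<in> V"
    then obtain u where u: "u \<in> C_inf_vanishing G \<Omega>" "a = (\<lambda>x. (u x, diff_op op_div u x))" unfolding V_def by blast
    have "(\<lambda>x. c *\<^sub>R a x) = (\<lambda>x. (c *\<^sub>R u x, diff_op op_div (\<lambda>x. c *\<^sub>R u x) x))"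
      by (simp add: u(2) diff_op_scaleR[OF linear_op_div C_inf_vanishing_smooth[OF u(1)]])
    then show "(\<lambda>x. c *\<^sub>R a x) \<in> V" using VI[OF C_inf_vanishing_scaleR[OF u(1), of c]] by simp
  qed
  define f where "f x = (s x, 0::real)" for x
  have fL: "f \<in> L2 \<Omega>" unfolding f_def by (rule pairL[OF s L2_zero])
  obtain p where p: "p \<in> L2 \<Omega>" "\<And>e. e > 0 \<Longrightarrow> \<exists>u\<in>V. L2_norm \<Omega> (\<lambda>x. p x - u x) < e"
    "\<And>u. u \<in> V \<Longrightarrow> L2_inner \<Omega> (\<lambda>x. f x - p x) u = 0"
    by (rule L2_projection_onto_closure[OF sV fL], rule that)
  define r where "r x = f x - p x" for x
  have rL: "r \<in> L2 \<Omega>" unfolding r_def by (rule L2_diff[OF fL p(1)])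
  have r12: "(\<lambda>x. fst (r x)) \<in> L2 \<Omega>" "(\<lambda>x. snd (r x)) \<in> L2 \<Omega>"
    by (auto intro!: L2_bounded_linear[OF rL] bounded_linear_fst bounded_linear_snd)
  \<comment> \<open>A test field with compact support off \<open>closure G\<close> keeps a positive
    distance from \<open>G\<close>, so it gives an element of \<open>V\<close>. Orthogonality of
    \<open>r\<close> to it is a weak gradient relation that reaches across \<Gamma>t away from
    \<open>closure G\<close>; this encodes the zero trace of \<open>snd r\<close> there.\<close>
  have w: "weak_op op_grad (- closure G) \<Omega> (\<lambda>x. snd (r x)) (\<lambda>x. fst (r x))"
    unfolding weak_op_def
  proof (intro conjI ballI r12)
    fix u :: "real^3 \<Rightarrow> real^3" assume u: "u \<in> test_functions (- closure G)"
    have "u \<in> C_inf_vanishing G \<Omega>"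
    proof -
      define K where "K = closure {x. u x \<noteq> 0}"
      have K: "compact K" "K \<inter> closure G = {}" using u by (auto simp: K_def test_functions_def)
      obtain d where d: "d > 0" "\<And>x y. x \<in> K \<Longrightarrow> y \<in> closure G \<Longrightarrow> d \<le> dist x y"
        using separate_compact_closed[OF K(1) closed_closure K(2)] by blast
      have "closure {x \<in> \<Omega>. u x \<noteq> 0} \<subseteq> K" unfolding K_def by (intro closure_mono) auto
      then show ?thesis
        using d closure_subset[of G] test_functionsD(1)[OF u] unfolding C_inf_vanishing_def by blast
    qed
    then have "(\<lambda>x. (u x, diff_op op_div u x)) \<in> V" "u \<in> L2 \<Omega>" "diff_op op_div u \<in> L2 \<Omega>"
      using uL unfolding V_def by auto
    note uV = this
    have "(\<integral>x. fst (r x) \<bullet> u x + snd (r x) * diff_op op_div u x \<partial>lebesgue_on \<Omega>) = 0"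
      using p(3)[OF uV(1)] unfolding L2_inner_def r_def[symmetric] by (simp add: inner_prod_def)
    moreover have "(\<integral>x. fst (r x) \<bullet> u x + snd (r x) * diff_op op_div u x \<partial>lebesgue_on \<Omega>)
      = L2_inner \<Omega> (\<lambda>x. fst (r x)) u + (\<integral>x. snd (r x) * diff_op op_div u x \<partial>lebesgue_on \<Omega>)"
      unfolding L2_inner_def using L2_inner_integrable[OF r12(1) uV(2)] L2_inner_integrable[OF r12(2) uV(3)]
      by (intro Bochner_Integration.integral_add) auto
    ultimately show "(\<integral>x. (\<Sum>i\<in>UNIV. op_grad i (snd (r x)) \<bullet> pd i u x) \<partial>lebesgue_on \<Omega>) = - L2_inner \<Omega> (\<lambda>x. fst (r x)) u"
      by (simp add: op_grad_inner)
  qed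
  obtain C0 where C0: "C0 \<ge> 0" "\<And>\<epsilon>. 0 < \<epsilon> \<Longrightarrow> \<epsilon> \<le> 1 \<Longrightarrow> measure lborel (nbhd \<epsilon> (closure \<Gamma>t \<inter> closure G)) \<le> C0 * \<epsilon>\<^sup>2"
    by (rule interface_volume[OF \<Omega>(1,2) \<Gamma>t sep, folded G_def], rule that)
  have I: "compact (closure \<Gamma>t \<inter> closure G)"
    unfolding compact_eq_bounded_closed
    using bounded_subset[OF bounded_closure[OF \<Omega>(2)], of "closure \<Gamma>t \<inter> closure G"] cl by (auto simp: frontier_def)
  have "L2_inner \<Omega> s (\<lambda>x. fst (r x)) = 0"
    by (rule grad_orthogonal[OF \<Omega> _ closed_closure _ I _ _ C0 w s grad]) (use sub cl fd in auto)
  then have "L2_inner \<Omega> r f = 0"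
    by (simp add: L2_inner_def f_def inner_prod_def inner_commute)
  moreover have "L2_inner \<Omega> r p = 0"
  proof (rule L2_inner_limit[OF p(1) rL])
    fix e :: real assume "e > 0"
    then obtain u where "u \<in> V" "L2_norm \<Omega> (\<lambda>x. p x - u x) < e" using p(2) by blast
    moreover have "V \<subseteq> L2 \<Omega>" using sV by (simp add: L2_subspace_def)
    ultimately show "\<exists>h\<in>L2 \<Omega>. L2_norm \<Omega> (\<lambda>x. p x - h x) < e \<and> L2_inner \<Omega> r h = 0"
      using p(3) unfolding r_def by blast
  qed
  ultimately have "L2_inner \<Omega> r (\<lambda>x. f x - p x) = 0" using L2_inner_diff_right[OF fL p(1) rL] by simp
  then have "(L2_norm \<Omega> r)\<^sup>2 = 0" unfolding L2_norm_sq_inner r_def[symmetric] by simp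
  then have r0: "L2_norm \<Omega> r = 0" by simp
  have appr: "smoothly_approximable G op_div \<Omega> s (\<lambda>x. 0)"
    unfolding smoothly_approximable_def
  proof (intro allI impI)
    fix e :: real assume "e > 0"
    then obtain u where u: "u \<in> C_inf_vanishing G \<Omega>" "L2_norm \<Omega> (\<lambda>x. p x - (u x, diff_op op_div u x)) < e"
      using p(2) unfolding V_def by blast
    have upL: "(\<lambda>x. (u x, diff_op op_div u x)) \<in> L2 \<Omega>" by (rule pairL[OF uL[OF u(1)]])
    have "L2_norm \<Omega> (\<lambda>x. f x - (u x, diff_op op_div u x)) \<le> L2_norm \<Omega> (\<lambda>x. f x - p x) + L2_norm \<Omega> (\<lambda>x. p x - (u x, diff_op op_div u x))"
      by (rule L2_norm_triangle_diff[OF fL p(1) upL])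
    then have le: "L2_norm \<Omega> (\<lambda>x. f x - (u x, diff_op op_div u x)) < e"
      using r0 u(2) unfolding r_def by simp
    have dL: "(\<lambda>x. f x - (u x, diff_op op_div u x)) \<in> L2 \<Omega>" by (rule L2_diff[OF fL upL])
    have "L2_norm \<Omega> (\<lambda>x. s x - u x) \<le> L2_norm \<Omega> (\<lambda>x. f x - (u x, diff_op op_div u x))"
      by (rule L2_norm_mono_AE[OF L2_diff[OF s uL(1)[OF u(1)]] dL])
        (simp add: f_def norm_Pair real_sqrt_sum_squares_ge1)
    moreover have "L2_norm \<Omega> (\<lambda>x. 0 - diff_op op_div u x) \<le> L2_norm \<Omega> (\<lambda>x. f x - (u x, diff_op op_div u x))"
      by (rule L2_norm_mono_AE[OF L2_diff[OF L2_zero uL(2)[OF u(1)]] dL])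
        (simp add: f_def norm_Pair abs_le_sqrt_sum)
    ultimately show "\<exists>\<phi>\<in>C_inf_vanishing G \<Omega>. L2_norm \<Omega> (\<lambda>x. s x - \<phi> x) < e \<and> L2_norm \<Omega> (\<lambda>x. 0 - diff_op op_div \<phi> x) < e"
      using le u(1) by (intro bexI[of _ u]) auto
  qed
  have wd: "weak_op op_div \<Omega> \<Omega> s (\<lambda>x. 0)"
    by (rule smoothly_approximable_weak_op[OF \<Omega>(1,2) linear_op_div s L2_zero appr])
  show "s \<in> H_div_bc (Gamma_n \<Omega> \<Gamma>t) \<Omega>"
    unfolding G_def[symmetric] by (rule H_div_bcI[OF \<Omega>(1,2) wd appr])
  show "L2_norm \<Omega> (weak_div \<Omega> s) = 0" using weak_div_AE(2)[OF \<Omega>(1,2) wd] by simp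
qed

section \<open>Tensor fields\<close>

lemma linear_mat_sym: "linear mat_sym"
  by (intro linearI) (simp_all add: mat_sym_def transpose_def vec_eq_iff algebra_simps)

lemma norm_transpose: "norm (transpose M) = norm M" for M :: "real^3^3"
  unfolding norm_eq_sqrt_inner by (simp add: inner_vec_def transpose_def sum_3)

lemma norm_mat_sym_le: "norm (mat_sym M) \<le> norm M"
  using norm_triangle_ineq[of M "transpose M"] by (simp add: mat_sym_def norm_transpose)

lemma bounded_linear_mat_sym: "bounded_linear mat_sym"
  by (simp add: linear_mat_sym flip: linear_conv_bounded_linear)

lemma transpose_diff: "transpose (A - B) = transpose A - transpose B" for A B :: "real^3^3"
  by (simp add: transpose_def vec_eq_iff)

lemma mat_skew_in_so3: "mat_skew M \<in> so3"
  by (simp add: so3_def mat_skew_def transpose_scalar transpose_diff transpose_transpose algebra_simps)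

lemma inner_transpose: "transpose M \<bullet> B = M \<bullet> transpose B" for M B :: "real^3^3"
  by (simp add: transpose_def inner_vec_def sum_3)

lemma inner_mat_skew: "B \<in> so3 \<Longrightarrow> M \<bullet> B = mat_skew M \<bullet> B"
  by (simp add: so3_def mat_skew_def inner_diff_left inner_transpose)

lemma so3_diff: "A \<in> so3 \<Longrightarrow> B \<in> so3 \<Longrightarrow> A - B \<in> so3"
  by (simp add: so3_def transpose_diff)

lemma so3_zero: "0 \<in> so3"
  by (simp add: so3_def transpose_def vec_eq_iff)

lemma L2_row: "T \<in> L2 \<Omega> \<Longrightarrow> row_field T i \<in> L2 \<Omega>"
  unfolding row_field_def by (rule L2_bounded_linear[OF _ bounded_linear_vec_nth])

lemma L2_rowsI:
  assumes "\<And>i. row_field T i \<in> L2 \<Omega>"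
  shows "T \<in> L2 \<Omega>"
proof -
  have "bounded_linear (axis i :: real^3 \<Rightarrow> real^3^3)" for i
    unfolding linear_conv_bounded_linear[symmetric]
    by (intro linearI) (auto simp: axis_def vec_eq_iff)
  then have "(\<lambda>x. \<Sum>i\<in>UNIV. axis i (row_field T i x) :: real^3^3) \<in> L2 \<Omega>"
    by (intro L2_sum L2_bounded_linear[OF assms])
  moreover have "(\<Sum>i\<in>UNIV. axis i (row_field T i x)) = T x" for x
    by (simp add: row_field_def axis_def vec_eq_iff forall_3 sum_3)
  ultimately show ?thesis by simp
qed

lemma L2_inner_rows:
  assumes "T \<in> L2 \<Omega>" "S \<in> L2 \<Omega>"
  shows "L2_inner \<Omega> T S = (\<Sum>i\<in>UNIV. L2_inner \<Omega> (row_field T i) (row_field S i))"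
proof -
  have "L2_inner \<Omega> T S = (\<integral>x. (\<Sum>i\<in>UNIV. row_field T i x \<bullet> row_field S i x) \<partial>lebesgue_on \<Omega>)"
    unfolding L2_inner_def by (simp add: inner_vec_def[of "T _"] row_field_def)
  also have "\<dots> = (\<Sum>i\<in>UNIV. L2_inner \<Omega> (row_field T i) (row_field S i))"
    unfolding L2_inner_def by (rule Bochner_Integration.integral_sum) (intro L2_inner_integrable L2_row assms)
  finally show ?thesis .
qed

lemma L2_norm_sq_rows: "T \<in> L2 \<Omega> \<Longrightarrow> (L2_norm \<Omega> T)\<^sup>2 = (\<Sum>i\<in>UNIV. (L2_norm \<Omega> (row_field T i))\<^sup>2)"
  unfolding L2_norm_sq_inner by (rule L2_inner_rows)

lemma row_field_diff: "row_field (\<lambda>x. S x - T x) i = (\<lambda>x. row_field S i x - row_field T i x)"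
  by (simp add: row_field_def)

lemma row_field_weak_Curl: "row_field (weak_Curl \<Omega> T) i = weak_curl \<Omega> (row_field T i)"
  by (simp add: row_field_def weak_Curl_def)

lemma H_Curl_L2: "T \<in> H_Curl \<Omega> \<Longrightarrow> T \<in> L2 \<Omega>"
  by (rule L2_rowsI) (auto simp: H_Curl_def H_curl_def)

lemma weak_Curl_L2: "T \<in> H_Curl \<Omega> \<Longrightarrow> weak_Curl \<Omega> T \<in> L2 \<Omega>"
  by (rule L2_rowsI) (auto simp: row_field_weak_Curl H_Curl_def intro: weak_op_L2(2)[OF weak_op_weak_curl])

lemma H_Curl_bc_subset: "H_Curl_bc \<gamma> \<Omega> \<subseteq> H_Curl \<Omega>"
  by (auto simp: H_Curl_bc_def H_Curl_def H_curl_bc_def)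

lemma H_Curl0_bc_subset: "H_Curl0_bc \<gamma> \<Omega> \<subseteq> H_Curl \<Omega>"
  by (auto simp: H_Curl0_bc_def H_Curl_def H_curl0_bc_def H_curl_bc_def)

lemma H_Curl_eq_bc_empty:
  assumes "open \<Omega>" "bounded \<Omega>" "lipschitz_boundary \<Omega>"
  shows "H_Curl \<Omega> = H_Curl_bc {} \<Omega>" "H_Curl0 \<Omega> = H_Curl0_bc {} \<Omega>"
  by (simp_all add: H_Curl_def H_Curl_bc_def H_Curl0_def H_Curl0_bc_def H_curl_eq_bc_empty[OF assms] H_curl0_eq_bc_empty[OF assms])

lemma curl_free_const:
  assumes "open \<Omega>" "bounded \<Omega>"
  shows "weak_op op_curl \<Omega> \<Omega> (\<lambda>x. c) (\<lambda>x. 0)"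
proof -
  have "diff_op op_curl (\<lambda>x. c) = (\<lambda>x. 0)" by (simp add: diff_op_def fun_eq_iff linear_0[OF linear_op_curl])
  then show ?thesis using smooth_weak_op[OF assms, of op_curl "\<lambda>x. c", OF linear_op_curl smooth_const] by simp
qed

lemma const_in_H_Curl0:
  assumes "open \<Omega>" "bounded \<Omega>"
  shows "(\<lambda>x. A) \<in> H_Curl0 \<Omega>"
  by (simp add: H_Curl0_def row_field_def H_curl0_iff[OF assms] curl_free_const[OF assms])

lemma H_Curl_diff_curl_free:
  assumes \<Omega>: "open \<Omega>" "bounded \<Omega>" and T: "T \<in> H_Curl \<Omega>" and R: "R \<in> H_Curl0 \<Omega>"
  shows "(\<lambda>x. T x - R x) \<in> H_Curl \<Omega>"
    "L2_norm \<Omega> (weak_Curl \<Omega> (\<lambda>x. T x - R x)) = L2_norm \<Omega> (weak_Curl \<Omega> T)"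
proof -
  have w: "weak_op op_curl \<Omega> \<Omega> (row_field (\<lambda>x. T x - R x) i) (weak_curl \<Omega> (row_field T i))" for i
  proof -
    have "weak_op op_curl \<Omega> \<Omega> (row_field R i) (\<lambda>x. 0)" using R H_curl0_iff[OF \<Omega>] by (auto simp: H_Curl0_def)
    moreover have "weak_op op_curl \<Omega> \<Omega> (row_field T i) (weak_curl \<Omega> (row_field T i))"
      using T by (intro weak_op_weak_curl) (auto simp: H_Curl_def)
    ultimately show ?thesis using weak_op_diff[OF _ _ \<Omega> linear_op_curl] by (fastforce simp: row_field_diff)
  qed
  then show H: "(\<lambda>x. T x - R x) \<in> H_Curl \<Omega>" using H_curl_iff unfolding H_Curl_def by blast
  have "(L2_norm \<Omega> (weak_Curl \<Omega> (\<lambda>x. T x - R x)))\<^sup>2 = (L2_norm \<Omega> (weak_Curl \<Omega> T))\<^sup>2"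
    unfolding L2_norm_sq_rows[OF weak_Curl_L2[OF T]] L2_norm_sq_rows[OF weak_Curl_L2[OF H]] row_field_weak_Curl
    using weak_curl_AE(2)[OF \<Omega> w] by simp
  then show "L2_norm \<Omega> (weak_Curl \<Omega> (\<lambda>x. T x - R x)) = L2_norm \<Omega> (weak_Curl \<Omega> T)"
    by (rule power2_eq_imp_eq) auto
qed

text \<open>Subtracting the curl-free part changes neither the curl nor the boundary condition on
  \<Gamma>t. The remainder is orthogonal to the harmonic fields because these are curl-free with
  that same condition, and with zero divergence only the curl is left on the right of the Maxwell
  estimate.\<close>

lemma maxwell_curl_estimate:
  assumes \<Omega>: "open \<Omega>" "bounded \<Omega>" "lipschitz_boundary \<Omega>"
    and \<Gamma>t: "openin (top_of_set (frontier \<Omega>)) \<Gamma>t" "lipschitz_separated \<Omega> \<Gamma>t"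
    and cm: "maxwell_constant \<Omega> \<Gamma>t cm" and v: "v \<in> H_curl_bc \<Gamma>t \<Omega>"
  obtains p where "p \<in> H_curl0_bc \<Gamma>t \<Omega>" "\<And>u. u \<in> H_curl0_bc \<Gamma>t \<Omega> \<Longrightarrow> L2_inner \<Omega> (\<lambda>x. v x - p x) u = 0"
    "L2_norm \<Omega> (\<lambda>x. v x - p x) \<le> cm * L2_norm \<Omega> (weak_curl \<Omega> v)"
proof -
  have w: "weak_op op_curl \<Omega> \<Omega> v (weak_curl \<Omega> v)" using v by (intro weak_op_weak_curl) (auto simp: H_curl_bc_def)
  note vL = weak_op_L2[OF w]
  obtain p where p: "p \<in> H_curl0_bc \<Gamma>t \<Omega>" "\<And>u. u \<in> H_curl0_bc \<Gamma>t \<Omega> \<Longrightarrow> L2_inner \<Omega> (\<lambda>x. v x - p x) u = 0"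
    by (rule curl_free_projection[OF \<Omega>(1,2) vL(1)], rule that)
  define s where "s x = v x - p x" for x
  have pL: "p \<in> L2 \<Omega>" and pa: "smoothly_approximable \<Gamma>t op_curl \<Omega> p (\<lambda>x. 0)" using p(1) H_curl0_bc_iff[OF \<Omega>(1,2)] by auto
  have sL: "s \<in> L2 \<Omega>" unfolding s_def by (rule L2_diff[OF vL(1) pL])
  have pw: "weak_op op_curl \<Omega> \<Omega> p (\<lambda>x. 0)"
    by (rule smoothly_approximable_weak_op[OF \<Omega>(1,2) linear_op_curl pL L2_zero pa])
  have sw: "weak_op op_curl \<Omega> \<Omega> s (weak_curl \<Omega> v)"
    using weak_op_diff[OF w pw \<Omega>(1,2) linear_op_curl] by (simp add: s_def[abs_def])
  have va: "smoothly_approximable \<Gamma>t op_curl \<Omega> v (weak_curl \<Omega> v)" using H_curl_bc_iff[OF \<Omega>(1,2) w] v by blast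
  have "smoothly_approximable \<Gamma>t op_curl \<Omega> (\<lambda>x. v x + (-1) *\<^sub>R p x) (\<lambda>x. weak_curl \<Omega> v x + (-1) *\<^sub>R 0)"
    by (intro smoothly_approximable_add smoothly_approximable_scaleR va pa vL L2_scaleR pL L2_zero \<Omega> linear_op_curl)
  then have "smoothly_approximable \<Gamma>t op_curl \<Omega> s (weak_curl \<Omega> v)" by (simp add: s_def[abs_def])
  then have sc: "s \<in> H_curl_bc \<Gamma>t \<Omega>" using H_curl_bc_iff[OF \<Omega>(1,2) sw] by blast
  have so: "L2_inner \<Omega> s u = 0" if "u \<in> H_curl0_bc \<Gamma>t \<Omega>" for u using p(2)[OF that] by (simp add: s_def[abs_def])
  note sd = orthogonal_curl_free_imp_H_div_bc[OF \<Omega> \<Gamma>t sL so]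
  have "s \<in> L2_perp \<Omega> (harmonic_fields \<Omega> \<Gamma>t)" using sL so by (auto simp: L2_perp_def harmonic_fields_def)
  then have "L2_norm \<Omega> s \<le> cm * sqrt ((L2_norm \<Omega> (weak_curl \<Omega> s))\<^sup>2 + (L2_norm \<Omega> (weak_div \<Omega> s))\<^sup>2)"
    using cm sc sd(1) unfolding maxwell_constant_def by blast
  then have "L2_norm \<Omega> s \<le> cm * L2_norm \<Omega> (weak_curl \<Omega> v)"
    using sd(2) weak_curl_AE(2)[OF \<Omega>(1,2) sw] by simp
  then show thesis using that p by (simp add: s_def[abs_def])
qed

text \<open>Inner products and squared norms are sums over rows, so the projection can be taken row
  by row and the estimates add up with the same constant.\<close>

lemma tensor_helmholtz:
  assumes \<Omega>: "open \<Omega>" "bounded \<Omega>" "lipschitz_boundary \<Omega>"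
    and \<Gamma>t: "openin (top_of_set (frontier \<Omega>)) \<Gamma>t" "lipschitz_separated \<Omega> \<Gamma>t"
    and cm: "maxwell_constant \<Omega> \<Gamma>t cm" and T: "T \<in> H_Curl_bc \<Gamma>t \<Omega>"
  obtains R where "R \<in> H_Curl0_bc \<Gamma>t \<Omega>" "\<And>U. U \<in> H_Curl0_bc \<Gamma>t \<Omega> \<Longrightarrow> L2_inner \<Omega> (\<lambda>x. T x - R x) U = 0"
    "L2_norm \<Omega> (\<lambda>x. T x - R x) \<le> cm * L2_norm \<Omega> (weak_Curl \<Omega> T)"
proof -
  have "\<exists>p. p \<in> H_curl0_bc \<Gamma>t \<Omega> \<and> (\<forall>u\<in>H_curl0_bc \<Gamma>t \<Omega>. L2_inner \<Omega> (\<lambda>x. row_field T i x - p x) u = 0)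
      \<and> L2_norm \<Omega> (\<lambda>x. row_field T i x - p x) \<le> cm * L2_norm \<Omega> (weak_curl \<Omega> (row_field T i))" for i
  proof -
    have "row_field T i \<in> H_curl_bc \<Gamma>t \<Omega>" using T by (simp add: H_Curl_bc_def)
    then show ?thesis by (rule maxwell_curl_estimate[OF \<Omega> \<Gamma>t cm]) (intro exI conjI ballI, assumption, blast, assumption)
  qed
  then have "\<forall>i. \<exists>p. p \<in> H_curl0_bc \<Gamma>t \<Omega> \<and> (\<forall>u\<in>H_curl0_bc \<Gamma>t \<Omega>. L2_inner \<Omega> (\<lambda>x. row_field T i x - p x) u = 0)
      \<and> L2_norm \<Omega> (\<lambda>x. row_field T i x - p x) \<le> cm * L2_norm \<Omega> (weak_curl \<Omega> (row_field T i))" by (rule allI)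
  from choice[OF this] obtain p where p: "\<And>i. p i \<in> H_curl0_bc \<Gamma>t \<Omega>" "\<And>i u. u \<in> H_curl0_bc \<Gamma>t \<Omega> \<Longrightarrow> L2_inner \<Omega> (\<lambda>x. row_field T i x - p i x) u = 0"
    "\<And>i. L2_norm \<Omega> (\<lambda>x. row_field T i x - p i x) \<le> cm * L2_norm \<Omega> (weak_curl \<Omega> (row_field T i))" by blast
  define R :: "real^3 \<Rightarrow> real^3^3" where "R x = (\<chi> i. p i x)" for x
  have rowR: "row_field R i = p i" for i by (simp add: row_field_def R_def)
  have R: "R \<in> H_Curl0_bc \<Gamma>t \<Omega>" by (simp add: H_Curl0_bc_def rowR p(1))
  note TH = subsetD[OF H_Curl_bc_subset T] and RH = subsetD[OF H_Curl0_bc_subset R]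
  have SL: "(\<lambda>x. T x - R x) \<in> L2 \<Omega>" by (rule L2_diff[OF H_Curl_L2[OF TH] H_Curl_L2[OF RH]])
  show thesis
  proof (rule that[OF R])
    fix U assume U: "U \<in> H_Curl0_bc \<Gamma>t \<Omega>"
    then have "U \<in> L2 \<Omega>" using H_Curl_L2 H_Curl0_bc_subset by blast
    from L2_inner_rows[OF SL this] show "L2_inner \<Omega> (\<lambda>x. T x - R x) U = 0"
      using U p(2) by (simp add: row_field_diff rowR H_Curl0_bc_def)
  next
    have c: "cm \<ge> 0" using cm by (simp add: maxwell_constant_def)
    have "(L2_norm \<Omega> (\<lambda>x. T x - R x))\<^sup>2 = (\<Sum>i\<in>UNIV. (L2_norm \<Omega> (\<lambda>x. row_field T i x - p i x))\<^sup>2)"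
      unfolding L2_norm_sq_rows[OF SL] by (simp add: row_field_diff rowR)
    also have "\<dots> \<le> (\<Sum>i\<in>UNIV. (cm * L2_norm \<Omega> (weak_curl \<Omega> (row_field T i)))\<^sup>2)"
      by (intro sum_mono power_mono p(3)) simp
    also have "\<dots> = (cm * L2_norm \<Omega> (weak_Curl \<Omega> T))\<^sup>2"
      unfolding power_mult_distrib L2_norm_sq_rows[OF weak_Curl_L2[OF TH]] row_field_weak_Curl by (simp add: sum_distrib_left)
    finally show "L2_norm \<Omega> (\<lambda>x. T x - R x) \<le> cm * L2_norm \<Omega> (weak_Curl \<Omega> T)"
      by (rule power2_le_imp_le) (use c in simp)
  qed
qed

section \<open>Estimates from the Maxwell and Korn constants\<close>

lemma sum_le_sqrt2: "a + b \<le> sqrt 2 * sqrt (a\<^sup>2 + b\<^sup>2)" for a b :: real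
proof -
  have "(a + b)\<^sup>2 \<le> 2 * (a\<^sup>2 + b\<^sup>2)" using sum_squares_bound[of a b] by (simp add: power2_sum)
  then show ?thesis by (metis real_le_rsqrt real_sqrt_mult)
qed

lemma square_sum_le: "(a + b)\<^sup>2 \<le> 2 * a\<^sup>2 + 2 * b\<^sup>2" for a b :: real
  using sum_squares_bound[of a b] by (simp add: power2_sum)

lemma c_hat_pos: "ck > 0 \<Longrightarrow> 0 < c_hat cm ck"
  unfolding c_hat_def by (simp add: less_max_iff_disj)

lemma c_hat_le_c_tilde:
  assumes "cm > 0" "ck > 0"
  shows "c_hat cm ck \<le> c_tilde cm ck"
proof -
  have "sqrt (1 + 2 * ck\<^sup>2) \<le> sqrt 2 * (1 + ck)"
  proof (rule real_le_lsqrt)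
    show "1 + 2 * ck\<^sup>2 \<le> (sqrt 2 * (1 + ck))\<^sup>2"
      using assms by (simp add: power_mult_distrib power2_sum)
  qed (use assms in auto)
  then have "cm * sqrt (1 + 2 * ck\<^sup>2) \<le> cm * (sqrt 2 * (1 + ck))" using assms by simp
  also have "\<dots> = sqrt 2 * (cm * (1 + ck))" by simp
  also have "\<dots> \<le> c_tilde cm ck" unfolding c_tilde_def by (intro mult_left_mono) auto
  finally show ?thesis unfolding c_hat_def c_tilde_def by auto
qed

text \<open>Used with \<open>r\<close> the norm of \<open>R\<close>, or of \<open>R\<close> minus
  its skew mean, \<open>s\<close> the norm of \<open>T - R\<close>, and \<sigma>, \<kappa> those of
  \<open>sym T\<close> and \<open>Curl T\<close>. Squaring produces the coefficients
  \<open>2 * ck\<^sup>2\<close> and \<open>cm\<^sup>2 * (1 + 2 * ck\<^sup>2)\<close>, whose roots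
  are the two entries of \<open>c_hat\<close>.\<close>

lemma c_hat_estimate:
  assumes c: "cm > 0" "ck > 0" and r: "0 \<le> r" "r \<le> ck * (\<sigma> + s)" and s: "0 \<le> s" "s \<le> cm * \<kappa>" and "0 \<le> \<sigma>"
  shows "r\<^sup>2 + s\<^sup>2 \<le> (c_hat cm ck * sqrt (\<sigma>\<^sup>2 + \<kappa>\<^sup>2))\<^sup>2"
proof -
  have "r\<^sup>2 \<le> (ck * (\<sigma> + s))\<^sup>2" by (rule power_mono[OF r(2,1)])
  also have "\<dots> \<le> ck\<^sup>2 * (2 * \<sigma>\<^sup>2 + 2 * s\<^sup>2)"
    unfolding power_mult_distrib by (intro mult_left_mono square_sum_le) auto
  finally have "r\<^sup>2 + s\<^sup>2 \<le> (2 * ck\<^sup>2) * \<sigma>\<^sup>2 + (1 + 2 * ck\<^sup>2) * s\<^sup>2" by (simp add: algebra_simps)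
  also have "\<dots> \<le> (2 * ck\<^sup>2) * \<sigma>\<^sup>2 + (1 + 2 * ck\<^sup>2) * (cm * \<kappa>)\<^sup>2"
    by (intro add_left_mono mult_left_mono power_mono s) auto
  also have "\<dots> = (sqrt 2 * ck)\<^sup>2 * \<sigma>\<^sup>2 + (cm * sqrt (1 + 2 * ck\<^sup>2))\<^sup>2 * \<kappa>\<^sup>2"
    by (simp add: power_mult_distrib algebra_simps)
  also have "\<dots> \<le> (c_hat cm ck)\<^sup>2 * \<sigma>\<^sup>2 + (c_hat cm ck)\<^sup>2 * \<kappa>\<^sup>2"
    using c by (intro add_mono mult_right_mono power_mono) (auto simp: c_hat_def)
  also have "\<dots> = (c_hat cm ck * sqrt (\<sigma>\<^sup>2 + \<kappa>\<^sup>2))\<^sup>2"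
    by (simp add: power_mult_distrib algebra_simps)
  finally show ?thesis .
qed

text \<open>The linear counterpart, for errors that are added rather than combined by Pythagoras.
  The coefficients are \<open>ck\<close> and \<open>cm * (1 + ck)\<close>; \<open>sqrt 2\<close>
  comes from passing from \<open>\<sigma> + \<kappa>\<close> to the Euclidean norm.\<close>

lemma c_tilde_estimate:
  assumes c: "cm > 0" "ck > 0" and s: "s \<le> cm * \<kappa>" "0 \<le> \<kappa>" and "0 \<le> \<sigma>"
  shows "ck * (\<sigma> + s) + s \<le> c_tilde cm ck * sqrt (\<sigma>\<^sup>2 + \<kappa>\<^sup>2)"
proof -
  define m where "m = max ck (cm * (1 + ck))"
  have "ck * (\<sigma> + s) + s = ck * \<sigma> + (1 + ck) * s" by (simp add: algebra_simps)
  also have "\<dots> \<le> ck * \<sigma> + (1 + ck) * (cm * \<kappa>)" using c s by simp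
  also have "\<dots> = ck * \<sigma> + (cm * (1 + ck)) * \<kappa>" by simp
  also have "\<dots> \<le> m * \<sigma> + m * \<kappa>" using assms by (intro add_mono mult_right_mono) (auto simp: m_def)
  also have "\<dots> \<le> m * (sqrt 2 * sqrt (\<sigma>\<^sup>2 + \<kappa>\<^sup>2))"
    unfolding distrib_left[symmetric] using c by (intro mult_left_mono sum_le_sqrt2) (auto simp: m_def max_def)
  finally show ?thesis by (simp add: c_tilde_def m_def mult_ac)
qed

lemma sqrt2_max_estimate:
  fixes t d a c N :: real
  assumes "t \<le> d + a" "d \<le> c * N" "0 \<le> N" "0 \<le> a"
  shows "t \<le> sqrt 2 * max c 1 * sqrt (N\<^sup>2 + a\<^sup>2)"
proof -
  have "t \<le> c * N + 1 * a" using assms by simp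
  also have "\<dots> \<le> max c 1 * N + max c 1 * a" using assms by (intro add_mono mult_right_mono) auto
  also have "\<dots> \<le> max c 1 * (sqrt 2 * sqrt (N\<^sup>2 + a\<^sup>2))"
    unfolding distrib_left[symmetric] by (intro mult_left_mono sum_le_sqrt2) auto
  finally show ?thesis by (simp add: mult_ac)
qed

lemma L2_norm_mat_sym_le:
  assumes "T \<in> L2 \<Omega>" "R \<in> L2 \<Omega>"
  shows "L2_norm \<Omega> (\<lambda>x. mat_sym (R x)) \<le> L2_norm \<Omega> (\<lambda>x. mat_sym (T x)) + L2_norm \<Omega> (\<lambda>x. T x - R x)"
proof -
  have D: "(\<lambda>x. T x - R x) \<in> L2 \<Omega>" by (rule L2_diff[OF assms])
  note L = L2_bounded_linear[OF _ bounded_linear_mat_sym]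
  have "L2_norm \<Omega> (\<lambda>x. mat_sym (T x) + - mat_sym (T x - R x)) \<le> L2_norm \<Omega> (\<lambda>x. mat_sym (T x)) + L2_norm \<Omega> (\<lambda>x. - mat_sym (T x - R x))"
    by (rule L2_norm_triangle[OF L[OF assms(1)] L2_uminus[OF L[OF D]]])
  moreover have "mat_sym (T x) + - mat_sym (T x - R x) = mat_sym (R x)" for x by (simp add: linear_diff[OF linear_mat_sym])
  moreover have "L2_norm \<Omega> (\<lambda>x. mat_sym (T x - R x)) \<le> L2_norm \<Omega> (\<lambda>x. T x - R x)"
    by (rule L2_norm_mono_AE[OF L[OF D] D]) (simp add: norm_mat_sym_le)
  ultimately show ?thesis by (simp add: L2_norm_minus)
qed

lemma sym_Curl_norm_nonneg: "0 \<le> sym_Curl_norm \<Omega> T"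
  by (simp add: sym_Curl_norm_def)

lemma L2_norm_pythagoras:
  assumes "f \<in> L2 \<Omega>" "g \<in> L2 \<Omega>" "L2_inner \<Omega> f g = 0"
  shows "(L2_norm \<Omega> (\<lambda>x. f x + g x))\<^sup>2 = (L2_norm \<Omega> f)\<^sup>2 + (L2_norm \<Omega> g)\<^sup>2"
  using L2_norm_sq_add[OF assms(1,2)] assms(3) by simp

lemma estimate_boundary_condition:
  assumes \<Omega>: "open \<Omega>" "bounded \<Omega>" "lipschitz_boundary \<Omega>"
    and \<Gamma>t: "openin (top_of_set (frontier \<Omega>)) \<Gamma>t" "lipschitz_separated \<Omega> \<Gamma>t"
    and cm: "maxwell_constant \<Omega> \<Gamma>t cm" and ck: "korn_constant \<Omega> \<Gamma>t J D ck" and ne: "\<Gamma>t \<noteq> {}"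
    and T: "T \<in> H_Curl_bc \<Gamma>t \<Omega>"
  shows "L2_norm \<Omega> T \<le> c_hat cm ck * sym_Curl_norm \<Omega> T"
proof -
  obtain R where R: "R \<in> H_Curl0_bc \<Gamma>t \<Omega>" "\<And>U. U \<in> H_Curl0_bc \<Gamma>t \<Omega> \<Longrightarrow> L2_inner \<Omega> (\<lambda>x. T x - R x) U = 0"
    "L2_norm \<Omega> (\<lambda>x. T x - R x) \<le> cm * L2_norm \<Omega> (weak_Curl \<Omega> T)"
    by (rule tensor_helmholtz[OF \<Omega> \<Gamma>t cm T], rule that)
  note TL = H_Curl_L2[OF subsetD[OF H_Curl_bc_subset T]] and RL = H_Curl_L2[OF subsetD[OF H_Curl0_bc_subset R(1)]]
  have c: "cm > 0" "ck > 0" using cm ck by (auto simp: maxwell_constant_def korn_constant_def)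
  have "L2_norm \<Omega> R \<le> ck * L2_norm \<Omega> (\<lambda>x. mat_sym (R x))" using ck ne R(1) unfolding korn_constant_def by blast
  also have "\<dots> \<le> ck * (L2_norm \<Omega> (\<lambda>x. mat_sym (T x)) + L2_norm \<Omega> (\<lambda>x. T x - R x))"
    using c by (intro mult_left_mono L2_norm_mat_sym_le TL RL) auto
  finally have r: "L2_norm \<Omega> R \<le> ck * (L2_norm \<Omega> (\<lambda>x. mat_sym (T x)) + L2_norm \<Omega> (\<lambda>x. T x - R x))" .
  have "(L2_norm \<Omega> T)\<^sup>2 = (L2_norm \<Omega> R)\<^sup>2 + (L2_norm \<Omega> (\<lambda>x. T x - R x))\<^sup>2"
    using L2_norm_pythagoras[OF L2_diff[OF TL RL] RL R(2)[OF R(1)]] by simp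
  also have "\<dots> \<le> (c_hat cm ck * sym_Curl_norm \<Omega> T)\<^sup>2"
    unfolding sym_Curl_norm_def by (rule c_hat_estimate[OF c _ r _ R(3)]) auto
  finally show ?thesis
    by (rule power2_le_imp_le) (use c_hat_pos[OF c(2), of cm] sym_Curl_norm_nonneg in simp)
qed

lemma AE_lebesgue_on_iff_lebesgue:
  "open \<Omega> \<Longrightarrow> (AE x in lebesgue_on \<Omega>. P x) \<longleftrightarrow> (AE x in lebesgue. x \<in> \<Omega> \<longrightarrow> P x)" for \<Omega> :: "(real^3) set"
  by (rule AE_restrict_space_iff) simp

text \<open>A piecewise constant field is known only almost everywhere on each piece and is
  arbitrary on the null set between them. The representative takes finitely many values, all of them
  skew, which yields measurability and square integrability.\<close>

lemma piecewise_const_representative: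
  assumes \<Omega>: "open \<Omega>" "bounded \<Omega>" and D: "slicing \<Omega> \<Gamma>t J D" and A: "piecewise_const_skew J D A"
  obtains B where "B \<in> borel_measurable borel" "\<And>x. B x \<in> so3" "bounded (range B)" "AE x in lebesgue_on \<Omega>. A x = B x"
proof -
  have dj: "disjoint_family_on D {1..J}" and op: "\<And>j. j \<in> {1..J} \<Longrightarrow> open (D j)" and neg: "negligible (\<Omega> - (\<Union>j\<in>{1..J}. D j))"
    using D by (auto simp: slicing_def domain_def)
  obtain C where C: "\<And>j. j \<in> {1..J} \<Longrightarrow> C j \<in> so3 \<and> (AE x in lebesgue_on (D j). A x = C j)"
    using A unfolding piecewise_const_skew_def by metis
  define B where "B x = (\<Sum>j\<in>{1..J}. indicator (D j) x *\<^sub>R C j)" for x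
  have Bj: "B x = C j" if "j \<in> {1..J}" "x \<in> D j" for x j
  proof -
    have "B x = (\<Sum>k\<in>{1..J}. if k = j then C j else 0)"
      unfolding B_def using that disjoint_family_onD[OF dj] by (intro sum.cong refl) (fastforce simp: indicator_def)
    then show ?thesis using that by simp
  qed
  have B0: "B x = 0" if "\<And>j. j \<in> {1..J} \<Longrightarrow> x \<notin> D j" for x
    unfolding B_def using that by (intro sum.neutral) auto
  show thesis
  proof (rule that[of B])
    show "B \<in> borel_measurable borel"
      unfolding B_def using op by (intro borel_measurable_sum borel_measurable_scaleR borel_measurable_indicator) auto
    show "B x \<in> so3" for x
      using Bj[of _ x] B0[of x] C so3_zero by (cases "\<exists>j\<in>{1..J}. x \<in> D j") auto
    have "range B \<subseteq> insert 0 (C ` {1..J})"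
    proof
      fix b assume "b \<in> range B"
      then obtain x where "b = B x" by blast
      then show "b \<in> insert 0 (C ` {1..J})"
        using Bj[of _ x] B0[of x] by (cases "\<exists>j\<in>{1..J}. x \<in> D j") auto
    qed
    then show "bounded (range B)" by (rule bounded_subset[rotated]) (simp add: finite_imp_bounded)
    have "AE x in lebesgue. x \<in> D j \<longrightarrow> A x = C j" if "j \<in> {1..J}" for j
      by (rule AE_lebesgue_on_iff_lebesgue[THEN iffD1, OF op[OF that]]) (use C[OF that] in blast)
    then have "AE x in lebesgue. \<forall>j\<in>{1..J}. x \<in> D j \<longrightarrow> A x = C j" by (intro AE_finite_allI) auto
    moreover have "AE x in lebesgue. x \<notin> \<Omega> - (\<Union>j\<in>{1..J}. D j)"
      using neg by (intro AE_not_in) (simp add: negligible_iff_null_sets)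
    ultimately have "AE x in lebesgue. x \<in> \<Omega> \<longrightarrow> A x = B x"
    proof eventually_elim
      case (elim x)
      show ?case
      proof
        assume "x \<in> \<Omega>"
        then obtain j where "j \<in> {1..J}" "x \<in> D j" using elim(2) by blast
        then show "A x = B x" using elim(1) Bj by simp
      qed
    qed
    then show "AE x in lebesgue_on \<Omega>. A x = B x" by (rule AE_lebesgue_on_iff_lebesgue[THEN iffD2, OF \<Omega>(1)])
  qed
qed

lemma L2_bounded_borel:
  fixes B :: "real^3 \<Rightarrow> 'b::euclidean_space"
  assumes "open \<Omega>" "bounded \<Omega>" "B \<in> borel_measurable borel" "bounded (range B)"
  shows "B \<in> L2 \<Omega>"
proof -
  obtain M where M: "\<And>x. norm (B x) \<le> M" using assms(4) by (auto simp: bounded_iff)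
  have "(\<lambda>x. 1::real) \<in> L2 \<Omega>" by (rule smooth_L2[OF assms(1,2) smooth_const])
  then show ?thesis
    by (rule L2_dominated[OF borel_imp_lebesgue_on[OF assms(3)], where C = M]) (simp add: M)
qed

lemma borel_measurable_lebesgue_on_AE:
  fixes f g :: "real^3 \<Rightarrow> 'b::euclidean_space"
  assumes "open \<Omega>" "f \<in> borel_measurable (lebesgue_on \<Omega>)" "AE x in lebesgue_on \<Omega>. g x = f x"
  shows "g \<in> borel_measurable (lebesgue_on \<Omega>)"
proof -
  have m: "\<Omega> \<in> sets lebesgue" using assms(1) by simp
  have "(\<lambda>x. indicator \<Omega> x *\<^sub>R f x) \<in> borel_measurable lebesgue"
    using assms(2) m by (simp add: borel_measurable_restrict_space_iff)
  moreover have "AE x in lebesgue. indicator \<Omega> x *\<^sub>R f x = indicator \<Omega> x *\<^sub>R g x"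
    using AE_lebesgue_on_iff_lebesgue[THEN iffD1, OF assms(1,3)] by eventually_elim (auto simp: indicator_def)
  ultimately have "(\<lambda>x. indicator \<Omega> x *\<^sub>R g x) \<in> borel_measurable lebesgue"
    by (rule borel_measurable_AE)
  then show ?thesis using m by (simp add: borel_measurable_restrict_space_iff)
qed

lemma piecewise_const_L2:
  assumes \<Omega>: "open \<Omega>" "bounded \<Omega>" and D: "slicing \<Omega> \<Gamma>t J D" and A: "piecewise_const_skew J D A"
  shows "A \<in> L2 \<Omega>"
proof -
  obtain B where B: "B \<in> borel_measurable borel" "\<And>x. B x \<in> so3" "bounded (range B)" "AE x in lebesgue_on \<Omega>. A x = B x"
    by (rule piecewise_const_representative[OF assms], rule that)
  have BL: "B \<in> L2 \<Omega>" by (rule L2_bounded_borel[OF \<Omega> B(1,3)])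
  show ?thesis
    by (rule L2_cong_AE[OF BL borel_measurable_lebesgue_on_AE[OF \<Omega>(1) L2_measurable[OF BL] B(4)] B(4)])
qed

lemma empty_openin_separated:
  "openin (top_of_set (frontier \<Omega>)) {}" "lipschitz_separated \<Omega> {}"
  by (simp_all add: lipschitz_separated_def interface_def)

text \<open>\<open>A\<close> need not be curl-free, so \<open>R - A\<close> need not be orthogonal
  to \<open>T - R\<close>. The two errors are added by the triangle inequality, which is where
  \<open>c_tilde\<close> replaces \<open>c_hat\<close>.\<close>

lemma estimate_piecewise:
  assumes \<Omega>: "open \<Omega>" "bounded \<Omega>" "lipschitz_boundary \<Omega>" and D: "slicing \<Omega> {} J D"
    and cm: "maxwell_constant \<Omega> {} cm" and ck: "korn_constant \<Omega> {} J D ck" and T: "T \<in> H_Curl \<Omega>"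
  obtains A where "piecewise_const_skew J D A"
    "L2_norm \<Omega> (\<lambda>x. T x - A x) \<le> c_tilde cm ck * sym_Curl_norm \<Omega> T"
    "L2_norm \<Omega> T \<le> sqrt 2 * max (c_tilde cm ck) 1 * sqrt ((sym_Curl_norm \<Omega> T)\<^sup>2 + (L2_norm \<Omega> A)\<^sup>2)"
proof -
  note E = H_Curl_eq_bc_empty[OF \<Omega>]
  obtain R where R: "R \<in> H_Curl0 \<Omega>" "\<And>U. U \<in> H_Curl0 \<Omega> \<Longrightarrow> L2_inner \<Omega> (\<lambda>x. T x - R x) U = 0"
    "L2_norm \<Omega> (\<lambda>x. T x - R x) \<le> cm * L2_norm \<Omega> (weak_Curl \<Omega> T)"
    by (rule tensor_helmholtz[OF \<Omega> empty_openin_separated cm, folded E, OF T], rule that)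
  note TL = H_Curl_L2[OF T] and RL = H_Curl_L2[OF subsetD[OF H_Curl0_bc_subset R(1)[unfolded E(2)]]]
  have c: "cm > 0" "ck > 0" using cm ck by (auto simp: maxwell_constant_def korn_constant_def)
  obtain A where A: "piecewise_const_skew J D A" "korn_estimates \<Omega> ck R A" using ck R(1) unfolding korn_constant_def by blast
  have AL: "A \<in> L2 \<Omega>" by (rule piecewise_const_L2[OF \<Omega>(1,2) D A(1)])
  have "L2_norm \<Omega> (\<lambda>x. R x - A x) \<le> ck * L2_norm \<Omega> (\<lambda>x. mat_sym (R x))" using A(2) unfolding korn_estimates_def by blast
  also have "\<dots> \<le> ck * (L2_norm \<Omega> (\<lambda>x. mat_sym (T x)) + L2_norm \<Omega> (\<lambda>x. T x - R x))"
    using c by (intro mult_left_mono L2_norm_mat_sym_le TL RL) auto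
  finally have "L2_norm \<Omega> (\<lambda>x. T x - A x)
      \<le> ck * (L2_norm \<Omega> (\<lambda>x. mat_sym (T x)) + L2_norm \<Omega> (\<lambda>x. T x - R x)) + L2_norm \<Omega> (\<lambda>x. T x - R x)"
    using L2_norm_triangle_diff[OF TL RL AL] by linarith
  also have "\<dots> \<le> c_tilde cm ck * sym_Curl_norm \<Omega> T"
    unfolding sym_Curl_norm_def by (rule c_tilde_estimate[OF c R(3)]) auto
  finally have d: "L2_norm \<Omega> (\<lambda>x. T x - A x) \<le> c_tilde cm ck * sym_Curl_norm \<Omega> T" .
  have "L2_norm \<Omega> T \<le> L2_norm \<Omega> (\<lambda>x. T x - A x) + L2_norm \<Omega> A"
    using L2_norm_triangle[OF L2_diff[OF TL AL] AL] by simp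
  from sqrt2_max_estimate[OF this d sym_Curl_norm_nonneg L2_norm_nonneg]
  show thesis using that A(1) d by blast
qed

section \<open>Means of fields and the projection onto constant skew matrices\<close>

lemma L2_integrable:
  fixes f :: "real^3 \<Rightarrow> 'b::euclidean_space"
  assumes "open \<Omega>" "bounded \<Omega>" "f \<in> L2 \<Omega>"
  shows "integrable (lebesgue_on \<Omega>) f"
proof (rule Bochner_Integration.integrable_bound)
  have "(\<lambda>x. 1::real) \<in> L2 \<Omega>" by (rule smooth_L2[OF assms(1,2) smooth_const])
  from Bochner_Integration.integrable_add[OF L2_integrable_sq[OF this] L2_integrable_sq[OF assms(3)]]
  show "integrable (lebesgue_on \<Omega>) (\<lambda>x. 1 + (norm (f x))\<^sup>2)" by simp
  have "a \<le> 1 + a\<^sup>2" for a :: real using sum_squares_bound[of a 1] zero_le_power2[of a] by (simp, linarith)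
  then show "AE x in lebesgue_on \<Omega>. norm (f x) \<le> norm (1 + (norm (f x))\<^sup>2)"
    unfolding real_norm_def by (intro AE_I2 order_trans[OF _ abs_ge_self])
qed (rule L2_measurable[OF assms(3)])

lemma measure_domain_pos:
  assumes "domain \<Omega>" "bounded \<Omega>"
  shows "measure lebesgue \<Omega> > 0"
proof -
  have o: "open \<Omega>" "\<Omega> \<noteq> {}" using assms(1) by (auto simp: domain_def)
  then have "\<not> negligible \<Omega>" using open_not_negligible by blast
  moreover have "\<Omega> \<in> lmeasurable" using o assms(2) by (intro lmeasurable_open) auto
  ultimately show ?thesis
    using measure_nonneg[of lebesgue \<Omega>] by (auto simp: negligible_iff_measure less_le)
qed

lemma skew_mean_in_so3: "skew_mean \<Omega> T \<in> so3"
  by (simp add: skew_mean_def mat_skew_in_so3)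

text \<open>A constant is paired with the integral of \<open>T\<close>, and a skew matrix only with
  the skew part of that integral.\<close>

lemma L2_inner_so3:
  assumes \<Omega>: "domain \<Omega>" "bounded \<Omega>" and T: "T \<in> L2 \<Omega>" and B: "B \<in> so3"
  shows "L2_inner \<Omega> T (\<lambda>_. B) = measure lebesgue \<Omega> * (skew_mean \<Omega> T \<bullet> B)"
proof -
  have o: "open \<Omega>" using \<Omega>(1) by (simp add: domain_def)
  have "L2_inner \<Omega> T (\<lambda>_. B) = (\<integral>x. T x \<partial>lebesgue_on \<Omega>) \<bullet> B"
    unfolding L2_inner_def by (rule integral_inner_left) (rule L2_integrable[OF o \<Omega>(2) T])
  also have "\<dots> = measure lebesgue \<Omega> * (((1 / measure lebesgue \<Omega>) *\<^sub>R (\<integral>x. T x \<partial>lebesgue_on \<Omega>)) \<bullet> B)"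
    using measure_domain_pos[OF \<Omega>] by simp
  finally show ?thesis by (simp only: skew_mean_def inner_mat_skew[OF B, symmetric])
qed

lemma L2_inner_const:
  assumes "open \<Omega>"
  shows "L2_inner \<Omega> (\<lambda>_. A) (\<lambda>_. B) = measure lebesgue \<Omega> * (A \<bullet> B)"
  using assms by (simp add: L2_inner_def measure_restrict_space)

lemma L2_proj_so3_iff:
  assumes \<Omega>: "domain \<Omega>" "bounded \<Omega>" and T: "T \<in> L2 \<Omega>" and A: "A \<in> so3"
  shows "(\<lambda>x. T x - A) \<in> L2_perp \<Omega> so3_fields \<longleftrightarrow> A = skew_mean \<Omega> T"
proof -
  have o: "open \<Omega>" using \<Omega>(1) by (simp add: domain_def)
  have cL: "(\<lambda>_. B) \<in> L2 \<Omega>" for B :: "real^3^3" by (rule smooth_L2[OF o \<Omega>(2) smooth_const])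
  have e: "L2_inner \<Omega> (\<lambda>x. T x - A) (\<lambda>_. B) = measure lebesgue \<Omega> * ((skew_mean \<Omega> T - A) \<bullet> B)" if "B \<in> so3" for B
    unfolding L2_inner_diff_left[OF T cL cL] L2_inner_so3[OF \<Omega> T that] L2_inner_const[OF o]
    by (simp add: inner_diff_left algebra_simps)
  show ?thesis
  proof
    assume "(\<lambda>x. T x - A) \<in> L2_perp \<Omega> so3_fields"
    then have "L2_inner \<Omega> (\<lambda>x. T x - A) (\<lambda>_. skew_mean \<Omega> T - A) = 0"
      using so3_diff[OF skew_mean_in_so3 A] unfolding L2_perp_def so3_fields_def by blast
    then show "A = skew_mean \<Omega> T"
      unfolding e[OF so3_diff[OF skew_mean_in_so3 A]] using measure_domain_pos[OF \<Omega>] by simp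
  next
    assume "A = skew_mean \<Omega> T"
    then show "(\<lambda>x. T x - A) \<in> L2_perp \<Omega> so3_fields"
      using e L2_diff[OF T cL] by (auto simp: L2_perp_def so3_fields_def)
  qed
qed

text \<open>Constant skew fields are curl-free, so \<open>T - R\<close> is orthogonal to them.
  Tested with the difference of the two means, this gives the squared norm of that difference times
  the volume.\<close>

lemma skew_mean_curl_free_projection:
  assumes \<Omega>: "domain \<Omega>" "bounded \<Omega>" and T: "T \<in> L2 \<Omega>" and R: "R \<in> L2 \<Omega>"
    and orth: "\<And>U. U \<in> H_Curl0 \<Omega> \<Longrightarrow> L2_inner \<Omega> (\<lambda>x. T x - R x) U = 0"
  shows "skew_mean \<Omega> R = skew_mean \<Omega> T"
proof -
  have o: "open \<Omega>" using \<Omega>(1) by (simp add: domain_def)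
  define B where "B = skew_mean \<Omega> T - skew_mean \<Omega> R"
  have B: "B \<in> so3" unfolding B_def by (intro so3_diff skew_mean_in_so3)
  have cL: "(\<lambda>_. B) \<in> L2 \<Omega>" by (rule smooth_L2[OF o \<Omega>(2) smooth_const])
  have "0 = L2_inner \<Omega> (\<lambda>x. T x - R x) (\<lambda>_. B)" using orth[OF const_in_H_Curl0[OF o \<Omega>(2)]] by simp
  also have "\<dots> = measure lebesgue \<Omega> * (B \<bullet> B)"
    unfolding L2_inner_diff_left[OF T R cL] L2_inner_so3[OF \<Omega> T B] L2_inner_so3[OF \<Omega> R B]
    by (simp add: B_def inner_diff_left right_diff_distrib)
  finally show ?thesis using measure_domain_pos[OF \<Omega>] by (simp add: B_def)
qed

text \<open>The constant \<open>A\<close> is curl-free, so \<open>R - A\<close> is orthogonal to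
  \<open>T - R\<close> and Pythagoras preserves \<open>c_hat\<close>. Korn's inequality is stated
  with the skew mean of \<open>R\<close>, which coincides with that of \<open>T\<close>.\<close>

lemma estimate_simply_connected:
  assumes dom: "domain \<Omega>" and \<Omega>: "bounded \<Omega>" "lipschitz_boundary \<Omega>" and sc: "simply_connected \<Omega>"
    and cm: "maxwell_constant \<Omega> {} cm" and ck: "korn_constant \<Omega> {} J D ck" and T: "T \<in> H_Curl \<Omega>"
  shows "L2_norm \<Omega> (\<lambda>x. T x - skew_mean \<Omega> T) \<le> c_hat cm ck * sym_Curl_norm \<Omega> T"
    and "\<exists>R. L2_proj \<Omega> (H_Curl0 \<Omega>) T R"
proof -
  have o: "open \<Omega>" using dom by (simp add: domain_def)
  note E = H_Curl_eq_bc_empty[OF o \<Omega>]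
  obtain R where R: "R \<in> H_Curl0 \<Omega>" "\<And>U. U \<in> H_Curl0 \<Omega> \<Longrightarrow> L2_inner \<Omega> (\<lambda>x. T x - R x) U = 0"
    "L2_norm \<Omega> (\<lambda>x. T x - R x) \<le> cm * L2_norm \<Omega> (weak_Curl \<Omega> T)"
    by (rule tensor_helmholtz[OF o \<Omega> empty_openin_separated cm, folded E, OF T], rule that)
  note TL = H_Curl_L2[OF T] and RL = H_Curl_L2[OF subsetD[OF H_Curl0_bc_subset R(1)[unfolded E(2)]]]
  have SL: "(\<lambda>x. T x - R x) \<in> L2 \<Omega>" by (rule L2_diff[OF TL RL])
  show "\<exists>R. L2_proj \<Omega> (H_Curl0 \<Omega>) T R" using R SL by (auto simp: L2_proj_def L2_perp_def)
  have c: "cm > 0" "ck > 0" using cm ck by (auto simp: maxwell_constant_def korn_constant_def)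
  define A where "A = skew_mean \<Omega> T"
  have AR: "skew_mean \<Omega> R = A" unfolding A_def by (rule skew_mean_curl_free_projection[OF dom \<Omega>(1) TL RL R(2)])
  have AL: "(\<lambda>_. A) \<in> L2 \<Omega>" by (rule smooth_L2[OF o \<Omega>(1) smooth_const])
  have "L2_norm \<Omega> (\<lambda>x. R x - A) \<le> ck * L2_norm \<Omega> (\<lambda>x. mat_sym (R x))"
    using ck R(1) sc unfolding korn_constant_def korn_estimates_def AR[symmetric] by blast
  also have "\<dots> \<le> ck * (L2_norm \<Omega> (\<lambda>x. mat_sym (T x)) + L2_norm \<Omega> (\<lambda>x. T x - R x))"
    using c by (intro mult_left_mono L2_norm_mat_sym_le TL RL) auto
  finally have r: "L2_norm \<Omega> (\<lambda>x. R x - A) \<le> ck * (L2_norm \<Omega> (\<lambda>x. mat_sym (T x)) + L2_norm \<Omega> (\<lambda>x. T x - R x))" .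
  have "L2_inner \<Omega> (\<lambda>x. T x - R x) (\<lambda>x. R x - A) = 0"
    unfolding L2_inner_diff_right[OF RL AL SL] using R(2)[OF R(1)] R(2)[OF const_in_H_Curl0[OF o \<Omega>(1)]] by simp
  then have "(L2_norm \<Omega> (\<lambda>x. T x - A))\<^sup>2 = (L2_norm \<Omega> (\<lambda>x. R x - A))\<^sup>2 + (L2_norm \<Omega> (\<lambda>x. T x - R x))\<^sup>2"
    using L2_norm_pythagoras[OF SL L2_diff[OF RL AL]] by simp
  also have "\<dots> \<le> (c_hat cm ck * sym_Curl_norm \<Omega> T)\<^sup>2"
    unfolding sym_Curl_norm_def by (rule c_hat_estimate[OF c _ r _ R(3)]) auto
  finally show "L2_norm \<Omega> (\<lambda>x. T x - skew_mean \<Omega> T) \<le> c_hat cm ck * sym_Curl_norm \<Omega> T"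
    unfolding A_def[symmetric] by (rule power2_le_imp_le) (use c_hat_pos[OF c(2), of cm] sym_Curl_norm_nonneg in simp)
qed

section \<open>A piecewise constant field that is not in the Curl space\<close>

lemma L2_subset:
  assumes "f \<in> L2 \<Omega>" "S \<subseteq> \<Omega>" "open S" "open \<Omega>"
  shows "f \<in> L2 S"
proof (rule L2_I)
  show "f \<in> borel_measurable (lebesgue_on S)"
    by (rule measurable_restrict_mono[OF L2_measurable[OF assms(1)] assms(2)])
  have "set_integrable lebesgue \<Omega> (\<lambda>x. (norm (f x))\<^sup>2)"
    using L2_integrable_sq[OF assms(1)] assms(4) by (simp add: set_integrable_def integrable_restrict_space)
  from set_integrable_subset[OF this _ assms(2)] show "integrable (lebesgue_on S) (\<lambda>x. (norm (f x))\<^sup>2)"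
    using assms(3) by (simp add: set_integrable_def integrable_restrict_space)
qed

lemma integral_lebesgue_on_supported:
  fixes f g :: "real^3 \<Rightarrow> real"
  assumes "S \<subseteq> \<Omega>" "open S" "open \<Omega>" "\<And>x. x \<in> S \<Longrightarrow> f x = g x" "\<And>x. x \<notin> S \<Longrightarrow> f x = 0"
  shows "(\<integral>x. f x \<partial>lebesgue_on \<Omega>) = (\<integral>x. g x \<partial>lebesgue_on S)"
proof -
  have "f = (\<lambda>x. if x \<in> S then g x else 0)" using assms(4,5) by auto
  then show ?thesis using Lebesgue_Measure.integral_restrict[of S \<Omega> g] assms(1-3) by simp
qed

text \<open>A weak curl can be tested inside each piece, where the field is constant, so it vanishes
  almost everywhere there; the pieces fill \<Omega> up to a null set.\<close>

lemma weak_curl_piecewise_const: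
  assumes \<Omega>: "open \<Omega>" "bounded \<Omega>" and D: "slicing \<Omega> \<Gamma>t J D"
    and v: "\<And>j. j \<in> {1..J} \<Longrightarrow> \<exists>c. \<forall>x\<in>D j. v x = c" and w: "weak_op op_curl \<Omega> \<Omega> v w"
  shows "weak_op op_curl \<Omega> \<Omega> v (\<lambda>x. 0)"
proof (rule weak_op_cong_AE[OF \<Omega> w L2_zero])
  have op: "\<And>j. j \<in> {1..J} \<Longrightarrow> open (D j)" and sub: "\<And>j. j \<in> {1..J} \<Longrightarrow> D j \<subseteq> \<Omega>"
    and neg: "negligible (\<Omega> - (\<Union>j\<in>{1..J}. D j))"
    using D by (auto simp: slicing_def domain_def)
  have wL: "w \<in> L2 \<Omega>" by (rule weak_op_L2(2)[OF w])
  have "AE x in lebesgue. x \<in> D j \<longrightarrow> w x = 0" if j: "j \<in> {1..J}" for j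
  proof (rule AE_lebesgue_on_iff_lebesgue[THEN iffD1, OF op[OF j]], rule fundamental_lemma)
    note o = op[OF j] and s = sub[OF j]
    show "open (D j)" "bounded (D j)" "w \<in> L2 (D j)"
      using o bounded_subset[OF \<Omega>(2) s] L2_subset[OF wL s o \<Omega>(1)] by auto
    fix u :: "real^3 \<Rightarrow> real^3" assume u: "u \<in> test_functions (D j)"
    then have u\<Omega>: "u \<in> test_functions \<Omega>" using s by (auto simp: test_functions_def)
    note U = test_functionsD[OF u]
    obtain c where c: "\<And>x. x \<in> D j \<Longrightarrow> v x = c" using v[OF j] by blast
    have "L2_inner (D j) w u = L2_inner \<Omega> w u"
      unfolding L2_inner_def by (rule integral_lebesgue_on_supported[symmetric, OF s o \<Omega>(1)]) (simp_all add: U(3))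
    also have "\<dots> = - (\<integral>x. (\<Sum>i\<in>UNIV. op_curl i (v x) \<bullet> pd i u x) \<partial>lebesgue_on \<Omega>)"
      using weak_opD[OF w u\<Omega>] by simp
    also have "(\<integral>x. (\<Sum>i\<in>UNIV. op_curl i (v x) \<bullet> pd i u x) \<partial>lebesgue_on \<Omega>) = (\<integral>x. (\<Sum>i\<in>UNIV. op_curl i c \<bullet> pd i u x) \<partial>lebesgue_on (D j))"
      by (rule integral_lebesgue_on_supported[OF s o \<Omega>(1)]) (simp_all add: U(4) c)
    also have "\<dots> = 0"
      using weak_opD[OF curl_free_const[OF o bounded_subset[OF \<Omega>(2) s]] u] by simp
    finally show "L2_inner (D j) w u = 0" by simp
  qed
  then have "AE x in lebesgue. \<forall>j\<in>{1..J}. x \<in> D j \<longrightarrow> w x = 0" by (intro AE_finite_allI) auto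
  moreover have "AE x in lebesgue. x \<notin> \<Omega> - (\<Union>j\<in>{1..J}. D j)"
    using neg by (intro AE_not_in) (simp add: negligible_iff_null_sets)
  ultimately have "AE x in lebesgue. x \<in> \<Omega> \<longrightarrow> 0 = w x" by eventually_elim auto
  then show "AE x in lebesgue_on \<Omega>. 0 = w x" by (rule AE_lebesgue_on_iff_lebesgue[THEN iffD2, OF \<Omega>(1)])
qed

text \<open>The closures cover \<Omega>, because a nonempty open set is not negligible. Were they
  disjoint within \<Omega>, they would disconnect it.\<close>

lemma connected_dense_parts_meet:
  fixes D E :: "(real^3) set"
  assumes \<Omega>: "domain \<Omega>" and D: "D \<subseteq> \<Omega>" "D \<noteq> {}" and E: "E \<subseteq> \<Omega>" "E \<noteq> {}" and neg: "negligible (\<Omega> - (D \<union> E))"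
  obtains x where "x \<in> \<Omega>" "x \<in> closure D" "x \<in> closure E"
proof -
  have o: "open \<Omega>" "connected \<Omega>" using \<Omega> by (auto simp: domain_def)
  have "\<Omega> - (closure D \<union> closure E) = {}"
  proof (rule ccontr)
    assume ne: "\<Omega> - (closure D \<union> closure E) \<noteq> {}"
    have "\<Omega> - (closure D \<union> closure E) \<subseteq> \<Omega> - (D \<union> E)" using closure_subset by blast
    then have "negligible (\<Omega> - (closure D \<union> closure E))" by (rule negligible_subset[OF neg])
    moreover have "open (\<Omega> - (closure D \<union> closure E))" using o by (intro open_Diff) auto
    ultimately show False using open_not_negligible ne by blast
  qed
  then have "\<Omega> \<subseteq> closure D \<union> closure E" by blast
  moreover have "closure D \<inter> \<Omega> \<noteq> {}" "closure E \<inter> \<Omega> \<noteq> {}" using D E closure_subset by blast+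
  ultimately have "closure D \<inter> closure E \<inter> \<Omega> \<noteq> {}"
    using o(2) unfolding connected_closed by (metis closed_closure)
  then show thesis using that by blast
qed

text \<open>The mollified indicator is locally constant, but takes the values 0 and 1 near a common
  boundary point of the two parts.\<close>

lemma indicator_not_curl_free:
  fixes D E :: "(real^3) set"
  assumes \<Omega>: "domain \<Omega>" "bounded \<Omega>" and D: "D \<subseteq> \<Omega>" "D \<noteq> {}" "open D" and E: "E \<subseteq> \<Omega>" "E \<noteq> {}" "open E"
    and dis: "D \<inter> E = {}" and neg: "negligible (\<Omega> - (D \<union> E))"
    and w1: "weak_op op_curl \<Omega> \<Omega> (\<lambda>x. indicator D x *\<^sub>R axis 1 1) (\<lambda>x. 0)"
    and w2: "weak_op op_curl \<Omega> \<Omega> (\<lambda>x. indicator D x *\<^sub>R axis 2 1) (\<lambda>x. 0)"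
  shows False
proof -
  have o: "open \<Omega>" using \<Omega>(1) by (simp add: domain_def)
  obtain x0 where x0: "x0 \<in> \<Omega>" "x0 \<in> closure D" "x0 \<in> closure E"
    by (rule connected_dense_parts_meet[OF \<Omega>(1) D(1,2) E(1,2) neg], rule that)
  obtain e where e: "e > 0" "cball x0 e \<subseteq> \<Omega>" using o x0(1) open_contains_cball by blast
  define B where "B = ball x0 (e/2)"
  have B: "open B" "x0 \<in> B" "convex B" using e by (auto simp: B_def)
  obtain y1 where y1: "y1 \<in> D" "y1 \<in> B" using B x0(2) open_Int_closure_eq_empty[of B D] by blast
  obtain y2 where y2: "y2 \<in> E" "y2 \<in> B" using B x0(3) open_Int_closure_eq_empty[of B E] by blast
  obtain r1 where r1: "r1 > 0" "ball y1 r1 \<subseteq> D" using D(3) y1(1) open_contains_ball by blast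
  obtain r2 where r2: "r2 > 0" "ball y2 r2 \<subseteq> E" using E(3) y2(1) open_contains_ball by blast
  \<comment> \<open>At this scale the averaging balls at points of \<open>B\<close> stay inside
    \<Omega>, the one at \<open>y1\<close> inside \<open>D\<close> and the one at \<open>y2\<close>
    inside \<open>E\<close>.\<close>
  define r where "r = min (e/2) (min r1 r2)"
  have r: "r > 0" "r \<le> e/2" "r \<le> r1" "r \<le> r2" using e r1 r2 by (auto simp: r_def)
  obtain \<rho> where \<rho>: "kernel \<rho> 0 r" by (rule kernel_exists[OF r(1)], rule that)
  note k = kernelD[OF \<rho>]
  define I :: "real^3 \<Rightarrow> real" where "I = indicator D"
  have Im: "I \<in> borel_measurable borel" using D(3) by (simp add: I_def)
  have Ii: "integrable lborel I"
    unfolding I_def using D(3) emeasure_bounded_lborel_finite[OF bounded_subset[OF \<Omega>(2) D(1)]]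
    by (intro integrable_real_indicator) auto
  define h where "h = conv \<rho> I"
  have hs: "smooth h" unfolding h_def by (rule smooth_conv[OF k(1,5) Ii])
  have curl: "(\<Sum>i\<in>UNIV. op_curl i (pd i h z *\<^sub>R c)) = 0"
    if w: "weak_op op_curl \<Omega> \<Omega> (\<lambda>x. indicator D x *\<^sub>R c) (\<lambda>x. 0)" and z: "z \<in> B" for c z
  proof -
    have sub: "cball (z - 0) r \<subseteq> \<Omega>"
    proof -
      have "cball z r \<subseteq> cball x0 e" using z r(2) by (intro cball_subset_cball_iff[THEN iffD2]) (auto simp: B_def dist_commute)
      then show ?thesis using e(2) by simp
    qed
    have hc: "conv \<rho> (\<lambda>x. indicator D x *\<^sub>R c) = (\<lambda>x. h x *\<^sub>R c)"
    proof
      fix x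
      have "integrable lborel (\<lambda>y. \<rho> (x - y) *\<^sub>R I y)" by (rule conv_integrable[OF k(6,5) Ii])
      then show "conv \<rho> (\<lambda>x. indicator D x *\<^sub>R c) x = h x *\<^sub>R c"
        using integral_scaleR_left[of c lborel "\<lambda>y. \<rho> (x - y) *\<^sub>R I y"] by (simp add: conv_def h_def I_def)
    qed
    have "diff_op op_curl (conv \<rho> (\<lambda>x. indicator D x *\<^sub>R c)) z = conv \<rho> (\<lambda>x. 0) z"
    proof (rule diff_op_conv[OF w o \<Omega>(2) linear_op_curl _ _ _ _ _ _ _ _ \<rho> sub])
      show "(\<lambda>x. indicator D x *\<^sub>R c) \<in> borel_measurable borel"
        using Im unfolding I_def by (intro borel_measurable_scaleR) auto
      show "integrable lborel (\<lambda>x. indicator D x *\<^sub>R c)"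
        using Ii unfolding I_def by (intro integrable_scaleR_left) auto
    qed (use D(1) in \<open>auto simp: indicator_def\<close>)
    then have "diff_op op_curl (\<lambda>x. h x *\<^sub>R c) z = 0" unfolding hc by (simp add: conv_def)
    moreover have "pd i (\<lambda>x. h x *\<^sub>R c) z = pd i h z *\<^sub>R c" for i
      by (rule pd_bounded_linear[OF hs bounded_linear_scaleR_left])
    ultimately show ?thesis by (simp add: diff_op_def)
  qed
  have der: "(h has_derivative (\<lambda>v. 0)) (at z within B)" if z: "z \<in> B" for z
  proof -
    have "pd i h z = 0" for i
    proof -
      \<comment> \<open>The curl of \<open>h\<close> times \<open>axis 1 1\<close> contains the
        second and third partial derivatives, that of \<open>h\<close> times \<open>axis 2 1\<close>
        the first and third, so two directions suffice.\<close>
      have "pd 3 h z = 0" "pd 2 h z = 0" "pd 1 h z = 0"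
        using curl[OF w1 z] curl[OF w2 z]
        by (simp_all add: op_curl_def cross3_def axis_def sum_3 vec_eq_iff forall_3)
      then have "\<forall>i. pd i h z = 0" by (simp add: forall_3)
      then show ?thesis by blast
    qed
    moreover have l: "linear (frechet_derivative h (at z))" by (rule frechet_derivative_linear[OF smoothD[OF hs]])
    ultimately have "frechet_derivative h (at z) = (\<lambda>v. 0)"
      by (intro linear_eq_stdbasis linear_zero) (auto simp: Basis_vec_def pd_def)
    then show ?thesis using has_derivative_at_withinI[OF smooth_has_derivative[OF hs, of z], of B] by simp
  qed
  have "h y1 = h y2" by (rule has_derivative_zero_unique[OF B(3) der y1(2) y2(2)])
  moreover have "h y1 = 1"
  proof -
    have "\<rho> (y1 - y) *\<^sub>R I y = \<rho> (y1 - y)" for y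
    proof (cases "\<rho> (y1 - y) = 0")
      case False
      then have "y \<in> ball y1 r1" using k(3)[of "y1 - y"] r(3) by (simp add: dist_norm norm_minus_commute)
      then show ?thesis using r1(2) by (auto simp: I_def)
    qed simp
    then have "h y1 = (\<integral>y. \<rho> (y1 - y) \<partial>lborel)" unfolding h_def conv_def by (simp only:)
    then show ?thesis using lborel_integral_reflect[OF k(8), of y1] k(4) by simp
  qed
  moreover have "h y2 = 0"
  proof -
    have "\<rho> (y2 - y) *\<^sub>R I y = 0" for y
    proof (cases "\<rho> (y2 - y) = 0")
      case False
      then have "y \<in> ball y2 r2" using k(3)[of "y2 - y"] r(4) by (simp add: dist_norm norm_minus_commute)
      then have "y \<notin> D" using r2(2) dis by blast
      then show ?thesis by (simp add: I_def)
    qed simp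
    then show ?thesis unfolding h_def conv_def by (simp only: Bochner_Integration.integral_zero)
  qed
  ultimately show False by simp
qed

text \<open>The inner product with \<open>mat 1\<close> is the trace.\<close>

lemma inner_mat1_so3:
  assumes "B \<in> so3"
  shows "mat 1 \<bullet> B = 0"
proof -
  have "mat 1 \<bullet> B = mat 1 \<bullet> transpose B" using inner_transpose[of "mat 1" B] by (simp only: transpose_mat)
  also have "\<dots> = - (mat 1 \<bullet> B)" using assms by (simp only: so3_def mem_Collect_eq inner_minus_right)
  finally show ?thesis by linarith
qed

lemma norm_mat1_diff_so3: "B \<in> so3 \<Longrightarrow> (norm (mat 1 - B))\<^sup>2 = (norm (mat 1 :: real^3^3))\<^sup>2 + (norm B)\<^sup>2"
  using inner_mat1_so3[of B] by (simp add: power2_norm_eq_inner inner_diff_left inner_diff_right inner_commute)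

lemma norm_mat1: "(norm (mat 1 :: real^3^3))\<^sup>2 = 3"
  unfolding power2_norm_eq_inner by (simp add: inner_vec_def sum_3 mat_def)

lemma piecewise_const_not_H_Curl:
  assumes \<Omega>: "domain \<Omega>" "bounded \<Omega>" and D: "slicing \<Omega> \<Gamma>t J D" and J: "J \<ge> 2"
  obtains A where "piecewise_const_skew J D A" "A \<notin> H_Curl \<Omega>" "\<And>x. norm (mat 1 - A x) \<le> sqrt 2 * norm (mat 1 :: real^3^3)"
proof -
  have o: "open \<Omega>" using \<Omega>(1) by (simp add: domain_def)
  have dj: "disjoint_family_on D {1..J}" and op: "\<And>j. j \<in> {1..J} \<Longrightarrow> open (D j)" and ne: "\<And>j. j \<in> {1..J} \<Longrightarrow> D j \<noteq> {}"
    and sub: "\<And>j. j \<in> {1..J} \<Longrightarrow> D j \<subseteq> \<Omega>" and neg: "negligible (\<Omega> - (\<Union>j\<in>{1..J}. D j))"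
    using D by (auto simp: slicing_def domain_def)
  \<comment> \<open>The generator of rotations about the third axis. Its first two rows are the
    directions that detect a jump in \<open>indicator_not_curl_free\<close>, and its squared norm 2
    is below the value 3 of \<open>mat 1\<close>, as the last claim requires.\<close>
  define B0 :: "real^3^3" where "B0 = vector [axis 2 1, - axis 1 1, 0]"
  have B0: "B0 \<in> so3" by (simp add: so3_def B0_def transpose_def vec_eq_iff forall_3 axis_def)
  have nB0: "(norm B0)\<^sup>2 = 2" unfolding power2_norm_eq_inner by (simp add: B0_def inner_vec_def sum_3 axis_def)
  define A where "A x = (if x \<in> D 1 then B0 else 0)" for x
  have one: "1 \<in> {1..J}" using J by auto
  have AD: "\<forall>x\<in>D j. A x = (if j = 1 then B0 else 0)" if "j \<in> {1..J}" for j
    using disjoint_family_onD[OF dj that one] by (auto simp: A_def)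
  show thesis
  proof (rule that[of A])
    show "piecewise_const_skew J D A"
      unfolding piecewise_const_skew_def
    proof (intro ballI bexI)
      fix j assume j: "j \<in> {1..J}"
      show "(if j = 1 then B0 else 0) \<in> so3" using B0 so3_zero by simp
      show "AE x in lebesgue_on (D j). A x = (if j = 1 then B0 else 0)"
        by (rule AE_I2) (use AD[OF j] in \<open>auto simp: space_restrict_space\<close>)
    qed
    show "norm (mat 1 - A x) \<le> sqrt 2 * norm (mat 1 :: real^3^3)" for x
    proof (rule power2_le_imp_le)
      show "(norm (mat 1 - A x))\<^sup>2 \<le> (sqrt 2 * norm (mat 1 :: real^3^3))\<^sup>2"
        using norm_mat1_diff_so3[OF B0] norm_mat1 nB0 by (simp add: A_def power_mult_distrib)
    qed simp
    show "A \<notin> H_Curl \<Omega>"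
    proof
      assume A: "A \<in> H_Curl \<Omega>"
      have rc: "\<exists>c. \<forall>x\<in>D j. row_field A i x = c" if "j \<in> {1..J}" for i j
        using AD[OF that] by (auto simp: row_field_def)
      have w: "weak_op op_curl \<Omega> \<Omega> (row_field A i) (\<lambda>x. 0)" for i
      proof -
        have "row_field A i \<in> H_curl \<Omega>" using A by (simp add: H_Curl_def)
        from weak_curl_piecewise_const[OF o \<Omega>(2) D rc weak_op_weak_curl[OF this]] show ?thesis by simp
      qed
      have "row_field A 1 = (\<lambda>x. indicator (D 1) x *\<^sub>R axis 2 1)" "row_field A 2 = (\<lambda>x. - (indicator (D 1) x *\<^sub>R axis 1 1))"
        by (auto simp: row_field_def A_def B0_def fun_eq_iff)
      then have w1: "weak_op op_curl \<Omega> \<Omega> (\<lambda>x. indicator (D 1) x *\<^sub>R axis 1 1) (\<lambda>x. 0)"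
        and w2: "weak_op op_curl \<Omega> \<Omega> (\<lambda>x. indicator (D 1) x *\<^sub>R axis 2 1) (\<lambda>x. 0)"
        using w[of 1] weak_op_scaleR[OF w[of 2] linear_op_curl, of "-1"] by simp_all
      define E where "E = (\<Union>j\<in>{2..J}. D j)"
      have "{1..J} = insert 1 {2..J}" using J by auto
      then have un: "(\<Union>j\<in>{1..J}. D j) = D 1 \<union> E" by (simp add: E_def)
      have "E \<subseteq> \<Omega>" unfolding E_def using sub by (intro UN_least) auto
      moreover have "E \<noteq> {}" using ne[of 2] J by (auto simp: E_def)
      moreover have "open E" unfolding E_def using op by (intro open_UN) auto
      moreover have "D 1 \<inter> D j = {}" if "j \<in> {2..J}" for j
        by (rule disjoint_family_onD[OF dj one]) (use that in auto)
      then have "D 1 \<inter> E = {}" unfolding E_def by blast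
      ultimately show False
        using indicator_not_curl_free[OF \<Omega> sub[OF one] ne[OF one] op[OF one] _ _ _ _ _ w1 w2, of E] neg unfolding un by blast
    qed
  qed
qed

section \<open>The constant field \<open>mat 1\<close> as a test case\<close>

lemma sym_Curl_norm_mat1:
  assumes \<Omega>: "open \<Omega>" "bounded \<Omega>"
  shows "(\<lambda>_. mat 1) \<in> H_Curl \<Omega>" "sym_Curl_norm \<Omega> (\<lambda>_. mat 1) = L2_norm \<Omega> (\<lambda>_. mat 1 :: real^3^3)"
proof -
  have w: "weak_op op_curl \<Omega> \<Omega> (row_field (\<lambda>_. mat 1) i) (\<lambda>x. 0)" for i
    unfolding row_field_def by (rule curl_free_const[OF \<Omega>])
  then show H: "(\<lambda>_. mat 1) \<in> H_Curl \<Omega>" using H_curl_iff unfolding H_Curl_def by blast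
  have "(L2_norm \<Omega> (weak_Curl \<Omega> (\<lambda>_. mat 1)))\<^sup>2 = 0"
    unfolding L2_norm_sq_rows[OF weak_Curl_L2[OF H]] row_field_weak_Curl weak_curl_AE(2)[OF \<Omega> w] by simp
  moreover have "mat_sym (mat 1) = mat 1" by (simp add: mat_sym_def transpose_mat flip: scaleR_2)
  ultimately show "sym_Curl_norm \<Omega> (\<lambda>_. mat 1) = L2_norm \<Omega> (\<lambda>_. mat 1 :: real^3^3)"
    by (simp add: sym_Curl_norm_def)
qed

text \<open>Tested with the constant field \<open>mat 1\<close>, which is its own symmetric part:
  skew matrices are orthogonal to it, so subtracting one cannot decrease the norm, and the Korn
  estimate forces the constant up to 1.\<close>

lemma korn_constant_ge_1:
  assumes \<Omega>: "domain \<Omega>" "bounded \<Omega>" and D: "slicing \<Omega> {} J D" and ck: "korn_constant \<Omega> {} J D ck"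
  shows "ck \<ge> 1"
proof -
  have o: "open \<Omega>" using \<Omega>(1) by (simp add: domain_def)
  define T :: "real^3 \<Rightarrow> real^3^3" where "T x = mat 1" for x
  have TL: "T \<in> L2 \<Omega>" unfolding T_def by (rule smooth_L2[OF o \<Omega>(2) smooth_const])
  have "T \<in> H_Curl0 \<Omega>" unfolding T_def by (rule const_in_H_Curl0[OF o \<Omega>(2)])
  then obtain A where A: "piecewise_const_skew J D A" "korn_estimates \<Omega> ck T A" using ck unfolding korn_constant_def by blast
  obtain B where B: "B \<in> borel_measurable borel" "\<And>x. B x \<in> so3" "bounded (range B)" "AE x in lebesgue_on \<Omega>. A x = B x"
    by (rule piecewise_const_representative[OF o \<Omega>(2) D A(1)], rule that)
  have "L2_norm \<Omega> T \<le> L2_norm \<Omega> (\<lambda>x. T x - A x)"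
  proof (rule L2_norm_mono_AE[OF TL L2_diff[OF TL piecewise_const_L2[OF o \<Omega>(2) D A(1)]]])
    have "norm (mat 1 :: real^3^3) \<le> norm (mat 1 - B x)" for x
      by (rule power2_le_imp_le) (simp_all add: norm_mat1_diff_so3[OF B(2)])
    then show "AE x in lebesgue_on \<Omega>. norm (T x) \<le> norm (T x - A x)"
      using B(4) by (auto simp: T_def elim!: eventually_mono)
  qed
  also have "\<dots> \<le> ck * L2_norm \<Omega> (\<lambda>x. mat_sym (T x))" using A(2) unfolding korn_estimates_def by blast
  also have "(\<lambda>x. mat_sym (T x)) = T" by (simp add: T_def mat_sym_def transpose_mat fun_eq_iff flip: scaleR_2)
  finally have "1 * L2_norm \<Omega> T \<le> ck * L2_norm \<Omega> T" by simp
  moreover have "(L2_norm \<Omega> T)\<^sup>2 = measure lebesgue \<Omega> * 3"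
    unfolding L2_norm_sq_inner T_def L2_inner_const[OF o] norm_mat1[symmetric] power2_norm_eq_inner ..
  then have "L2_norm \<Omega> T > 0"
    using measure_domain_pos[OF \<Omega>] L2_norm_nonneg[of \<Omega> T] by (cases "L2_norm \<Omega> T = 0") (auto simp: less_le)
  ultimately show ?thesis by simp
qed

text \<open>The witness is \<open>mat 1\<close> together with the field that is nonzero on one piece
  only. Pointwise their difference has norm at most \<open>sqrt 2\<close> times that of
  \<open>mat 1\<close>, and \<open>c_tilde\<close> is at least \<open>sqrt 2\<close> because
  \<open>ck \<ge> 1\<close>.\<close>

lemma estimate_piecewise_sharp:
  assumes \<Omega>: "domain \<Omega>" "bounded \<Omega>" and D: "slicing \<Omega> {} J D" and J: "J \<ge> 2" and ck: "korn_constant \<Omega> {} J D ck"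
  shows "\<exists>T \<in> H_Curl \<Omega>. \<exists>A. piecewise_const_skew J D A
             \<and> L2_norm \<Omega> (\<lambda>x. T x - A x) \<le> c_tilde cm ck * sym_Curl_norm \<Omega> T
             \<and> L2_norm \<Omega> T \<le> sqrt 2 * max (c_tilde cm ck) 1
                              * sqrt ((sym_Curl_norm \<Omega> T)\<^sup>2 + (L2_norm \<Omega> A)\<^sup>2)
             \<and> A \<notin> H_Curl \<Omega>"
proof -
  have o: "open \<Omega>" using \<Omega>(1) by (simp add: domain_def)
  obtain A where A: "piecewise_const_skew J D A" "A \<notin> H_Curl \<Omega>" "\<And>x. norm (mat 1 - A x) \<le> sqrt 2 * norm (mat 1 :: real^3^3)"
    by (rule piecewise_const_not_H_Curl[OF \<Omega> D J], rule that)
  define T :: "real^3 \<Rightarrow> real^3^3" where "T = (\<lambda>_. mat 1)"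
  have TL: "T \<in> L2 \<Omega>" unfolding T_def by (rule smooth_L2[OF o \<Omega>(2) smooth_const])
  have AL: "A \<in> L2 \<Omega>" by (rule piecewise_const_L2[OF o \<Omega>(2) D A(1)])
  note T = sym_Curl_norm_mat1[OF o \<Omega>(2), folded T_def]
  have "L2_norm \<Omega> (\<lambda>x. T x - A x) \<le> L2_norm \<Omega> (\<lambda>x. sqrt 2 *\<^sub>R T x)"
    by (rule L2_norm_mono_AE[OF L2_diff[OF TL AL] L2_scaleR[OF TL]]) (simp add: T_def A(3))
  also have "\<dots> = sqrt 2 * L2_norm \<Omega> T" by (simp add: L2_norm_scaleR)
  also have "\<dots> \<le> c_tilde cm ck * L2_norm \<Omega> T"
  proof (rule mult_right_mono)
    have "1 \<le> max ck (cm * (1 + ck))" using korn_constant_ge_1[OF \<Omega> D ck] by simp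
    then show "sqrt 2 \<le> c_tilde cm ck" unfolding c_tilde_def by simp
  qed simp
  finally have d: "L2_norm \<Omega> (\<lambda>x. T x - A x) \<le> c_tilde cm ck * sym_Curl_norm \<Omega> T" by (simp only: T(2))
  have "L2_norm \<Omega> T \<le> L2_norm \<Omega> (\<lambda>x. T x - A x) + L2_norm \<Omega> A"
    using L2_norm_triangle[OF L2_diff[OF TL AL] AL] by simp
  from sqrt2_max_estimate[OF this d sym_Curl_norm_nonneg L2_norm_nonneg]
  show ?thesis using T(1) A(1,2) d by blast
qed

lemma simply_connected_case:
  assumes dom: "domain \<Omega>" and \<Omega>: "bounded \<Omega>" "lipschitz_boundary \<Omega>" and sc: "simply_connected \<Omega>"
    and cm: "maxwell_constant \<Omega> {} cm" and ck: "korn_constant \<Omega> {} J D ck" and T: "T \<in> H_Curl \<Omega>"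
  defines "A \<equiv> skew_mean \<Omega> T"
  shows "A \<in> so3"
    and "L2_norm \<Omega> (\<lambda>x. T x - A) \<le> c_hat cm ck * sym_Curl_norm \<Omega> T"
    and "L2_norm \<Omega> T \<le> sqrt 2 * max (c_hat cm ck) 1 * sqrt ((sym_Curl_norm \<Omega> T)\<^sup>2 + (L2_norm \<Omega> (\<lambda>_. A))\<^sup>2)"
    and "H_Curl_norm \<Omega> (\<lambda>x. T x - A) \<le> sqrt (1 + (c_hat cm ck)\<^sup>2) * sym_Curl_norm \<Omega> T"
    and "H_Curl_norm \<Omega> T \<le> sqrt 2 * sqrt (1 + (c_hat cm ck)\<^sup>2) * sqrt ((sym_Curl_norm \<Omega> T)\<^sup>2 + (L2_norm \<Omega> (\<lambda>_. A))\<^sup>2)"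
    and "L2_proj \<Omega> so3_fields T (\<lambda>_. A)"
    and "\<forall>B \<in> so3. L2_proj \<Omega> so3_fields T (\<lambda>_. B) \<longrightarrow> B = A"
    and "(\<lambda>x. T x - A) \<in> H_Curl \<Omega> \<inter> L2_perp \<Omega> so3_fields"
    and "A = 0 \<longleftrightarrow> T \<in> L2_perp \<Omega> so3_fields"
    and "\<exists>R. L2_proj \<Omega> (H_Curl0 \<Omega>) T R"
    and "\<forall>R. L2_proj \<Omega> (H_Curl0 \<Omega>) T R \<longrightarrow> L2_proj \<Omega> so3_fields R (\<lambda>_. A) \<and> A = skew_mean \<Omega> R"
proof -
  have o: "open \<Omega>" using dom by (simp add: domain_def)
  note TL = H_Curl_L2[OF T]
  have AL: "(\<lambda>_. A) \<in> L2 \<Omega>" by (rule smooth_L2[OF o \<Omega>(1) smooth_const])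
  note iff = L2_proj_so3_iff[OF dom \<Omega>(1) TL]
  have c: "ck > 0" using ck by (auto simp: korn_constant_def)
  show A: "A \<in> so3" unfolding A_def by (rule skew_mean_in_so3)
  have perp: "(\<lambda>x. T x - A) \<in> L2_perp \<Omega> so3_fields" using iff[OF A] by (simp add: A_def)
  show d: "L2_norm \<Omega> (\<lambda>x. T x - A) \<le> c_hat cm ck * sym_Curl_norm \<Omega> T"
    unfolding A_def by (rule estimate_simply_connected(1)[OF dom \<Omega> sc cm ck T])
  show "\<exists>R. L2_proj \<Omega> (H_Curl0 \<Omega>) T R" by (rule estimate_simply_connected(2)[OF dom \<Omega> sc cm ck T])
  have "L2_norm \<Omega> T \<le> L2_norm \<Omega> (\<lambda>x. T x - A) + L2_norm \<Omega> (\<lambda>_. A)"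
    using L2_norm_triangle[OF L2_diff[OF TL AL] AL] by simp
  from sqrt2_max_estimate[OF this d sym_Curl_norm_nonneg L2_norm_nonneg]
  show "L2_norm \<Omega> T \<le> sqrt 2 * max (c_hat cm ck) 1 * sqrt ((sym_Curl_norm \<Omega> T)\<^sup>2 + (L2_norm \<Omega> (\<lambda>_. A))\<^sup>2)" .
  note H = H_Curl_diff_curl_free[OF o \<Omega>(1) T const_in_H_Curl0[OF o \<Omega>(1), of A]]
  show "(\<lambda>x. T x - A) \<in> H_Curl \<Omega> \<inter> L2_perp \<Omega> so3_fields" using H(1) perp by blast
  define N where "N = sym_Curl_norm \<Omega> T"
  define \<kappa> where "\<kappa> = L2_norm \<Omega> (weak_Curl \<Omega> T)"
  have N: "0 \<le> N" "\<kappa>\<^sup>2 \<le> N\<^sup>2" by (auto simp: N_def \<kappa>_def sym_Curl_norm_def)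
  have d2: "(L2_norm \<Omega> (\<lambda>x. T x - A))\<^sup>2 \<le> (c_hat cm ck)\<^sup>2 * N\<^sup>2"
    using power_mono[OF d L2_norm_nonneg, of 2] by (simp add: N_def power_mult_distrib)
  show "H_Curl_norm \<Omega> (\<lambda>x. T x - A) \<le> sqrt (1 + (c_hat cm ck)\<^sup>2) * sym_Curl_norm \<Omega> T"
  proof -
    have "H_Curl_norm \<Omega> (\<lambda>x. T x - A) \<le> sqrt ((1 + (c_hat cm ck)\<^sup>2) * N\<^sup>2)"
      unfolding H_Curl_norm_def H(2) \<kappa>_def[symmetric] using d2 N by (simp add: algebra_simps)
    then show ?thesis using N(1) by (simp add: real_sqrt_mult N_def)
  qed
  have "L2_inner \<Omega> (\<lambda>x. T x - A) (\<lambda>_. A) = 0" using perp A by (auto simp: L2_perp_def so3_fields_def)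
  from L2_norm_pythagoras[OF L2_diff[OF TL AL] AL this]
  have py: "(L2_norm \<Omega> T)\<^sup>2 = (L2_norm \<Omega> (\<lambda>x. T x - A))\<^sup>2 + (L2_norm \<Omega> (\<lambda>_. A))\<^sup>2" by simp
  show "H_Curl_norm \<Omega> T \<le> sqrt 2 * sqrt (1 + (c_hat cm ck)\<^sup>2) * sqrt ((sym_Curl_norm \<Omega> T)\<^sup>2 + (L2_norm \<Omega> (\<lambda>_. A))\<^sup>2)"
  proof -
    define a where "a = (L2_norm \<Omega> (\<lambda>_. A))\<^sup>2"
    have a: "0 \<le> a" by (simp add: a_def)
    \<comment> \<open>\<open>T - A\<close> and the constant \<open>A\<close> are orthogonal, so
      their squared norms add, and the Curl term is at most \<open>N\<^sup>2\<close>.\<close>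
    have "(L2_norm \<Omega> T)\<^sup>2 + \<kappa>\<^sup>2 \<le> (c_hat cm ck)\<^sup>2 * N\<^sup>2 + a + N\<^sup>2" using d2 N py by (simp add: a_def)
    also have "\<dots> \<le> (1 + (c_hat cm ck)\<^sup>2) * (N\<^sup>2 + a)" using a by (simp add: algebra_simps)
    also have "\<dots> \<le> 2 * ((1 + (c_hat cm ck)\<^sup>2) * (N\<^sup>2 + a))" using a by simp
    finally have "H_Curl_norm \<Omega> T \<le> sqrt (2 * ((1 + (c_hat cm ck)\<^sup>2) * (N\<^sup>2 + a)))"
      unfolding H_Curl_norm_def \<kappa>_def by (rule real_sqrt_le_mono)
    then show ?thesis by (simp only: real_sqrt_mult N_def a_def mult.assoc)
  qed
  \<comment> \<open>Stated for an arbitrary \<open>f\<close>, so that it serves both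
    \<open>T\<close> and its curl-free projection \<open>R\<close>.\<close>
  have proj: "L2_proj \<Omega> so3_fields f (\<lambda>_. B) \<longleftrightarrow> B = skew_mean \<Omega> f" if "f \<in> L2 \<Omega>" "B \<in> so3" for f B
    using L2_proj_so3_iff[OF dom \<Omega>(1) that] that(2) by (auto simp: L2_proj_def so3_fields_def)
  show "L2_proj \<Omega> so3_fields T (\<lambda>_. A)" using proj[OF TL A] by (simp add: A_def)
  show "\<forall>B \<in> so3. L2_proj \<Omega> so3_fields T (\<lambda>_. B) \<longrightarrow> B = A" using proj[OF TL] by (simp add: A_def)
  show "A = 0 \<longleftrightarrow> T \<in> L2_perp \<Omega> so3_fields" using iff[OF so3_zero] by (auto simp: A_def)
  show "\<forall>R. L2_proj \<Omega> (H_Curl0 \<Omega>) T R \<longrightarrow> L2_proj \<Omega> so3_fields R (\<lambda>_. A) \<and> A = skew_mean \<Omega> R"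
  proof (intro allI impI)
    fix R assume R: "L2_proj \<Omega> (H_Curl0 \<Omega>) T R"
    then have "R \<in> H_Curl0 \<Omega>" and R2: "\<And>U. U \<in> H_Curl0 \<Omega> \<Longrightarrow> L2_inner \<Omega> (\<lambda>x. T x - R x) U = 0"
      by (auto simp: L2_proj_def L2_perp_def)
    then have RL: "R \<in> L2 \<Omega>" by (intro H_Curl_L2) (auto simp: H_Curl0_def H_Curl_def H_curl0_def)
    have "skew_mean \<Omega> R = A" unfolding A_def by (rule skew_mean_curl_free_projection[OF dom \<Omega>(1) TL RL R2])
    then show "L2_proj \<Omega> so3_fields R (\<lambda>_. A) \<and> A = skew_mean \<Omega> R" using proj[OF RL A] by simp
  qed
qed

text \<open>The remark that in general \<open>A\<close> lies outside \<open>H_Curl\<close> becomes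
  an existence claim for \<open>J \<ge> 2\<close>: with a single piece \<open>A\<close> is almost
  everywhere constant, hence in the space. Uniqueness of the constant is that of the orthogonal
  projection onto \<open>so3_fields\<close>.\<close>

theorem theorem14:
  fixes \<Omega> \<Gamma>t :: "(real^3) set" and J :: nat and D :: "nat \<Rightarrow> (real^3) set" and cm ck :: real
  assumes "domain \<Omega>" and "bounded \<Omega>" and "lipschitz_boundary \<Omega>"
    and "openin (top_of_set (frontier \<Omega>)) \<Gamma>t"
    and "lipschitz_separated \<Omega> \<Gamma>t"
    and "slicing \<Omega> \<Gamma>t J D"
    and "maxwell_constant \<Omega> \<Gamma>t cm"
    and "korn_constant \<Omega> \<Gamma>t J D ck"
  shows
    "c_hat cm ck \<le> c_tilde cm ck
     \<and> (\<Gamma>t \<noteq> {} \<longrightarrow>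
          (\<forall>T \<in> H_Curl_bc \<Gamma>t \<Omega>. L2_norm \<Omega> T \<le> c_hat cm ck * sym_Curl_norm \<Omega> T))
     \<and> (\<Gamma>t = {} \<longrightarrow>
          (\<forall>T \<in> H_Curl \<Omega>. \<exists>A. piecewise_const_skew J D A
             \<and> L2_norm \<Omega> (\<lambda>x. T x - A x) \<le> c_tilde cm ck * sym_Curl_norm \<Omega> T
             \<and> L2_norm \<Omega> T \<le> sqrt 2 * max (c_tilde cm ck) 1
                              * sqrt ((sym_Curl_norm \<Omega> T)\<^sup>2 + (L2_norm \<Omega> A)\<^sup>2)))
     \<and> (\<Gamma>t = {} \<and> J \<ge> 2 \<longrightarrow>
          (\<exists>T \<in> H_Curl \<Omega>. \<exists>A. piecewise_const_skew J D A
             \<and> L2_norm \<Omega> (\<lambda>x. T x - A x) \<le> c_tilde cm ck * sym_Curl_norm \<Omega> T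
             \<and> L2_norm \<Omega> T \<le> sqrt 2 * max (c_tilde cm ck) 1
                              * sqrt ((sym_Curl_norm \<Omega> T)\<^sup>2 + (L2_norm \<Omega> A)\<^sup>2)
             \<and> A \<notin> H_Curl \<Omega>))
     \<and> (\<Gamma>t = {} \<and> simply_connected \<Omega> \<longrightarrow>
          (\<forall>T \<in> H_Curl \<Omega>. \<exists>A \<in> so3.
             L2_norm \<Omega> (\<lambda>x. T x - A) \<le> c_hat cm ck * sym_Curl_norm \<Omega> T
             \<and> L2_norm \<Omega> T \<le> sqrt 2 * max (c_hat cm ck) 1
                              * sqrt ((sym_Curl_norm \<Omega> T)\<^sup>2 + (L2_norm \<Omega> (\<lambda>_. A))\<^sup>2)
             \<and> H_Curl_norm \<Omega> (\<lambda>x. T x - A) \<le> sqrt (1 + (c_hat cm ck)\<^sup>2) * sym_Curl_norm \<Omega> T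
             \<and> H_Curl_norm \<Omega> T \<le> sqrt 2 * sqrt (1 + (c_hat cm ck)\<^sup>2)
                                  * sqrt ((sym_Curl_norm \<Omega> T)\<^sup>2 + (L2_norm \<Omega> (\<lambda>_. A))\<^sup>2)
             \<and> L2_proj \<Omega> so3_fields T (\<lambda>_. A)
             \<and> (\<forall>B \<in> so3. L2_proj \<Omega> so3_fields T (\<lambda>_. B) \<longrightarrow> B = A)
             \<and> A = skew_mean \<Omega> T
             \<and> (\<lambda>x. T x - A) \<in> H_Curl \<Omega> \<inter> L2_perp \<Omega> so3_fields
             \<and> (A = 0 \<longleftrightarrow> T \<in> L2_perp \<Omega> so3_fields)
             \<and> (\<exists>R. L2_proj \<Omega> (H_Curl0 \<Omega>) T R)
             \<and> (\<forall>R. L2_proj \<Omega> (H_Curl0 \<Omega>) T R \<longrightarrow>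
                    L2_proj \<Omega> so3_fields R (\<lambda>_. A) \<and> A = skew_mean \<Omega> R))
          \<and> (\<forall>T \<in> H_Curl \<Omega> \<inter> L2_perp \<Omega> so3_fields.
                L2_norm \<Omega> T \<le> c_hat cm ck * sym_Curl_norm \<Omega> T))"
proof (intro conjI impI ballI)
  note sep = assms(4,5) and cm = assms(7) and ck = assms(8)
  have o: "open \<Omega>" using assms(1) by (simp add: domain_def)
  show "c_hat cm ck \<le> c_tilde cm ck"
    using cm ck by (intro c_hat_le_c_tilde) (auto simp: maxwell_constant_def korn_constant_def)
  show "L2_norm \<Omega> T \<le> c_hat cm ck * sym_Curl_norm \<Omega> T" if "\<Gamma>t \<noteq> {}" "T \<in> H_Curl_bc \<Gamma>t \<Omega>" for T
    by (rule estimate_boundary_condition[OF o assms(2,3) sep cm ck that])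
  assume e: "\<Gamma>t = {}"
  note cm0 = cm[unfolded e] and ck0 = ck[unfolded e] and D0 = assms(6)[unfolded e]
  show "\<exists>A. piecewise_const_skew J D A
             \<and> L2_norm \<Omega> (\<lambda>x. T x - A x) \<le> c_tilde cm ck * sym_Curl_norm \<Omega> T
             \<and> L2_norm \<Omega> T \<le> sqrt 2 * max (c_tilde cm ck) 1
                              * sqrt ((sym_Curl_norm \<Omega> T)\<^sup>2 + (L2_norm \<Omega> A)\<^sup>2)"
    if "T \<in> H_Curl \<Omega>" for T
    by (rule estimate_piecewise[OF o assms(2,3) D0 cm0 ck0 that]) blast
next
  assume e: "\<Gamma>t = {} \<and> 2 \<le> J"
  then show "\<exists>T \<in> H_Curl \<Omega>. \<exists>A. piecewise_const_skew J D A
             \<and> L2_norm \<Omega> (\<lambda>x. T x - A x) \<le> c_tilde cm ck * sym_Curl_norm \<Omega> T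
             \<and> L2_norm \<Omega> T \<le> sqrt 2 * max (c_tilde cm ck) 1
                              * sqrt ((sym_Curl_norm \<Omega> T)\<^sup>2 + (L2_norm \<Omega> A)\<^sup>2)
             \<and> A \<notin> H_Curl \<Omega>"
    using assms by (intro estimate_piecewise_sharp) auto
next
  fix T assume e: "\<Gamma>t = {} \<and> simply_connected \<Omega>" and T: "T \<in> H_Curl \<Omega>"
  note S = simply_connected_case[OF assms(1-3) conjunct2[OF e] assms(7)[unfolded conjunct1[OF e]] assms(8)[unfolded conjunct1[OF e]] T]
  show "\<exists>A \<in> so3.
             L2_norm \<Omega> (\<lambda>x. T x - A) \<le> c_hat cm ck * sym_Curl_norm \<Omega> T
             \<and> L2_norm \<Omega> T \<le> sqrt 2 * max (c_hat cm ck) 1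
                              * sqrt ((sym_Curl_norm \<Omega> T)\<^sup>2 + (L2_norm \<Omega> (\<lambda>_. A))\<^sup>2)
             \<and> H_Curl_norm \<Omega> (\<lambda>x. T x - A) \<le> sqrt (1 + (c_hat cm ck)\<^sup>2) * sym_Curl_norm \<Omega> T
             \<and> H_Curl_norm \<Omega> T \<le> sqrt 2 * sqrt (1 + (c_hat cm ck)\<^sup>2)
                                  * sqrt ((sym_Curl_norm \<Omega> T)\<^sup>2 + (L2_norm \<Omega> (\<lambda>_. A))\<^sup>2)
             \<and> L2_proj \<Omega> so3_fields T (\<lambda>_. A)
             \<and> (\<forall>B \<in> so3. L2_proj \<Omega> so3_fields T (\<lambda>_. B) \<longrightarrow> B = A)
             \<and> A = skew_mean \<Omega> T
             \<and> (\<lambda>x. T x - A) \<in> H_Curl \<Omega> \<inter> L2_perp \<Omega> so3_fields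
             \<and> (A = 0 \<longleftrightarrow> T \<in> L2_perp \<Omega> so3_fields)
             \<and> (\<exists>R. L2_proj \<Omega> (H_Curl0 \<Omega>) T R)
             \<and> (\<forall>R. L2_proj \<Omega> (H_Curl0 \<Omega>) T R \<longrightarrow>
                    L2_proj \<Omega> so3_fields R (\<lambda>_. A) \<and> A = skew_mean \<Omega> R)"
    by (rule bexI[OF _ S(1)], intro conjI refl) (rule S)+
next
  fix T assume e: "\<Gamma>t = {} \<and> simply_connected \<Omega>" and T: "T \<in> H_Curl \<Omega> \<inter> L2_perp \<Omega> so3_fields"
  note S = simply_connected_case[OF assms(1-3) conjunct2[OF e] assms(7)[unfolded conjunct1[OF e]] assms(8)[unfolded conjunct1[OF e]] IntD1[OF T]]
  show "L2_norm \<Omega> T \<le> c_hat cm ck * sym_Curl_norm \<Omega> T" using S(2,9) T by simp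
qed

end
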